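(* Let $s\in(0,1)$, $a>0$ and let $n$ be a positive integer with $n>2s$. Suppose that $$\frac{\Gamma(\frac n2)\Gamma(s)}{\Gamma(\frac{n-2s}{2})}\left(s+\frac a2\right)> \frac{\Gamma^2(\frac{n+2s}{4})}{\Gamma^2(\frac{n-2s}{4})}.$$ Then the equation $(-\Delta)^s u=|x|^a e^u$ in $\mathbb{R}^n$ admits no finite Morse index solution $u\in L_s(\mathbb{R}^n)\cap W^{1,2}_{\mathrm{loc}}(\mathbb{R}^n)$ satisfying $|x|^a e^u\in L^2_{\mathrm{loc}}(\mathbb{R}^n)$.
   Context: For $s\in(0,1)$ the fractional Laplacian is $(-\Delta)^s u(x)=c_{n,s}\,\mathrm{P.V.}\int_{\mathbb{R}^n}\frac{u(x)-u(y)}{|x-y|^{n+2s}}dy$ with $c_{n,s}=\frac{2^{2s}}{\pi^{n/2}}\frac{\Gamma(\frac{n+2s}{2})}{|\Gamma(-s)|}$. $L_s(\mathbb{R}^n)=\{u\in L^1_{\mathrm{loc}}(\mathbb{R}^n):\int_{\mathbb{R}^n}\frac{|u(x)|}{1+|x|^{n+2s}}dx<\infty\}$. A solution of $(-\Delta)^s u=|x|^a e^u$ in $\mathbb{R}^n$ is a function $u\in L_s(\mathbb{R}^n)$ with $|x|^ae^u\in L^1_{\mathrm{loc}}(\mathbb{R}^n)$ such that $\int_{\mathbb{R}^n}u(-\Delta)^s\varphi\,dx=\int_{\mathbb{R}^n}|x|^ae^u\varphi\,dx$ for every $\varphi\in C_c^\infty(\mathbb{R}^n)$. Such a solution is stable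 in an open set $\Omega\subseteq\mathbb{R}^n$ if $\frac{c_{n,s}}{2}\int_{\mathbb{R}^n}\int_{\mathbb{R}^n}\frac{(\varphi(x)-\varphi(y))^2}{|x-y|^{n+2s}}dxdy\ge\int_{\mathbb{R}^n}|x|^ae^u\varphi^2dx$ for every $\varphi\in C_c^\infty(\Omega)$. It has finite Morse index if it is stable in $\mathbb{R}^n\setminus K$ for some compact set $K\subset\mathbb{R}^n$. *)

theory Defs
  imports "HOL-Analysis.Analysis"
begin

definition frac_const :: "nat \<Rightarrow> real \<Rightarrow> real" where
  "frac_const n s = ((2::real) powr (2 * s) / pi powr (real n / 2))
      * (Gamma ((real n + 2 * s) / 2) :: real) / abs (Gamma (-s) :: real)"

fun dir_derivs :: "('a::real_normed_vector) list \<Rightarrow> ('a \<Rightarrow> real) \<Rightarrow> 'a \<Rightarrow> real" where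
  "dir_derivs [] f = f"
| "dir_derivs (v # vs) f = (\<lambda>x. frechet_derivative (dir_derivs vs f) (at x) v)"

definition smooth_fun :: "('a::real_normed_vector \<Rightarrow> real) \<Rightarrow> bool" where
  "smooth_fun f \<longleftrightarrow> (\<forall>vs x. dir_derivs vs f differentiable (at x))"

definition test_fun :: "('a::euclidean_space) set \<Rightarrow> ('a \<Rightarrow> real) \<Rightarrow> bool" where
  "test_fun \<Omega> \<phi> \<longleftrightarrow> smooth_fun \<phi> \<and> compact (closure {x. \<phi> x \<noteq> 0})
      \<and> closure {x. \<phi> x \<noteq> 0} \<subseteq> \<Omega>"

definition frac_lap :: "real \<Rightarrow> (real^'n \<Rightarrow> real) \<Rightarrow> real^'n \<Rightarrow> real" where
  "frac_lap s \<phi> x = frac_const CARD('n) s *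
     Lim (at_right 0) (\<lambda>\<epsilon>. LINT y : {y. dist x y > \<epsilon>} | lebesgue.
          (\<phi> x - \<phi> y) / dist x y powr (real CARD('n) + 2 * s))"

definition L1_loc :: "('a::euclidean_space \<Rightarrow> real) \<Rightarrow> bool" where
  "L1_loc f \<longleftrightarrow> (\<forall>K. compact K \<longrightarrow> set_integrable lebesgue K f)"

definition L2_loc :: "('a::euclidean_space \<Rightarrow> real) \<Rightarrow> bool" where
  "L2_loc f \<longleftrightarrow> f \<in> borel_measurable lebesgue \<and>
     (\<forall>K. compact K \<longrightarrow> set_integrable lebesgue K (\<lambda>x. (f x)^2))"

definition L_s :: "real \<Rightarrow> (real^'n \<Rightarrow> real) \<Rightarrow> bool" where
  "L_s s u \<longleftrightarrow> L1_loc u \<and>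
     integrable lebesgue (\<lambda>x. \<bar>u x\<bar> / (1 + norm x powr (real CARD('n) + 2 * s)))"

definition W12_loc :: "(real^'n \<Rightarrow> real) \<Rightarrow> bool" where
  "W12_loc u \<longleftrightarrow> L2_loc u \<and>
     (\<forall>i. \<exists>g. L2_loc g \<and>
        (\<forall>\<phi>. test_fun UNIV \<phi> \<longrightarrow>
           (LINT x | lebesgue. u x * frechet_derivative \<phi> (at x) (axis i 1))
             = - (LINT x | lebesgue. g x * \<phi> x)))"

definition is_solution :: "real \<Rightarrow> real \<Rightarrow> (real^'n \<Rightarrow> real) \<Rightarrow> bool" where
  "is_solution s a u \<longleftrightarrow> L_s s u \<and> L1_loc (\<lambda>x. norm x powr a * exp (u x)) \<and>
     (\<forall>\<phi>. test_fun UNIV \<phi> \<longrightarrow>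
        (LINT x | lebesgue. u x * frac_lap s \<phi> x)
          = (LINT x | lebesgue. norm x powr a * exp (u x) * \<phi> x))"

definition stable_in :: "real \<Rightarrow> real \<Rightarrow> (real^'n \<Rightarrow> real) \<Rightarrow> (real^'n) set \<Rightarrow> bool" where
  "stable_in s a u \<Omega> \<longleftrightarrow> (\<forall>\<phi>. test_fun \<Omega> \<phi> \<longrightarrow>
     ennreal (frac_const CARD('n) s / 2) *
       (\<integral>\<^sup>+ x. \<integral>\<^sup>+ y. ennreal ((\<phi> x - \<phi> y)^2 / dist x y powr (real CARD('n) + 2 * s)) \<partial>lebesgue \<partial>lebesgue)
     \<ge> (\<integral>\<^sup>+ x. ennreal (norm x powr a * exp (u x) * (\<phi> x)^2) \<partial>lebesgue))"

definition finite_morse :: "real \<Rightarrow> real \<Rightarrow> (real^'n \<Rightarrow> real) \<Rightarrow> bool" where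
  "finite_morse s a u \<longleftrightarrow> (\<exists>K. compact K \<and> stable_in s a u (UNIV - K))"

end

(* Write lambda = n - 2s, v = |x|^{-lambda}, mu = |x|^{-lambda/2} and F = |x|^a e^u.  Suppose that u is a
   solution, stable outside a compact set.

   Testing stability with zeta * mu, where zeta is a logarithmic cutoff, and using the ground state form of
   the fractional Hardy inequality (mu is its virtual ground state, with constant Lambda), one gets
     int_{A <= |x| <= b} F v dx <= C + Lambda |S^{n-1}| ln (b / A).
   All fractional quadratic forms are handled as superpositions of heat semigroup forms, so that no principal
   value occurs in them.

   Let w be a smooth concave function of v with w = v for |x| >= 1, and w_R(x) = R^{-lambda} w(x/R).  Then
   w_{R0} - w_R is a test function.  Put m = (-Delta)^s w; it is nonnegative, decays like |x|^{-n-2s}, and has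
   mass kappa at least (and in fact equal to) |S^{n-1}| Gamma(s) 4^s Gamma(n/2) / (2 Gamma(lambda/2)).  The
   equation tested with w_{R0} - w_R says that the mean M_R of u against (-Delta)^s w_R decreases by at most
   int F (w_{R0} - w_R) <= C + Lambda |S^{n-1}| ln R.  By Jensen's inequality int m(y) F(R y) dy is then at
   least a constant times R^{a - Lambda |S^{n-1}| / kappa}, while the annulus bound gives at most
   C R^{-2s} (1 + ln R).  The hypothesis is exactly Lambda |S^{n-1}| < (2s + a) kappa, and R -> infinity
   gives a contradiction. *)

theory Submission
  imports Defs "HOL-Real_Asymp.Real_Asymp"
begin

section \<open>Polar coordinates and the heat kernel\<close>

text \<open>Both rates in ln R come from scale invariance. The weight \<open>mu x * mu y\<close>
  over |x - y|^(n+2s) has degree -2n, so a cutoff layer costs the same energy at every radius; and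
  (-Delta)^s w_R is the density R^(-n) m(x/R), whose mass does not depend on R. Only the slopes
  Lambda |S^(n-1)| and kappa compete, and their common factor 4^s |S^(n-1)| drops out. Concavity
  makes m a positive density, as Jensen requires: v is s-harmonic off the origin, so the tangent
  line inequality between w and v fixes the sign of (-Delta)^s w. A single w_R is not compactly
  supported; in w_{R0} - w_R the common tail v cancels. A lower bound on kappa points in the right
  direction for the comparison; it comes from pairing m with a wide heat kernel. The kernels
  |h|^(-n-2s) and |x|^(-beta) are Gaussian mixtures, so Tonelli in \<open>ennreal\<close> applies to
  each nonnegative term; in the Hardy argument terms are subtracted only at a fixed heat time, where
  they are finite. The factor |x|^a enters Jensen as a ln R plus a multiple of the mean of ln |y|
  against m, which only affects constants.\<close>

lemma nn_integral_lborel_shift: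
  fixes f :: "'a::euclidean_space \<Rightarrow> ennreal"
  assumes [measurable]: "f \<in> borel_measurable borel"
  shows "(\<integral>\<^sup>+x. f (c + x) \<partial>lborel) = (\<integral>\<^sup>+x. f x \<partial>lborel)"
  by (subst (2) lborel_distr_plus[of c, symmetric]) (simp add: nn_integral_distr)

lemma nn_integral_lborel_scale:
  fixes f :: "'a::euclidean_space \<Rightarrow> ennreal"
  assumes [measurable]: "f \<in> borel_measurable borel" and c: "c \<noteq> 0"
  shows "(\<integral>\<^sup>+x. f x \<partial>lborel) = ennreal (\<bar>c\<bar> ^ DIM('a)) * (\<integral>\<^sup>+x. f (c *\<^sub>R x) \<partial>lborel)"
  by (subst lborel_affine[OF c, of 0])
     (simp add: nn_integral_density nn_integral_distr nn_integral_cmult)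

lemma lborel_distr_uminus_euclidean:
  "distr lborel borel uminus = (lborel :: 'a::euclidean_space measure)"
  by (subst (2) lborel_affine[of "-1" 0]) (auto simp: density_1 one_ennreal_def[symmetric])

lemma nn_integral_lborel_minus:
  fixes f :: "'a::euclidean_space \<Rightarrow> ennreal"
  assumes [measurable]: "f \<in> borel_measurable borel"
  shows "(\<integral>\<^sup>+x. f (- x) \<partial>lborel) = (\<integral>\<^sup>+x. f x \<partial>lborel)"
  by (subst (2) lborel_distr_uminus_euclidean[symmetric]) (simp add: nn_integral_distr)

lemma nn_integral_lborel_reflect:
  fixes f :: "'a::euclidean_space \<Rightarrow> ennreal"
  assumes [measurable]: "f \<in> borel_measurable borel"
  shows "(\<integral>\<^sup>+x. f (c - x) \<partial>lborel) = (\<integral>\<^sup>+x. f x \<partial>lborel)"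
  using nn_integral_lborel_minus[of "\<lambda>x. f (c + x)"] nn_integral_lborel_shift[of f c] by simp

lemma integral_lborel_shift:
  fixes f :: "'a::euclidean_space \<Rightarrow> real"
  assumes [measurable]: "f \<in> borel_measurable borel"
  shows "(\<integral>x. f (c + x) \<partial>lborel) = (\<integral>x. f x \<partial>lborel)"
  by (subst (2) lborel_distr_plus[of c, symmetric]) (simp add: integral_distr)

lemma integral_lborel_minus:
  fixes f :: "'a::euclidean_space \<Rightarrow> real"
  assumes [measurable]: "f \<in> borel_measurable borel"
  shows "(\<integral>x. f (- x) \<partial>lborel) = (\<integral>x. f x \<partial>lborel)"
  by (subst (2) lborel_distr_uminus_euclidean[symmetric]) (simp add: integral_distr)

lemma integrable_lborel_shift:
  fixes f :: "'a::euclidean_space \<Rightarrow> real"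
  assumes f: "integrable lborel f"
  shows "integrable lborel (\<lambda>x. f (c + x))"
proof -
  have "integrable (distr lborel borel ((+) c)) f"
    using f by (simp add: lborel_distr_plus)
  then show ?thesis by (rule integrable_distr[rotated]) simp
qed

lemma integrable_lborel_minus:
  fixes f :: "'a::euclidean_space \<Rightarrow> real"
  assumes f: "integrable lborel f"
  shows "integrable lborel (\<lambda>x. f (- x))"
proof -
  have "integrable (distr lborel borel uminus) f"
    using f by (simp add: lborel_distr_uminus_euclidean)
  then show ?thesis by (rule integrable_distr[rotated]) simp
qed

lemma integrable_lborel_scale:
  fixes f :: "'a::euclidean_space \<Rightarrow> real"
  assumes f: "integrable lborel f" and c: "c \<noteq> 0"
  shows "integrable lborel (\<lambda>x. f (c *\<^sub>R x))"
proof -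
  have [measurable]: "f \<in> borel_measurable borel" using f by auto
  have "(\<integral>\<^sup>+x. ennreal (norm (f x)) \<partial>lborel) < \<infinity>" using f by (simp add: integrable_iff_bounded)
  then show ?thesis using c
    by (subst (asm) nn_integral_lborel_scale[of _ c])
       (auto simp: integrable_iff_bounded ennreal_mult_less_top)
qed

lemma integral_lborel_scale:
  fixes f :: "'a::euclidean_space \<Rightarrow> real"
  assumes f[measurable]: "f \<in> borel_measurable borel" and c: "c \<noteq> 0"
  shows "(\<integral>x. f x \<partial>lborel) = \<bar>c\<bar> ^ DIM('a) * (\<integral>x. f (c *\<^sub>R x) \<partial>lborel)"
  by (subst lborel_affine[OF c, of 0])
     (simp add: integral_density integral_distr)

text \<open>Half the surface measure of the unit sphere: integration runs over rho = |x|^2, and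
  r^(n-1) dr = (1/2) rho^(n/2-1) d rho.\<close>

definition radial_const :: "real \<Rightarrow> real" where
  "radial_const n = n / 2 * unit_ball_vol n"

lemma radial_const_pos: "n > 0 \<Longrightarrow> radial_const n > 0"
  by (simp add: radial_const_def)

lemma radial_const_nonneg [simp]: "n \<ge> 0 \<Longrightarrow> radial_const n \<ge> 0"
  by (simp add: radial_const_def)

text \<open>Polar coordinates for radial integrands, without a measure on the sphere: both measures
  give a half-line {..b} the volume of the ball of radius sqrt b, and half-lines are stable under
  intersection and generate the Borel sets.\<close>

lemma distr_norm_squared:
  "distr lborel borel (\<lambda>x::'a::euclidean_space. (norm x)\<^sup>2) =
   density lborel (\<lambda>\<rho>. ennreal (radial_const DIM('a) * (indicator {0<..} \<rho> * \<rho> powr (real DIM('a) / 2 - 1))))" (is "?M = density _ ?g")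
proof -
  let ?n = "real DIM('a)"
  have n: "?n > 0" by simp
  have *: "emeasure ?M {..b} = emeasure (density lborel ?g) {..b}" for b :: real
  proof (cases "b > 0")
    case True
    have eq: "(\<lambda>x::'a. (norm x)\<^sup>2) -` {..b} = cball 0 (sqrt b)"
      by (auto simp: real_le_rsqrt sqrt_ge_absD)
    have L: "emeasure ?M {..b} = ennreal (unit_ball_vol ?n * sqrt b ^ DIM('a))"
      using True by (subst emeasure_distr) (simp_all add: eq emeasure_cball)
    \<comment> \<open>For n = 1 the density is singular at 0; integrability rests on the exponent
      exceeding -1.\<close>
    have hi: "((\<lambda>\<rho>. \<rho> powr (?n / 2 - 1)) has_integral (b powr (?n/2 - 1 + 1) / (?n/2 - 1 + 1))) {0..b}"
      by (rule has_integral_powr_from_0) (use True n in auto)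
    have "emeasure (density lborel ?g) {..b} = (\<integral>\<^sup>+\<rho>. ?g \<rho> * indicator {..b} \<rho> \<partial>lborel)"
      by (subst emeasure_density) auto
    also have "\<dots> = (\<integral>\<^sup>+\<rho>. ennreal (radial_const ?n) * (ennreal (\<rho> powr (?n/2 - 1)) * indicator {0..b} \<rho>) \<partial>lborel)"
      using AE_lborel_singleton[of "0::real"]
      by (intro nn_integral_cong_AE, eventually_elim)
         (auto simp: indicator_def ennreal_mult' split: if_splits)
    also have "\<dots> = ennreal (radial_const ?n) * ennreal (b powr (?n/2) / (?n/2))"
      using nn_integral_has_integral_lebesgue'[OF _ hi] by (subst nn_integral_cmult) auto
    also have "\<dots> = ennreal (unit_ball_vol ?n * sqrt b ^ DIM('a))"
      using True n by (simp add: radial_const_def ennreal_mult'[symmetric] powr_half_sqrt[symmetric] powr_realpow[symmetric]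
          powr_powr)
    finally show ?thesis using L by simp
  next
    case False
    have "AE x in lborel. x \<noteq> (0::'a)" by (rule AE_lborel_singleton)
    then have "AE x in lborel. x \<notin> (\<lambda>x::'a. (norm x)\<^sup>2) -` {..b}"
      apply eventually_elim using False
      apply (auto simp: )
      by (meson order_trans not_le zero_less_norm_iff zero_less_power2 norm_not_less_zero less_le_trans power2_eq_iff_nonneg norm_eq_zero zero_eq_power2 order_antisym zero_le_power2)
    then have L: "emeasure ?M {..b} = 0"
      by (subst emeasure_distr) (auto simp: AE_iff_measurable[OF _ refl] vimage_def)
    have "emeasure (density lborel ?g) {..b} = (\<integral>\<^sup>+\<rho>. ?g \<rho> * indicator {..b} \<rho> \<partial>lborel)"
      by (subst emeasure_density) auto
    also have "\<dots> = (\<integral>\<^sup>+\<rho>. 0 \<partial>(lborel::real measure))"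
      using False by (intro nn_integral_cong) (auto simp: indicator_def)
    finally show ?thesis using L by simp
  qed
  show ?thesis
  proof (rule measure_eqI_generator_eq[where E="range (\<lambda>a::real. {..a})" and \<Omega>=UNIV and A="\<lambda>i. {..real i}"])
    show "Int_stable (range (\<lambda>a::real. {..a}))" by (auto simp: Int_stable_def)
    show "sets ?M = sigma_sets UNIV (range (\<lambda>a::real. {..a}))"
      by (simp add: borel_eq_atMost)
    show "sets (density lborel ?g) = sigma_sets UNIV (range (\<lambda>a::real. {..a}))"
      by (simp add: borel_eq_atMost)
    show "(\<Union>i. {..real i}) = UNIV" using real_arch_simple by auto
    show "emeasure ?M {..real i} \<noteq> \<infinity>" for i
    proof -
      have "(\<lambda>x::'a. (norm x)\<^sup>2) -` {..real i} \<subseteq> cball 0 (sqrt (real i))"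
        by (auto simp: real_le_rsqrt)
      then have "emeasure lborel ((\<lambda>x::'a. (norm x)\<^sup>2) -` {..real i}) \<le> emeasure lborel (cball (0::'a) (sqrt (real i)))"
        by (intro emeasure_mono) auto
      also have "\<dots> < \<infinity>" by (rule emeasure_lborel_cball_finite)
      finally show ?thesis by (subst emeasure_distr) auto
    qed
  qed (use * in auto)
qed

lemma nn_integral_radial:
  fixes F :: "real \<Rightarrow> ennreal"
  assumes [measurable]: "F \<in> borel_measurable borel"
  shows "(\<integral>\<^sup>+(x::'a::euclidean_space). F ((norm x)\<^sup>2) \<partial>lborel) =
    ennreal (radial_const DIM('a)) *
    (\<integral>\<^sup>+\<rho>. ennreal (indicator {0<..} \<rho> * \<rho> powr (real DIM('a) / 2 - 1)) * F \<rho> \<partial>lborel)"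
proof -
  have "(\<integral>\<^sup>+(x::'a). F ((norm x)\<^sup>2) \<partial>lborel) = (\<integral>\<^sup>+\<rho>. F \<rho> \<partial>distr lborel borel (\<lambda>x::'a. (norm x)\<^sup>2))"
    by (simp add: nn_integral_distr)
  also have "\<dots> = (\<integral>\<^sup>+\<rho>. ennreal (radial_const DIM('a)) *
      (ennreal (indicator {0<..} \<rho> * \<rho> powr (real DIM('a) / 2 - 1)) * F \<rho>) \<partial>lborel)"
    by (subst distr_norm_squared, subst nn_integral_density)
       (auto intro!: nn_integral_cong simp: ennreal_mult mult.assoc)
  finally show ?thesis by (simp add: nn_integral_cmult)
qed

lemma nn_integral_Gamma_scaled:
  fixes q b :: real assumes q: "q > 0" and b: "b > 0"
  shows "(\<integral>\<^sup>+\<rho>. ennreal (indicator {0<..} \<rho> * \<rho> powr (q - 1) * exp (- (b * \<rho>))) \<partial>lborel)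
    = ennreal (Gamma q * b powr (-q))"
proof -
  have "(\<integral>\<^sup>+t. ennreal (indicator {0..} t * t powr (q - 1) / exp t) \<partial>lborel) =
     (\<integral>\<^sup>+t. ennreal (indicator {0<..} t * t powr (q - 1) / exp t) \<partial>lborel)"
    using AE_lborel_singleton[of "0::real"]
    by (intro nn_integral_cong_AE, eventually_elim) (auto simp: indicator_def)
  then have *: "ennreal (Gamma q) = (\<integral>\<^sup>+t. ennreal (indicator {0<..} t * t powr (q - 1) / exp t) \<partial>lborel)"
    using Gamma_conv_nn_integral_real[OF q] by simp
  also have "\<dots> = ennreal \<bar>b\<bar> * (\<integral>\<^sup>+t. ennreal (indicator {0<..} (0 + b * t) * (0 + b * t) powr (q - 1) / exp (0 + b * t)) \<partial>lborel)"
    by (rule nn_integral_real_affine) (use b in auto)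
  also have "\<dots> = (\<integral>\<^sup>+t. ennreal (b powr q) * ennreal (indicator {0<..} t * t powr (q - 1) * exp (- (b * t))) \<partial>lborel)"
    using b by (subst nn_integral_cmult[symmetric])
      (auto intro!: nn_integral_cong simp: indicator_def ennreal_mult'[symmetric] zero_less_mult_iff exp_minus
        powr_mult powr_diff field_simps)
  also have "\<dots> = ennreal (b powr q) * (\<integral>\<^sup>+t. ennreal (indicator {0<..} t * t powr (q - 1) * exp (- (b * t))) \<partial>lborel)"
    by (subst nn_integral_cmult) auto
  finally have "ennreal (b powr (-q)) * ennreal (Gamma q) = ennreal (b powr (-q)) * ennreal (b powr q) *
     (\<integral>\<^sup>+t. ennreal (indicator {0<..} t * t powr (q - 1) * exp (- (b * t))) \<partial>lborel)"
    by (simp add: mult.assoc)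
  then show ?thesis using b q
    by (simp add: ennreal_mult'[symmetric] powr_add[symmetric] mult.commute)
qed

text \<open>The substitution x -> 1/x, routed through change of variables for absolutely integrable
  functions, which for a nonnegative integrand is the same as a finite \<open>nn_integral\<close>.
  It turns integrals over heat times into Gamma integrals.\<close>

lemma nn_integral_inverse_pos:
  fixes f :: "real \<Rightarrow> real"
  assumes nn: "\<And>x. x > 0 \<Longrightarrow> f x \<ge> 0" and r: "r \<ge> 0"
    and I: "(\<integral>\<^sup>+x. ennreal (indicator {0<..} x * f x) \<partial>lborel) = ennreal r"
    and [measurable]: "f \<in> borel_measurable borel"
  shows "(\<integral>\<^sup>+x. ennreal (indicator {0<..} x * (f (1 / x) / x\<^sup>2)) \<partial>lborel) = ennreal r"
proof -
  have "((\<lambda>x. indicator {0<..} x * f x) has_integral r) UNIV"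
    by (rule nn_integral_has_integral[OF _ _ I r]) (auto simp: indicator_def nn)
  moreover have "(\<lambda>x. indicator {0<..} x * f x) = (\<lambda>x. if x \<in> {0<..} then f x else 0)"
    by (auto simp: indicator_def)
  ultimately have hi: "(f has_integral r) {0<..}"
    by (simp only: has_integral_restrict_UNIV)
  then have ai: "f absolutely_integrable_on {0<..}"
    by (subst absolutely_integrable_on_iff_nonneg) (auto intro: nn)
  have im: "(\<lambda>x::real. 1 / x) ` {0<..} = {0<..}"
  proof safe
    fix x :: real assume "x > 0"
    then show "x \<in> (\<lambda>x. 1 / x) ` {0<..}" by (intro image_eqI[of _ _ "1/x"]) auto
  qed auto
  have "(\<lambda>x. \<bar>- (1 / x\<^sup>2)\<bar> * f (1 / x)) absolutely_integrable_on {0<..} \<and>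
      integral {0<..} (\<lambda>x. \<bar>- (1 / x\<^sup>2)\<bar> * f (1 / x)) = r"
    by (subst has_absolute_integral_change_of_variables_1')
       (use hi ai im in \<open>auto intro!: derivative_eq_intros inj_onI integral_unique simp: power2_eq_square\<close>)
  then have hi2: "((\<lambda>x. f (1 / x) / x\<^sup>2) has_integral r) {0<..}"
    using set_lebesgue_integral_eq_integral(1) by (auto simp: has_integral_iff)
  show ?thesis
    using nn_integral_has_integral_lebesgue[OF _ hi2] nn by simp
qed

section \<open>The Gaussian heat kernel, its semigroup law, and its integrals over time\<close>

definition heat :: "real \<Rightarrow> 'a::euclidean_space \<Rightarrow> real" where
  "heat t x = (4 * pi * t) powr (- (real DIM('a) / 2)) * exp (- ((norm x)\<^sup>2 / (4 * t)))"

lemma heat_nonneg [simp]: "heat t x \<ge> 0"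
  by (simp add: heat_def)

lemma heat_minus [simp]: "heat t (- x) = heat t x"
  by (simp add: heat_def)

lemma borel_measurable_heat [measurable (raw)]:
  assumes [measurable]: "f \<in> borel_measurable M" "g \<in> borel_measurable M"
  shows "(\<lambda>x. heat (f x) (g x)) \<in> borel_measurable M"
  unfolding heat_def by measurable

text \<open>In the variable rho this is a Gamma integral, whose value Gamma(n/2) cancels against the
  one inside \<open>radial_const\<close>.\<close>

lemma nn_integral_gaussian:
  assumes b: "b > (0::real)"
  shows "(\<integral>\<^sup>+(x::'a::euclidean_space). ennreal (exp (- (b * (norm x)\<^sup>2))) \<partial>lborel)
     = ennreal ((pi / b) powr (real DIM('a) / 2))"
proof -
  let ?n = "real DIM('a)"
  have n: "?n > 0" by simp
  have G: "Gamma (?n/2 + 1) = ?n/2 * Gamma (?n/2)" 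
    using Gamma_plus1[of "?n/2"] by (metis add_cancel_left_right n half_gt_zero less_irrefl nonpos_Ints_nonpos not_le)
  have Gp: "Gamma (?n/2) > 0" using n by (intro Gamma_real_pos) auto
  have "(\<integral>\<^sup>+(x::'a). ennreal (exp (- (b * (norm x)\<^sup>2))) \<partial>lborel) =
     ennreal (radial_const ?n) *
     (\<integral>\<^sup>+\<rho>. ennreal (indicator {0<..} \<rho> * \<rho> powr (?n / 2 - 1)) * ennreal (exp (- (b * \<rho>))) \<partial>lborel)"
    by (subst nn_integral_radial[where F="\<lambda>\<rho>. ennreal (exp (- (b * \<rho>)))"]) auto
  also have "\<dots> = ennreal (radial_const ?n) * ennreal (Gamma (?n/2) * b powr (- (?n/2)))"
    using nn_integral_Gamma_scaled[of "?n/2" b] n b by (simp add: ennreal_mult'[symmetric])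
  also have "\<dots> = ennreal ((pi / b) powr (?n / 2))"
  proof -
    have "radial_const ?n * (Gamma (?n/2) * b powr (- (?n/2))) = (pi / b) powr (?n / 2)"
      unfolding radial_const_def unit_ball_vol_def G using Gp n b by (simp add: less_imp_neq[OF Gp, symmetric] powr_divide powr_minus field_simps)
    then show ?thesis by (subst ennreal_mult'[symmetric]) auto
  qed
  finally show ?thesis .
qed

lemma nn_integral_heat:
  assumes t: "t > 0"
  shows "(\<integral>\<^sup>+(x::'a::euclidean_space). ennreal (heat t x) \<partial>lborel) = 1"
proof -
  let ?n = "real DIM('a)"
  have "(\<integral>\<^sup>+(x::'a). ennreal (heat t x) \<partial>lborel) =
    ennreal ((4 * pi * t) powr (- (?n / 2))) * (\<integral>\<^sup>+(x::'a). ennreal (exp (- (1 / (4*t) * (norm x)\<^sup>2))) \<partial>lborel)"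
    by (subst nn_integral_cmult[symmetric]) (auto simp: heat_def ennreal_mult' intro!: nn_integral_cong)
  also have "\<dots> = 1"
    using t by (subst nn_integral_gaussian)
      (auto simp: ennreal_mult'[symmetric] powr_add[symmetric] mult_ac)
  finally show ?thesis .
qed

lemma integrable_heat: "t > 0 \<Longrightarrow> integrable lborel (heat t :: 'a::euclidean_space \<Rightarrow> real)"
  using nn_integral_heat[of t, where 'a='a] by (simp add: integrable_iff_bounded)

lemma integral_heat: "t > 0 \<Longrightarrow> (\<integral>x. heat t (x::'a::euclidean_space) \<partial>lborel) = 1"
  by (subst integral_eq_nn_integral) (auto simp: nn_integral_heat)

text \<open>Completing the square in y: the product of the two Gaussians is centred at the weighted
  mean r/(t+r) x with time t r/(t+r), and the remaining factor does not involve y. Integrating in y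
  then gives the semigroup law.\<close>

lemma heat_mult_heat:
  fixes x y :: "'a::euclidean_space"
  assumes t: "t > 0" and r: "r > 0"
  shows "heat t (x - y) * heat r y = heat (t + r) x * heat (t * r / (t + r)) (y - (r / (t + r)) *\<^sub>R x)"
proof -
  let ?n = "real DIM('a)"
  have nx: "(norm z)\<^sup>2 = z \<bullet> z" for z :: 'a by (simp add: power2_norm_eq_inner)
  have e: "(norm (x - y))\<^sup>2 / (4 * t) + (norm y)\<^sup>2 / (4 * r) =
     (norm x)\<^sup>2 / (4 * (t + r)) + (norm (y - (r / (t + r)) *\<^sub>R x))\<^sup>2 / (4 * (t * r / (t + r)))"
  proof -
    define X Y Z where "X = x \<bullet> x" and "Y = y \<bullet> y" and "Z = x \<bullet> y"
    define q where "q = t + r"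
    have q: "q > 0" "t = q - r" using t r by (auto simp: q_def)
    have h: "(X - 2 * Z + Y) / (4 * t) + Y / (4 * r) =
      X / (4 * q) + (Y - 2 * (r / q) * Z + (r / q)\<^sup>2 * X) / (4 * (t * r / q))"
      using t r q(1) by (simp add: divide_simps) (simp add: q_def power2_eq_square algebra_simps)
    have 1: "(norm (x - y))\<^sup>2 = X - 2 * Z + Y" 
      by (simp only: nx X_def Y_def Z_def) (simp add: inner_diff inner_commute)
    have 2: "(norm (y - (r / q) *\<^sub>R x))\<^sup>2 = Y - 2 * (r / q) * Z + (r / q)\<^sup>2 * X"
      by (simp only: nx X_def Y_def Z_def) (simp add: inner_diff inner_commute power2_eq_square algebra_simps)
    show ?thesis using h 1 2 unfolding q_def by (simp add: nx[of x] nx[of y] X_def[symmetric] Y_def[symmetric])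
  qed
  have p: "(4 * pi * t) powr - (?n/2) * (4 * pi * r) powr - (?n/2) =
     (4 * pi * (t + r)) powr - (?n/2) * (4 * pi * (t * r / (t + r))) powr - (?n/2)"
  proof -
    have "(4 * pi * t) * (4 * pi * r) = (4 * pi * (t + r)) * (4 * pi * (t * r / (t + r)))"
      using t r by (simp add: add_pos_pos less_imp_neq[THEN not_sym])
    then show ?thesis using t r by (metis powr_mult)
  qed
  have "heat t (x - y) * heat r y = (4 * pi * t) powr - (?n/2) * (4 * pi * r) powr - (?n/2) *
     exp (- ((norm (x - y))\<^sup>2 / (4 * t) + (norm y)\<^sup>2 / (4 * r)))"
    by (simp add: heat_def exp_add[symmetric] exp_diff exp_minus field_simps)
  also have "\<dots> = heat (t + r) x * heat (t * r / (t + r)) (y - (r / (t + r)) *\<^sub>R x)"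
    unfolding p e by (simp add: heat_def exp_diff exp_minus exp_add field_simps)
  finally show ?thesis .
qed

lemma heat_semigroup:
  fixes x :: "'a::euclidean_space"
  assumes t: "t > 0" and r: "r > 0"
  shows "(\<integral>\<^sup>+y. ennreal (heat t (x - y) * heat r y) \<partial>lborel) = ennreal (heat (t + r) x)"
proof -
  let ?q = "t * r / (t + r)"
  have q: "?q > 0" using t r by simp
  have "(\<integral>\<^sup>+y. ennreal (heat t (x - y) * heat r y) \<partial>lborel) =
     (\<integral>\<^sup>+y. ennreal (heat (t + r) x) * ennreal (heat ?q (- ((r / (t + r)) *\<^sub>R x) + y)) \<partial>lborel)"
    by (intro nn_integral_cong) (auto simp: heat_mult_heat[OF t r] ennreal_mult')
  also have "\<dots> = ennreal (heat (t + r) x) * (\<integral>\<^sup>+y. ennreal (heat ?q (- ((r / (t + r)) *\<^sub>R x) + y)) \<partial>lborel)"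
    by (rule nn_integral_cmult) auto
  also have "(\<integral>\<^sup>+y. ennreal (heat ?q (- ((r / (t + r)) *\<^sub>R x) + y)) \<partial>lborel) = 1"
    using nn_integral_heat[OF q] 
    by (subst nn_integral_lborel_shift[of "\<lambda>y. ennreal (heat ?q y)"]) auto
  finally show ?thesis by simp
qed

text \<open>After t -> 1/t this is a Gamma integral with rate |x|^2/4. The choice p = n/2 + s
  produces the jump kernel of (-Delta)^s, and p = beta/2 produces |x|^(-beta).\<close>

lemma nn_integral_powr_heat:
  fixes x :: "'a::euclidean_space"
  assumes p: "p > 0" and x: "x \<noteq> 0"
  shows "(\<integral>\<^sup>+t. ennreal (indicator {0<..} t * t powr (real DIM('a) / 2 - p - 1) * heat t x) \<partial>lborel)
    = ennreal ((4 * pi) powr (- (real DIM('a) / 2)) * Gamma p * 4 powr p * norm x powr (- 2 * p))"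
proof -
  let ?n = "real DIM('a)"
  define b where "b = (norm x)\<^sup>2 / 4"
  have b: "b > 0" using x by (simp add: b_def)
  have G: "Gamma p > 0" using p by simp
  have bp: "b powr (-p) = 4 powr p * norm x powr (- 2 * p)"
  proof -
    have "(norm x)\<^sup>2 powr (-p) = norm x powr (- 2 * p)"
      using powr_powr[of "norm x" 2 "-p"] x by simp
    then show ?thesis by (simp add: b_def powr_divide powr_minus field_simps)
  qed
  have 1: "(\<integral>\<^sup>+t. ennreal (indicator {0<..} t * ((1/t) powr (p - 1) * exp (- (b * (1/t))) / t\<^sup>2)) \<partial>lborel)
      = ennreal (Gamma p * b powr (-p))"
  proof (rule nn_integral_inverse_pos[where f="\<lambda>t. t powr (p - 1) * exp (- (b * t))"])
    show "(\<integral>\<^sup>+t. ennreal (indicator {0<..} t * (t powr (p - 1) * exp (- (b * t)))) \<partial>lborel)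
      = ennreal (Gamma p * b powr (-p))"
      using nn_integral_Gamma_scaled[OF p b] by (simp only: mult.assoc)
    show "0 \<le> Gamma p * b powr (-p)" using G by simp
  qed (simp, measurable)
  have "(\<integral>\<^sup>+t. ennreal (indicator {0<..} t * t powr (?n / 2 - p - 1) * heat t x) \<partial>lborel) =
     (\<integral>\<^sup>+t. ennreal ((4 * pi) powr (- (?n / 2))) * ennreal (indicator {0<..} t * ((1/t) powr (p - 1) * exp (- (b * (1/t))) / t\<^sup>2)) \<partial>lborel)"
  proof (intro nn_integral_cong)
    fix t :: real
    show "ennreal (indicator {0<..} t * t powr (?n / 2 - p - 1) * heat t x) =
      ennreal ((4 * pi) powr (- (?n / 2))) * ennreal (indicator {0<..} t * ((1/t) powr (p - 1) * exp (- (b * (1/t))) / t\<^sup>2))"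
    proof (cases "t > 0")
      case True
      have tt: "t powr (?n / 2 - p - 1) * t powr (- (?n/2)) = (1/t) powr (p - 1) / t\<^sup>2"
      proof -
        have "t powr (?n / 2 - p - 1) * t powr (- (?n/2)) = t powr (- 1 - p)"
          by (subst powr_add[symmetric]) (simp add: algebra_simps)
        also have "\<dots> = t powr (- (p - 1)) * t powr (- 2)"
          by (subst powr_add[symmetric]) simp
        also have "t powr (- (p - 1)) = (1/t) powr (p - 1)"
          using True by (simp only: powr_minus powr_divide powr_one_eq_one) (simp add: field_simps)
        also have "t powr (- 2) = 1 / t\<^sup>2"
          using True by (simp add: powr_minus_divide)
        finally show ?thesis by simp
      qed
      have "t powr (?n / 2 - p - 1) * heat t x =
        (4 * pi) powr (- (?n/2)) * ((t powr (?n/2 - p - 1) * t powr (- (?n/2))) * exp (- (b * (1/t))))"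
        using True by (simp add: heat_def powr_mult b_def mult_ac)
      also have "\<dots> = (4 * pi) powr (- (?n/2)) * ((1/t) powr (p - 1) * exp (- (b * (1/t))) / t\<^sup>2)"
        unfolding tt by simp
      finally show ?thesis using True
        by (subst ennreal_mult'[symmetric]) (simp_all add: mult.assoc)
    qed auto
  qed
  also have "\<dots> = ennreal ((4 * pi) powr (- (?n / 2)) * (Gamma p * b powr (-p)))"
    by (subst nn_integral_cmult, measurable, subst 1, subst ennreal_mult') auto
  finally show ?thesis by (simp add: bp mult.assoc)
qed

section \<open>Bochner subordination\<close>

lemma abs_Gamma_minus:
  fixes s :: real assumes "0 < s" "s < 1"
  shows "\<bar>Gamma (-s)\<bar> = Gamma (1 - s) / s"
proof -
  have "-s \<notin> \<int>\<^sub>\<le>\<^sub>0"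
  proof
    assume "-s \<in> \<int>\<^sub>\<le>\<^sub>0"
    then obtain n where "- s = - real n" by (auto elim!: nonpos_Ints_cases')
    with assms show False by simp
  qed
  then have "Gamma (-s + 1) = -s * Gamma (-s)" by (rule Gamma_plus1)
  then have "Gamma (-s) = - (Gamma (1 - s) / s)" using assms by (simp add: field_simps)
  moreover have "Gamma (1 - s) > 0" using assms by simp
  ultimately show ?thesis using assms by simp
qed

text \<open>The Levy measure of the \<open>s\<close>-stable subordinator: \<open>\<lambda> powr s = (\<integral>t. 1 - exp (- \<lambda> * t) \<partial>subord s)\<close>.\<close>

definition subord :: "real \<Rightarrow> real measure" where
  "subord s = density lborel (\<lambda>t. ennreal (indicator {0<..} t * t powr (- 1 - s) / \<bar>Gamma (-s)\<bar>))"

lemma sets_subord [simp, measurable_cong]: "sets (subord s) = sets borel"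
  by (simp add: subord_def)

lemma space_subord [simp]: "space (subord s) = UNIV"
  by (simp add: subord_def)

lemma sigma_finite_subord: "sigma_finite_measure (subord s)"
  unfolding subord_def by (rule sigma_finite_measure.sigma_finite_iff_density_finite[THEN iffD2, OF sigma_finite_lborel]) auto

lemma AE_subord_pos: "AE t in subord s. t > 0"
  unfolding subord_def by (subst AE_density) (auto simp: indicator_def)

lemma nn_integral_subord:
  assumes [measurable]: "F \<in> borel_measurable borel"
  shows "(\<integral>\<^sup>+t. F t \<partial>subord s) =
    (\<integral>\<^sup>+t. ennreal (indicator {0<..} t * t powr (- 1 - s) / \<bar>Gamma (-s)\<bar>) * F t \<partial>lborel)"
  unfolding subord_def by (subst nn_integral_density) auto

text \<open>The density t^(-1-s) dt is homogeneous of degree -s, so integrals against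
  \<open>subord s\<close> can be computed at one fixed scale.\<close>

lemma subord_scale:
  assumes c: "c > 0"
  shows "subord s = density (distr (subord s) borel ((*) c)) (\<lambda>_. ennreal (c powr (- s)))"
proof (rule measure_eqI)
  fix A assume "A \<in> sets (subord s)"
  then have [measurable]: "A \<in> sets borel" by simp
  have "emeasure (subord s) A = (\<integral>\<^sup>+t. indicator A t \<partial>subord s)" by simp
  also have "\<dots> = (\<integral>\<^sup>+t. ennreal (indicator {0<..} t * t powr (- 1 - s) / \<bar>Gamma (-s)\<bar>) * indicator A t \<partial>lborel)"
    by (subst nn_integral_subord) auto
  also have "\<dots> = ennreal \<bar>c\<bar> * (\<integral>\<^sup>+t. ennreal (indicator {0<..} (0 + c * t) * (0 + c * t) powr (- 1 - s) / \<bar>Gamma (-s)\<bar>) * indicator A (0 + c * t) \<partial>lborel)"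
    by (rule nn_integral_real_affine) (use c in auto)
  also have "\<dots> = (\<integral>\<^sup>+t. ennreal (indicator {0<..} t * t powr (- 1 - s) / \<bar>Gamma (-s)\<bar>) * (ennreal (c powr (- s)) * indicator A (c * t)) \<partial>lborel)"
  proof (subst nn_integral_cmult[symmetric], measurable, intro nn_integral_cong)
    fix t :: real
    have "c * (c * t) powr (- 1 - s) = t powr (- 1 - s) * c powr (- s)" if "t > 0"
      using c that by (simp add: powr_mult powr_diff powr_minus field_simps)
    then show "ennreal \<bar>c\<bar> * (ennreal (indicat_real {0<..} (0 + c * t) * (0 + c * t) powr (- 1 - s) / \<bar>Gamma (- s)\<bar>) * indicator A (0 + c * t)) =
         ennreal (indicat_real {0<..} t * t powr (- 1 - s) / \<bar>Gamma (- s)\<bar>) * (ennreal (c powr - s) * indicator A (c * t))"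
      using c by (auto simp: indicator_def zero_less_mult_iff ennreal_mult'[symmetric] simp flip: mult.assoc)
  qed
  also have "\<dots> = (\<integral>\<^sup>+t. ennreal (c powr (- s)) * indicator A (c * t) \<partial>subord s)"
    by (subst nn_integral_subord) auto
  also have "\<dots> = emeasure (density (distr (subord s) borel ((*) c)) (\<lambda>_. ennreal (c powr (- s)))) A"
    by (subst emeasure_density) (auto simp: nn_integral_distr)
  finally show "emeasure (subord s) A = \<dots>" .
qed simp

lemma nn_integral_subord_scale:
  assumes [measurable]: "F \<in> borel_measurable borel" and c: "c > 0"
  shows "(\<integral>\<^sup>+t. F t \<partial>subord s) = ennreal (c powr (- s)) * (\<integral>\<^sup>+t. F (c * t) \<partial>subord s)"
  by (subst subord_scale[OF c]) (simp add: nn_integral_density nn_integral_distr nn_integral_cmult)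

lemma integrable_subord_scale:
  fixes F :: "real \<Rightarrow> real"
  assumes F: "integrable (subord s) (\<lambda>t. F (c * t))" and [measurable]: "F \<in> borel_measurable borel" and c: "c > 0"
  shows "integrable (subord s) F"
  using F unfolding integrable_iff_bounded
  by (subst nn_integral_subord_scale[OF _ c]) (auto simp: ennreal_mult_less_top)

lemma integral_subord_scale:
  fixes F :: "real \<Rightarrow> real"
  assumes [measurable]: "F \<in> borel_measurable borel" and c: "c > 0"
  shows "(\<integral>t. F t \<partial>subord s) = c powr (- s) * (\<integral>t. F (c * t) \<partial>subord s)"
  by (subst subord_scale[OF c]) (simp add: integral_density integral_distr)

text \<open>This is where the normalisation of \<open>frac_const\<close> is matched: p = n/2 + s in
  \<open>nn_integral_powr_heat\<close>. At h = 0 the left side diverges while division by zero would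
  make the right side 0.\<close>

lemma nn_integral_subord_heat:
  fixes h :: "'a::euclidean_space"
  assumes s: "0 < s" "s < 1" and h: "h \<noteq> 0"
  shows "(\<integral>\<^sup>+t. ennreal (heat t h) \<partial>subord s) =
    ennreal (frac_const DIM('a) s / norm h powr (real DIM('a) + 2 * s))"
proof -
  let ?n = "real DIM('a)" and ?g = "\<bar>Gamma (-s)\<bar>"
  define p where "p = ?n / 2 + s"
  have p: "p > 0" using s by (simp add: p_def add_pos_pos)
  have e: "?n / 2 - p - 1 = - 1 - s" by (simp add: p_def)
  have "(\<integral>\<^sup>+t. ennreal (heat t h) \<partial>subord s) =
     (\<integral>\<^sup>+t. ennreal (1 / ?g) * ennreal (indicator {0<..} t * t powr (?n / 2 - p - 1) * heat t h) \<partial>lborel)"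
    unfolding e by (subst nn_integral_subord, measurable)
       (auto intro!: nn_integral_cong simp: ennreal_mult'[symmetric] indicator_def)
  also have "\<dots> = ennreal (1 / ?g) * ennreal ((4 * pi) powr (- (?n / 2)) * Gamma p * 4 powr p * norm h powr (- 2 * p))"
    by (subst nn_integral_cmult, measurable, subst nn_integral_powr_heat[OF p h]) (rule refl)
  also have "\<dots> = ennreal (1 / ?g * ((4 * pi) powr (- (?n / 2)) * Gamma p * 4 powr p * norm h powr (- 2 * p)))"
    by (subst ennreal_mult') auto
  also have "1 / ?g * ((4 * pi) powr (- (?n / 2)) * Gamma p * 4 powr p * norm h powr (- 2 * p)) =
     frac_const DIM('a) s / norm h powr (?n + 2 * s)"
  proof -
    have 4: "(4::real) powr s = 2 powr (2 * s)"
      using powr_powr[of 2 2 s] by simp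
    have 1: "(4 * pi) powr (- (?n / 2)) * 4 powr p = 2 powr (2 * s) / pi powr (?n/2)"
      by (simp add: powr_mult powr_minus p_def powr_add 4 field_simps)
    have "- 2 * p = - (?n + 2 * s)" by (simp add: p_def)
    then have 2: "norm h powr (- 2 * p) = 1 / norm h powr (?n + 2 * s)"
      by (simp only: powr_minus_divide)
    have 3: "(?n + 2 * s) / 2 = p" by (simp add: p_def field_simps)
    have "1 / ?g * ((4 * pi) powr (- (?n / 2)) * Gamma p * 4 powr p * norm h powr (- 2 * p)) =
      ((4 * pi) powr (- (?n / 2)) * 4 powr p) * Gamma p / ?g * norm h powr (- 2 * p)"
      by simp
    also have "\<dots> = frac_const DIM('a) s / norm h powr (?n + 2 * s)"
      unfolding frac_const_def 1 2 3 by simp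
    finally show ?thesis .
  qed
  finally show ?thesis .
qed

lemma frac_const_pos:
  assumes s: "0 < s" "s < 1" and n: "n > 0"
  shows "frac_const n s > 0"
  using abs_Gamma_minus[OF s] s n by (simp add: frac_const_def add_pos_pos)

text \<open>Writing 1 - exp(-t) as the integral of exp(-r) over 0 < r < t and exchanging integrals
  leaves Gamma(1-s) / (s |Gamma(-s)|), which is 1. A general \<open>\<sigma>\<close> follows by
  scaling.\<close>

lemma nn_integral_subord_one_minus_exp:
  assumes s: "0 < s" "s < 1" and \<sigma>: "\<sigma> > 0"
  shows "(\<integral>\<^sup>+t. ennreal (1 - exp (- (\<sigma> * t))) \<partial>subord s) = ennreal (\<sigma> powr s)"
proof -
  let ?g = "\<bar>Gamma (-s)\<bar>"
  have g: "?g > 0" "?g = Gamma (1 - s) / s" using abs_Gamma_minus[OF s] s by (simp_all add: Gamma_real_pos)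
  have inner: "ennreal (1 - exp (- t)) = (\<integral>\<^sup>+r. ennreal (indicator {0<..<t} r * exp (- r)) \<partial>lborel)" if t: "t > 0" for t :: real
  proof -
    have "(\<integral>\<^sup>+r. ennreal (exp (- r)) * indicator {0..t} r \<partial>lborel) = ennreal (- exp (- t) - (- exp (- 0)))"
      by (rule nn_integral_FTC_Icc) (use t in \<open>auto intro!: derivative_eq_intros\<close>)
    moreover have "(\<integral>\<^sup>+r. ennreal (exp (- r)) * indicator {0..t} r \<partial>lborel) = (\<integral>\<^sup>+r. ennreal (indicator {0<..<t} r * exp (- r)) \<partial>lborel)"
      using AE_lborel_singleton[of "0::real"] AE_lborel_singleton[of t]
      by (intro nn_integral_cong_AE, eventually_elim) (auto simp: indicator_def)
    ultimately show ?thesis by simp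
  qed
  have outer: "(\<integral>\<^sup>+t. ennreal (indicator {r<..} t * t powr (- 1 - s)) \<partial>lborel) = ennreal (r powr (- s) / s)" if r: "r > 0" for r :: real
  proof -
    have hi: "((\<lambda>t. t powr (- 1 - s)) has_integral - (r powr (- 1 - s + 1)) / (- 1 - s + 1)) {r..}"
      by (rule has_integral_powr_to_inf) (use s r in auto)
    have "(\<integral>\<^sup>+t. ennreal (indicator {r<..} t * t powr (- 1 - s)) \<partial>lborel) = (\<integral>\<^sup>+t. ennreal (indicator {r..} t * t powr (- 1 - s)) \<partial>lborel)"
      using AE_lborel_singleton[of r]
      by (intro nn_integral_cong_AE, eventually_elim) (auto simp: indicator_def)
    then show ?thesis using nn_integral_has_integral_lebesgue[OF _ hi] by simp
  qed
  have "(\<integral>\<^sup>+t. ennreal (1 - exp (- t)) \<partial>subord s) =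
    (\<integral>\<^sup>+t. \<integral>\<^sup>+r. ennreal (1 / ?g) * (ennreal (indicator {0<..} r * exp (- r)) * ennreal (indicator {r<..} t * t powr (- 1 - s))) \<partial>lborel \<partial>lborel)"
  proof (subst nn_integral_subord, measurable, intro nn_integral_cong)
    fix t :: real
    show "ennreal (indicator {0<..} t * t powr (- 1 - s) / ?g) * ennreal (1 - exp (- t)) =
      (\<integral>\<^sup>+r. ennreal (1 / ?g) * (ennreal (indicator {0<..} r * exp (- r)) * ennreal (indicator {r<..} t * t powr (- 1 - s))) \<partial>lborel)"
    proof (cases "t > 0")
      case True
      show ?thesis
        by (subst inner[OF True], subst nn_integral_cmult[symmetric], measurable, intro nn_integral_cong)
           (use True in \<open>auto simp: indicator_def ennreal_mult'[symmetric]\<close>)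
    next
      case False
      have "(\<integral>\<^sup>+r. ennreal (1 / ?g) * (ennreal (indicator {0<..} r * exp (- r)) * ennreal (indicator {r<..} t * t powr (- 1 - s))) \<partial>lborel) = (\<integral>\<^sup>+r. 0 \<partial>(lborel :: real measure))"
        by (intro nn_integral_cong) (use False in \<open>auto simp: indicator_def\<close>)
      then show ?thesis using False by simp
    qed
  qed
  also have "\<dots> = (\<integral>\<^sup>+r. \<integral>\<^sup>+t. ennreal (1 / ?g) * (ennreal (indicator {0<..} r * exp (- r)) * ennreal (indicator {r<..} t * t powr (- 1 - s))) \<partial>lborel \<partial>lborel)"
    by (rule lborel_pair.Fubini') (unfold indicator_def greaterThan_iff, measurable)
  also have "\<dots> = (\<integral>\<^sup>+r. ennreal (1 / (?g * s)) * ennreal (indicator {0<..} r * r powr ((1 - s) - 1) * exp (- (1 * r))) \<partial>lborel)"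
  proof (intro nn_integral_cong)
    fix r :: real
    show "(\<integral>\<^sup>+t. ennreal (1 / ?g) * (ennreal (indicator {0<..} r * exp (- r)) * ennreal (indicator {r<..} t * t powr (- 1 - s))) \<partial>lborel)
      = ennreal (1 / (?g * s)) * ennreal (indicator {0<..} r * r powr ((1 - s) - 1) * exp (- (1 * r)))"
    proof (cases "r > 0")
      case True
      show ?thesis
        by (subst nn_integral_cmult, measurable, subst nn_integral_cmult, measurable, subst outer[OF True])
           (use True s in \<open>simp add: ennreal_mult'[symmetric] mult_ac\<close>)
    qed simp
  qed
  also have "\<dots> = ennreal (1 / (?g * s)) * ennreal (Gamma (1 - s) * 1 powr (- (1 - s)))"
    by (subst nn_integral_cmult, measurable, subst nn_integral_Gamma_scaled) (use s in auto)
  also have "\<dots> = 1"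
  proof -
    have G1: "Gamma (1 - s) \<noteq> 0" using Gamma_real_pos[of "1 - s"] s by linarith
    have "1 / (?g * s) * (Gamma (1 - s) * 1 powr (- (1 - s))) = 1"
      using g(2) s G1 by simp
    then show ?thesis using Gamma_real_pos[of "1 - s"] s by (subst ennreal_mult'[symmetric]) auto
  qed
  finally have one: "(\<integral>\<^sup>+t. ennreal (1 - exp (- t)) \<partial>subord s) = 1" .
  have "(\<integral>\<^sup>+t. ennreal (1 - exp (- (\<sigma> * t))) \<partial>subord s) = ennreal ((1/\<sigma>) powr (- s)) * (\<integral>\<^sup>+t. ennreal (1 - exp (- (\<sigma> * ((1/\<sigma>) * t)))) \<partial>subord s)"
    by (rule nn_integral_subord_scale) (use \<sigma> in auto)
  also have "\<dots> = ennreal (\<sigma> powr s)"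
    using \<sigma> one by (simp add: powr_minus powr_divide)
  finally show ?thesis .
qed

text \<open>(1 + t/R)^(-b) is the Laplace transform of a Gamma density, so the claim is
  \<open>nn_integral_subord_one_minus_exp\<close> with \<open>\<sigma>\<close> = rho/R, averaged
  over rho. It will evaluate the fractional Laplacian of heat means decaying like R^(-b).\<close>

lemma nn_integral_subord_one_minus_powr:
  assumes s: "0 < s" "s < 1" and R: "R > 0" and b: "b > 0"
  shows "(\<integral>\<^sup>+t. ennreal (1 - (1 + t / R) powr (- b)) \<partial>subord s) = ennreal (R powr (- s) * Gamma (b + s) / Gamma b)"
proof -
  interpret T: sigma_finite_measure "subord s" by (rule sigma_finite_subord)
  interpret P: pair_sigma_finite "subord s" lborel
    by (intro pair_sigma_finite.intro sigma_finite_subord sigma_finite_lborel)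
  have Gb: "Gamma b > 0" using b by simp
  have inner: "ennreal (Gamma b) * ennreal (1 - (1 + t / R) powr (- b)) =
    (\<integral>\<^sup>+\<rho>. ennreal (indicator {0<..} \<rho> * \<rho> powr (b - 1) * exp (- (1 * \<rho>))) * ennreal (1 - exp (- (\<rho> / R * t))) \<partial>lborel)"
    if t: "t > 0" for t
  proof -
    have tR: "1 + t / R > 0" using t R by (simp add: add_pos_pos)
    have le1: "(1 + t / R) powr (- b) \<le> 1"
      using powr_mono2'[of "-b" 1 "1 + t/R"] t R b by simp
    let ?A = "\<lambda>c. (\<integral>\<^sup>+\<rho>. ennreal (indicator {0<..} \<rho> * \<rho> powr (b - 1) * exp (- (c * \<rho>))) \<partial>lborel)"
    have "(\<integral>\<^sup>+\<rho>. ennreal (indicator {0<..} \<rho> * \<rho> powr (b - 1) * exp (- (1 * \<rho>))) * ennreal (1 - exp (- (\<rho> / R * t))) \<partial>lborel)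
      = (\<integral>\<^sup>+\<rho>. ennreal (indicator {0<..} \<rho> * \<rho> powr (b - 1) * exp (- (1 * \<rho>))) - ennreal (indicator {0<..} \<rho> * \<rho> powr (b - 1) * exp (- ((1 + t / R) * \<rho>))) \<partial>lborel)"
    proof (intro nn_integral_cong)
      fix \<rho> :: real
      show "ennreal (indicator {0<..} \<rho> * \<rho> powr (b - 1) * exp (- (1 * \<rho>))) * ennreal (1 - exp (- (\<rho> / R * t)))
       = ennreal (indicator {0<..} \<rho> * \<rho> powr (b - 1) * exp (- (1 * \<rho>))) - ennreal (indicator {0<..} \<rho> * \<rho> powr (b - 1) * exp (- ((1 + t / R) * \<rho>)))"
      proof (cases "\<rho> > 0")
        case True
        have "exp (- ((1 + t / R) * \<rho>)) = exp (- (1 * \<rho>)) * exp (- (\<rho> / R * t))"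
          by (simp add: exp_add[symmetric] algebra_simps)
        moreover have "exp (- (\<rho> / R * t)) \<le> 1" using True R t by simp
        ultimately show ?thesis using True
          by (subst ennreal_minus) (auto simp: ennreal_mult'[symmetric] right_diff_distrib)
      qed simp
    qed
    also have "\<dots> = ?A 1 - ?A (1 + t / R)"
    proof (rule nn_integral_diff)
      show "?A (1 + t / R) \<noteq> \<infinity>" by (subst nn_integral_Gamma_scaled[OF b tR]) simp
      show "AE \<rho> in lborel. ennreal (indicator {0<..} \<rho> * \<rho> powr (b - 1) * exp (- ((1 + t / R) * \<rho>))) \<le> ennreal (indicator {0<..} \<rho> * \<rho> powr (b - 1) * exp (- (1 * \<rho>)))"
        using R t by (intro AE_I2 ennreal_leI) (auto simp: indicator_def intro!: mult_left_mono)
    qed auto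
    also have "\<dots> = ennreal (Gamma b - Gamma b * (1 + t / R) powr (- b))"
      using nn_integral_Gamma_scaled[OF b tR] nn_integral_Gamma_scaled[OF b zero_less_one] Gb
      by (simp add: ennreal_minus)
    also have "\<dots> = ennreal (Gamma b) * ennreal (1 - (1 + t / R) powr (- b))"
      using Gb le1 by (simp add: ennreal_mult'[symmetric] right_diff_distrib)
    finally show ?thesis by simp
  qed
  have "ennreal (Gamma b) * (\<integral>\<^sup>+t. ennreal (1 - (1 + t / R) powr (- b)) \<partial>subord s) =
     (\<integral>\<^sup>+t. ennreal (Gamma b) * ennreal (1 - (1 + t / R) powr (- b)) \<partial>subord s)"
    by (rule nn_integral_cmult[symmetric]) auto
  also have "\<dots> = (\<integral>\<^sup>+t. \<integral>\<^sup>+\<rho>. ennreal (indicator {0<..} \<rho> * \<rho> powr (b - 1) * exp (- (1 * \<rho>))) * ennreal (1 - exp (- (\<rho> / R * t))) \<partial>lborel \<partial>subord s)"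
    using AE_subord_pos[of s] by (intro nn_integral_cong_AE, eventually_elim) (rule inner)
  also have "\<dots> = (\<integral>\<^sup>+\<rho>. \<integral>\<^sup>+t. ennreal (indicator {0<..} \<rho> * \<rho> powr (b - 1) * exp (- (1 * \<rho>))) * ennreal (1 - exp (- (\<rho> / R * t))) \<partial>subord s \<partial>lborel)"
    by (rule P.Fubini'[symmetric]) measurable
  also have "\<dots> = (\<integral>\<^sup>+\<rho>. ennreal (R powr (- s)) * ennreal (indicator {0<..} \<rho> * \<rho> powr (b + s - 1) * exp (- (1 * \<rho>))) \<partial>lborel)"
  proof (intro nn_integral_cong)
    fix \<rho> :: real
    show "(\<integral>\<^sup>+t. ennreal (indicator {0<..} \<rho> * \<rho> powr (b - 1) * exp (- (1 * \<rho>))) * ennreal (1 - exp (- (\<rho> / R * t))) \<partial>subord s) =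
      ennreal (R powr (- s)) * ennreal (indicator {0<..} \<rho> * \<rho> powr (b + s - 1) * exp (- (1 * \<rho>)))"
    proof (cases "\<rho> > 0")
      case True
      have "\<rho> powr (b - 1) * (\<rho> / R) powr s = R powr (- s) * \<rho> powr (b + s - 1)"
        using True R by (simp add: powr_divide powr_minus powr_diff powr_add field_simps)
      then have "\<rho> powr (b - 1) * exp (- \<rho>) * (\<rho> / R) powr s = R powr (- s) * (\<rho> powr (b + s - 1) * exp (- \<rho>))"
        by (simp add: algebra_simps)
      then show ?thesis
        by (subst nn_integral_cmult, measurable, subst nn_integral_subord_one_minus_exp[OF s])
           (use True R in \<open>auto simp: ennreal_mult'[symmetric]\<close>)
    qed simp
  qed
  also have "\<dots> = ennreal (R powr (- s) * Gamma (b + s))"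
    using nn_integral_Gamma_scaled[of "b + s" 1] b s
    by (subst nn_integral_cmult, measurable) (auto simp: ennreal_mult'[symmetric])
  finally have "ennreal (1 / Gamma b) * (ennreal (Gamma b) * (\<integral>\<^sup>+t. ennreal (1 - (1 + t / R) powr (- b)) \<partial>subord s)) =
     ennreal (1 / Gamma b) * ennreal (R powr (- s) * Gamma (b + s))" by simp
  moreover have "ennreal (1 / Gamma b) * (ennreal (Gamma b) * X) = X" for X
    using Gb by (simp add: mult.assoc[symmetric] ennreal_mult'[symmetric])
  ultimately show ?thesis using Gb b s by (simp add: ennreal_mult'[symmetric])
qed

text \<open>A bound O(min 1 t) on a heat difference thus suffices for convergence against
  \<open>subord s\<close>. It follows from min 1 t <= 2 t/(1+t) <= 2 (1 - exp(-t)).\<close>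

lemma nn_integral_subord_min:
  assumes s: "0 < s" "s < 1"
  shows "(\<integral>\<^sup>+t. ennreal (min 1 t) \<partial>subord s) < \<infinity>"
proof -
  have le: "min 1 t \<le> 2 * (1 - exp (- t))" if "t > 0" for t :: real
  proof -
    have "1 + t \<le> exp t" using exp_ge_add_one_self[of t] by simp
    then have "exp (- t) \<le> 1 / (1 + t)" using that by (simp add: exp_minus field_simps)
    moreover have "min 1 t \<le> 2 * (1 - 1 / (1 + t))"
      using that by (simp add: min_def field_simps)
    ultimately show ?thesis by argo
  qed
  have "(\<integral>\<^sup>+t. ennreal (min 1 t) \<partial>subord s) \<le> (\<integral>\<^sup>+t. ennreal 2 * ennreal (1 - exp (- (1 * t))) \<partial>subord s)"
    using AE_subord_pos[of s]
    by (intro nn_integral_mono_AE, eventually_elim) (use le in \<open>auto simp: ennreal_mult'[symmetric] simp del: ennreal_numeral intro!: ennreal_leI\<close>)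
  also have "\<dots> = ennreal 2"
    by (subst nn_integral_cmult, measurable, subst nn_integral_subord_one_minus_exp[OF s]) auto
  also have "\<dots> < \<infinity>" by simp
  finally show ?thesis .
qed

lemma Fubini_swap:
  fixes f :: "'a \<Rightarrow> 'b \<Rightarrow> real"
  assumes sf: "sigma_finite_measure M1" "sigma_finite_measure M2"
    and [measurable]: "case_prod f \<in> borel_measurable (M1 \<Otimes>\<^sub>M M2)"
    and fin: "(\<integral>\<^sup>+x. \<integral>\<^sup>+y. ennreal \<bar>f x y\<bar> \<partial>M2 \<partial>M1) < \<infinity>"
  shows "integrable M1 (\<lambda>x. \<integral>y. f x y \<partial>M2)" "integrable M2 (\<lambda>y. \<integral>x. f x y \<partial>M1)"
    "(\<integral>x. \<integral>y. f x y \<partial>M2 \<partial>M1) = (\<integral>y. \<integral>x. f x y \<partial>M1 \<partial>M2)"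
    "AE x in M1. integrable M2 (f x)" "AE y in M2. integrable M1 (\<lambda>x. f x y)"
proof -
  interpret P: pair_sigma_finite M1 M2 by (intro pair_sigma_finite.intro sf)
  have int: "integrable (M1 \<Otimes>\<^sub>M M2) (case_prod f)"
    unfolding integrable_iff_bounded using fin
    by (simp add: P.M2.nn_integral_fst[symmetric] split_beta')
  show "integrable M1 (\<lambda>x. \<integral>y. f x y \<partial>M2)" "integrable M2 (\<lambda>y. \<integral>x. f x y \<partial>M1)"
    "(\<integral>x. \<integral>y. f x y \<partial>M2 \<partial>M1) = (\<integral>y. \<integral>x. f x y \<partial>M1 \<partial>M2)"
    "AE x in M1. integrable M2 (f x)" "AE y in M2. integrable M1 (\<lambda>x. f x y)"
    using P.integrable_fst[OF int] P.integrable_snd[OF int] P.integral_fst[OF int] P.integral_snd[OF int]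
      P.AE_integrable_fst[OF int] P.AE_integrable_snd[OF int] by auto
qed

text \<open>Since \<open>\<integral>t. gap \<gamma> \<tau> t \<partial>subord s\<close> is the Marchaud derivative of \<open>\<tau> powr (\<gamma> - 1)\<close>, it equals \<open>marchaud s \<gamma> * \<tau> powr (\<gamma> - s - 1)\<close>.\<close>

definition gap :: "real \<Rightarrow> real \<Rightarrow> real \<Rightarrow> real" where
  "gap \<gamma> \<tau> t = \<tau> powr (\<gamma> - 1) - (if t < \<tau> then (\<tau> - t) powr (\<gamma> - 1) else 0)"

text \<open>This is Gamma(\<open>\<gamma>\<close>) / Gamma(\<open>\<gamma>\<close> - s) with
  numerator and denominator multiplied by \<open>\<gamma>\<close> - s, so that no pole is met at
  \<open>\<gamma>\<close> = s. The value 0 there is what makes the fundamental solution s-harmonic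
  off the origin.\<close>

definition marchaud :: "real \<Rightarrow> real \<Rightarrow> real" where
  "marchaud s \<gamma> = (\<gamma> - s) * Gamma \<gamma> / Gamma (\<gamma> + 1 - s)"

lemma borel_measurable_gap [measurable (raw)]:
  assumes [measurable]: "f \<in> borel_measurable M" "g \<in> borel_measurable M"
  shows "(\<lambda>x. gap \<gamma> (f x) (g x)) \<in> borel_measurable M"
  unfolding gap_def by measurable

lemma gap_scale:
  assumes "\<tau> > 0" shows "gap \<gamma> \<tau> (\<tau> * r) = \<tau> powr (\<gamma> - 1) * gap \<gamma> 1 r"
proof -
  have "(\<tau> - \<tau> * r) powr (\<gamma> - 1) = \<tau> powr (\<gamma> - 1) * (1 - r) powr (\<gamma> - 1)" if "r < 1"
    using assms that powr_mult[of \<tau> "1 - r" "\<gamma> - 1"] by (simp add: right_diff_distrib)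
  moreover have "\<tau> * r < \<tau> \<longleftrightarrow> r < 1" using assms by simp
  ultimately show ?thesis by (simp add: gap_def right_diff_distrib)
qed

text \<open>Integration by parts. The primitive \<open>F\<close> of the singular part has boundary
  contribution -1/s, and what is left over is a multiple of the Beta integrand. The exponent in
  \<open>F\<close> is \<open>\<gamma>\<close> instead of \<open>\<gamma>\<close> - 1 so that
  \<open>F\<close> stays continuous at t = 1 for small \<open>\<gamma>\<close>.\<close>

lemma has_integral_gap_near:
  fixes s \<gamma> :: real
  assumes s: "0 < s" "s < 1" and g: "\<gamma> > 0"
  shows "((\<lambda>t. t powr (- 1 - s) * (1 - (1 - t) powr (\<gamma> - 1))) has_integral
    (- 1 / s + (\<gamma> - s) / s * Beta (1 - s) \<gamma>)) {0..1}"
proof -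
  define F where "F t = (1 / s) * (t powr (- s) * (1 - t) powr \<gamma> - t powr (- s))" for t :: real
  define F' where "F' t = t powr (- 1 - s) * (1 - (1 - t) powr \<gamma>) - \<gamma> / s * (t powr (- s) * (1 - t) powr (\<gamma> - 1))" for t :: real
  have lim: "((\<lambda>t::real. t powr (1 - s) * (((1 - t) powr \<gamma> - (1 - 0) powr \<gamma>) / (t - 0))) \<longlongrightarrow> 0 powr (1 - s) * (- \<gamma>)) (at 0 within {0..1})"
  proof (intro tendsto_mult)
    show "((\<lambda>t. t powr (1 - s)) \<longlongrightarrow> 0 powr (1 - s)) (at 0 within {0..1})"
      by (intro tendsto_powr') (use s in \<open>auto simp: eventually_at_filter\<close>)
    have "((\<lambda>t::real. (1 - t) powr \<gamma>) has_field_derivative (- \<gamma>)) (at 0)"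
      by (auto intro!: derivative_eq_intros)
    then have "((\<lambda>t::real. (1 - t) powr \<gamma>) has_field_derivative (- \<gamma>)) (at 0 within {0..1})"
      by (rule has_field_derivative_at_within)
    then show "((\<lambda>t::real. ((1 - t) powr \<gamma> - (1 - 0) powr \<gamma>) / (t - 0)) \<longlongrightarrow> - \<gamma>) (at 0 within {0..1})"
      by (simp add: has_field_derivative_iff)
  qed
  \<comment> \<open>The convention 0 powr x = 0 supplies the right value: \<open>F\<close> tends to
    0 at the origin because it is t^(1-s) times a bounded difference quotient.\<close>
  have F0: "F 0 = 0" by (simp add: F_def)
  have "((\<lambda>t. (1 / s) * (t powr (1 - s) * (((1 - t) powr \<gamma> - (1 - 0) powr \<gamma>) / (t - 0)))) \<longlongrightarrow> (1 / s) * (0 powr (1 - s) * (- \<gamma>))) (at 0 within {0..1})"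
    by (intro tendsto_mult tendsto_const lim)
  then have "((\<lambda>t. (1 / s) * (t powr (1 - s) * (((1 - t) powr \<gamma> - (1 - 0) powr \<gamma>) / (t - 0)))) \<longlongrightarrow> 0) (at 0 within {0..1})"
    by simp
  moreover have "\<forall>\<^sub>F t in at 0 within {0..1}. (1 / s) * (t powr (1 - s) * (((1 - t) powr \<gamma> - (1 - 0) powr \<gamma>) / (t - 0))) = F t"
    unfolding eventually_at_filter
  proof (intro always_eventually allI impI)
    fix t :: real assume t: "t \<noteq> 0" "t \<in> {0..1}"
    have "t powr (1 - s) = t * t powr (- s)" using t by (simp add: powr_diff powr_minus field_simps)
    then show "(1 / s) * (t powr (1 - s) * (((1 - t) powr \<gamma> - (1 - 0) powr \<gamma>) / (t - 0))) = F t"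
      using t by (simp add: F_def) (simp add: right_diff_distrib)
  qed
  ultimately have "(F \<longlongrightarrow> F 0) (at 0 within {0..1})"
    unfolding F0 by (rule Lim_transform_eventually)
  then have c0: "continuous (at 0 within {0..1}) F" by (simp add: continuous_within)
  have cont: "continuous_on {0..1} F"
    unfolding continuous_on_eq_continuous_within
  proof
    fix x :: real assume x: "x \<in> {0..1}"
    show "continuous (at x within {0..1}) F"
    proof (cases "x = 0")
      case True then show ?thesis using c0 by simp
    next
      case False
      have "continuous_on {0<..1} F"
        unfolding F_def by (intro continuous_intros continuous_on_powr') (use g in auto)
      then have "continuous (at x within {0<..1}) F"
        using x False by (simp add: continuous_on_eq_continuous_within)
      moreover have "at x within {0<..1} = at x within {0..1}"
        using x False by (intro at_within_nhd[of x "{0<..}"]) auto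
      ultimately show ?thesis by (simp add: continuous_within)
    qed
  qed
  have "(F' has_integral (F 1 - F 0)) {0..1}"
  proof (rule fundamental_theorem_of_calculus_interior[OF _ cont])
    fix x :: real assume x: "x \<in> {0<..<1}"
    have "(F has_field_derivative F' x) (at x)"
      unfolding F_def F'_def
      by (rule derivative_eq_intros refl | (use x in force))+
         (use x s in \<open>simp add: field_simps powr_diff powr_minus powr_add\<close>)
    then show "(F has_vector_derivative F' x) (at x)"
      by (simp add: has_real_derivative_iff_has_vector_derivative)
  qed simp
  moreover have "F 1 - F 0 = - 1 / s" using g by (simp add: F_def)
  moreover have "((\<lambda>t. t powr ((1 - s) - 1) * (1 - t) powr (\<gamma> - 1)) has_integral Beta (1 - s) \<gamma>) {0..1}"
    by (rule has_integral_Beta_real) (use s g in auto)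
  ultimately have "((\<lambda>t. F' t + (\<gamma> - s) / s * (t powr ((1 - s) - 1) * (1 - t) powr (\<gamma> - 1))) has_integral
     (- 1 / s + (\<gamma> - s) / s * Beta (1 - s) \<gamma>)) {0..1}"
    by (intro has_integral_add has_integral_mult_right) simp_all
  then show ?thesis
  proof (rule has_integral_spike[of "{0,1}", rotated 2])
    fix t :: real assume t: "t \<in> {0..1} - {0,1}"
    have a: "(1 - t) powr \<gamma> = (1 - t) * (1 - t) powr (\<gamma> - 1)" 
      using t by (simp add: powr_diff)
    have b: "t powr (- s) = t * t powr (- 1 - s)" using t by (simp add: powr_diff powr_minus field_simps)
    show "t powr (- 1 - s) * (1 - (1 - t) powr (\<gamma> - 1)) = F' t + (\<gamma> - s) / s * (t powr ((1 - s) - 1) * (1 - t) powr (\<gamma> - 1))"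
      unfolding F'_def a using s by (simp add: b field_simps)
  qed auto
qed

text \<open>The range t >= 1, where \<open>gap\<close> is 1, contributes 1/s and cancels the
  boundary term of \<open>has_integral_gap_near\<close>. Only the Beta integral survives, and it
  combines with |Gamma(-s)| into \<open>marchaud\<close>.\<close>

lemma gap_subord_one:
  assumes s: "0 < s" "s < 1" and g: "\<gamma> > 0"
  shows "integrable (subord s) (gap \<gamma> 1)" "(\<integral>t. gap \<gamma> 1 t \<partial>subord s) = marchaud s \<gamma>"
proof -
  let ?I1 = "- 1 / s + (\<gamma> - s) / s * Beta (1 - s) \<gamma>"
  define \<psi> where "\<psi> t = t powr (- 1 - s) * gap \<gamma> 1 t" for t :: real
  have [measurable]: "\<psi> \<in> borel_measurable borel" unfolding \<psi>_def by measurable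
  have h1: "(\<psi> has_integral ?I1) {0<..<1}"
  proof -
    have "((\<lambda>t. t powr (- 1 - s) * (1 - (1 - t) powr (\<gamma> - 1))) has_integral ?I1) {0<..<1}"
      using has_integral_gap_near[OF s g] by (simp add: has_integral_Icc_iff_Ioo)
    then show ?thesis
      by (rule has_integral_eq[rotated]) (auto simp: \<psi>_def gap_def)
  qed
  have a1: "\<psi> absolutely_integrable_on {0<..<1}"
  \<comment> \<open>On (0,1) the sign of \<open>gap\<close> is constant: nonnegative for
    \<open>\<gamma>\<close> >= 1, nonpositive otherwise. Hence integrability there is automatically
    absolute.\<close>
  proof (cases "\<gamma> \<ge> 1")
    case True
    have "\<psi> t \<ge> 0" if "t \<in> {0<..<1}" for t
      using that True powr_le1[of "\<gamma> - 1" "1 - t"] by (auto simp: \<psi>_def gap_def intro!: mult_nonneg_nonneg)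
    then show ?thesis using h1 by (subst absolutely_integrable_on_iff_nonneg) auto
  next
    case False
    have "- \<psi> t \<ge> 0" if "t \<in> {0<..<1}" for t
      using that False powr_mono2'[of "\<gamma> - 1" "1 - t" 1] by (auto simp: \<psi>_def gap_def mult_le_0_iff)
    then have "(\<lambda>t. - \<psi> t) absolutely_integrable_on {0<..<1}"
      using h1 by (subst absolutely_integrable_on_iff_nonneg) (auto intro: integrable_neg)
    then show ?thesis
      unfolding set_integrable_def by (drule_tac integrable_minus) simp
  qed
  have h2: "(\<psi> has_integral (1 / s)) {1..}"
  proof -
    have "((\<lambda>t. t powr (- 1 - s)) has_integral - (1 powr (- 1 - s + 1)) / (- 1 - s + 1)) {1..}"
      by (rule has_integral_powr_to_inf) (use s in auto)
    then have "((\<lambda>t. t powr (- 1 - s)) has_integral 1 / s) {1..}" by simp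
    then show ?thesis by (rule has_integral_eq[rotated]) (auto simp: \<psi>_def gap_def)
  qed
  have a2: "\<psi> absolutely_integrable_on {1..}"
    using h2 by (subst absolutely_integrable_on_iff_nonneg) (auto simp: \<psi>_def gap_def)
  have L1: "set_integrable lborel {0<..<1} \<psi>" "set_lebesgue_integral lborel {0<..<1} \<psi> = ?I1"
    using a1 h1 set_lebesgue_integral_eq_integral[OF a1]
    by (auto simp: set_integrable_def set_lebesgue_integral_def integrable_completion integral_completion integral_unique)
  have L2: "set_integrable lborel {1..} \<psi>" "set_lebesgue_integral lborel {1..} \<psi> = 1 / s"
    using a2 h2 set_lebesgue_integral_eq_integral[OF a2]
    by (auto simp: set_integrable_def set_lebesgue_integral_def integrable_completion integral_completion integral_unique)
  have U: "{0<..<1} \<union> {1..} = {0::real<..}" by auto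
  have L: "set_integrable lborel {0<..} \<psi>" "set_lebesgue_integral lborel {0<..} \<psi> = (\<gamma> - s) / s * Beta (1 - s) \<gamma>"
    using set_integrable_Un[OF L1(1) L2(1)] set_integral_Un[OF _ L1(1) L2(1)] L1(2) L2(2)
    unfolding U by (auto simp: disjoint_iff)
  have eq: "(\<lambda>t. (indicator {0<..} t * t powr (- 1 - s) / \<bar>Gamma (-s)\<bar>) *\<^sub>R gap \<gamma> 1 t) = (\<lambda>t. (1 / \<bar>Gamma (-s)\<bar>) * (indicator {0<..} t *\<^sub>R \<psi> t))"
    by (auto simp: \<psi>_def)
  have I: "integrable lborel (\<lambda>t. (indicator {0<..} t * t powr (- 1 - s) / \<bar>Gamma (-s)\<bar>) *\<^sub>R gap \<gamma> 1 t)"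
    unfolding eq by (intro integrable_mult_right L(1)[unfolded set_integrable_def])
  have m: "gap \<gamma> 1 \<in> borel_measurable lborel"
    "(\<lambda>t. indicat_real {0<..} t * t powr (- 1 - s) / \<bar>Gamma (-s)\<bar>) \<in> borel_measurable lborel"
    by measurable
  have nn: "AE t in lborel. 0 \<le> indicat_real {0<..} t * t powr (- 1 - s) / \<bar>Gamma (-s)\<bar>" by simp
  show "integrable (subord s) (gap \<gamma> 1)"
    unfolding subord_def using I integrable_density[OF m nn] by blast
  have "(\<integral>t. gap \<gamma> 1 t \<partial>subord s) = (\<integral>t. (indicator {0<..} t * t powr (- 1 - s) / \<bar>Gamma (-s)\<bar>) *\<^sub>R gap \<gamma> 1 t \<partial>lborel)"
    unfolding subord_def by (rule integral_density[OF m nn])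
  also have "\<dots> = (1 / \<bar>Gamma (-s)\<bar>) * ((\<gamma> - s) / s * Beta (1 - s) \<gamma>)"
    unfolding eq using L(2) by (simp only: integral_mult_right_zero set_lebesgue_integral_def)
  also have "\<dots> = marchaud s \<gamma>"
  proof -
    have "Gamma (1 - s) \<noteq> 0" using Gamma_real_pos[of "1 - s"] s by linarith
    then show ?thesis using s
      by (simp add: abs_Gamma_minus[OF s] marchaud_def Beta_def add.commute add_diff_eq)
  qed
  finally show "(\<integral>t. gap \<gamma> 1 t \<partial>subord s) = marchaud s \<gamma>" .
qed

text \<open>By \<open>gap_scale\<close> and the homogeneity of \<open>subord\<close> everything
  reduces to \<open>\<tau>\<close> = 1. The third claim is the absolute bound that later justifies
  Fubini.\<close>

lemma gap_subord:
  assumes s: "0 < s" "s < 1" and g: "\<gamma> > 0" and t: "\<tau> > 0"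
  shows "integrable (subord s) (gap \<gamma> \<tau>)" "(\<integral>t. gap \<gamma> \<tau> t \<partial>subord s) = marchaud s \<gamma> * \<tau> powr (\<gamma> - s - 1)"
    "(\<integral>\<^sup>+t. ennreal \<bar>gap \<gamma> \<tau> t\<bar> \<partial>subord s) = ennreal (\<tau> powr (\<gamma> - s - 1)) * (\<integral>\<^sup>+t. ennreal \<bar>gap \<gamma> 1 t\<bar> \<partial>subord s)"
proof -
  have p: "\<tau> powr (- s) * \<tau> powr (\<gamma> - 1) = \<tau> powr (\<gamma> - s - 1)"
    by (subst powr_add[symmetric]) (simp add: algebra_simps)
  have [measurable]: "gap \<gamma> \<tau> \<in> borel_measurable borel" by measurable
  show "integrable (subord s) (gap \<gamma> \<tau>)"
    by (rule integrable_subord_scale[OF _ _ t]) (use gap_subord_one(1)[OF s g] in \<open>simp_all add: gap_scale[OF t]\<close>)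
  show "(\<integral>t. gap \<gamma> \<tau> t \<partial>subord s) = marchaud s \<gamma> * \<tau> powr (\<gamma> - s - 1)"
    by (subst integral_subord_scale[OF _ t]) (simp_all add: gap_scale[OF t] gap_subord_one(2)[OF s g] p[symmetric])
  have "(\<integral>\<^sup>+t. ennreal \<bar>gap \<gamma> \<tau> t\<bar> \<partial>subord s) = ennreal (\<tau> powr (- s)) * (\<integral>\<^sup>+t. ennreal (\<tau> powr (\<gamma> - 1)) * ennreal \<bar>gap \<gamma> 1 t\<bar> \<partial>subord s)"
    by (subst nn_integral_subord_scale[OF _ t]) (simp_all add: gap_scale[OF t] abs_mult ennreal_mult')
  also have "\<dots> = ennreal (\<tau> powr (\<gamma> - s - 1)) * (\<integral>\<^sup>+t. ennreal \<bar>gap \<gamma> 1 t\<bar> \<partial>subord s)"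
    by (subst nn_integral_cmult, measurable) (simp add: p[symmetric] ennreal_mult' mult.assoc)
  finally show "(\<integral>\<^sup>+t. ennreal \<bar>gap \<gamma> \<tau> t\<bar> \<partial>subord s) = ennreal (\<tau> powr (\<gamma> - s - 1)) * (\<integral>\<^sup>+t. ennreal \<bar>gap \<gamma> 1 t\<bar> \<partial>subord s)" .
qed

lemma sets_borel_cball [measurable]: "cball c r \<in> sets (borel :: 'a::euclidean_space measure)"
  by simp

lemma nn_integral_norm_powr_cball:
  assumes \<beta>: "\<beta> < real DIM('a)" and R: "R > 0"
  shows "(\<integral>\<^sup>+(x::'a::euclidean_space). ennreal (indicator (cball 0 R) x * norm x powr (- \<beta>)) \<partial>lborel) < \<infinity>"
proof -
  let ?n = "real DIM('a)"
  define e where "e = (?n - \<beta>) / 2 - 1"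
  have e: "e > -1" using \<beta> by (simp add: e_def)
  have hi: "((\<lambda>\<rho>. \<rho> powr e) has_integral ((R\<^sup>2) powr (e + 1) / (e + 1))) {0..R\<^sup>2}"
    by (rule has_integral_powr_from_0) (use e in auto)
  have "(\<integral>\<^sup>+(x::'a). ennreal (indicator (cball 0 R) x * norm x powr (- \<beta>)) \<partial>lborel) =
    (\<integral>\<^sup>+(x::'a). (\<lambda>\<rho>. ennreal (indicator {0..R\<^sup>2} \<rho> * \<rho> powr (- \<beta> / 2))) ((norm x)\<^sup>2) \<partial>lborel)"
  proof (intro nn_integral_cong)
    fix x :: 'a
    have "norm x powr (- \<beta>) = (norm x)\<^sup>2 powr (- \<beta> / 2)" if "x \<noteq> 0"
      using that powr_powr[of "norm x" 2 "- \<beta> / 2"] by simp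
    moreover have "(norm x)\<^sup>2 \<le> R\<^sup>2 \<longleftrightarrow> norm x \<le> R" using R by (simp add: abs_le_square_iff[symmetric])
    ultimately show "ennreal (indicator (cball 0 R) x * norm x powr (- \<beta>)) = (\<lambda>\<rho>. ennreal (indicator {0..R\<^sup>2} \<rho> * \<rho> powr (- \<beta> / 2))) ((norm x)\<^sup>2)"
      by (cases "x = 0") (auto simp: indicator_def)
  qed
  also have "\<dots> = ennreal (radial_const ?n) * (\<integral>\<^sup>+\<rho>. ennreal (indicator {0<..} \<rho> * \<rho> powr (?n / 2 - 1)) * ennreal (indicator {0..R\<^sup>2} \<rho> * \<rho> powr (- \<beta> / 2)) \<partial>lborel)"
    by (rule nn_integral_radial) measurable
  finally have 1: "(\<integral>\<^sup>+(x::'a). ennreal (indicator (cball 0 R) x * norm x powr (- \<beta>)) \<partial>lborel) =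
    ennreal (radial_const ?n) * (\<integral>\<^sup>+\<rho>. ennreal (indicator {0<..} \<rho> * \<rho> powr (?n / 2 - 1)) * ennreal (indicator {0..R\<^sup>2} \<rho> * \<rho> powr (- \<beta> / 2)) \<partial>lborel)" .
  have "(\<integral>\<^sup>+\<rho>. ennreal (indicator {0<..} \<rho> * \<rho> powr (?n / 2 - 1)) * ennreal (indicator {0..R\<^sup>2} \<rho> * \<rho> powr (- \<beta> / 2)) \<partial>lborel)
     \<le> (\<integral>\<^sup>+\<rho>. ennreal (indicator {0..R\<^sup>2} \<rho> * \<rho> powr e) \<partial>lborel)"
  proof (intro nn_integral_mono)
    fix \<rho> :: real
    have "\<rho> powr (?n / 2 - 1) * \<rho> powr (- \<beta> / 2) = \<rho> powr e"
      unfolding e_def powr_add[symmetric] by (rule arg_cong[where f="\<lambda>z. \<rho> powr z"]) (simp add: field_simps)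
    then show "ennreal (indicator {0<..} \<rho> * \<rho> powr (?n / 2 - 1)) * ennreal (indicator {0..R\<^sup>2} \<rho> * \<rho> powr (- \<beta> / 2)) \<le> ennreal (indicator {0..R\<^sup>2} \<rho> * \<rho> powr e)"
      by (auto simp: indicator_def ennreal_mult'[symmetric])
  qed
  also have "(\<integral>\<^sup>+\<rho>. ennreal (indicator {0..R\<^sup>2} \<rho> * \<rho> powr e) \<partial>lborel) = ennreal ((R\<^sup>2) powr (e + 1) / (e + 1))"
    by (rule nn_integral_has_integral_lebesgue[OF _ hi]) auto
  finally show ?thesis unfolding 1 by (auto simp: ennreal_mult_less_top intro: order_le_less_trans)
qed

section \<open>Powers of the norm under the heat semigroup\<close>

definition riesz_const :: "real \<Rightarrow> real \<Rightarrow> real" where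
  "riesz_const n \<beta> = (4 * pi) powr (- (n / 2)) * Gamma (\<beta> / 2) * 4 powr (\<beta> / 2)"

lemma riesz_const_pos: "\<beta> > 0 \<Longrightarrow> riesz_const n \<beta> > 0"
  by (simp add: riesz_const_def)

text \<open>Riesz kernels are mixtures of heat kernels. Only positivity of \<open>\<beta>\<close>
  enters, so the order may reach or exceed n; order exactly n occurs for the fractional Laplacian of
  |x|^(-(n-2s)).\<close>

lemma nn_integral_riesz:
  fixes x :: "'a::euclidean_space"
  assumes "\<beta> > 0" "x \<noteq> 0"
  shows "(\<integral>\<^sup>+t. ennreal (indicator {0<..} t * t powr ((real DIM('a) - \<beta>) / 2 - 1) * heat t x) \<partial>lborel)
    = ennreal (riesz_const DIM('a) \<beta> * norm x powr (- \<beta>))"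
proof -
  have "real DIM('a) / 2 - \<beta> / 2 - 1 = (real DIM('a) - \<beta>) / 2 - 1" by (simp add: diff_divide_distrib)
  then show ?thesis using nn_integral_powr_heat[of "\<beta> / 2" x] assms by (simp only: riesz_const_def) simp
qed

definition heat_powr :: "real \<Rightarrow> real \<Rightarrow> 'a::euclidean_space \<Rightarrow> real" where
  "heat_powr \<beta> t x = (\<integral>y. norm y powr (- \<beta>) * heat t (x - y) \<partial>lborel)"

lemma heat_le: "t > 0 \<Longrightarrow> heat t (x::'a::euclidean_space) \<le> (4 * pi * t) powr (- (real DIM('a) / 2))"
  by (simp add: heat_def mult_left_le)

text \<open>Inside the unit ball the heat kernel is bounded and the power is locally integrable;
  outside, the power is at most 1 and the heat kernel has mass 1.\<close>

lemma nn_integral_powr_heat_finite: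
  fixes x :: "'a::euclidean_space"
  assumes \<beta>: "0 < \<beta>" "\<beta> < real DIM('a)" and t: "t > 0"
  shows "(\<integral>\<^sup>+y. ennreal (norm y powr (- \<beta>) * heat t (x - y)) \<partial>lborel) < \<infinity>"
proof -
  let ?C = "(4 * pi * t) powr (- (real DIM('a) / 2))"
  have "(\<integral>\<^sup>+y. ennreal (norm y powr (- \<beta>) * heat t (x - y)) \<partial>lborel) \<le>
     (\<integral>\<^sup>+y. ennreal (heat t (x - y)) + ennreal ?C * ennreal (indicator (cball 0 1) y * norm y powr (- \<beta>)) \<partial>lborel)"
  proof (intro nn_integral_mono)
    fix y :: 'a
    show "ennreal (norm y powr (- \<beta>) * heat t (x - y)) \<le> ennreal (heat t (x - y)) + ennreal ?C * ennreal (indicator (cball 0 1) y * norm y powr (- \<beta>))"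
    proof (cases "norm y \<le> 1")
      case True
      have "norm y powr (- \<beta>) * heat t (x - y) \<le> heat t (x - y) + ?C * norm y powr (- \<beta>)"
        using heat_le[OF t, of "x - y"] by (smt (verit) heat_nonneg mult.commute mult_left_mono powr_ge_zero)
      then show ?thesis using True by (simp add: ennreal_mult'[symmetric] ennreal_plus[symmetric] del: ennreal_plus)
    next
      case False
      then have "norm y powr (- \<beta>) \<le> 1" using powr_mono2'[of "-\<beta>" 1 "norm y"] \<beta> by auto
      then have "norm y powr (- \<beta>) * heat t (x - y) \<le> heat t (x - y)" by (simp add: mult_left_le_one_le)
      then show ?thesis using False by (simp add: ennreal_leI)
    qed
  qed
  also have "\<dots> = (\<integral>\<^sup>+y. ennreal (heat t (x - y)) \<partial>lborel) + ennreal ?C * (\<integral>\<^sup>+(y::'a). ennreal (indicator (cball 0 1) y * norm y powr (- \<beta>)) \<partial>lborel)"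
  proof -
    have A: "(\<lambda>y. ennreal (heat t (x - y))) \<in> borel_measurable lborel"
      and B: "(\<lambda>y::'a. ennreal (indicator (cball 0 1) y * norm y powr (- \<beta>))) \<in> borel_measurable lborel"
      by measurable
    show ?thesis
      by (subst nn_integral_add[OF A]) (use B in \<open>simp_all add: nn_integral_cmult[OF B]\<close>)
  qed
  also have "\<dots> < \<infinity>"
  proof -
    have "(\<integral>\<^sup>+y. ennreal (heat t (x - y)) \<partial>lborel) = 1"
      using nn_integral_heat[OF t, where 'a='a] nn_integral_lborel_reflect[of "\<lambda>y. ennreal (heat t y)" x] by simp
    then show ?thesis
      using nn_integral_norm_powr_cball[OF \<beta>(2) zero_less_one] by (simp add: ennreal_mult_less_top)
  qed
  finally show ?thesis .
qed

text \<open>By the semigroup law, applying heat for time t to the mixture of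
  \<open>nn_integral_riesz\<close> shifts the mixing parameter from \<open>\<tau>\<close> to
  \<open>\<tau>\<close> + t.\<close>

lemma heat_powr_eq:
  fixes x :: "'a::euclidean_space"
  assumes \<beta>: "0 < \<beta>" "\<beta> < real DIM('a)" and t: "t > 0"
  shows "(\<integral>\<^sup>+\<tau>. ennreal (indicator {t<..} \<tau> * (\<tau> - t) powr ((real DIM('a) - \<beta>) / 2 - 1) * heat \<tau> x) \<partial>lborel)
    = ennreal (riesz_const DIM('a) \<beta> * heat_powr \<beta> t x)"
proof -
  let ?e = "(real DIM('a) - \<beta>) / 2 - 1" and ?k = "riesz_const DIM('a) \<beta>"
  have k: "?k > 0" by (rule riesz_const_pos[OF \<beta>(1)])
  have "ennreal (?k * heat_powr \<beta> t x) = ennreal ?k * (\<integral>\<^sup>+y. ennreal (norm y powr (- \<beta>) * heat t (x - y)) \<partial>lborel)"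
    unfolding heat_powr_def using nn_integral_powr_heat_finite[OF \<beta> t, of x] k
    by (subst ennreal_mult, simp, simp, subst nn_integral_eq_integral) (auto intro: integrableI_bounded)
  also have "\<dots> = (\<integral>\<^sup>+y. ennreal (?k * norm y powr (- \<beta>)) * ennreal (heat t (x - y)) \<partial>lborel)"
    using k by (subst nn_integral_cmult[symmetric], measurable) (simp add: ennreal_mult' mult.assoc)
  also have "\<dots> = (\<integral>\<^sup>+y. \<integral>\<^sup>+\<tau>. ennreal (indicator {0<..} \<tau> * \<tau> powr ?e * heat \<tau> y) * ennreal (heat t (x - y)) \<partial>lborel \<partial>lborel)"
    using AE_lborel_singleton[of "0::'a"]
  proof (intro nn_integral_cong_AE, eventually_elim)
    fix y :: 'a assume y: "y \<noteq> 0"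
    show "ennreal (?k * norm y powr (- \<beta>)) * ennreal (heat t (x - y)) = (\<integral>\<^sup>+\<tau>. ennreal (indicator {0<..} \<tau> * \<tau> powr ?e * heat \<tau> y) * ennreal (heat t (x - y)) \<partial>lborel)"
      by (subst nn_integral_multc, measurable, subst nn_integral_riesz[OF \<beta>(1) y]) (rule refl)
  qed
  also have "\<dots> = (\<integral>\<^sup>+\<tau>. \<integral>\<^sup>+y. ennreal (indicator {0<..} \<tau> * \<tau> powr ?e * heat \<tau> y) * ennreal (heat t (x - y)) \<partial>lborel \<partial>lborel)"
    by (rule lborel_pair.Fubini') measurable
  also have "\<dots> = (\<integral>\<^sup>+\<tau>. ennreal (indicator {0<..} \<tau> * \<tau> powr ?e * heat (t + \<tau>) x) \<partial>lborel)"
  proof (intro nn_integral_cong)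
    fix \<tau> :: real
    show "(\<integral>\<^sup>+y. ennreal (indicator {0<..} \<tau> * \<tau> powr ?e * heat \<tau> y) * ennreal (heat t (x - y)) \<partial>lborel) = ennreal (indicator {0<..} \<tau> * \<tau> powr ?e * heat (t + \<tau>) x)"
    proof (cases "\<tau> > 0")
      case True
      have "(\<integral>\<^sup>+y. ennreal (indicator {0<..} \<tau> * \<tau> powr ?e * heat \<tau> y) * ennreal (heat t (x - y)) \<partial>lborel)
        = (\<integral>\<^sup>+y. ennreal (\<tau> powr ?e) * ennreal (heat t (x - y) * heat \<tau> y) \<partial>lborel)"
        using True by (intro nn_integral_cong) (auto simp: ennreal_mult'[symmetric] mult_ac)
      also have "\<dots> = ennreal (\<tau> powr ?e) * ennreal (heat (t + \<tau>) x)"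
        by (subst nn_integral_cmult, measurable, subst heat_semigroup[OF t True]) (rule refl)
      finally show ?thesis using True by (simp add: ennreal_mult')
    qed simp
  qed
  also have "\<dots> = (\<integral>\<^sup>+\<tau>. (\<lambda>\<tau>. ennreal (indicator {t<..} \<tau> * (\<tau> - t) powr ?e * heat \<tau> x)) (t + \<tau>) \<partial>lborel)"
    by (intro nn_integral_cong) (auto simp: indicator_def)
  also have "\<dots> = (\<integral>\<^sup>+\<tau>. ennreal (indicator {t<..} \<tau> * (\<tau> - t) powr ?e * heat \<tau> x) \<partial>lborel)"
    by (rule nn_integral_lborel_shift) measurable
  finally show ?thesis by simp
qed

text \<open>The two mixtures, shifted and unshifted, are finite and can be subtracted; the
  difference of their densities is exactly \<open>gap\<close>.\<close>

lemma powr_minus_heat_powr: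
  fixes x :: "'a::euclidean_space"
  assumes \<beta>: "0 < \<beta>" "\<beta> < real DIM('a)" and t: "t > 0" and x: "x \<noteq> 0"
  shows "riesz_const DIM('a) \<beta> * (norm x powr (- \<beta>) - heat_powr \<beta> t x) =
     (\<integral>\<tau>. indicator {0<..} \<tau> * gap ((real DIM('a) - \<beta>) / 2) \<tau> t * heat \<tau> x \<partial>lborel)"
proof -
  let ?e = "(real DIM('a) - \<beta>) / 2 - 1" and ?k = "riesz_const DIM('a) \<beta>"
  have k: "?k > 0" by (rule riesz_const_pos[OF \<beta>(1)])
  have h0: "heat_powr \<beta> t x \<ge> 0" unfolding heat_powr_def by (intro integral_nonneg_AE) auto
  have 1: "has_bochner_integral lborel (\<lambda>\<tau>. indicator {0<..} \<tau> * \<tau> powr ?e * heat \<tau> x) (?k * norm x powr (- \<beta>))"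
    by (rule has_bochner_integral_nn_integral) (use k nn_integral_riesz[OF \<beta>(1) x] in auto)
  have 2: "has_bochner_integral lborel (\<lambda>\<tau>. indicator {t<..} \<tau> * (\<tau> - t) powr ?e * heat \<tau> x) (?k * heat_powr \<beta> t x)"
    by (rule has_bochner_integral_nn_integral) (use k h0 heat_powr_eq[OF \<beta> t, of x] in auto)
  have "has_bochner_integral lborel (\<lambda>\<tau>. indicator {0<..} \<tau> * \<tau> powr ?e * heat \<tau> x - indicator {t<..} \<tau> * (\<tau> - t) powr ?e * heat \<tau> x) (?k * norm x powr (- \<beta>) - ?k * heat_powr \<beta> t x)"
    by (intro has_bochner_integral_diff 1 2)
  moreover have "(\<lambda>\<tau>. indicator {0<..} \<tau> * \<tau> powr ?e * heat \<tau> x - indicator {t<..} \<tau> * (\<tau> - t) powr ?e * heat \<tau> x) =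
     (\<lambda>\<tau>. indicator {0<..} \<tau> * gap ((real DIM('a) - \<beta>) / 2) \<tau> t * heat \<tau> x)"
    using t by (auto simp: indicator_def gap_def algebra_simps)
  ultimately show ?thesis
    by (simp add: has_bochner_integral_iff right_diff_distrib)
qed

lemma borel_measurable_heat_powr [measurable]:
  "(\<lambda>(t, x). heat_powr \<beta> t x) \<in> borel_measurable (borel \<Otimes>\<^sub>M borel)"
proof -
  have "(\<lambda>z::real \<times> 'a. \<integral>y. norm y powr (- \<beta>) * heat (fst z) (snd z - y) \<partial>lborel) \<in> borel_measurable (borel \<Otimes>\<^sub>M borel)"
    by (rule lborel.borel_measurable_lebesgue_integral) measurable
  then show ?thesis by (simp add: heat_powr_def split_beta')
qed

text \<open>The fractional Laplacian of |x|^(-beta), read as the integral of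
  \<open>id - heat semigroup\<close> against \<open>subord s\<close>. Exchanging the integrals in t
  and \<open>\<tau>\<close> reduces it to the one-dimensional Marchaud derivative, after which the
  remaining mixture is again a Riesz kernel. The bound with \<open>C\<close> allows a further
  integration in x.\<close>

lemma subord_powr:
  fixes \<beta> s :: real
  assumes s: "0 < s" "s < 1" and \<beta>: "0 < \<beta>" "\<beta> < real DIM('a::euclidean_space)"
  obtains C where
    "\<And>x::'a. x \<noteq> 0 \<Longrightarrow> integrable (subord s) (\<lambda>t. norm x powr (- \<beta>) - heat_powr \<beta> t x)"
    "\<And>x::'a. x \<noteq> 0 \<Longrightarrow> (\<integral>t. norm x powr (- \<beta>) - heat_powr \<beta> t x \<partial>subord s) =
       marchaud s ((real DIM('a) - \<beta>) / 2) * (riesz_const DIM('a) (\<beta> + 2 * s) / riesz_const DIM('a) \<beta>) * norm x powr (- (\<beta> + 2 * s))"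
    "\<And>x::'a. x \<noteq> 0 \<Longrightarrow> (\<integral>\<^sup>+t. ennreal \<bar>norm x powr (- \<beta>) - heat_powr \<beta> t x\<bar> \<partial>subord s) \<le> ennreal (C * norm x powr (- (\<beta> + 2 * s)))"
    "C \<ge> 0"
proof -
  let ?\<gamma> = "(real DIM('a) - \<beta>) / 2" and ?k = "riesz_const DIM('a) \<beta>" and ?k2 = "riesz_const DIM('a) (\<beta> + 2 * s)"
  have g: "?\<gamma> > 0" using \<beta> by simp
  have k: "?k > 0" "?k2 > 0" using riesz_const_pos \<beta> s by auto
  define Cg where "Cg = enn2real (\<integral>\<^sup>+t. ennreal \<bar>gap ?\<gamma> 1 t\<bar> \<partial>subord s)"
  have "(\<integral>\<^sup>+t. ennreal \<bar>gap ?\<gamma> 1 t\<bar> \<partial>subord s) < \<infinity>"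
    using gap_subord_one(1)[OF s g] by (simp add: integrable_iff_bounded)
  then have Cg: "(\<integral>\<^sup>+t. ennreal \<bar>gap ?\<gamma> 1 t\<bar> \<partial>subord s) = ennreal Cg" by (simp add: Cg_def)
  have Cg0: "Cg \<ge> 0" by (simp add: Cg_def)
  define f where "f x \<tau> t = indicator {0<..} \<tau> * gap ?\<gamma> \<tau> t * heat \<tau> x" for x :: 'a and \<tau> t :: real
  have [measurable]: "(\<lambda>(\<tau>, t). f x \<tau> t) \<in> borel_measurable (borel \<Otimes>\<^sub>M borel)" for x unfolding f_def by measurable
  \<comment> \<open>The power of \<open>\<tau>\<close> left by the Marchaud derivative is the mixing
    exponent of a Riesz kernel of order beta + 2s.\<close>
  have e: "?\<gamma> - s - 1 = (real DIM('a) - (\<beta> + 2 * s)) / 2 - 1" by (simp add: field_simps)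
  have bs: "\<beta> + 2 * s > 0" using \<beta> s by (simp add: add_pos_pos)
  have riesz: "(\<integral>\<^sup>+\<tau>. ennreal (indicator {0<..} \<tau> * \<tau> powr (?\<gamma> - s - 1) * heat \<tau> x) \<partial>lborel)
      = ennreal (?k2 * norm x powr (- (\<beta> + 2 * s)))" if x: "x \<noteq> 0" for x :: 'a
    by (simp only: e nn_integral_riesz[OF bs x])
  have riesz': "has_bochner_integral lborel (\<lambda>\<tau>. indicator {0<..} \<tau> * \<tau> powr (?\<gamma> - s - 1) * heat \<tau> x)
      (?k2 * norm x powr (- (\<beta> + 2 * s)))" if x: "x \<noteq> 0" for x :: 'a
    by (rule has_bochner_integral_nn_integral) (use k in \<open>auto simp: riesz[OF x] simp del: minus_add_distrib\<close>)
  have abs: "(\<integral>\<^sup>+\<tau>. \<integral>\<^sup>+t. ennreal \<bar>f x \<tau> t\<bar> \<partial>subord s \<partial>lborel) = ennreal (Cg * ?k2 * norm x powr (- (\<beta> + 2 * s)))" if x: "x \<noteq> 0" for x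
  proof -
    have "(\<integral>\<^sup>+\<tau>. \<integral>\<^sup>+t. ennreal \<bar>f x \<tau> t\<bar> \<partial>subord s \<partial>lborel) = (\<integral>\<^sup>+\<tau>. ennreal Cg * ennreal (indicator {0<..} \<tau> * \<tau> powr (?\<gamma> - s - 1) * heat \<tau> x) \<partial>lborel)"
    proof (intro nn_integral_cong)
      fix \<tau> :: real
      show "(\<integral>\<^sup>+t. ennreal \<bar>f x \<tau> t\<bar> \<partial>subord s) = ennreal Cg * ennreal (indicator {0<..} \<tau> * \<tau> powr (?\<gamma> - s - 1) * heat \<tau> x)"
      proof (cases "\<tau> > 0")
        case True
        have "(\<integral>\<^sup>+t. ennreal \<bar>f x \<tau> t\<bar> \<partial>subord s) = (\<integral>\<^sup>+t. ennreal (heat \<tau> x) * ennreal \<bar>gap ?\<gamma> \<tau> t\<bar> \<partial>subord s)"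
          using True by (intro nn_integral_cong) (auto simp: f_def abs_mult ennreal_mult' mult.commute)
        also have "\<dots> = ennreal (heat \<tau> x) * (ennreal (\<tau> powr (?\<gamma> - s - 1)) * ennreal Cg)"
          by (subst nn_integral_cmult, measurable, subst gap_subord(3)[OF s g True], subst Cg) (rule refl)
        finally show ?thesis using True Cg0 by (simp add: ennreal_mult'[symmetric] mult_ac)
      qed (simp add: f_def)
    qed
    also have "\<dots> = ennreal Cg * ennreal (?k2 * norm x powr (- (\<beta> + 2 * s)))"
      by (subst nn_integral_cmult, measurable) (simp only: riesz[OF x])
    finally show ?thesis using Cg0 k by (simp add: ennreal_mult'[symmetric] mult.assoc)
  qed
  have fin: "(\<integral>\<^sup>+\<tau>. \<integral>\<^sup>+t. ennreal \<bar>f x \<tau> t\<bar> \<partial>subord s \<partial>lborel) < \<infinity>" if x: "x \<noteq> 0" for x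
    using abs[OF x] by simp
  have m: "case_prod (f x) \<in> borel_measurable (lborel \<Otimes>\<^sub>M subord s)" for x by measurable
  have F: "integrable (subord s) (\<lambda>t. \<integral>\<tau>. f x \<tau> t \<partial>lborel)"
    "(\<integral>t. \<integral>\<tau>. f x \<tau> t \<partial>lborel \<partial>subord s) = (\<integral>\<tau>. \<integral>t. f x \<tau> t \<partial>subord s \<partial>lborel)"
    "AE t in subord s. integrable lborel (\<lambda>\<tau>. f x \<tau> t)" if x: "x \<noteq> 0" for x
    using Fubini_swap[OF sigma_finite_lborel sigma_finite_subord m fin[OF x]] by simp_all
  have rep: "AE t in subord s. (\<integral>\<tau>. f x \<tau> t \<partial>lborel) = ?k * (norm x powr (- \<beta>) - heat_powr \<beta> t x)" if x: "x \<noteq> 0" for x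
    using AE_subord_pos[of s]
    by eventually_elim (simp only: f_def powr_minus_heat_powr[OF \<beta> _ x])
  have rep': "AE t in subord s. norm x powr (- \<beta>) - heat_powr \<beta> t x = (1 / ?k) * (\<integral>\<tau>. f x \<tau> t \<partial>lborel)" if x: "x \<noteq> 0" for x
    using rep[OF x] by eventually_elim (use k in simp)
  have m2[measurable]: "(\<lambda>t. \<integral>\<tau>. f x \<tau> t \<partial>lborel) \<in> borel_measurable (subord s)" for x
    by (rule lborel.borel_measurable_lebesgue_integral) (unfold f_def, measurable)
  show ?thesis
  proof (rule that[of "Cg * ?k2 / ?k"])
    fix x :: 'a assume x: "x \<noteq> 0"
    have I: "integrable (subord s) (\<lambda>t. (1 / ?k) * (\<integral>\<tau>. f x \<tau> t \<partial>lborel))"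
      by (intro integrable_mult_right F(1)[OF x])
    show "integrable (subord s) (\<lambda>t. norm x powr (- \<beta>) - heat_powr \<beta> t x)"
      by (rule integrable_cong_AE_imp[OF I]) (use rep'[OF x] in auto)
    have "(\<integral>t. norm x powr (- \<beta>) - heat_powr \<beta> t x \<partial>subord s) = (\<integral>t. (1 / ?k) * (\<integral>\<tau>. f x \<tau> t \<partial>lborel) \<partial>subord s)"
      by (rule integral_cong_AE) (use rep'[OF x] in auto)
    also have "\<dots> = (1 / ?k) * (\<integral>\<tau>. \<integral>t. f x \<tau> t \<partial>subord s \<partial>lborel)"
      by (simp add: F(2)[OF x])
    also have "(\<integral>\<tau>. \<integral>t. f x \<tau> t \<partial>subord s \<partial>lborel) = (\<integral>\<tau>. marchaud s ?\<gamma> * (indicator {0<..} \<tau> * \<tau> powr (?\<gamma> - s - 1) * heat \<tau> x) \<partial>lborel)"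
    proof (intro Bochner_Integration.integral_cong refl)
      fix \<tau> :: real
      show "(\<integral>t. f x \<tau> t \<partial>subord s) = marchaud s ?\<gamma> * (indicator {0<..} \<tau> * \<tau> powr (?\<gamma> - s - 1) * heat \<tau> x)"
        by (cases "\<tau> > 0") (simp_all add: f_def gap_subord(2)[OF s g])
    qed
    also have "\<dots> = marchaud s ?\<gamma> * (?k2 * norm x powr (- (\<beta> + 2 * s)))"
      using riesz'[OF x] by (simp only: integral_mult_right_zero has_bochner_integral_iff)
    finally show "(\<integral>t. norm x powr (- \<beta>) - heat_powr \<beta> t x \<partial>subord s) =
       marchaud s ?\<gamma> * (?k2 / ?k) * norm x powr (- (\<beta> + 2 * s))" by simp
    have "(\<integral>\<^sup>+t. ennreal \<bar>norm x powr (- \<beta>) - heat_powr \<beta> t x\<bar> \<partial>subord s) = (\<integral>\<^sup>+t. ennreal (1 / ?k) * ennreal \<bar>\<integral>\<tau>. f x \<tau> t \<partial>lborel\<bar> \<partial>subord s)"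
      using rep'[OF x] by (intro nn_integral_cong_AE, eventually_elim) (use k in \<open>simp add: abs_mult ennreal_mult'[symmetric]\<close>)
    also have "\<dots> \<le> (\<integral>\<^sup>+t. ennreal (1 / ?k) * (\<integral>\<^sup>+\<tau>. ennreal \<bar>f x \<tau> t\<bar> \<partial>lborel) \<partial>subord s)"
    proof (rule nn_integral_mono_AE)
      show "AE t in subord s. ennreal (1 / ?k) * ennreal \<bar>\<integral>\<tau>. f x \<tau> t \<partial>lborel\<bar> \<le> ennreal (1 / ?k) * (\<integral>\<^sup>+\<tau>. ennreal \<bar>f x \<tau> t\<bar> \<partial>lborel)"
        using F(3)[OF x]
      proof eventually_elim
        case (elim t)
        show ?case using integral_norm_bound_ennreal[OF elim] by (intro mult_left_mono) auto
      qed
    qed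
    also have "\<dots> = ennreal (1 / ?k) * (\<integral>\<^sup>+t. (\<integral>\<^sup>+\<tau>. ennreal \<bar>f x \<tau> t\<bar> \<partial>lborel) \<partial>subord s)"
      by (rule nn_integral_cmult) (unfold f_def, measurable)
    also have "(\<integral>\<^sup>+t. (\<integral>\<^sup>+\<tau>. ennreal \<bar>f x \<tau> t\<bar> \<partial>lborel) \<partial>subord s) = (\<integral>\<^sup>+\<tau>. \<integral>\<^sup>+t. ennreal \<bar>f x \<tau> t\<bar> \<partial>subord s \<partial>lborel)"
      by (rule pair_sigma_finite.Fubini'[OF pair_sigma_finite.intro[OF sigma_finite_lborel sigma_finite_subord]])
         (unfold f_def, measurable)
    finally show "(\<integral>\<^sup>+t. ennreal \<bar>norm x powr (- \<beta>) - heat_powr \<beta> t x\<bar> \<partial>subord s) \<le> ennreal (Cg * ?k2 / ?k * norm x powr (- (\<beta> + 2 * s)))"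
      using k Cg0 by (simp add: abs[OF x] ennreal_mult'[symmetric])
  qed (use Cg0 k in auto)
qed

section \<open>The fractional Hardy inequality in ground state form\<close>

lemma norm_powr_eq_norm_squared_powr:
  fixes x :: "'a::real_normed_vector"
  shows "norm x powr p = (norm x)\<^sup>2 powr (p / 2)"
  using powr_powr[of "norm x" 2 "p / 2"] by (cases "x = 0") simp_all

lemma nn_integral_norm_powr_outside:
  assumes p: "p > real DIM('a)" and R: "R > 0"
  shows "(\<integral>\<^sup>+(x::'a::euclidean_space). ennreal (indicator (- ball 0 R) x * norm x powr (- p)) \<partial>lborel) < \<infinity>"
proof -
  let ?n = "real DIM('a)"
  define e where "e = (?n - p) / 2 - 1"
  have e: "e < -1" using p by (simp add: e_def)
  have hi: "((\<lambda>\<rho>. \<rho> powr e) has_integral (- ((R\<^sup>2) powr (e + 1)) / (e + 1))) {R\<^sup>2..}"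
    by (rule has_integral_powr_to_inf) (use e R in auto)
  have "(\<integral>\<^sup>+(x::'a). ennreal (indicator (- ball 0 R) x * norm x powr (- p)) \<partial>lborel) =
    (\<integral>\<^sup>+(x::'a). (\<lambda>\<rho>. ennreal (indicator {R\<^sup>2..} \<rho> * \<rho> powr (- p / 2))) ((norm x)\<^sup>2) \<partial>lborel)"
  proof (intro nn_integral_cong)
    fix x :: 'a
    have "R\<^sup>2 \<le> (norm x)\<^sup>2 \<longleftrightarrow> R \<le> norm x" using R by (simp add: abs_le_square_iff[symmetric])
    then show "ennreal (indicator (- ball 0 R) x * norm x powr (- p)) = (\<lambda>\<rho>. ennreal (indicator {R\<^sup>2..} \<rho> * \<rho> powr (- p / 2))) ((norm x)\<^sup>2)"
      by (simp add: indicator_def norm_powr_eq_norm_squared_powr[of x "-p"] not_less)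
  qed
  also have "\<dots> = ennreal (radial_const ?n) * (\<integral>\<^sup>+\<rho>. ennreal (indicator {0<..} \<rho> * \<rho> powr (?n / 2 - 1)) * ennreal (indicator {R\<^sup>2..} \<rho> * \<rho> powr (- p / 2)) \<partial>lborel)"
    by (rule nn_integral_radial) measurable
  finally have 1: "(\<integral>\<^sup>+(x::'a). ennreal (indicator (- ball 0 R) x * norm x powr (- p)) \<partial>lborel) = \<dots>" .
  have "(\<integral>\<^sup>+\<rho>. ennreal (indicator {0<..} \<rho> * \<rho> powr (?n / 2 - 1)) * ennreal (indicator {R\<^sup>2..} \<rho> * \<rho> powr (- p / 2)) \<partial>lborel)
     \<le> (\<integral>\<^sup>+\<rho>. ennreal (indicator {R\<^sup>2..} \<rho> * \<rho> powr e) \<partial>lborel)"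
  proof (intro nn_integral_mono)
    fix \<rho> :: real
    have "\<rho> powr (?n / 2 - 1) * \<rho> powr (- p / 2) = \<rho> powr e"
      unfolding e_def powr_add[symmetric] by (rule arg_cong[where f="\<lambda>z. \<rho> powr z"]) (simp add: field_simps)
    then show "ennreal (indicator {0<..} \<rho> * \<rho> powr (?n / 2 - 1)) * ennreal (indicator {R\<^sup>2..} \<rho> * \<rho> powr (- p / 2)) \<le> ennreal (indicator {R\<^sup>2..} \<rho> * \<rho> powr e)"
      by (auto simp: indicator_def ennreal_mult'[symmetric])
  qed
  also have "\<dots> = ennreal (- ((R\<^sup>2) powr (e + 1)) / (e + 1))"
    by (rule nn_integral_has_integral_lebesgue[OF _ hi]) auto
  finally show ?thesis unfolding 1 by (auto simp: ennreal_mult_less_top intro: order_le_less_trans)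
qed

lemma nn_integral_annulus:
  assumes r: "0 < r" "r \<le> R"
  shows "(\<integral>\<^sup>+(x::'a::euclidean_space). ennreal (indicator {x. r \<le> norm x \<and> norm x \<le> R} x * norm x powr (- real DIM('a))) \<partial>lborel)
    = ennreal (2 * radial_const DIM('a) * ln (R / r))"
proof -
  let ?n = "real DIM('a)"
  have R: "R > 0" using r by simp
  have "(\<integral>\<^sup>+(x::'a). ennreal (indicator {x. r \<le> norm x \<and> norm x \<le> R} x * norm x powr (- ?n)) \<partial>lborel) =
    (\<integral>\<^sup>+(x::'a). (\<lambda>\<rho>. ennreal (indicator {r\<^sup>2..R\<^sup>2} \<rho> * \<rho> powr (- ?n / 2))) ((norm x)\<^sup>2) \<partial>lborel)"
  proof (intro nn_integral_cong)
    fix x :: 'a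
    have "r\<^sup>2 \<le> (norm x)\<^sup>2 \<longleftrightarrow> r \<le> norm x" "(norm x)\<^sup>2 \<le> R\<^sup>2 \<longleftrightarrow> norm x \<le> R" using r R by (simp_all add: abs_le_square_iff[symmetric])
    then show "ennreal (indicator {x. r \<le> norm x \<and> norm x \<le> R} x * norm x powr (- ?n)) = (\<lambda>\<rho>. ennreal (indicator {r\<^sup>2..R\<^sup>2} \<rho> * \<rho> powr (- ?n / 2))) ((norm x)\<^sup>2)"
      by (simp add: indicator_def norm_powr_eq_norm_squared_powr[of x "-?n"])
  qed
  also have "\<dots> = ennreal (radial_const ?n) * (\<integral>\<^sup>+\<rho>. ennreal (indicator {0<..} \<rho> * \<rho> powr (?n / 2 - 1)) * ennreal (indicator {r\<^sup>2..R\<^sup>2} \<rho> * \<rho> powr (- ?n / 2)) \<partial>lborel)"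
    by (rule nn_integral_radial) measurable
  also have "(\<integral>\<^sup>+\<rho>. ennreal (indicator {0<..} \<rho> * \<rho> powr (?n / 2 - 1)) * ennreal (indicator {r\<^sup>2..R\<^sup>2} \<rho> * \<rho> powr (- ?n / 2)) \<partial>lborel)
     = (\<integral>\<^sup>+\<rho>. ennreal (1 / \<rho>) * indicator {r\<^sup>2..R\<^sup>2} \<rho> \<partial>lborel)"
  proof (intro nn_integral_cong)
    fix \<rho> :: real
    have "\<rho> powr (?n / 2 - 1) * \<rho> powr (- ?n / 2) = 1 / \<rho>" if "\<rho> > 0"
      using that unfolding powr_add[symmetric] by (simp add: powr_minus_divide)
    moreover have "\<rho> > 0" if "r\<^sup>2 \<le> \<rho>" using r that by (meson less_le_trans zero_less_power)
    ultimately show "ennreal (indicator {0<..} \<rho> * \<rho> powr (?n / 2 - 1)) * ennreal (indicator {r\<^sup>2..R\<^sup>2} \<rho> * \<rho> powr (- ?n / 2)) = ennreal (1 / \<rho>) * indicator {r\<^sup>2..R\<^sup>2} \<rho>"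
      by (auto simp: indicator_def ennreal_mult'[symmetric])
  qed
  also have "\<dots> = ennreal (ln (R\<^sup>2) - ln (r\<^sup>2))"
  proof (rule nn_integral_FTC_Icc)
    fix \<rho> :: real assume "\<rho> \<in> {r\<^sup>2..R\<^sup>2}"
    then have "r\<^sup>2 \<le> \<rho>" by simp
    then have "\<rho> > 0" using r by (meson less_le_trans zero_less_power)
    then show "(ln has_real_derivative 1 / \<rho>) (at \<rho>)" "0 \<le> 1 / \<rho>"
      by (auto intro!: derivative_eq_intros)
  qed (use r in \<open>auto intro!: power_mono\<close>)
  also have "ln (R\<^sup>2) - ln (r\<^sup>2) = 2 * ln (R / r)" using r R by (simp add: ln_realpow ln_div)
  also have "ennreal (radial_const ?n) * ennreal (2 * ln (R / r)) = ennreal (2 * radial_const ?n * ln (R / r))"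
    by (subst ennreal_mult'[symmetric]) (simp_all add: mult_ac)
  finally show ?thesis .
qed

text \<open>\<open>ty\<close> is a phantom parameter fixing the type of points.\<close>

locale frac =
  fixes s n cns :: real and ty :: "'a::euclidean_space itself"
  assumes s: "0 < s" "s < 1" and dim: "2 * s < n"
    and n: "n = real DIM('a)" and cns: "cns = frac_const DIM('a) s"
begin

definition mu :: "'a \<Rightarrow> real" where "mu x = norm x powr (- ((n - 2 * s) / 2))"

lemma mu_nonneg [simp]: "mu x \<ge> 0" by (simp add: mu_def)

lemma borel_measurable_mu [measurable]: "mu \<in> borel_measurable borel"
  unfolding mu_def by measurable

lemma n_pos: "n > 0" by (simp add: n)

lemma cns_pos: "cns > 0" unfolding cns by (rule frac_const_pos[OF s]) simp

text \<open>Tonelli replaces a double integral against the singular kernel by a superposition of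
  heat forms. The condition on the diagonal is needed for equality at x = y: there the quotient is 0
  by convention, whereas the heat kernel integrates to infinity.\<close>

lemma nn_integral_subord_pair:
  fixes g :: "'a \<Rightarrow> 'a \<Rightarrow> real"
  assumes [measurable]: "case_prod g \<in> borel_measurable (borel \<Otimes>\<^sub>M borel)" and g: "\<And>x y. g x y \<ge> 0" "\<And>x. g x x = 0"
  shows "(\<integral>\<^sup>+x. \<integral>\<^sup>+y. ennreal (cns * g x y / dist x y powr (n + 2 * s)) \<partial>lborel \<partial>lborel) =
    (\<integral>\<^sup>+t. \<integral>\<^sup>+x. \<integral>\<^sup>+y. ennreal (g x y * heat t (x - y)) \<partial>lborel \<partial>lborel \<partial>subord s)"
proof -
  interpret P: pair_sigma_finite "subord s" "lborel :: 'a measure"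
    by (intro pair_sigma_finite.intro sigma_finite_subord sigma_finite_lborel)
  have [measurable (raw)]: "(\<lambda>x. g (f x) (h x)) \<in> borel_measurable M" if "f \<in> borel_measurable M" "h \<in> borel_measurable M" for f h and M :: "('a \<times> real \<times> 'a) measure"
    using measurable_compose[OF measurable_Pair[OF that] assms(1)] by (simp add: o_def)
  have [measurable (raw)]: "(\<lambda>x. g (f x) (h x)) \<in> borel_measurable M" if "f \<in> borel_measurable M" "h \<in> borel_measurable M" for f h and M :: "(real \<times> 'a) measure"
    using measurable_compose[OF measurable_Pair[OF that] assms(1)] by (simp add: o_def)
  have [measurable (raw)]: "(\<lambda>x. g (f x) (h x)) \<in> borel_measurable M" if "f \<in> borel_measurable M" "h \<in> borel_measurable M" for f h and M :: "((real \<times> 'a) \<times> 'a) measure"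
    using measurable_compose[OF measurable_Pair[OF that] assms(1)] by (simp add: o_def)
  have "(\<integral>\<^sup>+x. \<integral>\<^sup>+y. ennreal (cns * g x y / dist x y powr (n + 2 * s)) \<partial>lborel \<partial>lborel) =
     (\<integral>\<^sup>+x. \<integral>\<^sup>+y. \<integral>\<^sup>+t. ennreal (g x y * heat t (x - y)) \<partial>subord s \<partial>lborel \<partial>lborel)"
  proof (intro nn_integral_cong)
    fix x y :: 'a
    show "ennreal (cns * g x y / dist x y powr (n + 2 * s)) = (\<integral>\<^sup>+t. ennreal (g x y * heat t (x - y)) \<partial>subord s)"
    proof (cases "x = y")
      case False
      have "(\<integral>\<^sup>+t. ennreal (g x y * heat t (x - y)) \<partial>subord s) = ennreal (g x y) * (\<integral>\<^sup>+t. ennreal (heat t (x - y)) \<partial>subord s)"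
        by (subst nn_integral_cmult[symmetric], measurable) (simp add: ennreal_mult' g)
      also have "\<dots> = ennreal (g x y) * ennreal (cns / norm (x - y) powr (n + 2 * s))"
        using nn_integral_subord_heat[OF s, of "x - y"] False by (simp add: n cns)
      finally show ?thesis using g(1)[of x y] by (simp add: ennreal_mult'[symmetric] dist_norm mult_ac)
    qed (simp add: g)
  qed
  also have "\<dots> = (\<integral>\<^sup>+x. \<integral>\<^sup>+t. \<integral>\<^sup>+y. ennreal (g x y * heat t (x - y)) \<partial>lborel \<partial>subord s \<partial>lborel)"
    by (intro nn_integral_cong P.Fubini') measurable
  also have "\<dots> = (\<integral>\<^sup>+t. \<integral>\<^sup>+x. \<integral>\<^sup>+y. ennreal (g x y * heat t (x - y)) \<partial>lborel \<partial>lborel \<partial>subord s)"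
    by (intro P.Fubini') measurable
  finally show ?thesis .
qed

end

lemma nn_integral_heat_powr:
  fixes x :: "'a::euclidean_space"
  assumes \<beta>: "0 < \<beta>" "\<beta> < real DIM('a)" and t: "t > 0"
  shows "(\<integral>\<^sup>+y. ennreal (norm y powr (- \<beta>) * heat t (x - y)) \<partial>lborel) = ennreal (heat_powr \<beta> t x)"
  unfolding heat_powr_def using nn_integral_powr_heat_finite[OF \<beta> t, of x]
  by (intro nn_integral_eq_integral integrableI_bounded) auto

lemma heat_powr_nonneg [simp]: "heat_powr \<beta> t x \<ge> 0"
  unfolding heat_powr_def by (intro integral_nonneg_AE) auto

lemma nn_integral_heat_diff:
  fixes x :: "'a::euclidean_space"
  assumes t: "t > 0"
  shows "(\<integral>\<^sup>+y. ennreal (heat t (x - y)) \<partial>lborel) = 1"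
  using nn_integral_heat[OF t, where 'a='a] nn_integral_lborel_reflect[of "\<lambda>y. ennreal (heat t y)" x] by simp

lemma heat_commute: "heat t (x - y) = heat t (y - x)"
  by (metis heat_minus minus_diff_eq)

context frac
begin

text \<open>Ground state substitution at a fixed heat time. It integrates the pointwise identity (ax
  - by)^2 + xy (a^2 + b^2) = xy (a - b)^2 + a^2 x^2 + b^2 y^2. The negative cross terms stand on the
  left so that only nonnegative integrals occur and no finiteness is assumed.\<close>

lemma heat_energy_identity:
  fixes \<zeta> :: "'a \<Rightarrow> real"
  assumes [measurable]: "\<zeta> \<in> borel_measurable borel" and t: "t > 0"
  shows "(\<integral>\<^sup>+x. \<integral>\<^sup>+y. ennreal (1/2 * (\<zeta> x * mu x - \<zeta> y * mu y)\<^sup>2 * heat t (x - y)) \<partial>lborel \<partial>lborel)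
     + (\<integral>\<^sup>+x. ennreal ((\<zeta> x)\<^sup>2 * mu x * heat_powr ((n - 2 * s) / 2) t x) \<partial>lborel)
     = (\<integral>\<^sup>+x. \<integral>\<^sup>+y. ennreal (1/2 * (mu x * mu y * (\<zeta> x - \<zeta> y)\<^sup>2) * heat t (x - y)) \<partial>lborel \<partial>lborel)
     + (\<integral>\<^sup>+x. ennreal ((\<zeta> x * mu x)\<^sup>2) \<partial>lborel)"
proof -
  have \<beta>: "0 < (n - 2 * s) / 2" "(n - 2 * s) / 2 < real DIM('a)" using s dim n n_pos by auto
  let ?I = "\<lambda>G. (\<integral>\<^sup>+x. \<integral>\<^sup>+y. ennreal (G x y) \<partial>(lborel :: 'a measure) \<partial>(lborel :: 'a measure))"
  let ?h = "\<lambda>x y. heat t (x - y)"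
  have add: "?I (\<lambda>x y. F x y + G x y) = ?I F + ?I G"
    if m[measurable]: "case_prod F \<in> borel_measurable (borel \<Otimes>\<^sub>M borel)" "case_prod G \<in> borel_measurable (borel \<Otimes>\<^sub>M borel)"
      and nn: "\<And>x y. F x y \<ge> 0" "\<And>x y. G x y \<ge> 0" for F G
  proof -
    have 1[measurable]: "F x \<in> borel_measurable borel" "G x \<in> borel_measurable borel" for x
      using m[THEN measurable_compose_Pair1[rotated]] measurable_Pair2[OF m(1)] measurable_Pair2[OF m(2)] by auto
    have 2: "(\<lambda>x. \<integral>\<^sup>+y. ennreal (F x y) \<partial>lborel) \<in> borel_measurable lborel" "(\<lambda>x. \<integral>\<^sup>+y. ennreal (G x y) \<partial>lborel) \<in> borel_measurable lborel"
      by measurable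
    show ?thesis
      by (simp add: nn nn_integral_add 2)
  qed
  have swap: "?I (\<lambda>x y. F y x) = ?I F" if "case_prod F \<in> borel_measurable (borel \<Otimes>\<^sub>M borel)" for F
    by (rule lborel_pair.Fubini') (use that in measurable)
  \<comment> \<open>One half each of the cross term and of the diagonal term. The heat kernel is
    symmetric, so the mirrored halves have the same integrals; integrating out y turns
    \<open>b\<close> into a heat average of \<open>mu\<close> and \<open>c\<close> into plain
    mass.\<close>
  define b where "b x y = 1/2 * (\<zeta> x)\<^sup>2 * mu x * mu y * heat t (x - y)" for x y
  define c where "c x y = 1/2 * (\<zeta> x * mu x)\<^sup>2 * heat t (x - y)" for x y
  have mb[measurable]: "case_prod b \<in> borel_measurable (borel \<Otimes>\<^sub>M borel)" "case_prod c \<in> borel_measurable (borel \<Otimes>\<^sub>M borel)"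
    "case_prod (\<lambda>x y. b y x) \<in> borel_measurable (borel \<Otimes>\<^sub>M borel)" "case_prod (\<lambda>x y. c y x) \<in> borel_measurable (borel \<Otimes>\<^sub>M borel)"
    unfolding b_def c_def by measurable
  have swb: "?I (\<lambda>x y. b y x) = ?I b" and swc: "?I (\<lambda>x y. c y x) = ?I c"
    by (rule swap, fact mb)+
  have nn: "b x y \<ge> 0" "c x y \<ge> 0" for x y by (simp_all add: b_def c_def)
  have Ib: "?I b + ?I b = (\<integral>\<^sup>+x. ennreal ((\<zeta> x)\<^sup>2 * mu x * heat_powr ((n - 2 * s) / 2) t x) \<partial>lborel)"
  proof -
    have "(\<integral>\<^sup>+y. ennreal (b x y) \<partial>lborel) = ennreal (1/2 * (\<zeta> x)\<^sup>2 * mu x * heat_powr ((n - 2 * s) / 2) t x)" for x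
    proof -
      have "(\<integral>\<^sup>+y. ennreal (b x y) \<partial>lborel) = (\<integral>\<^sup>+y. ennreal (1/2 * (\<zeta> x)\<^sup>2 * mu x) * ennreal (norm y powr (- ((n - 2 * s) / 2)) * heat t (x - y)) \<partial>lborel)"
        by (intro nn_integral_cong, subst ennreal_mult'[symmetric]) (simp_all add: b_def mu_def mult.assoc)
      also have "\<dots> = ennreal (1/2 * (\<zeta> x)\<^sup>2 * mu x) * ennreal (heat_powr ((n - 2 * s) / 2) t x)"
        by (subst nn_integral_cmult, measurable) (simp only: nn_integral_heat_powr[OF \<beta> t])
      finally show ?thesis by (simp add: ennreal_mult'[symmetric])
    qed
    then have "?I b + ?I b = (\<integral>\<^sup>+x. ennreal (1/2 * (\<zeta> x)\<^sup>2 * mu x * heat_powr ((n - 2 * s) / 2) t x) + ennreal (1/2 * (\<zeta> x)\<^sup>2 * mu x * heat_powr ((n - 2 * s) / 2) t x) \<partial>lborel)"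
      by (subst nn_integral_add) simp_all
    also have "\<dots> = (\<integral>\<^sup>+x. ennreal ((\<zeta> x)\<^sup>2 * mu x * heat_powr ((n - 2 * s) / 2) t x) \<partial>lborel)"
      by (intro nn_integral_cong, subst ennreal_plus[symmetric]) simp_all
    finally show ?thesis .
  qed
  have Ic: "?I c + ?I c = (\<integral>\<^sup>+x. ennreal ((\<zeta> x * mu x)\<^sup>2) \<partial>lborel)"
  proof -
    have "(\<integral>\<^sup>+y. ennreal (c x y) \<partial>lborel) = ennreal (1/2 * (\<zeta> x * mu x)\<^sup>2)" for x
    proof -
      have "(\<integral>\<^sup>+y. ennreal (c x y) \<partial>lborel) = (\<integral>\<^sup>+y. ennreal (1/2 * (\<zeta> x * mu x)\<^sup>2) * ennreal (heat t (x - y)) \<partial>lborel)"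
        by (intro nn_integral_cong, subst ennreal_mult'[symmetric]) (simp_all add: c_def)
      also have "\<dots> = ennreal (1/2 * (\<zeta> x * mu x)\<^sup>2) * 1"
        by (subst nn_integral_cmult, measurable) (simp only: nn_integral_heat_diff[OF t])
      finally show ?thesis by simp
    qed
    then have "?I c + ?I c = (\<integral>\<^sup>+x. ennreal (1/2 * (\<zeta> x * mu x)\<^sup>2) + ennreal (1/2 * (\<zeta> x * mu x)\<^sup>2) \<partial>lborel)"
      by (subst nn_integral_add) simp_all
    also have "\<dots> = (\<integral>\<^sup>+x. ennreal ((\<zeta> x * mu x)\<^sup>2) \<partial>lborel)"
      by (intro nn_integral_cong, subst ennreal_plus[symmetric]) simp_all
    finally show ?thesis .
  qed
  let ?F = "\<lambda>x y. 1/2 * (\<zeta> x * mu x - \<zeta> y * mu y)\<^sup>2 * heat t (x - y)"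
  let ?G = "\<lambda>x y. 1/2 * (mu x * mu y * (\<zeta> x - \<zeta> y)\<^sup>2) * heat t (x - y)"
  have mFG: "case_prod ?F \<in> borel_measurable (borel \<Otimes>\<^sub>M borel)" "case_prod ?G \<in> borel_measurable (borel \<Otimes>\<^sub>M borel)"
    by measurable
  have nnFG: "?F x y \<ge> 0" "?G x y \<ge> 0" for x y by simp_all
  have add3: "?I (\<lambda>x y. F x y + (G x y + H x y)) = ?I F + (?I G + ?I H)"
    if "case_prod F \<in> borel_measurable (borel \<Otimes>\<^sub>M borel)" "\<And>x y. F x y \<ge> 0"
      "case_prod G \<in> borel_measurable (borel \<Otimes>\<^sub>M borel)" "case_prod H \<in> borel_measurable (borel \<Otimes>\<^sub>M borel)"
      "\<And>x y. G x y \<ge> 0" "\<And>x y. H x y \<ge> 0" for F G H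
  proof -
    have "case_prod (\<lambda>x y. G x y + H x y) \<in> borel_measurable (borel \<Otimes>\<^sub>M borel)"
      using borel_measurable_add[OF that(3,4)] by (simp add: split_beta')
    from add[OF that(1) this that(2)] add[OF that(3,4,5,6)] show ?thesis
      using that(5,6) by (simp only: add_nonneg_nonneg)
  qed
  note addF = add3[OF mFG(1) nnFG(1)] and addG = add3[OF mFG(2) nnFG(2)]
  have "?I ?F + (?I b + ?I b) = ?I ?F + (?I b + ?I (\<lambda>x y. b y x))" by (simp only: swb)
  also have "\<dots> = ?I (\<lambda>x y. ?F x y + (b x y + b y x))"
    by (simp only: addF[OF mb(1) mb(3) nn(1) nn(1)])
  also have "(\<lambda>x y. ?F x y + (b x y + b y x)) = (\<lambda>x y. ?G x y + (c x y + c y x))"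
  proof (intro ext)
    fix x y
    show "?F x y + (b x y + b y x) = ?G x y + (c x y + c y x)"
      unfolding b_def c_def heat_commute[of t y x] by (simp add: power2_eq_square algebra_simps)
  qed
  also have "?I (\<lambda>x y. ?G x y + (c x y + c y x)) = ?I ?G + (?I c + ?I (\<lambda>x y. c y x))"
    by (simp only: addG[OF mb(2) mb(4) nn(2) nn(2)])
  also have "\<dots> = ?I ?G + (?I c + ?I c)" by (simp only: swc)
  finally show ?thesis unfolding Ib Ic .
qed

text \<open>The optimal constant of the fractional Hardy inequality; see \<open>hardy_const_eq\<close> for its usual form.\<close>

definition "\<Lambda> = marchaud s ((n + 2 * s) / 4) * (riesz_const n ((n + 2 * s) / 2) / riesz_const n ((n - 2 * s) / 2))"

lemma \<Lambda>_nonneg: "\<Lambda> \<ge> 0"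
proof -
  have G: "Gamma ((n + 2 * s) / 4) > 0" "Gamma ((n + 2 * s) / 4 + 1 - s) > 0"
    using s dim by (auto intro!: Gamma_real_pos simp: field_simps)
  have "(n + 2 * s) / 4 - s \<ge> 0" using dim by (simp add: field_simps)
  then show ?thesis
    using G riesz_const_pos[of "(n + 2 * s) / 2" n] riesz_const_pos[of "(n - 2 * s) / 2" n] s dim
    unfolding \<Lambda>_def marchaud_def by (intro mult_nonneg_nonneg divide_nonneg_nonneg) (auto intro: less_imp_le)
qed

text \<open>At each heat time the ground state identity reads Q = A + (N - B), where N - B is the
  integral of zeta^2 mu (mu - heat average of mu). Integrated over \<open>subord s\<close> this last
  term is computed by \<open>subord_powr\<close> with beta = (n-2s)/2, giving Lambda times the
  weight |x|^(-n). The support away from the origin makes N finite, so B may be subtracted.\<close>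

theorem hardy_energy:
  fixes \<zeta> :: "'a \<Rightarrow> real"
  assumes [measurable]: "\<zeta> \<in> borel_measurable borel" and \<zeta>: "\<And>x. \<bar>\<zeta> x\<bar> \<le> 1"
    and r: "0 < r" and supp: "\<And>x. \<zeta> x \<noteq> 0 \<Longrightarrow> r \<le> norm x \<and> norm x \<le> R"
  shows "(\<integral>\<^sup>+x. \<integral>\<^sup>+y. ennreal (cns * (1/2 * (\<zeta> x * mu x - \<zeta> y * mu y)\<^sup>2) / dist x y powr (n + 2 * s)) \<partial>lborel \<partial>lborel)
    \<le> (\<integral>\<^sup>+x. \<integral>\<^sup>+y. ennreal (cns * (1/2 * (mu x * mu y * (\<zeta> x - \<zeta> y)\<^sup>2)) / dist x y powr (n + 2 * s)) \<partial>lborel \<partial>lborel)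
     + ennreal \<Lambda> * (\<integral>\<^sup>+x. ennreal ((\<zeta> x)\<^sup>2 * norm x powr (- n)) \<partial>lborel)"
    (is "?Q \<le> ?A + _")
proof -
  let ?\<beta> = "(n - 2 * s) / 2"
  have \<beta>: "0 < ?\<beta>" "?\<beta> < real DIM('a)" using s dim n n_pos by auto
  define Q where "Q t = (\<integral>\<^sup>+x. \<integral>\<^sup>+y. ennreal (1/2 * (\<zeta> x * mu x - \<zeta> y * mu y)\<^sup>2 * heat t (x - y)) \<partial>lborel \<partial>lborel)" for t
  define A where "A t = (\<integral>\<^sup>+x. \<integral>\<^sup>+y. ennreal (1/2 * (mu x * mu y * (\<zeta> x - \<zeta> y)\<^sup>2) * heat t (x - y)) \<partial>lborel \<partial>lborel)" for t
  define B where "B t = (\<integral>\<^sup>+x. ennreal ((\<zeta> x)\<^sup>2 * mu x * heat_powr ?\<beta> t x) \<partial>lborel)" for t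
  define N where "N = (\<integral>\<^sup>+x. ennreal ((\<zeta> x * mu x)\<^sup>2) \<partial>lborel)"
  have [measurable]: "Q \<in> borel_measurable borel" "A \<in> borel_measurable borel"
    unfolding Q_def A_def by measurable
  have Qeq: "?Q = (\<integral>\<^sup>+t. Q t \<partial>subord s)" 
    unfolding Q_def by (rule nn_integral_subord_pair) auto
  have Aeq: "?A = (\<integral>\<^sup>+t. A t \<partial>subord s)"
    unfolding A_def by (rule nn_integral_subord_pair) auto
  have ball: "(\<integral>\<^sup>+x. ennreal (c * indicator (cball 0 R) x) \<partial>(lborel :: 'a measure)) < \<infinity>" if "c \<ge> 0" for c
  proof -
    have "(\<integral>\<^sup>+x. ennreal (c * indicator (cball 0 R) x) \<partial>(lborel :: 'a measure)) = ennreal c * emeasure lborel (cball (0::'a) R)"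
      using that by (subst nn_integral_cmult_indicator[symmetric]) (auto intro!: nn_integral_cong simp: ennreal_mult' ennreal_indicator)
    also have "\<dots> < \<infinity>" using emeasure_lborel_cball_finite[of "0::'a" R] by (simp add: ennreal_mult_less_top)
    finally show ?thesis .
  qed
  have z2: "(\<zeta> x)\<^sup>2 \<le> 1" for x using \<zeta>[of x] by (simp add: abs_square_le_1)
  have bound: "(\<zeta> x)\<^sup>2 * norm x powr (- p) \<le> r powr (- p) * indicator (cball 0 R) x" if p: "p > 0" for x p
  proof (cases "\<zeta> x = 0")
    case False
    then have x: "r \<le> norm x" "norm x \<le> R" using supp by auto
    have "norm x powr (- p) \<le> r powr (- p)" using powr_mono2'[of "-p" r "norm x"] x r p by simp
    then have "(\<zeta> x)\<^sup>2 * norm x powr (- p) \<le> 1 * r powr (- p)" by (intro mult_mono z2) auto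
    then show ?thesis using x by simp
  qed simp
  have mu2: "(\<zeta> x * mu x)\<^sup>2 = (\<zeta> x)\<^sup>2 * norm x powr (- (n - 2 * s))" for x
    by (cases "x = 0") (simp_all add: mu_def power_mult_distrib power2_eq_square powr_add[symmetric])
  have Nfin: "N < \<infinity>"
  proof -
    have "N \<le> (\<integral>\<^sup>+x. ennreal (r powr (- (n - 2 * s)) * indicator (cball 0 R) x) \<partial>(lborel :: 'a measure))"
      unfolding N_def mu2 by (intro nn_integral_mono ennreal_leI bound) (use dim in auto)
    also have "\<dots> < \<infinity>" by (rule ball) simp
    finally show ?thesis .
  qed
  define f where "f x t = (\<zeta> x)\<^sup>2 * mu x * (mu x - heat_powr ?\<beta> t x)" for x :: 'a and t
  define X where "X t = (\<integral>x. f x t \<partial>lborel)" for t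
  obtain C where C: "\<And>x::'a. x \<noteq> 0 \<Longrightarrow> integrable (subord s) (\<lambda>t. norm x powr (- ?\<beta>) - heat_powr ?\<beta> t x)"
    "\<And>x::'a. x \<noteq> 0 \<Longrightarrow> (\<integral>t. norm x powr (- ?\<beta>) - heat_powr ?\<beta> t x \<partial>subord s) =
       marchaud s ((real DIM('a) - ?\<beta>) / 2) * (riesz_const DIM('a) (?\<beta> + 2 * s) / riesz_const DIM('a) ?\<beta>) * norm x powr (- (?\<beta> + 2 * s))"
    "\<And>x::'a. x \<noteq> 0 \<Longrightarrow> (\<integral>\<^sup>+t. ennreal \<bar>norm x powr (- ?\<beta>) - heat_powr ?\<beta> t x\<bar> \<partial>subord s) \<le> ennreal (C * norm x powr (- (?\<beta> + 2 * s)))"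
    "C \<ge> 0"
    using subord_powr[OF s \<beta>] by blast
  have coeff: "marchaud s ((real DIM('a) - ?\<beta>) / 2) * (riesz_const DIM('a) (?\<beta> + 2 * s) / riesz_const DIM('a) ?\<beta>) = \<Lambda>"
  proof -
    have "(real DIM('a) - ?\<beta>) / 2 = (n + 2 * s) / 4" "?\<beta> + 2 * s = (n + 2 * s) / 2" unfolding n[symmetric] by (simp_all add: field_simps)
    then show ?thesis by (simp only: n[symmetric] \<Lambda>_def)
  qed
  \<comment> \<open>The exponents (n-2s)/2 and (n+2s)/2 add up to n: this is the critical Hardy
    weight, and the source of the logarithm.\<close>
  have mup: "mu x * norm x powr (- (?\<beta> + 2 * s)) = norm x powr (- n)" for x :: 'a
    unfolding mu_def powr_add[symmetric] by (simp add: field_simps)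
  have fm: "case_prod f \<in> borel_measurable (lborel \<Otimes>\<^sub>M subord s)" unfolding f_def by measurable
  have ffin: "(\<integral>\<^sup>+x. \<integral>\<^sup>+t. ennreal \<bar>f x t\<bar> \<partial>subord s \<partial>lborel) < \<infinity>"
  proof -
    have "(\<integral>\<^sup>+x. \<integral>\<^sup>+t. ennreal \<bar>f x t\<bar> \<partial>subord s \<partial>lborel) \<le> (\<integral>\<^sup>+x. ennreal (C * r powr (- n) * indicator (cball 0 R) x) \<partial>(lborel :: 'a measure))"
    proof (intro nn_integral_mono)
      fix x :: 'a
      show "(\<integral>\<^sup>+t. ennreal \<bar>f x t\<bar> \<partial>subord s) \<le> ennreal (C * r powr (- n) * indicator (cball 0 R) x)"
      proof (cases "x = 0")
        case True
        then have "\<zeta> x = 0" using supp[of x] r by auto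
        then show ?thesis by (simp add: f_def)
      next
        case False
        have "(\<integral>\<^sup>+t. ennreal \<bar>f x t\<bar> \<partial>subord s) = (\<integral>\<^sup>+t. ennreal ((\<zeta> x)\<^sup>2 * mu x) * ennreal \<bar>norm x powr (- ?\<beta>) - heat_powr ?\<beta> t x\<bar> \<partial>subord s)"
          by (intro nn_integral_cong, subst ennreal_mult'[symmetric]) (auto simp: f_def mu_def abs_mult)
        also have "\<dots> = ennreal ((\<zeta> x)\<^sup>2 * mu x) * (\<integral>\<^sup>+t. ennreal \<bar>norm x powr (- ?\<beta>) - heat_powr ?\<beta> t x\<bar> \<partial>subord s)"
          by (rule nn_integral_cmult) measurable
        also have "\<dots> \<le> ennreal ((\<zeta> x)\<^sup>2 * mu x) * ennreal (C * norm x powr (- (?\<beta> + 2 * s)))"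
          by (intro mult_left_mono C(3) False) simp
        also have "\<dots> = ennreal (C * ((\<zeta> x)\<^sup>2 * norm x powr (- n)))"
          unfolding mup[symmetric] using C(4) by (subst ennreal_mult'[symmetric]) (simp_all add: mult_ac)
        also have "\<dots> \<le> ennreal (C * (r powr (- n) * indicator (cball 0 R) x))"
          by (intro ennreal_leI mult_left_mono bound n_pos C(4))
        finally show ?thesis by (simp add: mult.assoc)
      qed
    qed
    also have "\<dots> < \<infinity>" by (rule ball) (use C(4) in simp)
    finally show ?thesis .
  qed
  note F = Fubini_swap[OF sigma_finite_lborel sigma_finite_subord fm ffin]
  have Xint: "integrable (subord s) X" unfolding X_def by (rule F(2))
  define z where "z = (\<integral>x. (\<zeta> x)\<^sup>2 * norm x powr (- n) \<partial>lborel)"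
  have z_int: "integrable lborel (\<lambda>x. (\<zeta> x)\<^sup>2 * norm x powr (- n))"
  proof (rule integrableI_bounded)
    have "(\<integral>\<^sup>+x. ennreal (norm ((\<zeta> x)\<^sup>2 * norm x powr (- n))) \<partial>lborel) \<le> (\<integral>\<^sup>+x. ennreal (r powr (- n) * indicator (cball 0 R) x) \<partial>(lborel :: 'a measure))"
      by (intro nn_integral_mono ennreal_leI) (use bound[OF n_pos] in auto)
    also have "\<dots> < \<infinity>" by (rule ball) simp
    finally show "(\<integral>\<^sup>+x. ennreal (norm ((\<zeta> x)\<^sup>2 * norm x powr (- n))) \<partial>lborel) < \<infinity>" .
  qed simp
  have z0: "z \<ge> 0" unfolding z_def by (intro integral_nonneg_AE) auto
  have Xval: "(\<integral>t. X t \<partial>subord s) = \<Lambda> * z"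
  proof -
    have "(\<integral>t. X t \<partial>subord s) = (\<integral>x. \<integral>t. f x t \<partial>subord s \<partial>lborel)" unfolding X_def by (rule F(3)[symmetric])
    also have "\<dots> = (\<integral>x. \<Lambda> * ((\<zeta> x)\<^sup>2 * norm x powr (- n)) \<partial>lborel)"
    proof (intro Bochner_Integration.integral_cong refl)
      fix x :: 'a
      show "(\<integral>t. f x t \<partial>subord s) = \<Lambda> * ((\<zeta> x)\<^sup>2 * norm x powr (- n))"
      proof (cases "x = 0")
        case True
        then have "\<zeta> x = 0" using supp[of x] r by auto
        then show ?thesis by (simp add: f_def)
      next
        case False
        have "(\<integral>t. f x t \<partial>subord s) = (\<zeta> x)\<^sup>2 * mu x * (\<Lambda> * norm x powr (- (?\<beta> + 2 * s)))"
          unfolding f_def integral_mult_right_zero using C(2)[OF False] unfolding coeff by (simp only: mu_def)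
        then show ?thesis unfolding mup[symmetric] by (simp only: mult_ac)
      qed
    qed
    also have "\<dots> = \<Lambda> * z" unfolding z_def by (rule integral_mult_right_zero)
    finally show ?thesis .
  qed
  have zn: "(\<integral>\<^sup>+x. ennreal ((\<zeta> x)\<^sup>2 * norm x powr (- n)) \<partial>lborel) = ennreal z"
    unfolding z_def by (rule nn_integral_eq_integral[OF z_int]) simp
  show ?thesis
  \<comment> \<open>If the ground state form is infinite the bound is void. Otherwise
    \<open>A t\<close> is finite for almost every t and the identity may be rewritten with real
    numbers.\<close>
  proof (cases "?A = \<infinity>")
    case False
    then have Afin: "(\<integral>\<^sup>+t. A t \<partial>subord s) \<noteq> \<infinity>" unfolding Aeq by simp
    have AEA: "AE t in subord s. A t \<noteq> \<infinity>"
      by (rule nn_integral_PInf_AE) (use Afin in auto)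
    define a where "a t = enn2real (A t)" for t
    have [measurable]: "a \<in> borel_measurable borel" unfolding a_def by measurable
    have aA: "AE t in subord s. ennreal (a t) = A t"
      using AEA by eventually_elim (simp add: a_def ennreal_enn2real_if)
    have inta: "(\<integral>\<^sup>+t. ennreal (a t) \<partial>subord s) = (\<integral>\<^sup>+t. A t \<partial>subord s)"
      by (rule nn_integral_cong_AE) (use aA in auto)
    have ai: "integrable (subord s) a"
      using Afin inta by (intro integrableI_bounded) (auto simp: a_def top.not_eq_extremum)
    have aint: "ennreal (\<integral>t. a t \<partial>subord s) = (\<integral>\<^sup>+t. A t \<partial>subord s)"
      unfolding inta[symmetric] by (rule nn_integral_eq_integral[symmetric, OF ai]) (simp add: a_def)
    \<comment> \<open>\<open>X t\<close> has no sign of its own, but the sum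
      \<open>a t + X t\<close> equals the nonnegative energy \<open>Q t\<close>, so its integral can
      be taken both as a Bochner and as a nonnegative integral.\<close>
    have QX: "AE t in subord s. Q t = ennreal (a t + X t) \<and> 0 \<le> a t + X t"
      using aA AEA AE_subord_pos[of s]
    proof eventually_elim
      case (elim t)
      have id: "Q t + B t = A t + N" unfolding Q_def B_def A_def N_def by (rule heat_energy_identity) (use elim in auto)
      have fin: "A t + N < \<infinity>" using Nfin elim by (simp add: top.not_eq_extremum)
      have Bf: "B t < \<infinity>" and Qf: "Q t < \<infinity>" using id fin by (metis add.commute ennreal_add_eq_top top.not_eq_extremum infinity_ennreal_def)+
      have IB: "has_bochner_integral lborel (\<lambda>x. (\<zeta> x)\<^sup>2 * mu x * heat_powr ?\<beta> t x) (enn2real (B t))"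
        by (rule has_bochner_integral_nn_integral) (use Bf in \<open>auto simp: B_def top.not_eq_extremum\<close>)
      have IN: "has_bochner_integral lborel (\<lambda>x. (\<zeta> x * mu x)\<^sup>2) (enn2real N)"
        by (rule has_bochner_integral_nn_integral) (use Nfin in \<open>auto simp: N_def top.not_eq_extremum\<close>)
      have "(\<lambda>x. f x t) = (\<lambda>x. (\<zeta> x * mu x)\<^sup>2 - (\<zeta> x)\<^sup>2 * mu x * heat_powr ?\<beta> t x)"
        by (simp add: f_def power2_eq_square algebra_simps fun_eq_iff)
      then have Xt: "X t = enn2real N - enn2real (B t)"
        unfolding X_def using has_bochner_integral_diff[OF IN IB] by (simp add: has_bochner_integral_iff)
      have "enn2real (Q t + B t) = enn2real (A t + N)" using id by simp
      then have "enn2real (Q t) + enn2real (B t) = a t + enn2real N"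
        using Bf Qf Nfin elim by (simp add: enn2real_plus a_def top.not_eq_extremum)
      then have "a t + X t = enn2real (Q t)" using Xt by simp
      then show ?case using Qf by (simp add: ennreal_enn2real_if top.not_eq_extremum)
    qed
    have a0: "(\<integral>t. a t \<partial>subord s) \<ge> 0" by (intro integral_nonneg_AE) (simp add: a_def)
    have "?Q = (\<integral>\<^sup>+t. ennreal (a t + X t) \<partial>subord s)"
      unfolding Qeq by (rule nn_integral_cong_AE) (use QX in auto)
    also have "\<dots> = ennreal (\<integral>t. a t + X t \<partial>subord s)"
      by (rule nn_integral_eq_integral) (use QX ai Xint in auto)
    also have "(\<integral>t. a t + X t \<partial>subord s) = (\<integral>t. a t \<partial>subord s) + \<Lambda> * z"
      by (simp only: Bochner_Integration.integral_add[OF ai Xint] Xval)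
    also have "ennreal ((\<integral>t. a t \<partial>subord s) + \<Lambda> * z) = ?A + ennreal \<Lambda> * ennreal z"
      unfolding Aeq aint[symmetric]
      by (simp only: ennreal_plus[OF a0 mult_nonneg_nonneg[OF \<Lambda>_nonneg z0]] ennreal_mult[OF \<Lambda>_nonneg z0])
    finally show ?thesis unfolding zn by simp
  qed simp
qed

end

section \<open>Radial test functions\<close>

text \<open>Smoothness is witnessed by a whole sequence of derivatives, which avoids iterating a
  derivative operator whose values would have to be identified each time.\<close>

definition smooth1 :: "(real \<Rightarrow> real) \<Rightarrow> bool" where
  "smooth1 g \<longleftrightarrow> (\<exists>G. G 0 = g \<and> (\<forall>k x. (G k has_real_derivative G (Suc k) x) (at x)))"

inductive_set fun_span :: "(real \<Rightarrow> real) set \<Rightarrow> (real \<Rightarrow> real) set" for B where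
  base: "b \<in> B \<Longrightarrow> b \<in> fun_span B"
| scale: "f \<in> fun_span B \<Longrightarrow> (\<lambda>x. c * f x) \<in> fun_span B"
| add: "f \<in> fun_span B \<Longrightarrow> g \<in> fun_span B \<Longrightarrow> (\<lambda>x. f x + g x) \<in> fun_span B"

text \<open>If every member of a family has its derivative in the linear span of the family, the
  span is closed under differentiation and can be iterated. The later smoothness proofs only exhibit
  a suitable family.\<close>

lemma smooth1_fun_span:
  assumes B: "\<And>b. b \<in> B \<Longrightarrow> \<exists>b'\<in>fun_span B. \<forall>x. (b has_real_derivative b' x) (at x)"
    and f: "f \<in> fun_span B"
  shows "smooth1 f"
proof -
  have step: "\<exists>f'\<in>fun_span B. \<forall>x. (f has_real_derivative f' x) (at x)" if "f \<in> fun_span B" for f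
    using that
  proof induction
    case (base b) then show ?case by (rule B)
  next
    case (scale f c)
    then obtain f' where "f' \<in> fun_span B" "\<forall>x. (f has_real_derivative f' x) (at x)" by blast
    then show ?case by (intro bexI[of _ "\<lambda>x. c * f' x"]) (auto intro!: derivative_eq_intros fun_span.scale)
  next
    case (add f g)
    then obtain f' g' where "f' \<in> fun_span B" "\<forall>x. (f has_real_derivative f' x) (at x)"
      "g' \<in> fun_span B" "\<forall>x. (g has_real_derivative g' x) (at x)" by blast
    then show ?case by (intro bexI[of _ "\<lambda>x. f' x + g' x"]) (auto intro!: derivative_eq_intros fun_span.add)
  qed
  then obtain d where d: "\<And>f. f \<in> fun_span B \<Longrightarrow> d f \<in> fun_span B \<and> (\<forall>x. (f has_real_derivative d f x) (at x))"
    by metis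
  have G: "(d ^^ k) f \<in> fun_span B" for k by (induction k) (use f d in auto)
  show ?thesis unfolding smooth1_def
    by (rule exI[of _ "\<lambda>k. (d ^^ k) f"]) (use G d in auto)
qed

lemma smooth1_deriv:
  assumes "smooth1 g"
  obtains g' where "smooth1 g'" "\<And>x. (g has_real_derivative g' x) (at x)"
proof -
  obtain G where G: "G 0 = g" "\<And>k x. (G k has_real_derivative G (Suc k) x) (at x)"
    using assms by (auto simp: smooth1_def)
  have "smooth1 (G 1)" unfolding smooth1_def
    by (rule exI[of _ "\<lambda>k. G (Suc k)"]) (use G in auto)
  then show ?thesis using G(2)[of 0] G(1) by (intro that[of "G 1"]) auto
qed

lemma smooth1_antideriv:
  assumes "smooth1 g'" "\<And>x. (g has_real_derivative g' x) (at x)"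
  shows "smooth1 g"
proof -
  obtain G where G: "G 0 = g'" "\<And>k x. (G k has_real_derivative G (Suc k) x) (at x)"
    using assms by (auto simp: smooth1_def)
  show ?thesis unfolding smooth1_def
    by (rule exI[of _ "\<lambda>k. case k of 0 \<Rightarrow> g | Suc j \<Rightarrow> G j"]) (use G assms(2) in \<open>auto split: nat.split\<close>)
qed

lemma smooth1_span_smooth1:
  assumes "f \<in> fun_span {f. smooth1 f}" shows "smooth1 f"
proof (rule smooth1_fun_span[OF _ assms])
  fix b assume "b \<in> {f. smooth1 f}"
  then show "\<exists>b'\<in>fun_span {f. smooth1 f}. \<forall>x. (b has_real_derivative b' x) (at x)"
    using smooth1_deriv[of b] fun_span.base by (metis mem_Collect_eq)
qed

lemma smooth1_add: "smooth1 f \<Longrightarrow> smooth1 g \<Longrightarrow> smooth1 (\<lambda>x. f x + g x)"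
  by (rule smooth1_span_smooth1) (auto intro: fun_span.intros)

lemma smooth1_scale: "smooth1 f \<Longrightarrow> smooth1 (\<lambda>x. c * f x)"
  by (rule smooth1_span_smooth1) (auto intro: fun_span.intros)

lemma smooth1_diff: "smooth1 f \<Longrightarrow> smooth1 g \<Longrightarrow> smooth1 (\<lambda>x. f x - g x)"
  using smooth1_add[OF _ smooth1_scale[of g "-1"], of f] by simp

lemma smooth1_const: "smooth1 (\<lambda>x. c)"
  unfolding smooth1_def by (rule exI[of _ "\<lambda>k. case k of 0 \<Rightarrow> (\<lambda>x. c) | Suc _ \<Rightarrow> (\<lambda>x. 0)"]) (auto split: nat.split)

lemma smooth1_mult:
  assumes "smooth1 f" "smooth1 g" shows "smooth1 (\<lambda>x. f x * g x)"
proof -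
  let ?B = "{\<lambda>x. f x * g x | f g. smooth1 f \<and> smooth1 g}"
  show ?thesis
  proof (rule smooth1_fun_span[of ?B])
    fix b assume "b \<in> ?B"
    then obtain f g where b: "b = (\<lambda>x. f x * g x)" and fg: "smooth1 f" "smooth1 g" by auto
    obtain f' g' where f': "smooth1 f'" "\<And>x. (f has_real_derivative f' x) (at x)"
      and g': "smooth1 g'" "\<And>x. (g has_real_derivative g' x) (at x)"
      using smooth1_deriv fg by metis
    show "\<exists>b'\<in>fun_span ?B. \<forall>x. (b has_real_derivative b' x) (at x)"
    proof (rule bexI[of _ "\<lambda>x. f' x * g x + f x * g' x"])
      show "\<forall>x. (b has_real_derivative f' x * g x + f x * g' x) (at x)"
        unfolding b using f'(2) g'(2) by (auto intro!: derivative_eq_intros)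
      show "(\<lambda>x. f' x * g x + f x * g' x) \<in> fun_span ?B"
        using f' g' fg by (intro fun_span.add fun_span.base) blast+
    qed
  qed (use assms in \<open>auto intro: fun_span.base\<close>)
qed

lemma smooth1_affine:
  assumes "smooth1 g" shows "smooth1 (\<lambda>x. g (c * x + d))"
proof -
  obtain G where G: "G 0 = g" "\<And>k x. (G k has_real_derivative G (Suc k) x) (at x)"
    using assms by (auto simp: smooth1_def)
  show ?thesis unfolding smooth1_def
  proof (intro exI[of _ "\<lambda>k x. c ^ k * G k (c * x + d)"] conjI allI)
    fix k x
    show "((\<lambda>x. c ^ k * G k (c * x + d)) has_real_derivative c ^ Suc k * G (Suc k) (c * x + d)) (at x)"
      by (rule derivative_eq_intros refl DERIV_chain2[OF G(2)])+ simp
  qed (simp add: G)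
qed

text \<open>The factor \<open>b\<close> vanishes in a neighbourhood of the half-line where the power
  is singular. Products of a power with such a factor form a family closed under differentiation up
  to linear combinations.\<close>

lemma smooth1_powr_mult:
  assumes b: "smooth1 b" and z: "\<And>x. x < e \<Longrightarrow> b x = 0" and e: "e > 0"
  shows "smooth1 (\<lambda>x. x powr p * b x)"
proof -
  let ?B = "{\<lambda>x. x powr p * b x | p b. smooth1 b \<and> (\<forall>x<e. b x = 0)}"
  show ?thesis
  proof (rule smooth1_fun_span[of ?B])
    fix c assume "c \<in> ?B"
    then obtain p b where c: "c = (\<lambda>x. x powr p * b x)" and b: "smooth1 b" "\<And>x. x < e \<Longrightarrow> b x = 0" by auto
    obtain b' where b': "smooth1 b'" "\<And>x. (b has_real_derivative b' x) (at x)"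
      using smooth1_deriv b(1) by metis
    have z': "b' x = 0" if "x < e" for x
    proof -
      have "((\<lambda>x. 0) has_real_derivative b' x) (at x)"
        by (rule has_field_derivative_transform_within_open[OF b'(2), of "{..<e}"]) (use that b(2) in auto)
      then show ?thesis using DERIV_const DERIV_unique by blast
    qed
    show "\<exists>c'\<in>fun_span ?B. \<forall>x. (c has_real_derivative c' x) (at x)"
    proof (rule bexI[of _ "\<lambda>x. p * (x powr (p - 1) * b x) + x powr p * b' x"], rule allI)
      fix x
      show "(c has_real_derivative p * (x powr (p - 1) * b x) + x powr p * b' x) (at x)"
      proof (cases "x < e")
        case True
        have "((\<lambda>x. 0) has_real_derivative 0) (at x)" by simp
        then have "(c has_real_derivative 0) (at x)"
          by (rule has_field_derivative_transform_within_open[of _ _ _ "{..<e}"]) (use True b(2) in \<open>auto simp: c\<close>)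
        then show ?thesis using True by (simp add: z' b(2))
      next
        case False
        then have "x > 0" using e by simp
        then show ?thesis unfolding c
          by (auto intro!: derivative_eq_intros b'(2))
      qed
    next
      have "(\<lambda>x. x powr (p - 1) * b x) \<in> ?B" "(\<lambda>x. x powr p * b' x) \<in> ?B"
        using b b'(1) z' by blast+
      then show "(\<lambda>x. p * (x powr (p - 1) * b x) + x powr p * b' x) \<in> fun_span ?B"
        by (intro fun_span.add fun_span.scale fun_span.base)
    qed
  qed (use assms in \<open>auto intro!: fun_span.base\<close>)
qed

text \<open>The functions x^p exp(-1/x), extended by 0, work as a family for real p: the derivative
  is p times the member p - 1 plus the member p - 2.\<close>

lemma smooth1_exp_bump: "smooth1 (\<lambda>x. if x > 0 then exp (- 1 / x) else 0)"
proof -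
  define E :: "real \<Rightarrow> real \<Rightarrow> real" where "E p x = (if x > 0 then x powr p * exp (- 1 / x) else 0)" for p x
  have E: "(E p has_real_derivative p * E (p - 1) x + E (p - 2) x) (at x)" for p x
  proof -
    consider "x > 0" | "x < 0" | "x = 0" by linarith
    then show ?thesis
    proof cases
      case 1
      have "((\<lambda>x. x powr p * exp (- 1 / x)) has_real_derivative p * E (p - 1) x + E (p - 2) x) (at x)"
        using 1 by (auto intro!: derivative_eq_intros simp: E_def powr_diff power2_eq_square field_simps)
      then show ?thesis
        by (rule has_field_derivative_transform_within_open[of _ _ _ "{0<..}"]) (use 1 in \<open>auto simp: E_def\<close>)
    next
      case 2
      have "((\<lambda>x. 0) has_real_derivative p * E (p - 1) x + E (p - 2) x) (at x)"
        using 2 by (simp add: E_def)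
      then show ?thesis
        by (rule has_field_derivative_transform_within_open[of _ _ _ "{..<0}"]) (use 2 in \<open>auto simp: E_def\<close>)
    next
      case 3
      \<comment> \<open>At 0 the difference quotient is itself a member of the family on the right,
        and it vanishes because the exponential beats every power.\<close>
      have "((\<lambda>h. E p h / h) \<longlongrightarrow> 0) (at 0)"
      proof (rule filterlim_split_at)
        have "((\<lambda>h. h powr (p - 1) * exp (- 1 / h)) \<longlongrightarrow> 0) (at_right 0)" by real_asymp
        moreover have "\<forall>\<^sub>F h in at_right 0. h powr (p - 1) * exp (- 1 / h) = E p h / h"
          unfolding eventually_at_right_field by (intro exI[of _ 1]) (auto simp: E_def powr_diff)
        ultimately show "((\<lambda>h. E p h / h) \<longlongrightarrow> 0) (at_right 0)"
          by (rule Lim_transform_eventually)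
        have "\<forall>\<^sub>F h in at_left 0. 0 = E p h / h"
          unfolding eventually_at_left_field by (intro exI[of _ "-1"]) (auto simp: E_def)
        then show "((\<lambda>h. E p h / h) \<longlongrightarrow> 0) (at_left 0)"
          by (rule Lim_transform_eventually[OF tendsto_const])
      qed
      then show ?thesis using 3 by (simp add: has_field_derivative_iff E_def)
    qed
  qed
  have Eb: "E p \<in> fun_span (range E)" for p by (auto intro: fun_span.base)
  have "smooth1 (E 0)"
  proof (rule smooth1_fun_span[of "range E"])
    fix b assume "b \<in> range E"
    then obtain p where "b = E p" by auto
    then show "\<exists>b'\<in>fun_span (range E). \<forall>x. (b has_real_derivative b' x) (at x)"
      using E[of p] by (intro bexI[OF _ fun_span.add[OF fun_span.scale[OF Eb[of "p - 1"], of p] Eb[of "p - 2"]]]) simp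
  qed (auto intro: fun_span.base)
  moreover have "E 0 = (\<lambda>x. if x > 0 then exp (- 1 / x) else 0)" by (auto simp: E_def fun_eq_iff)
  ultimately show ?thesis by simp
qed

lemma smooth1_continuous: "smooth1 g \<Longrightarrow> continuous_on S g"
  by (metis smooth1_deriv has_field_derivative_imp_has_derivative has_derivative_continuous continuous_at_imp_continuous_on)

text \<open>Integration starts at 0, inside the zero set of \<open>b\<close>. For negative x the
  interval {0..x} is empty, so the integral is 0, which is the correct primitive there.\<close>

lemma smooth1_primitive:
  assumes b: "smooth1 b" and z: "\<And>x. x < e \<Longrightarrow> b x = 0" and e: "e > 0"
  obtains F where "smooth1 F" "\<And>x. (F has_real_derivative b x) (at x)" "\<And>x. x < e \<Longrightarrow> F x = 0"
proof -
  define F where "F x = integral {0..x} b" for x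
  have F0: "F x = 0" if "x < e" for x
  proof -
    have "integral {0..x} b = integral {0..x} (\<lambda>x. 0)"
      by (rule integral_cong) (use that z in auto)
    then show ?thesis by (simp add: F_def)
  qed
  have F: "(F has_real_derivative b x) (at x)" for x
  proof (cases "x < e")
    case True
    have "((\<lambda>x. 0) has_real_derivative b x) (at x)" using True z by simp
    then show ?thesis
      by (rule has_field_derivative_transform_within_open[of _ _ _ "{..<e}"]) (use True F0 in auto)
  next
    case False
    have "(F has_real_derivative b x) (at x within {0..x + 1})"
      unfolding F_def by (rule integral_has_real_derivative) (use False e smooth1_continuous[OF b] in auto)
    moreover have "at x within {0..x + 1} = at x"
      by (rule at_within_interior) (use False e in auto)
    ultimately show ?thesis by simp
  qed
  show ?thesis by (rule that[of F]) (use smooth1_antideriv[OF b F] F F0 in auto)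
qed

text \<open>The normalised primitive of a bump supported in [1/2, 1]. Monotonicity matters beyond
  smoothness: it will give the concavity of the truncated fundamental solution.\<close>

lemma smooth_step_exists:
  obtains \<theta> where "smooth1 \<theta>" "mono \<theta>" "\<And>x. x \<le> 1/2 \<Longrightarrow> \<theta> x = 0" "\<And>x. x \<ge> 1 \<Longrightarrow> \<theta> x = 1"
proof -
  define e where "e x = (if x > 0 then exp (- 1 / x) else 0)" for x :: real
  define b where "b x = e (1 * x + (- 1/2)) * e ((-1) * x + 1)" for x
  have b: "smooth1 b" unfolding b_def e_def
    using smooth1_mult[OF smooth1_affine[OF smooth1_exp_bump, of 1 "- 1/2"] smooth1_affine[OF smooth1_exp_bump, of "-1" 1]] .
  have b0: "b x = 0" if "x \<le> 1/2 \<or> x \<ge> 1" for x using that by (auto simp: b_def e_def)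
  have bn: "b x \<ge> 0" for x by (simp add: b_def e_def)
  obtain F where F: "smooth1 F" "\<And>x. (F has_real_derivative b x) (at x)" "\<And>x. x < 1/2 \<Longrightarrow> F x = 0"
    using smooth1_primitive[OF b, of "1/2"] b0 by auto
  have mono: "F x \<le> F y" if "x \<le> y" for x y
    by (rule DERIV_nonneg_imp_nondecreasing[OF that]) (use F(2) bn in auto)
  \<comment> \<open>The bump is strictly positive on [5/8, 7/8], hence the total mass
    \<open>F 1\<close> is positive and can be divided by.\<close>
  have "F (5/8) < F (7/8)"
    by (rule DERIV_pos_imp_increasing) (use F(2) in \<open>auto intro!: exI simp: b_def e_def\<close>)
  moreover have "F (1/4) = 0" using F(3) by simp
  ultimately have F1: "F 1 > 0" using mono[of "1/4" "5/8"] mono[of "7/8" 1] by linarith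
  have Fc: "F x = F 1" if "x \<ge> 1" for x
  proof (cases "x = 1")
    case False
    have "\<exists>z>1. z < x \<and> F x - F 1 = (x - 1) * b z"
      by (rule MVT2) (use that False F(2) in auto)
    then show ?thesis using b0 by auto
  qed simp
  have F2: "F x = 0" if "x \<le> 1/2" for x
  proof (cases "x = 1/2")
    case True
    have "\<exists>z>1/4. z < 1/2 \<and> F (1/2) - F (1/4) = (1/2 - 1/4) * b z"
      by (rule MVT2) (use F(2) in auto)
    then have "F (1/2) = 0" using b0 \<open>F (1/4) = 0\<close> by auto
    then show ?thesis by (simp only: True)
  qed (use that F(3) in auto)
  show ?thesis
  proof (rule that[of "\<lambda>x. (1 / F 1) * F x"])
    show "smooth1 (\<lambda>x. (1 / F 1) * F x)" by (rule smooth1_scale[OF F(1)])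
    show "mono (\<lambda>x. (1 / F 1) * F x)" using mono F1 by (auto simp: mono_def divide_right_mono)
    show "(1 / F 1) * F x = 0" if "x \<le> 1/2" for x using F2[OF that] by simp
    show "(1 / F 1) * F x = 1" if "x \<ge> 1" for x using Fc[OF that] F1 by simp
  qed
qed

text \<open>The smallest convenient algebra closed under directional derivatives: differentiating
  g(x . x) in direction h gives 2 g'(x . x) (x . h), so linear functionals and products have to be
  included.\<close>

inductive_set radial_alg :: "('a::euclidean_space \<Rightarrow> real) set" where
  radial: "smooth1 g \<Longrightarrow> (\<lambda>x. g (x \<bullet> x)) \<in> radial_alg"
| inner: "(\<lambda>x. x \<bullet> v) \<in> radial_alg"
| const: "(\<lambda>x. c) \<in> radial_alg"
| add: "f \<in> radial_alg \<Longrightarrow> g \<in> radial_alg \<Longrightarrow> (\<lambda>x. f x + g x) \<in> radial_alg"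
| mult: "f \<in> radial_alg \<Longrightarrow> g \<in> radial_alg \<Longrightarrow> (\<lambda>x. f x * g x) \<in> radial_alg"

lemma radial_alg_deriv:
  assumes "f \<in> radial_alg"
  shows "\<exists>D. (\<forall>x. (f has_derivative D x) (at x)) \<and> (\<forall>h. (\<lambda>x. D x h) \<in> radial_alg)"
  using assms
proof induction
  case (radial g)
  obtain g' where g': "smooth1 g'" "\<And>x. (g has_real_derivative g' x) (at x)"
    using smooth1_deriv radial by metis
  have "((\<lambda>x. g (x \<bullet> x)) has_derivative (\<lambda>h. g' (x \<bullet> x) * (x \<bullet> h + h \<bullet> x))) (at x)" for x :: 'a
  proof -
    have "((\<lambda>x. x \<bullet> x) has_derivative (\<lambda>h. x \<bullet> h + h \<bullet> x)) (at x)"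
      by (auto intro!: derivative_eq_intros)
    from has_derivative_compose[OF this g'(2)[THEN has_field_derivative_imp_has_derivative]]
    show ?thesis by simp
  qed
  moreover have "(\<lambda>x. g' (x \<bullet> x) * (x \<bullet> h + h \<bullet> x)) \<in> radial_alg" for h :: 'a
    using radial_alg.mult[OF radial_alg.radial[OF g'(1)] radial_alg.add[OF radial_alg.inner[of h] radial_alg.inner[of h]]]
    by (simp add: inner_commute[of h])
  ultimately show ?case by (intro exI[of _ "\<lambda>x h. g' (x \<bullet> x) * (x \<bullet> h + h \<bullet> x)"]) simp
next
  case (inner v)
  have "((\<lambda>x. x \<bullet> v) has_derivative (\<lambda>h. h \<bullet> v)) (at x)" for x by (auto intro!: derivative_eq_intros)
  then show ?case by (intro exI[of _ "\<lambda>x h. h \<bullet> v"]) (auto intro: radial_alg.const)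
next
  case (const c)
  have "((\<lambda>x::'a. c) has_derivative (\<lambda>h. 0)) (at x)" for x by simp
  then show ?case by (intro exI[of _ "\<lambda>x h. 0"]) (auto intro: radial_alg.const)
next
  case (add f g)
  then obtain D E where "\<forall>x. (f has_derivative D x) (at x)" "\<forall>h. (\<lambda>x. D x h) \<in> radial_alg"
    "\<forall>x. (g has_derivative E x) (at x)" "\<forall>h. (\<lambda>x. E x h) \<in> radial_alg" by blast
  then show ?case
    by (intro exI[of _ "\<lambda>x h. D x h + E x h"]) (auto intro!: derivative_eq_intros radial_alg.add)
next
  case (mult f g)
  then obtain D E where "\<forall>x. (f has_derivative D x) (at x)" "\<forall>h. (\<lambda>x. D x h) \<in> radial_alg"
    "\<forall>x. (g has_derivative E x) (at x)" "\<forall>h. (\<lambda>x. E x h) \<in> radial_alg" by blast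
  then show ?case using mult.hyps
    by (intro exI[of _ "\<lambda>x h. f x * E x h + D x h * g x"]) (auto intro!: derivative_eq_intros radial_alg.intros)
qed

lemma radial_alg_smooth:
  assumes f: "f \<in> radial_alg" shows "smooth_fun f"
proof -
  have "dir_derivs vs f \<in> radial_alg" for vs
  proof (induction vs)
    case (Cons v vs)
    obtain D where D: "\<And>x. (dir_derivs vs f has_derivative D x) (at x)" "\<And>h. (\<lambda>x. D x h) \<in> radial_alg"
      using radial_alg_deriv[OF Cons] by blast
    have "frechet_derivative (dir_derivs vs f) (at x) = D x" for x
      using frechet_derivative_at[OF D(1)] by simp
    then show ?case using D(2) by simp
  qed (use f in simp)
  then show ?thesis unfolding smooth_fun_def differentiable_def using radial_alg_deriv by metis
qed

lemma smooth_fun_radial: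
  assumes "smooth1 g" shows "smooth_fun (\<lambda>x::'a::euclidean_space. g ((norm x)\<^sup>2))"
  using radial_alg_smooth[OF radial_alg.radial[OF assms]] by (simp add: power2_norm_eq_inner)

text \<open>The conditions on \<open>g\<close> concern nonnegative arguments only, since
  \<open>g\<close> is seen through the squared norm; its values on the negative axis are
  free.\<close>

lemma test_fun_radial:
  fixes \<Omega> :: "'a::euclidean_space set"
  assumes g: "smooth1 g" and R: "\<And>\<rho>. \<rho> \<ge> 0 \<Longrightarrow> g \<rho> \<noteq> 0 \<Longrightarrow> \<rho> \<le> R\<^sup>2"
    and r: "\<And>\<rho>. \<rho> \<ge> 0 \<Longrightarrow> g \<rho> \<noteq> 0 \<Longrightarrow> r\<^sup>2 \<le> \<rho>"
    and nn: "r \<ge> 0" "R \<ge> 0"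
    and sub: "{x. r \<le> norm x \<and> norm x \<le> R} \<subseteq> \<Omega>"
  shows "test_fun \<Omega> (\<lambda>x. g ((norm x)\<^sup>2))"
proof -
  have eq: "{x::'a. r \<le> norm x \<and> norm x \<le> R} = norm -` {r..R}" by auto
  have cl: "closed {x::'a. r \<le> norm x \<and> norm x \<le> R}"
    unfolding eq by (intro closed_vimage continuous_intros)
  have "{x::'a. g ((norm x)\<^sup>2) \<noteq> 0} \<subseteq> {x. r \<le> norm x \<and> norm x \<le> R}"
    using power2_le_imp_le[OF r[OF zero_le_power2] norm_ge_zero] power2_le_imp_le[OF R[OF zero_le_power2] nn(2)] by auto
  then have c: "closure {x::'a. g ((norm x)\<^sup>2) \<noteq> 0} \<subseteq> {x. r \<le> norm x \<and> norm x \<le> R}"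
    using cl by (rule closure_minimal)
  have "bounded (closure {x::'a. g ((norm x)\<^sup>2) \<noteq> 0})"
    by (rule bounded_subset[of "cball 0 R"]) (use c in auto)
  then have "compact (closure {x::'a. g ((norm x)\<^sup>2) \<noteq> 0})" by (simp add: compact_eq_bounded_closed)
  then show ?thesis unfolding test_fun_def using smooth_fun_radial[OF g] c sub by blast
qed

text \<open>Along the line x + t h the second derivative is 4 g2 ((x + t h) . h)^2 + 2 g1 |h|^2, and
  Cauchy-Schwarz bounds the inner product by the full squared norm. The hypothesis on
  \<open>K\<close> is thus a Hessian bound for the radial function.\<close>

lemma second_difference_radial:
  assumes g: "\<And>\<rho>. (g has_real_derivative g1 \<rho>) (at \<rho>)" "\<And>\<rho>. (g1 has_real_derivative g2 \<rho>) (at \<rho>)"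
    and K: "\<And>\<rho>. \<rho> \<ge> 0 \<Longrightarrow> 4 * \<rho> * \<bar>g2 \<rho>\<bar> + 2 * \<bar>g1 \<rho>\<bar> \<le> K"
  shows "\<bar>2 * g ((norm x)\<^sup>2) - g ((norm (x + h))\<^sup>2) - g ((norm (x - h))\<^sup>2)\<bar> \<le> 2 * K * (norm (h::'a::euclidean_space))\<^sup>2"
proof -
  define q where "q t = (x + t *\<^sub>R h) \<bullet> (x + t *\<^sub>R h)" for t
  define \<psi> where "\<psi> t = g (q t)" for t
  define \<psi>1 where "\<psi>1 t = g1 (q t) * (2 * ((x + t *\<^sub>R h) \<bullet> h))" for t
  define \<psi>2 where "\<psi>2 t = g2 (q t) * (2 * ((x + t *\<^sub>R h) \<bullet> h))\<^sup>2 + g1 (q t) * (2 * (h \<bullet> h))" for t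
  have q: "(q has_real_derivative 2 * ((x + t *\<^sub>R h) \<bullet> h)) (at t)" for t
  proof -
    have "q = (\<lambda>t. x \<bullet> x + 2 * t * (x \<bullet> h) + t * t * (h \<bullet> h))"
      by (auto simp: q_def fun_eq_iff inner_add inner_commute algebra_simps)
    then show ?thesis by (auto intro!: derivative_eq_intros simp: inner_add inner_commute algebra_simps)
  qed
  have l: "((\<lambda>t. 2 * ((x + t *\<^sub>R h) \<bullet> h)) has_real_derivative 2 * (h \<bullet> h)) (at t)" for t
    by (auto intro!: derivative_eq_intros simp: inner_add)
  have d1: "(\<psi> has_real_derivative \<psi>1 t) (at t)" for t
    unfolding \<psi>_def \<psi>1_def by (rule DERIV_chain2[OF g(1) q])
  have d2: "(\<psi>1 has_real_derivative \<psi>2 t) (at t)" for t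
    unfolding \<psi>1_def \<psi>2_def
    using DERIV_mult[OF DERIV_chain2[OF g(2) q] l] by (simp add: power2_eq_square algebra_simps)
  have b2: "\<bar>\<psi>2 t\<bar> \<le> K * (norm h)\<^sup>2" for t
  proof -
    have q0: "q t \<ge> 0" by (simp add: q_def)
    have "((x + t *\<^sub>R h) \<bullet> h)\<^sup>2 \<le> q t * (norm h)\<^sup>2"
      using Cauchy_Schwarz_ineq[of "x + t *\<^sub>R h" h] by (simp add: q_def power2_norm_eq_inner)
    then have "\<bar>g2 (q t)\<bar> * (4 * ((x + t *\<^sub>R h) \<bullet> h)\<^sup>2) \<le> \<bar>g2 (q t)\<bar> * (4 * (q t * (norm h)\<^sup>2))"
      by (intro mult_left_mono) auto
    moreover have "\<bar>\<psi>2 t\<bar> \<le> \<bar>g2 (q t)\<bar> * (4 * ((x + t *\<^sub>R h) \<bullet> h)\<^sup>2) + \<bar>g1 (q t)\<bar> * (2 * (norm h)\<^sup>2)"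
      unfolding \<psi>2_def using abs_triangle_ineq[of "g2 (q t) * (2 * ((x + t *\<^sub>R h) \<bullet> h))\<^sup>2" "g1 (q t) * (2 * (h \<bullet> h))"]
      by (simp add: abs_mult power_mult_distrib power2_norm_eq_inner)
    ultimately have "\<bar>\<psi>2 t\<bar> \<le> (4 * q t * \<bar>g2 (q t)\<bar> + 2 * \<bar>g1 (q t)\<bar>) * (norm h)\<^sup>2"
      by (simp add: algebra_simps)
    also have "\<dots> \<le> K * (norm h)\<^sup>2" by (intro mult_right_mono K q0) simp
    finally show ?thesis .
  qed
  \<comment> \<open>Adding the values at t and -t removes the first order term, so two applications
    of the mean value theorem leave only a second derivative.\<close>
  define \<omega> where "\<omega> t = \<psi> t + \<psi> (- t)" for t
  have "\<exists>z>0. z < 1 \<and> \<omega> 1 - \<omega> 0 = (1 - 0) * (\<psi>1 z - \<psi>1 (- z))"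
    unfolding \<omega>_def by (rule MVT2) (auto intro!: derivative_eq_intros d1 DERIV_chain2[OF d1, where g=uminus])
  then obtain z where z: "0 < z" "z < 1" "\<omega> 1 - \<omega> 0 = \<psi>1 z - \<psi>1 (- z)" by auto
  have "\<exists>y>-z. y < z \<and> \<psi>1 z - \<psi>1 (- z) = (z - (- z)) * \<psi>2 y"
    by (rule MVT2) (use z d2 in auto)
  then obtain y where y: "\<psi>1 z - \<psi>1 (- z) = 2 * z * \<psi>2 y" by auto
  have "\<bar>\<omega> 1 - \<omega> 0\<bar> = 2 * z * \<bar>\<psi>2 y\<bar>" using z y by (simp add: abs_mult)
  also have "\<dots> \<le> 2 * 1 * (K * (norm h)\<^sup>2)" using z b2 by (intro mult_mono) auto
  finally have "\<bar>\<omega> 1 - \<omega> 0\<bar> \<le> 2 * K * (norm h)\<^sup>2" by simp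
  moreover have "\<omega> 1 - \<omega> 0 = - (2 * g ((norm x)\<^sup>2) - g ((norm (x + h))\<^sup>2) - g ((norm (x - h))\<^sup>2))"
    by (simp add: \<omega>_def \<psi>_def q_def power2_norm_eq_inner)
  ultimately show ?thesis by simp
qed


section \<open>Concave truncation of a negative power\<close>

lemma smooth1_bounded_on_compact:
  assumes "continuous_on UNIV (f :: real \<Rightarrow> real)"
  obtains B where "\<And>x. x \<in> {a..b} \<Longrightarrow> \<bar>f x\<bar> \<le> B"
proof -
  have "compact (f ` {a..b})"
    by (rule compact_continuous_image) (auto intro: continuous_on_subset[OF assms])
  then have "bounded (f ` {a..b})" by (rule compact_imp_bounded)
  then obtain B where "\<forall>y\<in>f ` {a..b}. norm y \<le> B" by (auto simp: bounded_iff)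
  then show ?thesis by (intro that[of B]) auto
qed

text \<open>The derivative of \<open>g\<close> is that of rho^(-q) multiplied by
  \<open>\<theta>\<close>. Viewed as a function of the power rho^(-q), \<open>g\<close> therefore
  has slope \<open>\<theta>\<close>, which decreases as the power increases: \<open>g\<close> is
  concave in it, and the inequality with two points is its tangent line inequality. The last bound
  feeds \<open>second_difference_radial\<close>.\<close>

lemma truncated_powr:
  assumes q: "q > 0"
    and \<theta>: "smooth1 \<theta>" "mono \<theta>" "\<And>x. x \<le> 1/2 \<Longrightarrow> \<theta> x = 0" "\<And>x. x \<ge> 1 \<Longrightarrow> \<theta> x = 1"
  obtains g g1 g2 C K where "smooth1 g" 
    "\<And>\<rho>. (g has_real_derivative g1 \<rho>) (at \<rho>)" "\<And>\<rho>. (g1 has_real_derivative g2 \<rho>) (at \<rho>)"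
    "\<And>\<rho>. \<rho> \<ge> 1 \<Longrightarrow> g \<rho> = \<rho> powr (- q)" "\<And>\<rho>. 0 \<le> g \<rho>" "\<And>\<rho>. g \<rho> \<le> C"
    "\<And>\<rho> \<rho>0. \<rho> > 0 \<Longrightarrow> \<rho>0 > 0 \<Longrightarrow> g \<rho> \<le> g \<rho>0 + \<theta> \<rho>0 * (\<rho> powr (- q) - \<rho>0 powr (- q))"
    "\<And>\<rho>. \<rho> \<ge> 0 \<Longrightarrow> 4 * \<rho> * \<bar>g2 \<rho>\<bar> + 2 * \<bar>g1 \<rho>\<bar> \<le> K"
proof -
  have \<theta>01: "0 \<le> \<theta> x" "\<theta> x \<le> 1" for x
    using \<theta>(2)[THEN monoD, of "min x 0" x] \<theta>(2)[THEN monoD, of x "max x 1"] \<theta>(3)[of "min x 0"] \<theta>(4)[of "max x 1"] by auto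
  define b where "b x = x powr (- q - 1) * \<theta> x" for x
  have bs: "smooth1 b" unfolding b_def by (rule smooth1_powr_mult[OF \<theta>(1), of "1/2"]) (use \<theta>(3) in auto)
  have b0: "b x = 0" if "x \<le> 1/2" for x using \<theta>(3)[OF that] by (simp add: b_def)
  have bn: "b x \<ge> 0" for x using \<theta>01 by (simp add: b_def)
  obtain F where F: "smooth1 F" "\<And>x. (F has_real_derivative b x) (at x)" "\<And>x. x < 1/2 \<Longrightarrow> F x = 0"
    using smooth1_primitive[OF bs, of "1/2"] b0 by auto
  \<comment> \<open>This value makes \<open>g 1\<close> = 1, so that \<open>g\<close> joins the
    power at rho = 1; it is also the constant value of \<open>g\<close> near 0.\<close>
  define C where "C = 1 + q * F 1"
  define g where "g x = C - q * F x" for x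
  define g1 where "g1 x = (- q) * b x" for x
  have gs: "smooth1 g" unfolding g_def by (intro smooth1_diff smooth1_const smooth1_scale F(1))
  have g1: "(g has_real_derivative g1 x) (at x)" for x
    unfolding g_def g1_def by (auto intro!: derivative_eq_intros F(2))
  have "smooth1 g1" unfolding g1_def by (rule smooth1_scale[OF bs])
  then obtain g2 where g2: "smooth1 g2" "\<And>x. (g1 has_real_derivative g2 x) (at x)"
    using smooth1_deriv by blast
  have mono: "g y \<le> g x" if "x \<le> y" for x y
    by (rule DERIV_nonpos_imp_nonincreasing[OF that]) (use g1 bn q in \<open>force simp: g1_def\<close>)
  have pd: "((\<lambda>x. x powr (- q)) has_real_derivative (- q) * x powr (- q - 1)) (at x)" if "x > 0" for x
    using that by (auto intro!: derivative_eq_intros)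
  have tail: "g x = x powr (- q)" if "x \<ge> 1" for x
  proof (cases "x = 1")
    case False
    have "\<exists>z>1. z < x \<and> (g x - x powr (- q)) - (g 1 - 1 powr (- q)) = (x - 1) * (g1 z - (- q) * z powr (- q - 1))"
    proof (rule MVT2[where f="\<lambda>x. g x - x powr (- q)" and f'="\<lambda>z. g1 z - (- q) * z powr (- q - 1)"])
      fix z assume "1 \<le> z" "z \<le> x"
      then show "((\<lambda>x. g x - x powr (- q)) has_real_derivative g1 z - (- q) * z powr (- q - 1)) (at z)"
        by (intro DERIV_diff g1 pd) auto
    qed (use that False in auto)
    then obtain z where z: "z > 1" "(g x - x powr (- q)) - (g 1 - 1 powr (- q)) = (x - 1) * (g1 z - (- q) * z powr (- q - 1))" by blast
    moreover have "g1 z = (- q) * z powr (- q - 1)" using \<theta>(4)[of z] z(1) by (simp add: g1_def b_def)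
    ultimately show ?thesis by (simp add: g_def C_def)
  qed (simp add: g_def C_def)
  have up: "g x \<le> C" for x
  proof -
    have "g (min x 0) = C" using F(3)[of "min x 0"] by (simp add: g_def)
    then show ?thesis using mono[of "min x 0" x] by simp
  qed
  have lo: "0 \<le> g x" for x
  proof -
    have "g (max x 1) \<ge> 0" using tail[of "max x 1"] by simp
    then show ?thesis using mono[of x "max x 1"] by simp
  qed
  have conc: "g \<rho> \<le> g \<rho>0 + \<theta> \<rho>0 * (\<rho> powr (- q) - \<rho>0 powr (- q))" if p: "\<rho> > 0" "\<rho>0 > 0" for \<rho> \<rho>0
  proof -
    \<comment> \<open>Subtracting the tangent: the derivative of \<open>k\<close> has the sign of
      \<open>\<theta> \<rho>0 - \<theta> x\<close>, so \<open>k\<close> rises up to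
      \<open>\<rho>0\<close> and falls afterwards, with its maximum at the point of
      tangency.\<close>
    define k where "k x = g x - \<theta> \<rho>0 * x powr (- q)" for x
    have k: "(k has_real_derivative q * x powr (- q - 1) * (\<theta> \<rho>0 - \<theta> x)) (at x)" if "x > 0" for x
    proof -
      have "(k has_real_derivative g1 x - \<theta> \<rho>0 * ((- q) * x powr (- q - 1))) (at x)"
        unfolding k_def by (intro DERIV_diff g1 DERIV_cmult pd that)
      then show ?thesis by (simp add: g1_def b_def algebra_simps)
    qed
    have "k \<rho> \<le> k \<rho>0"
    proof (cases "\<rho> \<le> \<rho>0")
      case True
      show ?thesis
      proof (rule DERIV_nonneg_imp_nondecreasing[OF True, of k])
        fix x assume x: "\<rho> \<le> x" "x \<le> \<rho>0"
        have "\<theta> x \<le> \<theta> \<rho>0" using \<theta>(2) x by (simp add: monoD)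
        then show "\<exists>y. (k has_real_derivative y) (at x) \<and> 0 \<le> y"
          using k[of x] x p q by (intro exI conjI) (auto intro!: mult_nonneg_nonneg)
      qed
    next
      case False
      show ?thesis
      proof (rule DERIV_nonpos_imp_nonincreasing[of \<rho>0 \<rho> k])
        show "\<rho>0 \<le> \<rho>" using False by simp
      next
        fix x assume x: "\<rho>0 \<le> x" "x \<le> \<rho>"
        have "\<theta> \<rho>0 \<le> \<theta> x" using \<theta>(2) x by (simp add: monoD)
        then show "\<exists>y. (k has_real_derivative y) (at x) \<and> y \<le> 0"
          using k[of x] x p q by (intro exI conjI) (auto intro!: mult_nonneg_nonpos)
      qed
    qed
    then show ?thesis by (simp add: k_def algebra_simps)
  qed
  obtain B1 where B1: "\<And>x. x \<in> {0..1} \<Longrightarrow> \<bar>g1 x\<bar> \<le> B1"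
    using smooth1_bounded_on_compact[OF smooth1_continuous[OF \<open>smooth1 g1\<close>], of 0 1] by blast
  obtain B2 where B2: "\<And>x. x \<in> {0..1} \<Longrightarrow> \<bar>g2 x\<bar> \<le> B2"
    using smooth1_bounded_on_compact[OF smooth1_continuous[OF g2(1)], of 0 1] by blast
  \<comment> \<open>On [0,1] continuity gives the bound; beyond 1 the function is the pure power,
    and rho times its second derivative is of the size rho^(-q-1) <= 1.\<close>
  have K: "4 * \<rho> * \<bar>g2 \<rho>\<bar> + 2 * \<bar>g1 \<rho>\<bar> \<le> (4 * B2 + 2 * B1) + (4 * (q * (q + 1)) + 2 * q)" if "\<rho> \<ge> 0" for \<rho>
  proof (cases "\<rho> \<le> 1")
    case True
    have "4 * \<rho> * \<bar>g2 \<rho>\<bar> \<le> 4 * 1 * B2" using that True B2[of \<rho>] by (intro mult_mono) auto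
    moreover have "\<bar>g1 \<rho>\<bar> \<le> B1" using that True B1[of \<rho>] by auto
    moreover have "0 \<le> q * (q + 1)" using q by simp
    ultimately show ?thesis using q by linarith
  next
    case False
    have g1e: "g1 x = (- q) * x powr (- q - 1)" if "x > 1" for x using \<theta>(4)[of x] that by (simp add: g1_def b_def)
    have "((\<lambda>x. x powr (- q - 1)) has_real_derivative (- q - 1) * \<rho> powr (- q - 1 - 1)) (at \<rho>)"
      using False has_real_derivative_powr[of \<rho> "- q - 1"] by simp
    moreover have "- q - 1 - 1 = - q - 2" by simp
    ultimately have "((\<lambda>x. x powr (- q - 1)) has_real_derivative (- q - 1) * \<rho> powr (- q - 2)) (at \<rho>)"
      by (simp only:)
    then have "((\<lambda>x. (- q) * x powr (- q - 1)) has_real_derivative (- q) * ((- q - 1) * \<rho> powr (- q - 2))) (at \<rho>)"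
      by (rule DERIV_cmult)
    then have "(g1 has_real_derivative (- q) * ((- q - 1) * \<rho> powr (- q - 2))) (at \<rho>)"
      by (rule has_field_derivative_transform_within_open[of _ _ _ "{1<..}"]) (use False g1e in auto)
    then have "g2 \<rho> = (- q) * ((- q - 1) * \<rho> powr (- q - 2))" using g2(2) DERIV_unique by blast
    then have a2: "\<bar>g2 \<rho>\<bar> = q * (q + 1) * \<rho> powr (- q - 2)" using q by (simp add: abs_mult algebra_simps)
    have "\<rho> * \<rho> powr (- q - 2) = \<rho> powr (- q - 1)" using False by (simp add: powr_diff power2_eq_square field_simps)
    then have "\<rho> * \<bar>g2 \<rho>\<bar> = q * (q + 1) * \<rho> powr (- q - 1)" unfolding a2 by (simp add: mult.left_commute)
    moreover have le1: "\<rho> powr (- q - 1) \<le> 1" using powr_mono2'[of "- q - 1" 1 \<rho>] False q by simp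
    ultimately have "\<rho> * \<bar>g2 \<rho>\<bar> \<le> q * (q + 1)" using q by (simp add: mult_left_le)
    moreover have "\<bar>g1 \<rho>\<bar> \<le> q" using g1e[of \<rho>] False le1 q by (simp add: abs_mult mult_left_le)
    moreover have "0 \<le> B1" "0 \<le> B2" using B1[of 0] B2[of 0] by auto
    ultimately show ?thesis by linarith
  qed
  show ?thesis
    by (rule that[OF gs g1 g2(2) tail lo up conc K])
qed

text \<open>The squared norm is not globally Lipschitz, but \<open>\<theta>\<close> is constant
  beyond 1, so |z| may be replaced by min |z| 1, for which squaring has Lipschitz constant
  2.\<close>

lemma norm_cutoff_Lipschitz:
  assumes \<theta>: "smooth1 \<theta>" "\<And>x. x \<ge> 1 \<Longrightarrow> \<theta> x = 1"
  obtains L where "L \<ge> 0" "\<And>x y::'a::euclidean_space. \<bar>\<theta> ((norm x)\<^sup>2) - \<theta> ((norm y)\<^sup>2)\<bar> \<le> L * norm (x - y)"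
proof -
  obtain \<theta>' where \<theta>': "smooth1 \<theta>'" "\<And>x. (\<theta> has_real_derivative \<theta>' x) (at x)" using smooth1_deriv \<theta>(1) by metis
  obtain B where B: "\<And>x. x \<in> {0..1} \<Longrightarrow> \<bar>\<theta>' x\<bar> \<le> B"
    using smooth1_bounded_on_compact[OF smooth1_continuous[OF \<theta>'(1)], of 0 1] by blast
  have B0: "B \<ge> 0" using B[of 0] by auto
  have lip: "\<bar>\<theta> a - \<theta> b\<bar> \<le> B * \<bar>a - b\<bar>" if "a \<in> {0..1}" "b \<in> {0..1}" for a b
    using field_differentiable_bound[of "{0..1}" \<theta> \<theta>' B b a] that B \<theta>'(2)
    by (auto simp: has_field_derivative_at_within abs_minus_commute)
  show ?thesis
  proof (rule that[of "2 * B"])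
    fix x y :: 'a
    have m: "\<theta> ((norm z)\<^sup>2) = \<theta> ((min (norm z) 1)\<^sup>2)" for z :: 'a
    proof (cases "norm z \<le> 1")
      case False
      then have "(norm z)\<^sup>2 \<ge> 1" by simp
      then show ?thesis using False \<theta>(2)[of "(norm z)\<^sup>2"] \<theta>(2)[of 1] by (simp add: min_def)
    qed (simp add: min_def)
    have sq: "(min (norm z) 1)\<^sup>2 \<in> {0..1}" for z :: 'a by (auto simp: min_def power_le_one)
    have "\<bar>\<theta> ((norm x)\<^sup>2) - \<theta> ((norm y)\<^sup>2)\<bar> \<le> B * \<bar>(min (norm x) 1)\<^sup>2 - (min (norm y) 1)\<^sup>2\<bar>"
      unfolding m[of x] m[of y] by (rule lip[OF sq sq])
    also have "\<bar>(min (norm x) 1)\<^sup>2 - (min (norm y) 1)\<^sup>2\<bar> = \<bar>min (norm x) 1 + min (norm y) 1\<bar> * \<bar>min (norm x) 1 - min (norm y) 1\<bar>"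
      by (subst abs_mult[symmetric]) (simp add: power2_eq_square algebra_simps)
    also have "B * \<dots> \<le> B * (2 * norm (x - y))"
    proof (intro mult_left_mono mult_mono)
      have "0 \<le> min (norm x) 1" "0 \<le> min (norm y) 1" by auto
      then show "\<bar>min (norm x) 1 + min (norm y) 1\<bar> \<le> 2" by linarith
      show "\<bar>min (norm x) 1 - min (norm y) 1\<bar> \<le> norm (x - y)"
        using norm_triangle_ineq3[of x y] by linarith
    qed (use B0 in auto)
    finally show "\<bar>\<theta> ((norm x)\<^sup>2) - \<theta> ((norm y)\<^sup>2)\<bar> \<le> 2 * B * norm (x - y)" by simp
  qed (use B0 in simp)
qed

section \<open>Stability with a logarithmic cutoff\<close>

text \<open>Near 0 the quadratic factor lowers the singularity to order n + 2s - 2, which is below n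
  because s < 1; at infinity the order n + 2s exceeds n.\<close>

lemma nn_integral_min_kernel_finite:
  assumes s: "0 < s" "s < 1" and n: "n = real DIM('a::euclidean_space)" and L: "L \<ge> 0"
  shows "(\<integral>\<^sup>+(h::'a). ennreal (min 1 (L * (norm h)\<^sup>2) / norm h powr (n + 2 * s)) \<partial>lborel) < \<infinity>"
proof -
  have "(\<integral>\<^sup>+(h::'a). ennreal (min 1 (L * (norm h)\<^sup>2) / norm h powr (n + 2 * s)) \<partial>lborel)
    \<le> (\<integral>\<^sup>+(h::'a). ennreal L * ennreal (indicator (cball 0 1) h * norm h powr (- (n + 2 * s - 2)))
      + ennreal (indicator (- ball 0 1) h * norm h powr (- (n + 2 * s))) \<partial>lborel)"
  proof (intro nn_integral_mono)
    fix h :: 'a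
    have "min 1 (L * (norm h)\<^sup>2) / norm h powr (n + 2 * s) \<le> L * (indicator (cball 0 1) h * norm h powr (- (n + 2 * s - 2)))
      + indicator (- ball 0 1) h * norm h powr (- (n + 2 * s))"
    proof (cases "norm h < 1")
      case True
      show ?thesis
      proof (cases "h = 0")
        case False
        have "min 1 (L * (norm h)\<^sup>2) / norm h powr (n + 2 * s) \<le> L * (norm h)\<^sup>2 / norm h powr (n + 2 * s)"
          by (intro divide_right_mono) auto
        also have "\<dots> = L * norm h powr (- (n + 2 * s - 2))"
        proof -
          have p: "norm h powr (- (n + 2 * s - 2)) = norm h powr 2 * norm h powr (- (n + 2 * s))"
            by (subst powr_add[symmetric]) (simp add: algebra_simps)
          show ?thesis unfolding p powr_minus_divide[of "norm h" "n + 2 * s"] using False by simp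
        qed
        finally show ?thesis using True by simp
      qed (use L in simp)
    next
      case False
      have "min 1 (L * (norm h)\<^sup>2) / norm h powr (n + 2 * s) \<le> 1 / norm h powr (n + 2 * s)"
        by (intro divide_right_mono) auto
      moreover have "0 \<le> L * (indicator (cball 0 1) h * norm h powr (- (n + 2 * s - 2)))" using L by simp
      ultimately show ?thesis using False by (simp only: powr_minus_divide) simp
    qed
    then show "ennreal (min 1 (L * (norm h)\<^sup>2) / norm h powr (n + 2 * s)) \<le> ennreal L * ennreal (indicator (cball 0 1) h * norm h powr (- (n + 2 * s - 2)))
      + ennreal (indicator (- ball 0 1) h * norm h powr (- (n + 2 * s)))"
      using L by (simp only: ennreal_mult[symmetric] ennreal_plus[symmetric] mult_nonneg_nonneg indicator_pos_le powr_ge_zero ennreal_leI)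
  qed
  also have "\<dots> = ennreal L * (\<integral>\<^sup>+(h::'a). ennreal (indicator (cball 0 1) h * norm h powr (- (n + 2 * s - 2))) \<partial>lborel)
     + (\<integral>\<^sup>+(h::'a). ennreal (indicator (- ball 0 1) h * norm h powr (- (n + 2 * s))) \<partial>lborel)"
  proof -
    have m: "(\<lambda>h::'a. ennreal (indicator (cball 0 1) h * norm h powr (- (n + 2 * s - 2)))) \<in> borel_measurable lborel"
      "(\<lambda>h::'a. ennreal (indicator (- ball 0 1) h * norm h powr (- (n + 2 * s)))) \<in> borel_measurable lborel"
      by auto
    show ?thesis using m by (subst nn_integral_add) (auto simp: nn_integral_cmult[OF m(1)] simp del: minus_add_distrib minus_diff_eq)
  qed
  also have "\<dots> < \<infinity>"
    using nn_integral_norm_powr_cball[where 'a='a, of "n + 2 * s - 2" 1] nn_integral_norm_powr_outside[where 'a='a, of "n + 2 * s" 1] s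
    by (simp add: n ennreal_mult_less_top)
  finally show ?thesis .
qed

section \<open>Energy of a cutoff relative to the ground state\<close>

context frac
begin

lemma mu_squared: "(mu x)\<^sup>2 = norm x powr (- (n - 2 * s))"
  by (cases "x = 0") (simp_all add: mu_def power2_eq_square powr_add[symmetric])

text \<open>The remainder form in the ground state representation of the Hardy inequality, that is,
  the part of the energy not accounted for by the Hardy weight.\<close>

definition cut_energy :: "('a \<Rightarrow> real) \<Rightarrow> ennreal" where
  "cut_energy \<zeta> = (\<integral>\<^sup>+x. \<integral>\<^sup>+y. ennreal (cns * (1/2 * (mu x * mu y * (\<zeta> x - \<zeta> y)\<^sup>2)) / dist x y powr (n + 2 * s)) \<partial>lborel \<partial>lborel)"

text \<open>The cutoff tends to 1 at infinity instead of having compact support, but the form sees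
  only differences. A pair of points contributes only if one of them lies in the unit ball; there
  \<open>mu\<close> and \<open>mu\<close>^2 are integrable, while outside \<open>mu\<close> <= 1, so
  the integrand splits into an integrable function of one point times a finite kernel.\<close>

lemma cut_energy_finite:
  assumes [measurable]: "\<xi> \<in> borel_measurable borel"
    and b: "\<And>x. 0 \<le> \<xi> x" "\<And>x. \<xi> x \<le> 1" and one: "\<And>x. norm x \<ge> 1 \<Longrightarrow> \<xi> x = 1"
    and L: "L \<ge> 0" "\<And>x y. \<bar>\<xi> x - \<xi> y\<bar> \<le> L * norm (x - y)"
  shows "cut_energy \<xi> < \<infinity>"
proof -
  define F where "F x = indicator (cball 0 1) x * (mu x + (mu x)\<^sup>2)" for x :: 'a
  define k where "k h = min 1 (L\<^sup>2 * (norm h)\<^sup>2) / norm h powr (n + 2 * s)" for h :: 'a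
  have [measurable]: "F \<in> borel_measurable borel" "k \<in> borel_measurable borel" unfolding F_def k_def by measurable
  have F0: "F x \<ge> 0" and k0: "k x \<ge> 0" for x by (auto simp: F_def k_def)
  have pw: "mu x * mu y * (\<xi> x - \<xi> y)\<^sup>2 / dist x y powr (n + 2 * s) \<le> (F x + F y) * k (x - y)" for x y
  proof -
    have d1: "(\<xi> x - \<xi> y)\<^sup>2 \<le> 1" using b[of x] b[of y] by (intro abs_le_square_iff[THEN iffD1, of _ 1, simplified]) auto
    have "(\<xi> x - \<xi> y)\<^sup>2 \<le> (L * norm (x - y))\<^sup>2" using L(2)[of x y] L(1) by (intro abs_le_square_iff[THEN iffD1]) auto
    then have d2: "(\<xi> x - \<xi> y)\<^sup>2 \<le> min 1 (L\<^sup>2 * (norm (x - y))\<^sup>2)" using d1 by (simp add: power_mult_distrib)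
    have m1: "mu z \<le> 1" if "norm z \<ge> 1" for z
      using powr_mono2'[of "- ((n - 2 * s) / 2)" 1 "norm z"] that dim by (simp add: mu_def)
    have "mu x * mu y * (\<xi> x - \<xi> y)\<^sup>2 \<le> (F x + F y) * min 1 (L\<^sup>2 * (norm (x - y))\<^sup>2)"
    proof (cases "norm x \<ge> 1 \<and> norm y \<ge> 1")
      case True
      then have "\<xi> x - \<xi> y = 0" using one by simp
      then show ?thesis using F0 by (simp only:) (auto intro!: mult_nonneg_nonneg add_nonneg_nonneg)
    next
      case False
      \<comment> \<open>With both points in the ball the product is split by the square inequality;
        with just one of them inside, the other factor is at most 1.\<close>
      have "mu x * mu y \<le> F x + F y"
      proof (cases "norm x < 1")
        case x: True
        show ?thesis
        proof (cases "norm y < 1")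
          case True
          have "mu x * mu y \<le> (mu x)\<^sup>2 + (mu y)\<^sup>2"
            using sum_squares_bound[of "mu x" "mu y"] mult_nonneg_nonneg[OF mu_nonneg[of x] mu_nonneg[of y]] by linarith
          moreover have "F x = mu x + (mu x)\<^sup>2" "F y = mu y + (mu y)\<^sup>2" using x True by (simp_all add: F_def)
          ultimately show ?thesis using mu_nonneg[of x] mu_nonneg[of y] by linarith
        next
          case False
          then have "mu x * mu y \<le> mu x" using m1[of y] by (simp add: mult_left_le)
          moreover have "mu x \<le> F x" using x by (simp add: F_def)
          ultimately show ?thesis using F0[of y] by linarith
        qed
      next
        case x: False
        then have "norm y < 1" using False by auto
        have "mu x * mu y \<le> mu y" using m1[of x] x by (simp add: mult_left_le_one_le)
        moreover have "mu y \<le> F y" using \<open>norm y < 1\<close> by (simp add: F_def)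
        ultimately show ?thesis using F0[of x] by linarith
      qed
      then show ?thesis using d2 by (intro mult_mono) (auto intro: add_nonneg_nonneg F0)
    qed
    then show ?thesis
      unfolding k_def dist_norm times_divide_eq_right by (intro divide_right_mono) auto
  qed
  have kfin: "(\<integral>\<^sup>+h. ennreal (k h) \<partial>lborel) < \<infinity>"
    unfolding k_def by (rule nn_integral_min_kernel_finite[OF s n]) simp
  have Ffin: "(\<integral>\<^sup>+x. ennreal (F x) \<partial>lborel) < \<infinity>"
  proof -
    have "(\<integral>\<^sup>+x. ennreal (F x) \<partial>lborel) = (\<integral>\<^sup>+x. ennreal (indicator (cball 0 1) x * norm x powr (- ((n - 2 * s) / 2))) + ennreal (indicator (cball 0 1) x * norm (x::'a) powr (- (n - 2 * s))) \<partial>lborel)"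
      by (intro nn_integral_cong, subst ennreal_plus[symmetric]) (auto simp: F_def mu_squared, auto simp: mu_def algebra_simps)
    also have "\<dots> = (\<integral>\<^sup>+x. ennreal (indicator (cball 0 1) x * norm (x::'a) powr (- ((n - 2 * s) / 2))) \<partial>lborel) + (\<integral>\<^sup>+x. ennreal (indicator (cball 0 1) x * norm (x::'a) powr (- (n - 2 * s))) \<partial>lborel)"
      by (rule nn_integral_add) auto
    also have "\<dots> < \<infinity>"
      using nn_integral_norm_powr_cball[where 'a='a, of "(n - 2 * s) / 2" 1] nn_integral_norm_powr_cball[where 'a='a, of "n - 2 * s" 1] s n_pos
      by (simp add: n)
    finally show ?thesis .
  qed
  have I1: "(\<integral>\<^sup>+x. \<integral>\<^sup>+y. ennreal (F x) * ennreal (k (x - y)) \<partial>lborel \<partial>lborel) = (\<integral>\<^sup>+x. ennreal (F x) \<partial>lborel) * (\<integral>\<^sup>+h. ennreal (k h) \<partial>lborel)"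
  proof -
    have "(\<integral>\<^sup>+y. ennreal (F x) * ennreal (k (x - y)) \<partial>lborel) = ennreal (F x) * (\<integral>\<^sup>+h. ennreal (k h) \<partial>lborel)" for x
      by (subst nn_integral_cmult, measurable, subst nn_integral_lborel_reflect[of "\<lambda>h. ennreal (k h)" x]) auto
    then show ?thesis by (simp add: nn_integral_multc)
  qed
  have kc: "k (x - y) = k (y - x)" for x y by (simp add: k_def norm_minus_commute)
  have I2: "(\<integral>\<^sup>+x. \<integral>\<^sup>+y. ennreal (F y) * ennreal (k (x - y)) \<partial>lborel \<partial>lborel) = (\<integral>\<^sup>+x. ennreal (F x) \<partial>lborel) * (\<integral>\<^sup>+h. ennreal (k h) \<partial>lborel)"
  proof -
    have "(\<integral>\<^sup>+x. \<integral>\<^sup>+y. ennreal (F y) * ennreal (k (x - y)) \<partial>lborel \<partial>lborel) = (\<integral>\<^sup>+x. \<integral>\<^sup>+y. ennreal (F x) * ennreal (k (y - x)) \<partial>lborel \<partial>lborel)"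
      by (rule lborel_pair.Fubini') measurable
    also have "\<dots> = (\<integral>\<^sup>+x. \<integral>\<^sup>+y. ennreal (F x) * ennreal (k (x - y)) \<partial>lborel \<partial>lborel)"
      by (simp only: kc)
    finally show ?thesis using I1 by simp
  qed
  have "cut_energy \<xi> \<le> (\<integral>\<^sup>+x. \<integral>\<^sup>+y. ennreal (cns / 2) * (ennreal (F x) * ennreal (k (x - y)) + ennreal (F y) * ennreal (k (x - y))) \<partial>lborel \<partial>lborel)"
    unfolding cut_energy_def
  proof (intro nn_integral_mono)
    fix x y
    have "cns * (1/2 * (mu x * mu y * (\<xi> x - \<xi> y)\<^sup>2)) / dist x y powr (n + 2 * s) = cns / 2 * (mu x * mu y * (\<xi> x - \<xi> y)\<^sup>2 / dist x y powr (n + 2 * s))" by simp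
    also have "\<dots> \<le> cns / 2 * (F x * k (x - y) + F y * k (x - y))"
      using pw[of x y] cns_pos by (intro mult_left_mono) (auto simp: algebra_simps)
    finally show "ennreal (cns * (1/2 * (mu x * mu y * (\<xi> x - \<xi> y)\<^sup>2)) / dist x y powr (n + 2 * s)) \<le> ennreal (cns / 2) * (ennreal (F x) * ennreal (k (x - y)) + ennreal (F y) * ennreal (k (x - y)))"
      using cns_pos F0 k0 by (simp add: ennreal_mult[symmetric] ennreal_plus[symmetric] ennreal_leI del: ennreal_plus)
  qed
  also have "\<dots> = ennreal (cns / 2) * ((\<integral>\<^sup>+x. \<integral>\<^sup>+y. ennreal (F x) * ennreal (k (x - y)) \<partial>lborel \<partial>lborel) + (\<integral>\<^sup>+x. \<integral>\<^sup>+y. ennreal (F y) * ennreal (k (x - y)) \<partial>lborel \<partial>lborel))"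
    by (simp add: nn_integral_cmult nn_integral_add)
  also have "\<dots> < \<infinity>" unfolding I1 I2 using kfin Ffin by (simp add: ennreal_mult_less_top)
  finally show ?thesis .
qed

text \<open>Two volume elements give 2n, the weights give -(n-2s) and the kernel gives -(n+2s), with
  sum 0. This invariance keeps the cost of both cutoff layers bounded uniformly in the
  radii.\<close>

lemma cut_energy_scale:
  assumes [measurable]: "\<xi> \<in> borel_measurable borel" and A: "A > 0"
  shows "cut_energy (\<lambda>x. \<xi> ((1 / A) *\<^sub>R x)) = cut_energy \<xi>"
proof -
  define G where "G \<zeta> x y = cns * (1/2 * (mu x * mu y * (\<zeta> x - \<zeta> y)\<^sup>2)) / dist x y powr (n + 2 * s)" for \<zeta> :: "'a \<Rightarrow> real" and x y
  let ?\<zeta> = "\<lambda>x. \<xi> ((1 / A) *\<^sub>R x)"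
  have G: "A ^ DIM('a) * A ^ DIM('a) * G ?\<zeta> (A *\<^sub>R x) (A *\<^sub>R y) = G \<xi> x y" for x y
  proof -
    have m: "mu (A *\<^sub>R z) = A powr (- ((n - 2 * s) / 2)) * mu z" for z using A by (simp add: mu_def powr_mult)
    have d: "dist (A *\<^sub>R x) (A *\<^sub>R y) powr (n + 2 * s) = A powr (n + 2 * s) * dist x y powr (n + 2 * s)"
      using A by (simp add: dist_norm scaleR_diff_right[symmetric] powr_mult)
    have p: "A ^ DIM('a) = A powr n" using A by (simp add: n powr_realpow)
    have one: "A powr n * A powr n * (A powr (- ((n - 2 * s) / 2)) * A powr (- ((n - 2 * s) / 2))) / A powr (n + 2 * s) = 1"
      using A by (simp add: powr_add[symmetric] powr_diff[symmetric])
    have "A ^ DIM('a) * A ^ DIM('a) * G ?\<zeta> (A *\<^sub>R x) (A *\<^sub>R y) =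
      (A powr n * A powr n * (A powr (- ((n - 2 * s) / 2)) * A powr (- ((n - 2 * s) / 2))) / A powr (n + 2 * s)) * G \<xi> x y"
      unfolding G_def m d p using A by (simp add: mult_ac)
    then show ?thesis unfolding one by simp
  qed
  have [measurable]: "case_prod (G \<zeta>) \<in> borel_measurable (borel \<Otimes>\<^sub>M borel)" if [measurable]: "\<zeta> \<in> borel_measurable borel" for \<zeta>
    unfolding G_def by measurable
  have [measurable]: "?\<zeta> \<in> borel_measurable borel" by measurable
  have G0: "G \<zeta> x y \<ge> 0" for \<zeta> x y using cns_pos by (simp add: G_def)
  have "cut_energy ?\<zeta> = (\<integral>\<^sup>+x. \<integral>\<^sup>+y. ennreal (G ?\<zeta> x y) \<partial>lborel \<partial>lborel)" by (simp add: cut_energy_def G_def)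
  also have "\<dots> = ennreal (\<bar>A\<bar> ^ DIM('a)) * (\<integral>\<^sup>+x. (\<integral>\<^sup>+y. ennreal (G ?\<zeta> (A *\<^sub>R x) y) \<partial>lborel) \<partial>lborel)"
    by (rule nn_integral_lborel_scale) (use A in \<open>auto\<close>)
  also have "\<dots> = ennreal (\<bar>A\<bar> ^ DIM('a)) * (\<integral>\<^sup>+x. (ennreal (\<bar>A\<bar> ^ DIM('a)) * (\<integral>\<^sup>+y. ennreal (G ?\<zeta> (A *\<^sub>R x) (A *\<^sub>R y)) \<partial>lborel)) \<partial>lborel)"
    by (intro arg_cong2[where f="(*)"] refl nn_integral_cong nn_integral_lborel_scale) (use A in \<open>auto\<close>)
  also have "\<dots> = (\<integral>\<^sup>+x. \<integral>\<^sup>+y. ennreal (\<bar>A\<bar> ^ DIM('a)) * (ennreal (\<bar>A\<bar> ^ DIM('a)) * ennreal (G ?\<zeta> (A *\<^sub>R x) (A *\<^sub>R y))) \<partial>lborel \<partial>lborel)"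
    by (simp add: nn_integral_cmult)
  also have "\<dots> = (\<integral>\<^sup>+x. \<integral>\<^sup>+y. ennreal (G \<xi> x y) \<partial>lborel \<partial>lborel)"
  proof (intro nn_integral_cong)
    fix x y
    show "ennreal (\<bar>A\<bar> ^ DIM('a)) * (ennreal (\<bar>A\<bar> ^ DIM('a)) * ennreal (G ?\<zeta> (A *\<^sub>R x) (A *\<^sub>R y))) = ennreal (G \<xi> x y)"
      unfolding G[symmetric] using A G0 by (simp add: ennreal_mult mult.assoc)
  qed
  finally show ?thesis by (simp add: cut_energy_def G_def)
qed

text \<open>The inequality (a - b)^2 <= 2 a^2 + 2 b^2 decouples the inner layer of an annular cutoff
  from the outer one.\<close>

lemma cut_energy_diff:
  assumes [measurable]: "\<xi> \<in> borel_measurable borel" "\<eta> \<in> borel_measurable borel"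
  shows "cut_energy (\<lambda>x. \<xi> x - \<eta> x) \<le> 2 * cut_energy \<xi> + 2 * cut_energy \<eta>"
proof -
  define k where "k x y = cns * (1/2 * (mu x * mu y)) / dist x y powr (n + 2 * s)" for x y :: 'a
  have [measurable]: "case_prod k \<in> borel_measurable (borel \<Otimes>\<^sub>M borel)" unfolding k_def by measurable
  have k0: "k x y \<ge> 0" for x y using cns_pos by (simp add: k_def)
  have e: "cut_energy \<zeta> = (\<integral>\<^sup>+x. \<integral>\<^sup>+y. ennreal (k x y * (\<zeta> x - \<zeta> y)\<^sup>2) \<partial>lborel \<partial>lborel)" for \<zeta>
    unfolding cut_energy_def k_def by (intro nn_integral_cong) (simp add: mult.assoc)
  have m: "(\<lambda>(x, y). ennreal (k x y * (\<zeta> x - \<zeta> y)\<^sup>2)) \<in> borel_measurable (borel \<Otimes>\<^sub>M borel)" if [measurable]: "\<zeta> \<in> borel_measurable borel" for \<zeta>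
    by measurable
  have "cut_energy (\<lambda>x. \<xi> x - \<eta> x) \<le> (\<integral>\<^sup>+x. \<integral>\<^sup>+y. 2 * ennreal (k x y * (\<xi> x - \<xi> y)\<^sup>2) + 2 * ennreal (k x y * (\<eta> x - \<eta> y)\<^sup>2) \<partial>lborel \<partial>lborel)"
    unfolding e
  proof (intro nn_integral_mono)
    fix x y
    have "((\<xi> x - \<eta> x) - (\<xi> y - \<eta> y))\<^sup>2 \<le> 2 * (\<xi> x - \<xi> y)\<^sup>2 + 2 * (\<eta> x - \<eta> y)\<^sup>2"
    proof -
      have "((\<xi> x - \<eta> x) - (\<xi> y - \<eta> y))\<^sup>2 + ((\<xi> x - \<xi> y) + (\<eta> x - \<eta> y))\<^sup>2 = 2 * (\<xi> x - \<xi> y)\<^sup>2 + 2 * (\<eta> x - \<eta> y)\<^sup>2"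
        by (simp add: power2_eq_square algebra_simps)
      then show ?thesis by (smt (verit) zero_le_power2)
    qed
    then have "k x y * ((\<xi> x - \<eta> x) - (\<xi> y - \<eta> y))\<^sup>2 \<le> k x y * (2 * (\<xi> x - \<xi> y)\<^sup>2 + 2 * (\<eta> x - \<eta> y)\<^sup>2)"
      by (rule mult_left_mono[OF _ k0])
    then have "ennreal (k x y * ((\<xi> x - \<eta> x) - (\<xi> y - \<eta> y))\<^sup>2) \<le> ennreal (2 * (k x y * (\<xi> x - \<xi> y)\<^sup>2) + 2 * (k x y * (\<eta> x - \<eta> y)\<^sup>2))"
      by (intro ennreal_leI) (simp add: algebra_simps)
    also have "\<dots> = 2 * ennreal (k x y * (\<xi> x - \<xi> y)\<^sup>2) + 2 * ennreal (k x y * (\<eta> x - \<eta> y)\<^sup>2)"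
      using k0[of x y] by (subst ennreal_plus) (auto simp: ennreal_mult)
    finally show "ennreal (k x y * ((\<xi> x - \<eta> x) - (\<xi> y - \<eta> y))\<^sup>2) \<le> 2 * ennreal (k x y * (\<xi> x - \<xi> y)\<^sup>2) + 2 * ennreal (k x y * (\<eta> x - \<eta> y)\<^sup>2)" .
  qed
  also have "\<dots> = 2 * cut_energy \<xi> + 2 * cut_energy \<eta>"
    unfolding e by (simp add: nn_integral_cmult nn_integral_add)
  finally show ?thesis .
qed

text \<open>The test function is \<open>mu\<close> times the difference of two dilates of one fixed
  cutoff. Both layers cost a bounded amount, while the Hardy term grows with |S^(n-1)| ln(b/A); here
  \<open>2 * radial_const n\<close> is |S^(n-1)|. The condition 4 R0 <= A keeps the inner layer,
  which reaches down to A/2, away from \<open>K\<close>.\<close>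

theorem stability_log_bound:
  fixes f :: "'a \<Rightarrow> real"
  assumes f[measurable]: "f \<in> borel_measurable borel" and f0: "\<And>x. f x \<ge> 0"
    and K: "K \<subseteq> cball 0 R0" and R0: "R0 > 0"
    and stable: "\<And>\<phi>. test_fun (UNIV - K) \<phi> \<Longrightarrow> (\<integral>\<^sup>+x. ennreal (f x * (\<phi> x)\<^sup>2) \<partial>lborel) \<le>
       (\<integral>\<^sup>+x. \<integral>\<^sup>+y. ennreal (cns * (1/2 * (\<phi> x - \<phi> y)\<^sup>2) / dist x y powr (n + 2 * s)) \<partial>lborel \<partial>lborel)"
  obtains C where "C \<ge> 0" "\<And>A b. 4 * R0 \<le> A \<Longrightarrow> A \<le> b \<Longrightarrow>
     (\<integral>\<^sup>+x. ennreal (indicator {x. A \<le> norm x \<and> norm x \<le> b} x * (f x * norm x powr (- (n - 2 * s)))) \<partial>lborel)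
       \<le> ennreal (C + \<Lambda> * (2 * radial_const n) * ln (b / A))"
proof -
  obtain \<theta> where \<theta>: "smooth1 \<theta>" "mono \<theta>" "\<And>x. x \<le> 1/2 \<Longrightarrow> \<theta> x = 0" "\<And>x. x \<ge> 1 \<Longrightarrow> \<theta> x = 1"
    using smooth_step_exists by blast
  have \<theta>01: "0 \<le> \<theta> x" "\<theta> x \<le> 1" for x
    using \<theta>(2)[THEN monoD, of "min x 0" x] \<theta>(2)[THEN monoD, of x "max x 1"] \<theta>(3)[of "min x 0"] \<theta>(4)[of "max x 1"] by auto
  have [measurable]: "\<theta> \<in> borel_measurable borel" using smooth1_continuous[OF \<theta>(1)] by (rule borel_measurable_continuous_onI)
  define \<xi> where "\<xi> x = \<theta> ((norm x)\<^sup>2)" for x :: 'a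
  have [measurable]: "\<xi> \<in> borel_measurable borel" unfolding \<xi>_def by measurable
  obtain L where L: "L \<ge> 0" "\<And>x y::'a. \<bar>\<xi> x - \<xi> y\<bar> \<le> L * norm (x - y)"
    using norm_cutoff_Lipschitz[OF \<theta>(1) \<theta>(4), where 'a='a] unfolding \<xi>_def by blast
  have "cut_energy \<xi> < \<infinity>"
  proof (rule cut_energy_finite[OF _ _ _ _ L])
    show "\<xi> x = 1" if "norm x \<ge> 1" for x
      unfolding \<xi>_def by (rule \<theta>(4)) (use that in simp)
  qed (auto simp: \<xi>_def \<theta>01)
  define J where "J = enn2real (cut_energy \<xi>)"
  have J: "cut_energy \<xi> = ennreal J" using \<open>cut_energy \<xi> < \<infinity>\<close> by (simp add: J_def)
  have J0: "J \<ge> 0" by (simp add: J_def)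
  let ?c = "\<Lambda> * (2 * radial_const n)"
  have rc: "radial_const n \<ge> 0" using n_pos by simp
  have c0: "?c \<ge> 0" using \<Lambda>_nonneg rc by (intro mult_nonneg_nonneg) auto
  show ?thesis
  \<comment> \<open>4 J is the price of the two layers, and ln 4 the excess of ln(2b / (A/2)) over
    ln(b/A).\<close>
  proof (rule that[of "4 * J + ?c * ln 4"])
    show "0 \<le> 4 * J + ?c * ln 4" using J0 by (intro add_nonneg_nonneg mult_nonneg_nonneg[OF c0]) auto
    fix A b assume A: "4 * R0 \<le> A" and b: "A \<le> b"
    \<comment> \<open>The doubling makes the outer cutoff vanish on |x| <= b: there |x|^2 / B^2 is
      at most 1/4, below the threshold 1/2 of \<open>\<theta>\<close>.\<close>
    define B where "B = 2 * b"
    have A0: "A > 0" using A R0 by simp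
    have B0: "B > 0" "A \<le> B" using A0 b by (auto simp: B_def)
    define \<zeta> where "\<zeta> x = \<xi> ((1 / A) *\<^sub>R x) - \<xi> ((1 / B) *\<^sub>R x)" for x
    have [measurable]: "\<zeta> \<in> borel_measurable borel" unfolding \<zeta>_def by measurable
    have \<zeta>eq: "\<zeta> x = \<theta> ((1 / A\<^sup>2) * (norm x)\<^sup>2 + 0) - \<theta> ((1 / B\<^sup>2) * (norm x)\<^sup>2 + 0)" for x
      by (simp add: \<zeta>_def \<xi>_def power_divide)
    have AB: "(1 / B\<^sup>2) * \<rho> \<le> (1 / A\<^sup>2) * \<rho>" if "\<rho> \<ge> 0" for \<rho>
      using that A0 B0 by (intro mult_right_mono) (auto intro!: frac_le power_mono)
    have \<zeta>0: "0 \<le> \<zeta> x" for x unfolding \<zeta>eq using \<theta>(2)[THEN monoD, OF AB[of "(norm x)\<^sup>2"]] by simp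
    have \<zeta>1: "\<zeta> x \<le> 1" for x unfolding \<zeta>eq using \<theta>01(2)[of "(1 / A\<^sup>2) * (norm x)\<^sup>2 + 0"] \<theta>01(1)[of "(1 / B\<^sup>2) * (norm x)\<^sup>2 + 0"] by linarith
    define h where "h \<rho> = \<theta> ((1 / A\<^sup>2) * \<rho> + 0) - \<theta> ((1 / B\<^sup>2) * \<rho> + 0)" for \<rho>
    have h_zero_low: "h \<rho> = 0" if "\<rho> < A\<^sup>2 / 4" for \<rho>
    proof -
      have "A\<^sup>2 \<le> B\<^sup>2" using A0 B0 by (intro power_mono) auto
      moreover have "A\<^sup>2 > 0" using A0 by simp
      ultimately have "\<rho> < A\<^sup>2 / 2" "\<rho> < B\<^sup>2 / 2" using that by linarith+
      then have "(1 / A\<^sup>2) * \<rho> + 0 \<le> 1/2" "(1 / B\<^sup>2) * \<rho> + 0 \<le> 1/2" using A0 B0(1) by (simp_all add: field_simps)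
      then show ?thesis unfolding h_def using \<theta>(3) by simp
    qed
    have h_zero_high: "h \<rho> = 0" if "\<rho> > B\<^sup>2" for \<rho>
    proof -
      have "A\<^sup>2 \<le> \<rho>" using power_mono[OF B0(2), of 2] A0 that by linarith
      then have "(1 / A\<^sup>2) * \<rho> + 0 \<ge> 1" "(1 / B\<^sup>2) * \<rho> + 0 \<ge> 1" using A0 B0(1) that by (simp_all add: divide_simps)
      then show ?thesis unfolding h_def using \<theta>(4) by simp
    qed
    have \<zeta>h: "\<zeta> x = h ((norm x)\<^sup>2)" for x by (simp only: \<zeta>eq h_def)
    have supp: "A / 2 \<le> norm x \<and> norm x \<le> B" if "\<zeta> x \<noteq> 0" for x
    proof -
      have "\<not> (norm x)\<^sup>2 < A\<^sup>2 / 4" "\<not> (norm x)\<^sup>2 > B\<^sup>2" using that h_zero_low h_zero_high \<zeta>h by metis+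
      then have "(A / 2)\<^sup>2 \<le> (norm x)\<^sup>2" "(norm x)\<^sup>2 \<le> B\<^sup>2" by (auto simp: power_divide)
      then show ?thesis using power2_le_imp_le[of "A/2" "norm x"] power2_le_imp_le[of "norm x" B] B0 by simp
    qed
    define \<phi> where "\<phi> x = \<zeta> x * mu x" for x
    \<comment> \<open>In the variable rho the ground state is rho^(-(n-2s)/4), and \<open>h\<close>
      vanishes near 0, so the product is smooth although \<open>mu\<close> is singular at the
      origin.\<close>
    have "test_fun (UNIV - K) (\<lambda>x::'a. (\<lambda>\<rho>. \<rho> powr (- ((n - 2 * s) / 2) / 2) * h \<rho>) ((norm x)\<^sup>2))"
    proof (rule test_fun_radial[where r="A/2" and R=B])
      show "smooth1 (\<lambda>\<rho>. \<rho> powr (- ((n - 2 * s) / 2) / 2) * h \<rho>)"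
      proof (rule smooth1_powr_mult[where e="A\<^sup>2/4"])
        show "smooth1 h" unfolding h_def by (intro smooth1_diff smooth1_affine[OF \<theta>(1)])
      qed (use h_zero_low A0 in auto)
      show "{x::'a. A / 2 \<le> norm x \<and> norm x \<le> B} \<subseteq> UNIV - K" using K A R0 by auto
      show "\<rho> \<le> B\<^sup>2" if "\<rho> powr (- ((n - 2 * s) / 2) / 2) * h \<rho> \<noteq> 0" for \<rho> using that h_zero_high[of \<rho>] by (auto simp: not_less[symmetric])
      show "(A / 2)\<^sup>2 \<le> \<rho>" if "\<rho> powr (- ((n - 2 * s) / 2) / 2) * h \<rho> \<noteq> 0" for \<rho> using that h_zero_low[of \<rho>] by (auto simp: not_less[symmetric] power_divide)
    qed (use A0 B0 in auto)
    moreover have "(\<lambda>x::'a. (\<lambda>\<rho>. \<rho> powr (- ((n - 2 * s) / 2) / 2) * h \<rho>) ((norm x)\<^sup>2)) = \<phi>"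
      by (rule ext) (simp only: \<phi>_def \<zeta>h mu_def norm_powr_eq_norm_squared_powr[symmetric] mult.commute)
    ultimately have test: "test_fun (UNIV - K) \<phi>" by simp
    have "(\<integral>\<^sup>+x. ennreal (indicator {x. A \<le> norm x \<and> norm x \<le> b} x * (f x * norm x powr (- (n - 2 * s)))) \<partial>lborel)
      \<le> (\<integral>\<^sup>+x. ennreal (f x * (\<phi> x)\<^sup>2) \<partial>lborel)"
    proof (intro nn_integral_mono ennreal_leI)
      fix x :: 'a
      show "indicator {x. A \<le> norm x \<and> norm x \<le> b} x * (f x * norm x powr (- (n - 2 * s))) \<le> f x * (\<phi> x)\<^sup>2"
      proof (cases "A \<le> norm x \<and> norm x \<le> b")
        case True
        have "A\<^sup>2 \<le> (norm x)\<^sup>2" "(norm x)\<^sup>2 \<le> b\<^sup>2" using True A0 by (auto intro!: power_mono)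
        moreover from this have "(norm x)\<^sup>2 \<le> 2 * b\<^sup>2" using zero_le_power2[of b] by linarith
        ultimately have "(1 / A\<^sup>2) * (norm x)\<^sup>2 + 0 \<ge> 1" "(1 / B\<^sup>2) * (norm x)\<^sup>2 + 0 \<le> 1/2"
          using A0 b by (simp_all add: B_def field_simps)
        then have "\<zeta> x = 1" unfolding \<zeta>eq using \<theta>(3,4) by simp
        then show ?thesis using True by (simp add: \<phi>_def mu_squared)
      qed (use f0 in simp)
    qed
    also have "\<dots> \<le> (\<integral>\<^sup>+x. \<integral>\<^sup>+y. ennreal (cns * (1/2 * (\<phi> x - \<phi> y)\<^sup>2) / dist x y powr (n + 2 * s)) \<partial>lborel \<partial>lborel)"
      by (rule stable[OF test])
    also have "\<dots> \<le> cut_energy \<zeta> + ennreal \<Lambda> * (\<integral>\<^sup>+x. ennreal ((\<zeta> x)\<^sup>2 * norm x powr (- n)) \<partial>lborel)"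
      unfolding \<phi>_def cut_energy_def
      by (rule hardy_energy[where r="A/2" and R=B]) (use supp \<zeta>0 \<zeta>1 A0 in auto)
    also have "\<dots> \<le> ennreal (4 * J) + ennreal \<Lambda> * ennreal (2 * radial_const n * ln (B / (A / 2)))"
    proof (rule add_mono)
      have "cut_energy \<zeta> \<le> 2 * cut_energy (\<lambda>x. \<xi> ((1 / A) *\<^sub>R x)) + 2 * cut_energy (\<lambda>x. \<xi> ((1 / B) *\<^sub>R x))"
        unfolding \<zeta>_def by (rule cut_energy_diff) measurable
      also have "\<dots> = 2 * ennreal J + 2 * ennreal J"
        by (subst (1 2) cut_energy_scale) (use A0 B0 in \<open>simp_all add: J\<close>)
      also have "\<dots> = ennreal (4 * J)"
      proof -
        have "(2::ennreal) = ennreal 2" by simp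
        then have "2 * ennreal J = ennreal (2 * J)" using J0 by (simp only: ennreal_mult[symmetric])
        then show ?thesis using J0 by (simp add: ennreal_plus[symmetric] del: ennreal_plus)
      qed
      finally show "cut_energy \<zeta> \<le> ennreal (4 * J)" .
      have "(\<integral>\<^sup>+x. ennreal ((\<zeta> x)\<^sup>2 * norm x powr (- n)) \<partial>lborel) \<le> (\<integral>\<^sup>+(x::'a). ennreal (indicator {x. A / 2 \<le> norm x \<and> norm x \<le> B} x * norm x powr (- n)) \<partial>lborel)"
      proof (intro nn_integral_mono ennreal_leI mult_right_mono)
        fix x :: 'a
        show "(\<zeta> x)\<^sup>2 \<le> indicator {x. A / 2 \<le> norm x \<and> norm x \<le> B} x"
          using supp[of x] \<zeta>0[of x] \<zeta>1[of x] by (cases "\<zeta> x = 0") (auto simp: power_le_one)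
      qed simp
      also have "\<dots> = ennreal (2 * radial_const n * ln (B / (A / 2)))"
        unfolding n by (rule nn_integral_annulus) (use A0 B0 in auto)
      finally show "ennreal \<Lambda> * (\<integral>\<^sup>+x. ennreal ((\<zeta> x)\<^sup>2 * norm x powr (- n)) \<partial>lborel) \<le> ennreal \<Lambda> * ennreal (2 * radial_const n * ln (B / (A / 2)))"
        by (intro mult_left_mono) auto
    qed
    also have "\<dots> = ennreal (4 * J + ?c * ln 4 + ?c * ln (b / A))"
    proof -
      have l: "ln (B / (A / 2)) = ln 4 + ln (b / A)"
      proof -
        have e: "B / (A / 2) = 4 * (b / A)" by (simp add: B_def)
        have "b / A > 0" using A0 b by simp
        then show ?thesis unfolding e by (subst ln_mult_pos) auto
      qed
      have l0: "ln (B / (A / 2)) \<ge> 0" using A0 B0 by (intro ln_ge_zero) (simp add: field_simps)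
      have "ennreal (4 * J) + ennreal \<Lambda> * ennreal (2 * radial_const n * ln (B / (A / 2))) = ennreal (4 * J + \<Lambda> * (2 * radial_const n * ln (B / (A / 2))))"
        using J0 \<Lambda>_nonneg rc l0 by (simp only: ennreal_mult[symmetric] ennreal_plus mult_nonneg_nonneg zero_le_numeral)
      also have "4 * J + \<Lambda> * (2 * radial_const n * ln (B / (A / 2))) = 4 * J + ?c * ln 4 + ?c * ln (b / A)"
        unfolding l by (simp only: distrib_left mult.assoc add.assoc)
      finally show ?thesis .
    qed
    finally show "(\<integral>\<^sup>+x. ennreal (indicator {x. A \<le> norm x \<and> norm x \<le> b} x * (f x * norm x powr (- (n - 2 * s)))) \<partial>lborel)
       \<le> ennreal (4 * J + ?c * ln 4 + ?c * ln (b / A))" .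
  qed
qed

end

section \<open>Truncating the fundamental solution\<close>

text \<open>The symmetric second difference makes the integral of the fractional Laplacian absolutely convergent.\<close>

definition sdiff :: "('a::real_normed_vector \<Rightarrow> real) \<Rightarrow> 'a \<Rightarrow> 'a \<Rightarrow> real" where
  "sdiff g x h = 2 * g x - g (x + h) - g (x - h)"

lemma borel_measurable_sdiff [measurable (raw)]:
  fixes g :: "'a::euclidean_space \<Rightarrow> real"
  assumes [measurable]: "g \<in> borel_measurable borel" "f \<in> borel_measurable M" "h \<in> borel_measurable M"
  shows "(\<lambda>x. sdiff g (f x) (h x)) \<in> borel_measurable M"
  unfolding sdiff_def by measurable

text \<open>Half of the Gaussian exponent absorbs the factor |h|^2 through r exp(-r) <= 1, and the
  other half is a heat kernel at time 2t. Integrated in h it yields a second moment of order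
  t.\<close>

lemma norm_sq_heat_le:
  fixes h :: "'a::euclidean_space"
  assumes t: "t > 0"
  shows "(norm h)\<^sup>2 * heat t h \<le> 8 * 2 powr (real DIM('a) / 2) * t * heat (2 * t) h"
proof -
  define r where "r = (norm h)\<^sup>2 / (8 * t)"
  have r: "r * exp (- r) \<le> 1"
  proof -
    have "r \<le> exp r" using exp_ge_add_one_self[of r] by linarith
    then show ?thesis by (simp add: exp_minus field_simps)
  qed
  have e: "exp (- ((norm h)\<^sup>2 / (4 * t))) = exp (- r) * exp (- r)"
    using t by (simp add: r_def exp_add[symmetric] field_simps)
  have e2: "exp (- ((norm h)\<^sup>2 / (4 * (2 * t)))) = exp (- r)" by (simp add: r_def)
  have nh: "(norm h)\<^sup>2 = 8 * t * r" using t by (simp add: r_def)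
  have p: "(4 * pi * t) powr (- (real DIM('a) / 2)) = 2 powr (real DIM('a) / 2) * (4 * pi * (2 * t)) powr (- (real DIM('a) / 2))"
  proof -
    have "4 * pi * (2 * t) = 2 * (4 * pi * t)" by simp
    then have "(4 * pi * (2 * t)) powr (- (real DIM('a) / 2)) = 2 powr (- (real DIM('a) / 2)) * (4 * pi * t) powr (- (real DIM('a) / 2))"
      by (simp only: powr_mult)
    moreover have "2 powr (real DIM('a) / 2) * 2 powr (- (real DIM('a) / 2)) = (1::real)"
      by (subst powr_add[symmetric]) simp
    ultimately show ?thesis by (simp only: mult.assoc[symmetric])
  qed
  have "(norm h)\<^sup>2 * heat t h = (8 * t * (4 * pi * t) powr (- (real DIM('a) / 2)) * exp (- r)) * (r * exp (- r))"
    unfolding heat_def e by (simp add: nh)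
  also have "\<dots> \<le> (8 * t * (4 * pi * t) powr (- (real DIM('a) / 2)) * exp (- r)) * 1"
    by (intro mult_left_mono r) (use t in auto)
  also have "\<dots> = 8 * 2 powr (real DIM('a) / 2) * t * heat (2 * t) h"
    unfolding heat_def e2 p by simp
  finally show ?thesis .
qed

section \<open>The fractional Laplacian through second differences\<close>

context frac
begin

text \<open>(-Delta)^s written without principal value; the extra 1/2 comes from averaging over h
  and -h.\<close>

definition Dop :: "('a \<Rightarrow> real) \<Rightarrow> 'a \<Rightarrow> real" where
  "Dop g x = (\<integral>h. cns / 2 * (sdiff g x h / norm h powr (n + 2 * s)) \<partial>lborel)"

lemma integrable_min_kernel:
  "L \<ge> 0 \<Longrightarrow> integrable lborel (\<lambda>h::'a. min 1 (L * (norm h)\<^sup>2) / norm h powr (n + 2 * s))"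
  using nn_integral_min_kernel_finite[OF s n, of L] by (intro integrableI_bounded) auto

lemma integrable_kernel_bound:
  fixes F :: "'a \<Rightarrow> real"
  assumes [measurable]: "F \<in> borel_measurable borel" and F: "\<And>h. \<bar>F h\<bar> \<le> B * min 1 ((norm h)\<^sup>2)"
  shows "integrable lborel (\<lambda>h. F h / norm h powr (n + 2 * s))"
proof (rule Bochner_Integration.integrable_bound)
  show "integrable lborel (\<lambda>h::'a. B * (min 1 (1 * (norm h)\<^sup>2) / norm h powr (n + 2 * s)))"
    by (intro integrable_mult_right integrable_min_kernel) simp
  have "\<bar>F h\<bar> / norm h powr (n + 2 * s) \<le> B * min 1 ((norm h)\<^sup>2) / norm h powr (n + 2 * s)" for h
    by (intro divide_right_mono F) simp
  then have "norm (F h / norm h powr (n + 2 * s)) \<le> B * (min 1 (1 * (norm h)\<^sup>2) / norm h powr (n + 2 * s))" for h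
    by simp
  then show "AE h in lborel. norm (F h / norm h powr (n + 2 * s)) \<le> norm (B * (min 1 (1 * (norm h)\<^sup>2) / norm h powr (n + 2 * s)))"
    unfolding real_norm_def using abs_ge_self order_trans by (intro AE_I2) blast
qed measurable

text \<open>For each positive truncation radius the integral converges absolutely and may be
  symmetrised under h -> -h. The symmetrised integrand is dominated independently of the radius, so
  the principal value exists and is given by \<open>Dop\<close>.\<close>

lemma truncated_integral_tendsto_Dop:
  fixes \<phi> :: "'a \<Rightarrow> real"
  assumes [measurable]: "\<phi> \<in> borel_measurable borel" and M: "\<And>y. \<bar>\<phi> y\<bar> \<le> M"
    and B: "\<And>h. \<bar>sdiff \<phi> x h\<bar> \<le> B * min 1 ((norm h)\<^sup>2)"
  shows "((\<lambda>\<epsilon>. LINT y : {y. dist x y > \<epsilon>} | lborel. (\<phi> x - \<phi> y) / dist x y powr (n + 2 * s))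
    \<longlongrightarrow> Dop \<phi> x / cns) (at_right 0)"
proof -
  let ?p = "n + 2 * s"
  define k where "k \<epsilon> h = indicator {h. norm h > \<epsilon>} h / norm h powr ?p" for \<epsilon> and h :: 'a
  have [measurable]: "k \<epsilon> \<in> borel_measurable borel" for \<epsilon> unfolding k_def by measurable
  have kint: "integrable lborel (k \<epsilon>)" if e: "\<epsilon> > 0" for \<epsilon>
  proof (rule integrableI_bounded)
    have "(\<integral>\<^sup>+h. ennreal (norm (k \<epsilon> h)) \<partial>lborel) \<le> (\<integral>\<^sup>+h. ennreal (indicator (- ball 0 \<epsilon>) h * norm h powr (- ?p)) \<partial>(lborel :: 'a measure))"
      unfolding powr_minus_divide by (intro nn_integral_mono ennreal_leI) (auto simp: k_def indicator_def)
    also have "\<dots> < \<infinity>" by (rule nn_integral_norm_powr_outside) (use s n e in auto)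
    finally show "(\<integral>\<^sup>+h. ennreal (norm (k \<epsilon> h)) \<partial>lborel) < \<infinity>" .
  qed measurable
  have km: "k \<epsilon> (- h) = k \<epsilon> h" for \<epsilon> h by (simp add: k_def indicator_def)
  have half: "(LINT y : {y. dist x y > \<epsilon>} | lborel. (\<phi> x - \<phi> y) / dist x y powr ?p) = (\<integral>h. 1/2 * (sdiff \<phi> x h * k \<epsilon> h) \<partial>lborel)"
    if e: "\<epsilon> > 0" for \<epsilon>
  proof -
    define G where "G h = (\<phi> x - \<phi> (x + h)) * k \<epsilon> h" for h
    have [measurable]: "G \<in> borel_measurable borel" unfolding G_def by measurable
    have Gi: "integrable lborel G"
    proof (rule Bochner_Integration.integrable_bound)
      show "integrable lborel (\<lambda>h. (2 * M) * k \<epsilon> h)" by (intro integrable_mult_right kint e)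
      have "\<bar>G h\<bar> \<le> \<bar>2 * M * k \<epsilon> h\<bar>" for h
      proof -
        have "\<bar>\<phi> x - \<phi> (x + h)\<bar> \<le> 2 * M" using M[of x] M[of "x + h"] by linarith
        then show ?thesis unfolding G_def abs_mult by (intro mult_right_mono) auto
      qed
      then show "AE h in lborel. norm (G h) \<le> norm (2 * M * k \<epsilon> h)" by simp
    qed measurable
    have "(LINT y : {y. dist x y > \<epsilon>} | lborel. (\<phi> x - \<phi> y) / dist x y powr ?p) = (\<integral>y. (\<phi> x - \<phi> y) * k \<epsilon> (y - x) \<partial>lborel)"
      unfolding set_lebesgue_integral_def by (intro Bochner_Integration.integral_cong) (auto simp: k_def indicator_def dist_norm norm_minus_commute)
    also have "\<dots> = (\<integral>h. (\<phi> x - \<phi> (x + h)) * k \<epsilon> ((x + h) - x) \<partial>lborel)"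
      by (rule integral_lborel_shift[symmetric]) measurable
    also have "\<dots> = (\<integral>h. G h \<partial>lborel)" by (simp add: G_def)
    finally have 1: "(LINT y : {y. dist x y > \<epsilon>} | lborel. (\<phi> x - \<phi> y) / dist x y powr ?p) = (\<integral>h. G h \<partial>lborel)" .
    have 2: "(\<integral>h. G (- h) \<partial>lborel) = (\<integral>h. G h \<partial>lborel)" by (rule integral_lborel_minus) measurable
    have "(\<integral>h. G h \<partial>lborel) = 1/2 * ((\<integral>h. G h \<partial>lborel) + (\<integral>h. G (- h) \<partial>lborel))" using 2 by simp
    also have "\<dots> = 1/2 * (\<integral>h. G h + G (- h) \<partial>lborel)"
      by (subst Bochner_Integration.integral_add[OF Gi integrable_lborel_minus[OF Gi]]) simp
    also have "\<dots> = (\<integral>h. 1/2 * (G h + G (- h)) \<partial>lborel)" by (rule integral_mult_right_zero[symmetric])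
    also have "\<dots> = (\<integral>h. 1/2 * (sdiff \<phi> x h * k \<epsilon> h) \<partial>lborel)"
      by (intro Bochner_Integration.integral_cong refl) (simp add: G_def km sdiff_def algebra_simps)
    finally show ?thesis using 1 by simp
  qed
  have Di: "integrable lborel (\<lambda>h. sdiff \<phi> x h / norm h powr ?p)"
    by (rule integrable_kernel_bound[OF _ B]) measurable
  \<comment> \<open>Dominated convergence is applied along a parameter tending to infinity, so the
    truncation radius appears as its inverse and is translated back at the end.\<close>
  have "((\<lambda>\<epsilon>. \<integral>h. 1/2 * (sdiff \<phi> x h * k (inverse \<epsilon>) h) \<partial>lborel) \<longlongrightarrow> (\<integral>h. 1/2 * (sdiff \<phi> x h / norm h powr ?p) \<partial>lborel)) at_top"
  proof (rule integral_dominated_convergence_at_top[where w="\<lambda>h. \<bar>sdiff \<phi> x h / norm h powr ?p\<bar>"])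
    show "\<forall>\<^sub>F \<epsilon> in at_top. AE h in lborel. norm (1/2 * (sdiff \<phi> x h * k (inverse \<epsilon>) h)) \<le> \<bar>sdiff \<phi> x h / norm h powr ?p\<bar>"
      by (intro always_eventually allI AE_I2) (auto simp: k_def indicator_def abs_mult divide_simps)
    show "AE h in lborel. ((\<lambda>\<epsilon>. 1/2 * (sdiff \<phi> x h * k (inverse \<epsilon>) h)) \<longlongrightarrow> 1/2 * (sdiff \<phi> x h / norm h powr ?p)) at_top"
      using AE_lborel_singleton[of "0::'a"]
    proof eventually_elim
      case (elim h)
      then have h: "norm h > 0" by simp
      have "\<forall>\<^sub>F \<epsilon> in at_top. \<epsilon> > 1 / norm h" by (rule eventually_gt_at_top)
      then have "\<forall>\<^sub>F \<epsilon> in at_top. 1/2 * (sdiff \<phi> x h / norm h powr ?p) = 1/2 * (sdiff \<phi> x h * k (inverse \<epsilon>) h)"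
      proof eventually_elim
        case (elim \<epsilon>)
        have "\<epsilon> > 0" using elim h by (meson divide_pos_pos less_trans zero_less_one)
        then have "inverse \<epsilon> < norm h" using elim h by (simp add: field_simps)
        then show ?case by (simp add: k_def)
      qed
      then show ?case by (rule Lim_transform_eventually[OF tendsto_const])
    qed
  qed (use integrable_abs[OF Di] in auto)
  moreover have "(\<integral>h. 1/2 * (sdiff \<phi> x h / norm h powr ?p) \<partial>lborel) = Dop \<phi> x / cns"
    unfolding Dop_def using cns_pos by (simp only: integral_mult_right_zero) simp
  ultimately have "((\<lambda>\<epsilon>. \<integral>h. 1/2 * (sdiff \<phi> x h * k \<epsilon> h) \<partial>lborel) \<longlongrightarrow> Dop \<phi> x / cns) (at_right 0)"
    by (simp add: filterlim_at_right_to_top)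
  then show ?thesis
  proof (rule Lim_transform_eventually)
    show "\<forall>\<^sub>F \<epsilon> in at_right 0. (\<integral>h. 1/2 * (sdiff \<phi> x h * k \<epsilon> h) \<partial>lborel) = (LINT y : {y. dist x y > \<epsilon>} | lborel. (\<phi> x - \<phi> y) / dist x y powr ?p)"
      unfolding eventually_at_right_field by (intro exI[of _ 1]) (auto simp: half)
  qed
qed

text \<open>Subordination for a signed integrand: \<open>nn_integral_subord_heat\<close> applied to
  the modulus turns integrability against the kernel into the Fubini condition.\<close>

lemma subord_kernel_integral:
  fixes F :: "'a \<Rightarrow> real"
  assumes [measurable]: "F \<in> borel_measurable borel" and int: "integrable lborel (\<lambda>h. F h / norm h powr (n + 2 * s))"
  shows "(\<integral>h. cns * (F h / norm h powr (n + 2 * s)) \<partial>lborel) = (\<integral>t. \<integral>h. F h * heat t h \<partial>lborel \<partial>subord s)"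
    "integrable (subord s) (\<lambda>t. \<integral>h. F h * heat t h \<partial>lborel)"
proof -
  let ?p = "n + 2 * s"
  have m: "(\<lambda>(h, t). F h * heat t h) \<in> borel_measurable (lborel \<Otimes>\<^sub>M subord s)" by measurable
  have nn: "(\<integral>\<^sup>+t. ennreal (heat t h) \<partial>subord s) = ennreal (cns / norm h powr ?p)" if "h \<noteq> 0" for h :: 'a
    using nn_integral_subord_heat[OF s that] by (simp add: n cns)
  have "(\<integral>\<^sup>+h. \<integral>\<^sup>+t. ennreal \<bar>F h * heat t h\<bar> \<partial>subord s \<partial>lborel) = (\<integral>\<^sup>+h. ennreal cns * ennreal (norm (F h / norm h powr ?p)) \<partial>lborel)"
    using AE_lborel_singleton[of "0::'a"]
  proof (intro nn_integral_cong_AE, eventually_elim)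
    fix h :: 'a assume h: "h \<noteq> 0"
    have "(\<integral>\<^sup>+t. ennreal \<bar>F h * heat t h\<bar> \<partial>subord s) = (\<integral>\<^sup>+t. ennreal \<bar>F h\<bar> * ennreal (heat t h) \<partial>subord s)"
      by (intro nn_integral_cong) (simp add: abs_mult ennreal_mult')
    also have "\<dots> = ennreal \<bar>F h\<bar> * ennreal (cns / norm h powr ?p)"
      by (subst nn_integral_cmult, measurable) (simp only: nn[OF h])
    finally show "(\<integral>\<^sup>+t. ennreal \<bar>F h * heat t h\<bar> \<partial>subord s) = ennreal cns * ennreal (norm (F h / norm h powr ?p))"
      using cns_pos by (simp add: ennreal_mult[symmetric] mult.commute)
  qed
  also have "\<dots> = ennreal cns * (\<integral>\<^sup>+h. ennreal (norm (F h / norm h powr ?p)) \<partial>lborel)"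
    by (rule nn_integral_cmult) measurable
  also have "\<dots> < \<infinity>" using int by (simp add: integrable_iff_bounded ennreal_mult_less_top)
  finally have fin: "(\<integral>\<^sup>+h. \<integral>\<^sup>+t. ennreal \<bar>F h * heat t h\<bar> \<partial>subord s \<partial>lborel) < \<infinity>" .
  note Fub = Fubini_swap[OF sigma_finite_lborel sigma_finite_subord m fin]
  show "integrable (subord s) (\<lambda>t. \<integral>h. F h * heat t h \<partial>lborel)" by (rule Fub(2))
  have "(\<integral>h. cns * (F h / norm h powr ?p) \<partial>lborel) = (\<integral>h. \<integral>t. F h * heat t h \<partial>subord s \<partial>lborel)"
  proof (rule integral_cong_AE)
    show "AE h in lborel. cns * (F h / norm h powr ?p) = (\<integral>t. F h * heat t h \<partial>subord s)"
      using AE_lborel_singleton[of "0::'a"]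
    proof eventually_elim
      case (elim h)
      have "(\<integral>t. heat t h \<partial>subord s) = cns / norm h powr ?p"
        using nn[OF elim] cns_pos by (subst integral_eq_nn_integral) auto
      then show ?case by simp
    qed
  qed (use borel_measurable_integrable[OF Fub(1)] in auto)
  also have "\<dots> = (\<integral>t. \<integral>h. F h * heat t h \<partial>lborel \<partial>subord s)" by (rule Fub(3))
  finally show "(\<integral>h. cns * (F h / norm h powr ?p) \<partial>lborel) = (\<integral>t. \<integral>h. F h * heat t h \<partial>lborel \<partial>subord s)" .
qed

end

text \<open>These are the properties delivered by \<open>smooth_step_exists\<close>,
  \<open>truncated_powr\<close> and \<open>second_difference_radial\<close> for q = (n-2s)/2, the
  exponent for which rho^(-q) is the fundamental solution up to a constant factor.\<close>

locale truncated = frac s n cns ty for s n cns :: real and ty :: "'a::euclidean_space itself" +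
  fixes \<theta> g :: "real \<Rightarrow> real" and Cg Kg :: real
  assumes \<theta>01: "\<And>x. 0 \<le> \<theta> x" "\<And>x. \<theta> x \<le> 1" and \<theta>1: "\<And>x. x \<ge> 1 \<Longrightarrow> \<theta> x = 1"
    and g_smooth: "smooth1 g"
    and g_tail: "\<And>\<rho>. \<rho> \<ge> 1 \<Longrightarrow> g \<rho> = \<rho> powr (- ((n - 2 * s) / 2))"
    and g_nonneg: "\<And>\<rho>. 0 \<le> g \<rho>" and g_le: "\<And>\<rho>. g \<rho> \<le> Cg"
    and g_concave: "\<And>\<rho> \<rho>0. \<rho> > 0 \<Longrightarrow> \<rho>0 > 0 \<Longrightarrow>
      g \<rho> \<le> g \<rho>0 + \<theta> \<rho>0 * (\<rho> powr (- ((n - 2 * s) / 2)) - \<rho>0 powr (- ((n - 2 * s) / 2)))"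
    and g_sdiff: "\<And>(x::'a) h. \<bar>2 * g ((norm x)\<^sup>2) - g ((norm (x + h))\<^sup>2) - g ((norm (x - h))\<^sup>2)\<bar> \<le> Kg * (norm h)\<^sup>2"
begin

definition v :: "'a \<Rightarrow> real" where "v x = norm x powr (- (n - 2 * s))"
definition w :: "'a \<Rightarrow> real" where "w x = g ((norm x)\<^sup>2)"
definition Bw :: real where "Bw = 4 * Cg + \<bar>Kg\<bar>"

lemma v_eq: "v x = (norm x)\<^sup>2 powr (- ((n - 2 * s) / 2))"
proof -
  have "- (n - 2 * s) / 2 = - ((n - 2 * s) / 2)" by (simp only: minus_divide_left)
  then show ?thesis unfolding v_def using norm_powr_eq_norm_squared_powr[of x "- (n - 2 * s)"] by (simp only:)
qed

lemma borel_measurable_v [measurable]: "v \<in> borel_measurable borel" unfolding v_def by measurable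

lemma borel_measurable_g [measurable]: "g \<in> borel_measurable borel"
  using smooth1_continuous[OF g_smooth] by (rule borel_measurable_continuous_onI)

lemma borel_measurable_w [measurable]: "w \<in> borel_measurable borel" unfolding w_def by measurable

lemma v_nonneg [simp]: "v x \<ge> 0" by (simp add: v_def)
lemma w_nonneg [simp]: "w x \<ge> 0" by (simp add: w_def g_nonneg)
lemma w_le: "w x \<le> Cg" by (simp add: w_def g_le)
lemma Cg_nonneg: "Cg \<ge> 0" using g_nonneg[of 0] g_le[of 0] by linarith

lemma w_eq_v: "norm x \<ge> 1 \<Longrightarrow> w x = v x"
  unfolding w_def v_eq by (rule g_tail) simp

lemma w_concave:
  assumes "x \<noteq> 0" "y \<noteq> 0"
  shows "w y \<le> w x + \<theta> ((norm x)\<^sup>2) * (v y - v x)"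
  unfolding w_def v_eq by (rule g_concave) (use assms in auto)

text \<open>At a unit vector \<open>w\<close> and \<open>v\<close> agree and the slope is 1, so the
  tangent line of \<open>w\<close> there is \<open>v\<close> itself; a concave function lies below
  its tangent.\<close>

lemma w_le_v: assumes "x \<noteq> 0" shows "w x \<le> v x"
proof -
  obtain b :: 'a where b: "b \<in> Basis" using nonempty_Basis by blast
  then have nb: "norm b = 1" by simp
  then have "b \<noteq> 0" by auto
  have "w b = v b" using w_eq_v[of b] nb by simp
  moreover have "\<theta> ((norm b)\<^sup>2) = 1" using nb by (intro \<theta>1) simp
  ultimately show ?thesis using w_concave[OF \<open>b \<noteq> 0\<close> assms] by simp
qed

lemma sdiff_w: "\<bar>sdiff w x h\<bar> \<le> Bw * min 1 ((norm h)\<^sup>2)"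
proof -
  have "\<bar>sdiff w x h\<bar> \<le> 4 * Cg"
    using w_nonneg[of x] w_nonneg[of "x+h"] w_nonneg[of "x-h"] w_le[of x] w_le[of "x+h"] w_le[of "x-h"] Cg_nonneg
    unfolding sdiff_def by linarith
  then have 1: "\<bar>sdiff w x h\<bar> \<le> Bw" by (simp add: Bw_def)
  have "\<bar>sdiff w x h\<bar> \<le> Kg * (norm h)\<^sup>2" unfolding sdiff_def w_def by (rule g_sdiff)
  also have "\<dots> \<le> Bw * (norm h)\<^sup>2" using Cg_nonneg by (intro mult_right_mono) (auto simp: Bw_def)
  finally show ?thesis using 1 by (simp add: min_def)
qed

lemma Bw_nonneg: "Bw \<ge> 0" using Cg_nonneg by (simp add: Bw_def)

lemma integrable_sdiff_w: "integrable lborel (\<lambda>h. sdiff w x h / norm h powr (n + 2 * s))"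
  by (rule integrable_kernel_bound[OF _ sdiff_w]) measurable

definition w_scaled :: "real \<Rightarrow> 'a \<Rightarrow> real" where
  "w_scaled R x = R powr (- (n - 2 * s)) * w ((1 / R) *\<^sub>R x)"

text \<open>The prefactor in \<open>w_scaled\<close> compensates the homogeneity of
  \<open>v\<close>, so all scales share one tail. Differences of two scales are therefore compactly
  supported.\<close>

lemma w_scaled_eq_v: "R > 0 \<Longrightarrow> norm x \<ge> R \<Longrightarrow> w_scaled R x = v x"
proof -
  assume R: "R > 0" and x: "norm x \<ge> R"
  have "norm ((1 / R) *\<^sub>R x) \<ge> 1" using R x by simp
  then have "w ((1 / R) *\<^sub>R x) = v ((1 / R) *\<^sub>R x)" by (rule w_eq_v)
  also have "\<dots> = R powr (n - 2 * s) * v x"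
  proof -
    have "norm ((1 / R) *\<^sub>R x) = (1 / R) * norm x" using R by simp
    then have "v ((1 / R) *\<^sub>R x) = (1 / R) powr (- (n - 2 * s)) * v x"
      unfolding v_def by (simp only: powr_mult)
    moreover have "(1 / R) powr (- (n - 2 * s)) = R powr (n - 2 * s)"
      using R by (simp only: powr_minus powr_divide) simp
    ultimately show ?thesis by simp
  qed
  finally show ?thesis unfolding w_scaled_def using R by (simp only: mult.assoc[symmetric] powr_add[symmetric]) simp
qed

lemma borel_measurable_w_scaled [measurable]: "w_scaled R \<in> borel_measurable borel"
  unfolding w_scaled_def by measurable

lemma sdiff_w_scaled: "sdiff (w_scaled R) x h = R powr (- (n - 2 * s)) * sdiff w ((1 / R) *\<^sub>R x) ((1 / R) *\<^sub>R h)"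
  unfolding sdiff_def w_scaled_def by (simp add: scaleR_add_right scaleR_diff_right algebra_simps)

lemma sdiff_w_scaled_le:
  assumes r: "r > 0"
  shows "\<bar>sdiff (w_scaled r) x h\<bar> \<le> r powr (- (n - 2 * s)) * (Bw * max 1 ((1 / r)\<^sup>2)) * min 1 ((norm h)\<^sup>2)"
proof -
    have "min 1 ((norm ((1 / r) *\<^sub>R h))\<^sup>2) \<le> max 1 ((1 / r)\<^sup>2) * min 1 ((norm h)\<^sup>2)"
    proof -
      have e: "(norm ((1 / r) *\<^sub>R h))\<^sup>2 = (1 / r)\<^sup>2 * (norm h)\<^sup>2" using r by (simp add: power_mult_distrib power_divide)
      show ?thesis
      proof (cases "(norm h)\<^sup>2 \<le> 1")
        case True
        have "(1 / r)\<^sup>2 * (norm h)\<^sup>2 \<le> max 1 ((1 / r)\<^sup>2) * (norm h)\<^sup>2" by (intro mult_right_mono) auto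
        then show ?thesis unfolding e using True by (simp add: min_def)
      next
        case False
        then have "min 1 ((norm h)\<^sup>2) = 1" by simp
        moreover have "min 1 ((norm ((1 / r) *\<^sub>R h))\<^sup>2) \<le> 1" "1 \<le> max 1 ((1 / r)\<^sup>2)" by (rule min.cobounded1, rule max.cobounded1)
        ultimately show ?thesis by (simp only: mult_1_right)
      qed
    qed
    then have "Bw * min 1 ((norm ((1 / r) *\<^sub>R h))\<^sup>2) \<le> Bw * (max 1 ((1 / r)\<^sup>2) * min 1 ((norm h)\<^sup>2))"
      by (intro mult_left_mono Bw_nonneg)
    then have "\<bar>sdiff w ((1 / r) *\<^sub>R x) ((1 / r) *\<^sub>R h)\<bar> \<le> Bw * (max 1 ((1 / r)\<^sup>2) * min 1 ((norm h)\<^sup>2))"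
      using sdiff_w[of "(1 / r) *\<^sub>R x" "(1 / r) *\<^sub>R h"] by linarith
    then have "r powr (- (n - 2 * s)) * \<bar>sdiff w ((1 / r) *\<^sub>R x) ((1 / r) *\<^sub>R h)\<bar> \<le> r powr (- (n - 2 * s)) * (Bw * (max 1 ((1 / r)\<^sup>2) * min 1 ((norm h)\<^sup>2)))"
      by (intro mult_left_mono) auto
    then show ?thesis
      unfolding sdiff_w_scaled abs_mult by (simp add: mult.assoc)
qed

text \<open>The degree is -(n-2s) - 2s = -n, so these densities are mass-preserving dilations of a
  single one.\<close>

lemma Dop_w_scaled:
  assumes R: "R > 0"
  shows "Dop (w_scaled R) x = R powr (- n) * Dop w ((1 / R) *\<^sub>R x)"
proof -
  let ?p = "n + 2 * s"
  have "Dop (w_scaled R) x = \<bar>R\<bar> ^ DIM('a) * (\<integral>h. cns / 2 * (sdiff (w_scaled R) x (R *\<^sub>R h) / norm (R *\<^sub>R h) powr ?p) \<partial>lborel)"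
    unfolding Dop_def by (rule integral_lborel_scale) (use R in auto)
  also have "\<dots> = R powr n * (\<integral>h. (R powr (- (n - 2 * s)) / R powr ?p) * (cns / 2 * (sdiff w ((1 / R) *\<^sub>R x) h / norm h powr ?p)) \<partial>lborel)"
  proof -
    have "\<bar>R\<bar> ^ DIM('a) = R powr n" using R by (simp add: n powr_realpow)
    moreover have "cns / 2 * (sdiff (w_scaled R) x (R *\<^sub>R h) / norm (R *\<^sub>R h) powr ?p)
       = (R powr (- (n - 2 * s)) / R powr ?p) * (cns / 2 * (sdiff w ((1 / R) *\<^sub>R x) h / norm h powr ?p))" for h :: 'a
      unfolding sdiff_w_scaled using R by (simp add: powr_mult mult_ac)
    ultimately show ?thesis by (simp only:)
  qed
  also have "\<dots> = (R powr n * (R powr (- (n - 2 * s)) / R powr ?p)) * Dop w ((1 / R) *\<^sub>R x)"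
    unfolding Dop_def by (simp only: integral_mult_right_zero mult.assoc)
  also have "R powr n * (R powr (- (n - 2 * s)) / R powr ?p) = R powr (- n)"
    using R by (simp add: powr_add[symmetric] powr_diff[symmetric])
  finally show ?thesis .
qed

lemma integrable_v_ball: "integrable lborel (\<lambda>y. indicator (cball 0 1) y * v y)"
proof (rule integrableI_bounded)
  show "(\<integral>\<^sup>+y. ennreal (norm (indicator (cball 0 1) y * v y)) \<partial>lborel) < \<infinity>"
  proof -
    have "n - 2 * s < real DIM('a)" using s n by simp
    from nn_integral_norm_powr_cball[OF this zero_less_one] show ?thesis by (simp add: v_def abs_mult)
  qed
qed measurable

text \<open>For |h| < |x|/2 all three points stay where \<open>v\<close> equals the smooth function
  \<open>w_scaled r\<close>, whose second difference is quadratic in h. For larger h the kernel is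
  bounded and the singularity of \<open>v\<close> is integrable.\<close>

lemma integrable_sdiff_v:
  assumes x: "x \<noteq> 0"
  shows "integrable lborel (\<lambda>h. sdiff v x h / norm h powr (n + 2 * s))"
proof -
  let ?p = "n + 2 * s"
  define r where "r = norm x / 2"
  have r: "r > 0" using x by (simp add: r_def)
  define V where "V y = indicator (cball 0 1) y * v y" for y
  have V0: "V y \<ge> 0" for y by (simp add: V_def)
  have Vi: "integrable lborel V" unfolding V_def by (rule integrable_v_ball)
  have vV: "v y \<le> V y + 1" for y
  proof (cases "norm y \<le> 1")
    case False
    then show ?thesis using powr_mono2'[of "- (n - 2 * s)" 1 "norm y"] dim by (simp add: V_def v_def)
  qed (simp add: V_def)
  define N where "N h = sdiff (w_scaled r) x h / norm h powr ?p" for h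
  have Ni: "integrable lborel N"
    unfolding N_def by (rule integrable_kernel_bound[OF _ sdiff_w_scaled_le[OF r]]) measurable
  define T where "T h = (2 * v x + 2) * (indicator (- ball 0 r) h / norm h powr ?p)" for h :: 'a
  have Ti: "integrable lborel T"
    unfolding T_def
  proof (rule integrable_mult_right, rule integrableI_bounded)
    have "(\<integral>\<^sup>+(h::'a). ennreal (norm (indicator (- ball 0 r) h / norm h powr ?p)) \<partial>lborel) = (\<integral>\<^sup>+(h::'a). ennreal (indicator (- ball 0 r) h * norm h powr (- ?p)) \<partial>lborel)"
      unfolding powr_minus_divide by (intro nn_integral_cong) simp
    also have "\<dots> < \<infinity>" by (rule nn_integral_norm_powr_outside) (use s n r in auto)
    finally show "(\<integral>\<^sup>+(h::'a). ennreal (norm (indicator (- ball 0 r) h / norm h powr ?p)) \<partial>lborel) < \<infinity>" .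
  qed measurable
  have Vp: "integrable lborel (\<lambda>h. V (x + h))" by (rule integrable_lborel_shift[OF Vi])
  have Vm: "integrable lborel (\<lambda>h. V (x - h))" using integrable_lborel_minus[OF Vp] by simp
  show ?thesis
  proof (rule Bochner_Integration.integrable_bound)
    show "integrable lborel (\<lambda>h. \<bar>N h\<bar> + T h + (1 / r powr ?p) * (V (x + h) + V (x - h)))"
      by (intro Bochner_Integration.integrable_add integrable_mult_right integrable_abs Ni Ti Vp Vm)
    have T0: "T h \<ge> 0" for h by (simp add: T_def)
    have "\<bar>sdiff v x h / norm h powr ?p\<bar> \<le> \<bar>N h\<bar> + T h + (1 / r powr ?p) * (V (x + h) + V (x - h))" for h
    proof (cases "norm h < r")
      case True
      have "norm x \<ge> r" "norm (x + h) \<ge> r" "norm (x - h) \<ge> r"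
        using True norm_triangle_ineq4[of "x + h" h] norm_triangle_ineq[of "x - h" h] r by (auto simp: r_def)
      then have "sdiff v x h = sdiff (w_scaled r) x h" unfolding sdiff_def by (simp add: w_scaled_eq_v[OF r])
      moreover have "(1 / r powr ?p) * (V (x + h) + V (x - h)) \<ge> 0" using V0 by (intro mult_nonneg_nonneg add_nonneg_nonneg) auto
      ultimately show ?thesis using T0[of h] by (simp add: N_def)
    next
      case False
      have "\<bar>sdiff v x h\<bar> \<le> (2 * v x + 2) + (V (x + h) + V (x - h))"
        using vV[of "x + h"] vV[of "x - h"] v_nonneg[of x] v_nonneg[of "x + h"] v_nonneg[of "x - h"] V0[of "x + h"] V0[of "x - h"]
        unfolding sdiff_def by linarith
      then have "\<bar>sdiff v x h / norm h powr ?p\<bar> \<le> ((2 * v x + 2) + (V (x + h) + V (x - h))) / norm h powr ?p"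
        by (simp add: divide_right_mono)
      also have "\<dots> = T h + (1 / norm h powr ?p) * (V (x + h) + V (x - h))" using False by (simp add: T_def add_divide_distrib)
      also have "\<dots> \<le> T h + (1 / r powr ?p) * (V (x + h) + V (x - h))"
      proof -
        have "r powr ?p \<le> norm h powr ?p" using False r s n_pos by (intro powr_mono2) auto
        then have "1 / norm h powr ?p \<le> 1 / r powr ?p" using r by (intro frac_le) auto
        then show ?thesis using V0 by (intro add_left_mono mult_right_mono) auto
      qed
      finally show ?thesis by simp
    qed
    then show "AE h in lborel. norm (sdiff v x h / norm h powr ?p) \<le> norm (\<bar>N h\<bar> + T h + (1 / r powr ?p) * (V (x + h) + V (x - h)))"
      unfolding real_norm_def using abs_ge_self order_trans by (intro AE_I2) blast
  qed measurable
qed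

lemma integrable_v_heat: "t > 0 \<Longrightarrow> integrable lborel (\<lambda>y. v y * heat t (x - y))"
  unfolding v_def using nn_integral_powr_heat_finite[of "n - 2 * s" t x] dim s n_pos
  by (intro integrableI_bounded) (auto simp: n)

text \<open>For beta = n - 2s the mixing exponent (n - beta)/2 equals s, and
  \<open>marchaud s s\<close> = 0. Thus \<open>v\<close> is s-harmonic off the origin, with no use
  of distributions or Fourier transforms.\<close>

lemma Dop_v:
  assumes x: "x \<noteq> 0" shows "Dop v x = 0"
proof -
  let ?p = "n + 2 * s"
  have \<beta>: "0 < n - 2 * s" "n - 2 * s < real DIM('a)" using dim s n by auto
  have inner: "(\<integral>h. sdiff v x h * heat t h \<partial>lborel) = 2 * (v x - heat_powr (n - 2 * s) t x)" if t: "t > 0" for t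
  proof -
    define G where "G y = v y * heat t (x - y)" for y
    have Gi: "integrable lborel G" unfolding G_def by (rule integrable_v_heat[OF t])
    have [measurable]: "G \<in> borel_measurable borel" unfolding G_def by measurable
    have G1: "integrable lborel (\<lambda>h. G (x + h))" by (rule integrable_lborel_shift[OF Gi])
    have G2: "integrable lborel (\<lambda>h. G (x - h))" using integrable_lborel_minus[OF G1] by simp
    have e1: "(\<integral>h. G (x + h) \<partial>lborel) = (\<integral>h. G h \<partial>lborel)" by (rule integral_lborel_shift) measurable
    have e2: "(\<integral>h. G (x - h) \<partial>lborel) = (\<integral>h. G h \<partial>lborel)"
      using integral_lborel_minus[of "\<lambda>h. G (x + h)"] e1 by simp
    have "(\<integral>h. sdiff v x h * heat t h \<partial>lborel) = (\<integral>h. 2 * v x * heat t h - G (x + h) - G (x - h) \<partial>lborel)"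
      by (intro Bochner_Integration.integral_cong refl) (simp add: sdiff_def G_def algebra_simps)
    also have "\<dots> = 2 * v x * 1 - (\<integral>h. G h \<partial>lborel) - (\<integral>h. G h \<partial>lborel)"
      using G1 G2 e1 e2 integrable_heat[OF t, where 'a='a] integral_heat[OF t, where 'a='a] by simp
    finally show ?thesis by (simp add: G_def heat_powr_def v_def)
  qed
  have "2 * Dop v x = (\<integral>h. cns * (sdiff v x h / norm h powr ?p) \<partial>lborel)"
    unfolding Dop_def integral_mult_right_zero by simp
  also have "\<dots> = (\<integral>t. \<integral>h. sdiff v x h * heat t h \<partial>lborel \<partial>subord s)"
    by (rule subord_kernel_integral(1)[OF _ integrable_sdiff_v[OF x]]) measurable
  also have "\<dots> = (\<integral>t. 2 * (v x - heat_powr (n - 2 * s) t x) \<partial>subord s)"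
  proof (rule integral_cong_AE)
    show "AE t in subord s. (\<integral>h. sdiff v x h * heat t h \<partial>lborel) = 2 * (v x - heat_powr (n - 2 * s) t x)"
      using AE_subord_pos[of s] by eventually_elim (rule inner)
    show "(\<lambda>t. \<integral>h. sdiff v x h * heat t h \<partial>lborel) \<in> borel_measurable (subord s)"
      using subord_kernel_integral(2)[OF _ integrable_sdiff_v[OF x]] by auto
  qed measurable
  also have "\<dots> = 2 * (\<integral>t. norm x powr (- (n - 2 * s)) - heat_powr (n - 2 * s) t x \<partial>subord s)"
    unfolding v_def by (rule integral_mult_right_zero)
  also have "(\<integral>t. norm x powr (- (n - 2 * s)) - heat_powr (n - 2 * s) t x \<partial>subord s) = 0"
  proof -
    obtain C where C: "\<And>x::'a. x \<noteq> 0 \<Longrightarrow> integrable (subord s) (\<lambda>t. norm x powr (- (n - 2 * s)) - heat_powr (n - 2 * s) t x)"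
      "\<And>x::'a. x \<noteq> 0 \<Longrightarrow> (\<integral>t. norm x powr (- (n - 2 * s)) - heat_powr (n - 2 * s) t x \<partial>subord s) =
         marchaud s ((real DIM('a) - (n - 2 * s)) / 2) * (riesz_const DIM('a) (n - 2 * s + 2 * s) / riesz_const DIM('a) (n - 2 * s)) * norm x powr (- (n - 2 * s + 2 * s))"
      "\<And>x::'a. x \<noteq> 0 \<Longrightarrow> (\<integral>\<^sup>+t. ennreal \<bar>norm x powr (- (n - 2 * s)) - heat_powr (n - 2 * s) t x\<bar> \<partial>subord s) \<le> ennreal (C * norm x powr (- (n - 2 * s + 2 * s)))"
      "C \<ge> 0"
      using subord_powr[OF s \<beta>] by blast
    note C(2)[OF x]
    moreover have "(real DIM('a) - (n - 2 * s)) / 2 = s" unfolding n[symmetric] by simp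
    moreover have "marchaud s s = 0" by (simp add: marchaud_def)
    ultimately show ?thesis by (simp only: mult_zero_left)
  qed
  finally show ?thesis by simp
qed

definition m :: "'a \<Rightarrow> real" where "m x = Dop w x"

lemma borel_measurable_m [measurable]: "m \<in> borel_measurable borel"
proof -
  have "(\<lambda>x. \<integral>h. cns / 2 * (sdiff w x h / norm h powr (n + 2 * s)) \<partial>lborel) \<in> borel_measurable borel"
    by (rule lborel.borel_measurable_lebesgue_integral) measurable
  then show ?thesis by (simp add: m_def[abs_def] Dop_def[abs_def])
qed

lemma AE_shift_nonzero: "AE h in lborel. x + h \<noteq> (0::'a) \<and> x - h \<noteq> 0"
  using AE_lborel_singleton[of "- x"] AE_lborel_singleton[of x]
  by eventually_elim (auto simp: add_eq_0_iff)

text \<open>The tangent line inequality at x, applied at x + h and x - h, gives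
  \<open>sdiff w\<close> >= theta times \<open>sdiff v\<close>; after integration the right side is
  a multiple of \<open>Dop v x\<close>, which vanishes.\<close>

lemma m_nonneg: assumes x: "x \<noteq> 0" shows "m x \<ge> 0"
proof -
  let ?p = "n + 2 * s" and ?\<theta> = "\<theta> ((norm x)\<^sup>2)"
  have "?\<theta> * Dop v x \<le> Dop w x"
  proof -
    have "?\<theta> * Dop v x = (\<integral>h. ?\<theta> * (cns / 2 * (sdiff v x h / norm h powr ?p)) \<partial>lborel)"
      unfolding Dop_def by (rule integral_mult_right_zero[symmetric])
    also have "\<dots> \<le> Dop w x"
      unfolding Dop_def
    proof (rule integral_mono_AE)
      show "integrable lborel (\<lambda>h. ?\<theta> * (cns / 2 * (sdiff v x h / norm h powr ?p)))"
        by (intro integrable_mult_right integrable_sdiff_v x)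
      show "integrable lborel (\<lambda>h. cns / 2 * (sdiff w x h / norm h powr ?p))"
        by (intro integrable_mult_right integrable_sdiff_w)
      \<comment> \<open>The two displacements that hit the origin are excluded, because
        \<open>v\<close> takes the convention value 0 there and the tangent inequality could
        fail.\<close>
      show "AE h in lborel. ?\<theta> * (cns / 2 * (sdiff v x h / norm h powr ?p)) \<le> cns / 2 * (sdiff w x h / norm h powr ?p)"
        using AE_shift_nonzero[of x]
      proof eventually_elim
        case (elim h)
        have "?\<theta> * sdiff v x h \<le> sdiff w x h"
          using w_concave[OF x, of "x + h"] w_concave[OF x, of "x - h"] elim
          unfolding sdiff_def by (simp add: algebra_simps)
        then have "cns / 2 * (?\<theta> * sdiff v x h / norm h powr ?p) \<le> cns / 2 * (sdiff w x h / norm h powr ?p)"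
          using cns_pos by (intro mult_left_mono divide_right_mono) auto
        then show ?case by (simp add: mult.left_commute)
      qed
    qed
    finally show ?thesis .
  qed
  then show ?thesis using Dop_v[OF x] by (simp add: m_def)
qed

lemma m_bounded: obtains C where "C \<ge> 0" "\<And>x. \<bar>m x\<bar> \<le> C"
proof -
  let ?p = "n + 2 * s"
  define k where "k h = Bw * (min 1 (1 * (norm h)\<^sup>2) / norm h powr ?p)" for h :: 'a
  have ki: "integrable lborel k" unfolding k_def by (intro integrable_mult_right integrable_min_kernel) simp
  have "\<bar>m x\<bar> \<le> (\<integral>h. cns / 2 * k h \<partial>lborel)" for x
    unfolding m_def Dop_def
  proof (rule integral_abs_bound[THEN order_trans], rule integral_mono)
    show "integrable lborel (\<lambda>h. \<bar>cns / 2 * (sdiff w x h / norm h powr ?p)\<bar>)"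
      by (intro integrable_abs integrable_mult_right integrable_sdiff_w)
    show "integrable lborel (\<lambda>h. cns / 2 * k h)" by (intro integrable_mult_right ki)
    fix h :: 'a
    have "\<bar>sdiff w x h\<bar> / norm h powr ?p \<le> Bw * min 1 ((norm h)\<^sup>2) / norm h powr ?p"
      by (intro divide_right_mono sdiff_w) simp
    then have "cns / 2 * (\<bar>sdiff w x h\<bar> / norm h powr ?p) \<le> cns / 2 * (Bw * min 1 ((norm h)\<^sup>2) / norm h powr ?p)"
      using cns_pos by (intro mult_left_mono) auto
    then show "\<bar>cns / 2 * (sdiff w x h / norm h powr ?p)\<bar> \<le> cns / 2 * k h"
      using cns_pos by (simp add: k_def abs_mult)
  qed
  then show ?thesis by (meson abs_ge_zero order_trans that)
qed

text \<open>Far out \<open>w\<close> coincides with the s-harmonic \<open>v\<close>, so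
  \<open>m\<close> only sees the deficit v - w in the unit ball, at distance at least |x|/2. The
  deficit has finite integral and the kernel supplies the power.\<close>

lemma m_decay: obtains C where "C \<ge> 0" "\<And>x. norm x \<ge> 2 \<Longrightarrow> m x \<le> C * norm x powr (- (n + 2 * s))"
proof -
  let ?p = "n + 2 * s"
  define V where "V y = indicator (cball 0 1) y * v y" for y
  have V0: "V y \<ge> 0" for y by (simp add: V_def)
  have Vi: "integrable lborel V" unfolding V_def by (rule integrable_v_ball)
  define C where "C = cns / 2 * (2 powr ?p * (2 * (\<integral>y. V y \<partial>lborel)))"
  show ?thesis
  proof (rule that[of C])
    show "C \<ge> 0" unfolding C_def using cns_pos by (intro mult_nonneg_nonneg integral_nonneg_AE) (auto simp: V0)
    fix x :: 'a assume x2: "norm x \<ge> 2"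
    then have x: "x \<noteq> 0" by auto
    define r where "r = norm x / 2"
    have r: "r \<ge> 1" using x2 by (simp add: r_def)
    have Vp: "integrable lborel (\<lambda>h. V (x + h))" by (rule integrable_lborel_shift[OF Vi])
    have Vm: "integrable lborel (\<lambda>h. V (x - h))" using integrable_lborel_minus[OF Vp] by simp
    have Ip: "(\<integral>h. V (x + h) \<partial>lborel) = (\<integral>y. V y \<partial>lborel)" by (rule integral_lborel_shift) (use Vi in auto)
    have Im: "(\<integral>h. V (x - h) \<partial>lborel) = (\<integral>y. V y \<partial>lborel)"
      using integral_lborel_minus[of "\<lambda>h. V (x + h)"] Ip Vp by auto
    \<comment> \<open>Subtracting zero: \<open>Dop v x\<close> cancels the local contributions and
      leaves only points x + h and x - h in the unit ball.\<close>
    have "m x = Dop w x - Dop v x" using Dop_v[OF x] by (simp add: m_def)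
    also have "\<dots> = (\<integral>h. cns / 2 * (sdiff w x h / norm h powr ?p) - cns / 2 * (sdiff v x h / norm h powr ?p) \<partial>lborel)"
      unfolding Dop_def by (intro Bochner_Integration.integral_diff[symmetric] integrable_mult_right integrable_sdiff_w integrable_sdiff_v x)
    also have "\<dots> \<le> (\<integral>h. cns / 2 * ((1 / r powr ?p) * (V (x + h) + V (x - h))) \<partial>lborel)"
    proof (rule integral_mono_AE)
      show "integrable lborel (\<lambda>h. cns / 2 * (sdiff w x h / norm h powr ?p) - cns / 2 * (sdiff v x h / norm h powr ?p))"
        by (intro Bochner_Integration.integrable_diff integrable_mult_right integrable_sdiff_w integrable_sdiff_v x)
      show "integrable lborel (\<lambda>h. cns / 2 * ((1 / r powr ?p) * (V (x + h) + V (x - h))))"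
        by (intro integrable_mult_right Bochner_Integration.integrable_add Vp Vm)
      show "AE h in lborel. cns / 2 * (sdiff w x h / norm h powr ?p) - cns / 2 * (sdiff v x h / norm h powr ?p) \<le> cns / 2 * ((1 / r powr ?p) * (V (x + h) + V (x - h)))"
        using AE_shift_nonzero[of x]
      proof eventually_elim
        case (elim h)
        have wx: "w x = v x" using x2 by (intro w_eq_v) simp
        have GV: "v y - w y \<le> V y" if "y \<noteq> 0" for y
          using w_eq_v[of y] w_nonneg[of y] by (cases "norm y \<ge> 1") (auto simp: V_def)
        have Gz: "v y - w y = 0" if "norm y \<ge> 1" for y using w_eq_v[OF that] by simp
        have "(sdiff w x h - sdiff v x h) / norm h powr ?p \<le> (1 / r powr ?p) * (V (x + h) + V (x - h))"
        proof (cases "norm h < r")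
          case True
          have "norm (x + h) \<ge> 1" "norm (x - h) \<ge> 1"
            using True norm_triangle_ineq4[of "x + h" h] norm_triangle_ineq[of "x - h" h] r by (auto simp: r_def)
          then have "sdiff w x h - sdiff v x h = 0" using Gz wx unfolding sdiff_def by (simp add: w_eq_v)
          then show ?thesis using V0 by (simp add: add_nonneg_nonneg)
        next
          case False
          have "r powr ?p \<le> norm h powr ?p" using False r s n_pos by (intro powr_mono2) auto
          moreover have "r powr ?p > 0" using r by simp
          ultimately have k: "1 / norm h powr ?p \<le> 1 / r powr ?p" by (intro frac_le) auto
          have "sdiff w x h - sdiff v x h \<le> V (x + h) + V (x - h)"
            using GV[of "x + h"] GV[of "x - h"] elim wx unfolding sdiff_def by simp
          then have "(sdiff w x h - sdiff v x h) / norm h powr ?p \<le> (V (x + h) + V (x - h)) / norm h powr ?p"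
            by (intro divide_right_mono) auto
          also have "\<dots> = (1 / norm h powr ?p) * (V (x + h) + V (x - h))" by simp
          also have "\<dots> \<le> (1 / r powr ?p) * (V (x + h) + V (x - h))"
            using V0 by (intro mult_right_mono k) (auto intro: add_nonneg_nonneg)
          finally show ?thesis .
        qed
        then have "cns / 2 * ((sdiff w x h - sdiff v x h) / norm h powr ?p) \<le> cns / 2 * ((1 / r powr ?p) * (V (x + h) + V (x - h)))"
          using cns_pos by (intro mult_left_mono) auto
        then show ?case by (simp add: right_diff_distrib diff_divide_distrib)
      qed
    qed
    also have "\<dots> = cns / 2 * ((1 / r powr ?p) * (2 * (\<integral>y. V y \<partial>lborel)))"
      using Vp Vm Ip Im by (simp only: integral_mult_right_zero Bochner_Integration.integral_add) simp
    also have "1 / r powr ?p = 2 powr ?p * norm x powr (- ?p)"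
      using x2 unfolding powr_minus_divide[of "norm x" "n + 2 * s"] by (simp add: r_def powr_divide)
    finally show "m x \<le> C * norm x powr (- ?p)" by (simp add: C_def mult_ac)
  qed
qed

end

section \<open>The mass of the truncated fundamental solution\<close>

text \<open>The bound is the value of the difference at the origin: away from it the Gaussian factor
  at time R is smaller than the one at time R + t.\<close>

lemma heat_difference_le:
  fixes x :: "'a::euclidean_space"
  assumes R: "R > 0" and t: "t > 0"
  shows "heat R x - heat (R + t) x \<le> (4 * pi * R) powr (- (real DIM('a) / 2)) * (1 - (1 + t / R) powr (- (real DIM('a) / 2)))"
proof -
  let ?e = "- (real DIM('a) / 2)"
  have "4 * pi * (R + t) = (4 * pi * R) * (1 + t / R)" using R by (simp add: field_simps)
  then have p: "(4 * pi * (R + t)) powr ?e = (4 * pi * R) powr ?e * (1 + t / R) powr ?e" by (simp only: powr_mult)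
  have q: "(1 + t / R) powr ?e \<le> 1" using powr_mono2'[of ?e 1 "1 + t / R"] R t by simp
  have "exp (- ((norm x)\<^sup>2 / (4 * R))) \<le> exp (- ((norm x)\<^sup>2 / (4 * (R + t))))"
    using R t by (simp add: frac_le)
  then have "(4 * pi * (R + t)) powr ?e * exp (- ((norm x)\<^sup>2 / (4 * R))) \<le> heat (R + t) x"
    unfolding heat_def by (intro mult_left_mono) auto
  then have "heat R x - heat (R + t) x \<le> (4 * pi * R) powr ?e * (1 - (1 + t / R) powr ?e) * exp (- ((norm x)\<^sup>2 / (4 * R)))"
    unfolding p heat_def[of R x] by (simp add: algebra_simps)
  also have "\<dots> \<le> (4 * pi * R) powr ?e * (1 - (1 + t / R) powr ?e) * 1"
    using q R by (intro mult_left_mono) auto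
  finally show ?thesis by simp
qed

lemma integral_subord_one_minus_powr:
  assumes s: "0 < s" "s < 1" and R: "R > 0" and b: "b > 0"
  shows "has_bochner_integral (subord s) (\<lambda>t. 1 - (1 + t / R) powr (- b)) (R powr (- s) * Gamma (b + s) / Gamma b)"
proof (rule has_bochner_integral_nn_integral)
  show "AE t in subord s. 0 \<le> 1 - (1 + t / R) powr (- b)"
    using AE_subord_pos[of s]
  proof eventually_elim
    case (elim t)
    then show ?case using powr_mono2'[of "-b" 1 "1 + t / R"] R b by simp
  qed
  show "0 \<le> R powr (- s) * Gamma (b + s) / Gamma b" using b s by (simp add: Gamma_real_nonneg)
qed (use nn_integral_subord_one_minus_powr[OF assms] in auto)

text \<open>The heat average of the fundamental solution at the origin, in closed form: in the
  variable rho the powers combine to rho^(s-1), a Gamma integral.\<close>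

lemma has_bochner_integral_powr_heat:
  assumes s: "0 < s" and \<beta>: "real DIM('a::euclidean_space) - 2 * s > 0" and R: "R > 0"
  shows "has_bochner_integral lborel (\<lambda>x::'a. norm x powr (- (real DIM('a) - 2 * s)) * heat R x)
    ((4 * pi) powr (- (real DIM('a) / 2)) * radial_const DIM('a) * (Gamma s * 4 powr s) * R powr (- ((real DIM('a) - 2 * s) / 2)))"
    (is "has_bochner_integral _ _ ?v")
proof (rule has_bochner_integral_nn_integral)
  let ?n = "real DIM('a)"
  have G: "Gamma s \<ge> 0" using s by (simp add: Gamma_real_nonneg)
  show "0 \<le> ?v" using G by (intro mult_nonneg_nonneg) auto
  have "(\<integral>\<^sup>+(x::'a). ennreal (norm x powr (- (?n - 2 * s)) * heat R x) \<partial>lborel) =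
    (\<integral>\<^sup>+(x::'a). (\<lambda>\<rho>. ennreal ((4 * pi * R) powr (- (?n / 2)) * (\<rho> powr (- ((?n - 2 * s) / 2)) * exp (- (1 / (4 * R) * \<rho>))))) ((norm x)\<^sup>2) \<partial>lborel)"
  proof (intro nn_integral_cong)
    fix x :: 'a
    have "norm x powr (- (?n - 2 * s)) = (norm x)\<^sup>2 powr (- ((?n - 2 * s) / 2))"
      using norm_powr_eq_norm_squared_powr[of x "- (?n - 2 * s)"] by (simp only: minus_divide_left)
    then show "ennreal (norm x powr (- (?n - 2 * s)) * heat R x) = (\<lambda>\<rho>. ennreal ((4 * pi * R) powr (- (?n / 2)) * (\<rho> powr (- ((?n - 2 * s) / 2)) * exp (- (1 / (4 * R) * \<rho>))))) ((norm x)\<^sup>2)"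
      by (simp add: heat_def mult_ac)
  qed
  also have "\<dots> = ennreal (radial_const ?n) * (\<integral>\<^sup>+\<rho>. ennreal (indicator {0<..} \<rho> * \<rho> powr (?n / 2 - 1)) * ennreal ((4 * pi * R) powr (- (?n / 2)) * (\<rho> powr (- ((?n - 2 * s) / 2)) * exp (- (1 / (4 * R) * \<rho>)))) \<partial>lborel)"
    by (rule nn_integral_radial) measurable
  also have "(\<integral>\<^sup>+\<rho>. ennreal (indicator {0<..} \<rho> * \<rho> powr (?n / 2 - 1)) * ennreal ((4 * pi * R) powr (- (?n / 2)) * (\<rho> powr (- ((?n - 2 * s) / 2)) * exp (- (1 / (4 * R) * \<rho>)))) \<partial>lborel)
    = (\<integral>\<^sup>+\<rho>. ennreal ((4 * pi * R) powr (- (?n / 2))) * ennreal (indicator {0<..} \<rho> * \<rho> powr (s - 1) * exp (- (1 / (4 * R) * \<rho>))) \<partial>lborel)"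
  proof (intro nn_integral_cong)
    fix \<rho> :: real
    have e: "\<rho> powr (?n / 2 - 1) * \<rho> powr (- ((?n - 2 * s) / 2)) = \<rho> powr (s - 1)"
      unfolding powr_add[symmetric] by (rule arg_cong[where f="\<lambda>z. \<rho> powr z"]) (simp add: field_simps)
    have "indicator {0<..} \<rho> * \<rho> powr (?n / 2 - 1) * ((4 * pi * R) powr (- (?n / 2)) * (\<rho> powr (- ((?n - 2 * s) / 2)) * exp (- (1 / (4 * R) * \<rho>))))
       = (4 * pi * R) powr (- (?n / 2)) * (indicator {0<..} \<rho> * (\<rho> powr (?n / 2 - 1) * \<rho> powr (- ((?n - 2 * s) / 2))) * exp (- (1 / (4 * R) * \<rho>)))"
      by (simp only: mult_ac)
    also have "\<dots> = (4 * pi * R) powr (- (?n / 2)) * (indicator {0<..} \<rho> * \<rho> powr (s - 1) * exp (- (1 / (4 * R) * \<rho>)))"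
      by (simp only: e)
    finally have "indicator {0<..} \<rho> * \<rho> powr (?n / 2 - 1) * ((4 * pi * R) powr (- (?n / 2)) * (\<rho> powr (- ((?n - 2 * s) / 2)) * exp (- (1 / (4 * R) * \<rho>))))
       = (4 * pi * R) powr (- (?n / 2)) * (indicator {0<..} \<rho> * \<rho> powr (s - 1) * exp (- (1 / (4 * R) * \<rho>)))" .
    then show "ennreal (indicator {0<..} \<rho> * \<rho> powr (?n / 2 - 1)) * ennreal ((4 * pi * R) powr (- (?n / 2)) * (\<rho> powr (- ((?n - 2 * s) / 2)) * exp (- (1 / (4 * R) * \<rho>))))
       = ennreal ((4 * pi * R) powr (- (?n / 2))) * ennreal (indicator {0<..} \<rho> * \<rho> powr (s - 1) * exp (- (1 / (4 * R) * \<rho>)))"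
      by (subst (1 2) ennreal_mult'[symmetric]) auto
  qed
  also have "\<dots> = ennreal ((4 * pi * R) powr (- (?n / 2))) * ennreal (Gamma s * (1 / (4 * R)) powr (- s))"
    by (subst nn_integral_cmult, measurable, subst nn_integral_Gamma_scaled[OF s]) (use R in auto)
  also have "ennreal (radial_const ?n) * \<dots> = ennreal (radial_const ?n * ((4 * pi * R) powr (- (?n / 2)) * (Gamma s * (1 / (4 * R)) powr (- s))))"
    using G by (simp add: ennreal_mult[symmetric])
  also have "radial_const ?n * ((4 * pi * R) powr (- (?n / 2)) * (Gamma s * (1 / (4 * R)) powr (- s))) = ?v"
  proof -
    have a: "(1 / (4 * R)) powr (- s) = 4 powr s * R powr s"
      using R by (simp add: powr_minus powr_divide powr_mult)
    have b: "(4 * pi * R) powr (- (?n / 2)) = (4 * pi) powr (- (?n / 2)) * R powr (- (?n / 2))"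
      by (rule powr_mult)
    have c: "R powr (- (?n / 2)) * R powr s = R powr (- ((?n - 2 * s) / 2))"
      unfolding powr_add[symmetric] by (rule arg_cong[where f="\<lambda>z. R powr z"]) (simp add: field_simps)
    show ?thesis unfolding a b c[symmetric] by (simp only: mult_ac)
  qed
  finally show "(\<integral>\<^sup>+(x::'a). ennreal (norm x powr (- (?n - 2 * s)) * heat R x) \<partial>lborel) = ennreal ?v" .
qed auto

section \<open>Decay and total mass of the fractional Laplacian of the truncation\<close>

context truncated
begin

text \<open>The weight in the definition of \<open>L_s\<close>; it has the same decay as
  \<open>m\<close>, so membership in \<open>L_s\<close> is exactly what makes u integrable against
  \<open>m\<close>.\<close>

definition wt :: "'a \<Rightarrow> real" where "wt x = 1 / (1 + norm x powr (n + 2 * s))"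

lemma wt_pos: "wt x > 0" by (simp add: wt_def add_pos_nonneg)

lemma borel_measurable_wt [measurable]: "wt \<in> borel_measurable borel" unfolding wt_def by measurable

lemma wt_le_1: "wt x \<le> 1" unfolding wt_def by (subst divide_le_eq_1_pos) (auto intro: add_pos_nonneg)

lemma wt_le_powr: "x \<noteq> 0 \<Longrightarrow> wt x \<le> norm x powr (- (n + 2 * s))"
  unfolding powr_minus_divide wt_def by (intro frac_le) auto

lemma m_le_wt: obtains C where "C \<ge> 0" "\<And>x. m x \<le> C * wt x"
proof -
  let ?p = "n + 2 * s"
  obtain C1 where C1: "C1 \<ge> 0" "\<And>x. \<bar>m x\<bar> \<le> C1" using m_bounded by blast
  obtain C2 where C2: "C2 \<ge> 0" "\<And>x. norm x \<ge> 2 \<Longrightarrow> m x \<le> C2 * norm x powr (- ?p)" using m_decay by blast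
  show ?thesis
  proof (rule that[of "C1 * (1 + 2 powr ?p) + C2 * 2"])
    show "C1 * (1 + 2 powr ?p) + C2 * 2 \<ge> 0" using C1 C2 by (intro add_nonneg_nonneg mult_nonneg_nonneg) auto
    fix x
    show "m x \<le> (C1 * (1 + 2 powr ?p) + C2 * 2) * wt x"
    proof (cases "norm x \<ge> 2")
      case True
      have "norm x powr ?p \<ge> 1" using True s n_pos by (intro ge_one_powr_ge_zero) auto
      moreover have "1 / y \<le> 2 * (1 / (1 + y))" if "y \<ge> 1" for y :: real using that by (simp add: divide_simps)
      ultimately have "norm x powr (- ?p) \<le> 2 * wt x" unfolding powr_minus_divide wt_def by blast
      then have "C2 * norm x powr (- ?p) \<le> C2 * (2 * wt x)" by (intro mult_left_mono C2)
      moreover have "0 \<le> C1 * (1 + 2 powr ?p) * wt x" using C1 wt_pos[of x] by (intro mult_nonneg_nonneg) auto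
      ultimately show ?thesis using C2(2)[OF True] by (simp add: distrib_right)
    next
      case False
      have "norm x powr ?p \<le> 2 powr ?p" using False s n_pos by (intro powr_mono2) auto
      then have "1 \<le> (1 + 2 powr ?p) * wt x" unfolding wt_def by (simp add: add_pos_nonneg)
      then have "C1 * 1 \<le> C1 * ((1 + 2 powr ?p) * wt x)" by (intro mult_left_mono C1)
      moreover have "0 \<le> C2 * 2 * wt x" using C2 wt_pos[of x] by (intro mult_nonneg_nonneg) auto
      moreover have "m x \<le> C1" using C1(2)[of x] by linarith
      ultimately show ?thesis by (simp add: distrib_right mult.assoc)
    qed
  qed
qed

text \<open>The admissible growth is chosen with room for logarithms: |x|^(-1/2) is integrable at 0
  in every dimension, and |x|^s against decay n + 2s leaves the integrable order n + s at
  infinity.\<close>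

lemma integrable_weighted:
  assumes [measurable]: "F \<in> borel_measurable borel"
    and F1: "\<And>x. x \<noteq> 0 \<Longrightarrow> norm x \<le> 1 \<Longrightarrow> \<bar>F x\<bar> \<le> A * norm x powr (- (1/2))"
    and F2: "\<And>x. norm x \<ge> 1 \<Longrightarrow> \<bar>F x\<bar> \<le> A * norm x powr s" and A: "A \<ge> 0"
  shows "integrable lborel (\<lambda>x::'a. F x * wt x)"
proof (rule Bochner_Integration.integrable_bound)
  have I1: "integrable lborel (\<lambda>x::'a. indicator (cball 0 1) x * norm x powr (- (1/2)))"
    using nn_integral_norm_powr_cball[where 'a='a, of "1/2" 1] DIM_ge_Suc0[where 'a='a]
    by (intro integrableI_bounded) (auto simp: abs_mult)
  have I2: "integrable lborel (\<lambda>x::'a. indicator (- ball 0 1) x * norm x powr (- (n + s)))"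
  proof (rule integrableI_bounded)
    have "real DIM('a) < n + s" using s n by simp
    from nn_integral_norm_powr_outside[OF this zero_less_one]
    show "(\<integral>\<^sup>+(x::'a). ennreal (norm (indicator (- ball 0 1) x * norm x powr (- (n + s)))) \<partial>lborel) < \<infinity>"
      by (simp add: abs_mult)
  qed auto
  show "integrable lborel (\<lambda>x::'a. A * (indicator (cball 0 1) x * norm x powr (- (1/2))) + A * (indicator (- ball 0 1) x * norm x powr (- (n + s))))"
    by (intro Bochner_Integration.integrable_add integrable_mult_right I1 I2)
  show "AE x in lborel. norm (F x * wt x) \<le> norm (A * (indicator (cball 0 1) x * norm x powr (- (1/2))) + A * (indicator (- ball 0 1) (x::'a) * norm x powr (- (n + s))))"
    using AE_lborel_singleton[of "0::'a"]
  proof eventually_elim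
    case (elim x)
    have "\<bar>F x\<bar> * wt x \<le> A * (indicator (cball 0 1) x * norm x powr (- (1/2))) + A * (indicator (- ball 0 1) x * norm x powr (- (n + s)))"
    proof (cases "norm x \<le> 1")
      case True
      have "\<bar>F x\<bar> * wt x \<le> (A * norm x powr (- (1/2))) * 1"
        by (intro mult_mono F1 elim True wt_le_1) (use A wt_pos[of x] in auto)
      moreover have "0 \<le> A * (indicator (- ball 0 1) x * norm x powr (- (n + s)))" using A by simp
      ultimately show ?thesis using True by simp
    next
      case False
      have "\<bar>F x\<bar> * wt x \<le> (A * norm x powr s) * norm x powr (- (n + 2 * s))"
        by (intro mult_mono F2 wt_le_powr elim) (use False A wt_pos[of x] in auto)
      also have "\<dots> = A * norm x powr (- (n + s))"
      proof -
        have "s + - (n + 2 * s) = - (n + s)" by simp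
        then show ?thesis by (simp only: mult.assoc powr_add[symmetric])
      qed
      finally show ?thesis using False by simp
    qed
    then show ?case using wt_pos[of x] by (simp add: abs_mult)
  qed
qed measurable

lemma integrable_wt: "integrable lborel wt"
proof -
  have "integrable lborel (\<lambda>x::'a. 1 * wt x)"
  proof (rule integrable_weighted[where A=1])
    fix x :: 'a assume "x \<noteq> 0" "norm x \<le> 1"
    then show "\<bar>1\<bar> \<le> 1 * norm x powr (- (1/2))" using powr_mono2'[of "-(1/2)" "norm x" 1] by simp
  next
    fix x :: 'a assume "norm x \<ge> 1"
    then show "\<bar>1\<bar> \<le> 1 * norm x powr s" using s by (simp add: ge_one_powr_ge_zero)
  qed auto
  then show ?thesis by simp
qed

lemma integrable_ln_wt: "integrable lborel (\<lambda>x::'a. ln (norm x) * wt x)"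
proof (rule integrable_weighted[where A="2 + 1 / s"])
  have s1: "1 / s \<ge> 0" using s by simp
  fix x :: 'a assume x: "x \<noteq> 0" "norm x \<le> 1"
  have "ln (1 / norm x) \<le> (1 / norm x) powr (1/2) / (1/2)" using x by (intro ln_powr_bound) auto
  moreover have "(1 / norm x) powr (1/2) = norm x powr (- (1/2))" using x by (simp add: powr_minus powr_divide field_simps)
  ultimately have "\<bar>ln (norm x)\<bar> \<le> 2 * norm x powr (- (1/2))" using x by (simp add: ln_div)
  moreover have "0 \<le> 1 / s * norm x powr (- (1/2))" using s1 by (intro mult_nonneg_nonneg) auto
  ultimately show "\<bar>ln (norm x)\<bar> \<le> (2 + 1 / s) * norm x powr (- (1/2))" by (simp add: distrib_right)
next
  fix x :: 'a assume x: "norm x \<ge> 1"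
  have "ln (norm x) \<le> norm x powr s / s" using x s by (intro ln_powr_bound) auto
  moreover have "0 \<le> 2 * norm x powr s" by simp
  moreover have "(2 + 1 / s) * norm x powr s = 2 * norm x powr s + norm x powr s / s" by (simp add: distrib_right)
  moreover have "\<bar>ln (norm x)\<bar> = ln (norm x)" using x by simp
  ultimately show "\<bar>ln (norm x)\<bar> \<le> (2 + 1 / s) * norm x powr s" by linarith
qed (use s in auto)

lemma AE_m_nonneg: "AE x in lborel. m x \<ge> 0"
  using AE_lborel_singleton[of "0::'a"] by eventually_elim (rule m_nonneg)

lemma integrable_mult_m:
  assumes "integrable lborel (\<lambda>x. F x * wt x)" and [measurable]: "F \<in> borel_measurable borel"
  shows "integrable lborel (\<lambda>x. F x * m x)"
proof -
  obtain C where C: "C \<ge> 0" "\<And>x. m x \<le> C * wt x" using m_le_wt by blast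
  show ?thesis
  proof (rule Bochner_Integration.integrable_bound)
    show "integrable lborel (\<lambda>x. C * (F x * wt x))" by (intro integrable_mult_right assms)
    show "AE x in lborel. norm (F x * m x) \<le> norm (C * (F x * wt x))"
      using AE_m_nonneg
    proof eventually_elim
      case (elim x)
      have "\<bar>F x\<bar> * m x \<le> \<bar>F x\<bar> * (C * wt x)" by (intro mult_left_mono C) auto
      then show ?case using elim C(1) wt_pos[of x] by (simp add: abs_mult mult_ac)
    qed
  qed measurable
qed

lemma integrable_m: "integrable lborel m"
  using integrable_mult_m[of "\<lambda>_. 1"] integrable_wt by simp

definition heatw :: "real \<Rightarrow> 'a \<Rightarrow> real" where "heatw t x = (\<integral>h. w (x + h) * heat t h \<partial>lborel)"

lemma borel_measurable_heatw [measurable (raw)]: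
  assumes [measurable]: "f \<in> borel_measurable M" "h \<in> borel_measurable M"
  shows "(\<lambda>x. heatw (f x) (h x)) \<in> borel_measurable M"
proof -
  have "(\<lambda>z::real \<times> 'a. \<integral>h. w (snd z + h) * heat (fst z) h \<partial>lborel) \<in> borel_measurable (borel \<Otimes>\<^sub>M borel)"
    by (rule lborel.borel_measurable_lebesgue_integral) measurable
  then have a: "(\<lambda>z. heatw (fst z) (snd z)) \<in> borel_measurable (borel \<Otimes>\<^sub>M borel)" by (simp add: heatw_def)
  have "(\<lambda>x. (f x, h x)) \<in> measurable M (borel \<Otimes>\<^sub>M borel)" by measurable
  from measurable_compose[OF this a] show ?thesis by simp
qed

lemma integrable_w_heat: assumes t: "t > 0" shows "integrable lborel (\<lambda>h. w (x + h) * heat t h)"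
proof (rule Bochner_Integration.integrable_bound)
  show "integrable lborel (\<lambda>h::'a. Cg * heat t h)" by (intro integrable_mult_right integrable_heat t)
  show "AE h in lborel. norm (w (x + h) * heat t h) \<le> norm (Cg * heat t h)"
    using w_le Cg_nonneg by (intro AE_I2) (auto simp: abs_mult intro!: mult_right_mono)
qed measurable

lemma integral_sdiff_w_heat:
  assumes t: "t > 0"
  shows "(\<integral>h. sdiff w x h * heat t h \<partial>lborel) = 2 * (w x - heatw t x)"
proof -
  define G where "G h = w (x + h) * heat t h" for h
  have Gi: "integrable lborel G" unfolding G_def by (rule integrable_w_heat[OF t])
  have Gm: "integrable lborel (\<lambda>h. G (- h))" by (rule integrable_lborel_minus[OF Gi])
  have e: "(\<integral>h. G (- h) \<partial>lborel) = (\<integral>h. G h \<partial>lborel)" by (rule integral_lborel_minus) (use Gi in auto)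
  have "(\<integral>h. sdiff w x h * heat t h \<partial>lborel) = (\<integral>h. 2 * w x * heat t h - G h - G (- h) \<partial>lborel)"
    by (intro Bochner_Integration.integral_cong refl) (simp add: sdiff_def G_def algebra_simps)
  also have "\<dots> = 2 * w x * 1 - (\<integral>h. G h \<partial>lborel) - (\<integral>h. G h \<partial>lborel)"
    using Gi Gm e integrable_heat[OF t, where 'a='a] integral_heat[OF t, where 'a='a] by simp
  finally show ?thesis by (simp add: G_def heatw_def)
qed

text \<open>\<open>m\<close> as the superposition of w minus its heat evolution
  \<open>heatw\<close>. This form lets the semigroup law act when \<open>m\<close> is paired with a
  heat kernel.\<close>

lemma m_eq_subord: "m x = (\<integral>t. w x - heatw t x \<partial>subord s)"
proof -
  let ?p = "n + 2 * s"
  have "2 * m x = (\<integral>h. cns * (sdiff w x h / norm h powr ?p) \<partial>lborel)"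
    unfolding m_def Dop_def integral_mult_right_zero by simp
  also have "\<dots> = (\<integral>t. \<integral>h. sdiff w x h * heat t h \<partial>lborel \<partial>subord s)"
    by (rule subord_kernel_integral(1)[OF _ integrable_sdiff_w]) measurable
  also have "\<dots> = (\<integral>t. 2 * (w x - heatw t x) \<partial>subord s)"
  proof (rule integral_cong_AE)
    show "AE t in subord s. (\<integral>h. sdiff w x h * heat t h \<partial>lborel) = 2 * (w x - heatw t x)"
      using AE_subord_pos[of s] by eventually_elim (rule integral_sdiff_w_heat)
    show "(\<lambda>t. \<integral>h. sdiff w x h * heat t h \<partial>lborel) \<in> borel_measurable (subord s)"
      using subord_kernel_integral(2)[OF _ integrable_sdiff_w] by auto
  qed measurable
  also have "\<dots> = 2 * (\<integral>t. w x - heatw t x \<partial>subord s)" by (rule integral_mult_right_zero)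
  finally show ?thesis by simp
qed

text \<open>Second differences are bounded by min 1 |h|^2, and the Gaussian second moment is of
  order t. The resulting rate min 1 t is integrable against \<open>subord s\<close>.\<close>

lemma heatw_close: obtains C where "C \<ge> 0" "\<And>t x. t > 0 \<Longrightarrow> \<bar>w x - heatw t x\<bar> \<le> C * min 1 t"
proof -
  define c where "c = max 1 (8 * 2 powr (n / 2))"
  have c1: "c \<ge> 1" by (simp add: c_def)
  have b: "\<bar>w x - heatw t x\<bar> \<le> Bw / 2 * (c * min 1 t)" if t: "t > 0" for t x
  proof -
    have i1: "integrable lborel (\<lambda>h::'a. Bw * (c * min 1 t * (heat t h + heat (2 * t) h)))"
      by (intro integrable_mult_right Bochner_Integration.integrable_add integrable_heat) (use t in auto)
    \<comment> \<open>A dominating function of mass comparable to min 1 t: for short times the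
      quadratic bound through \<open>norm_sq_heat_le\<close>, for long times the heat kernel
      itself.\<close>
    define q where "q = (\<lambda>h::'a. if t \<le> 1 then c * t * heat (2 * t) h else heat t h)"
    have qi: "integrable lborel q" "(\<integral>h. q h \<partial>lborel) = (if t \<le> 1 then c * t else 1)"
      using integrable_heat[of t, where 'a='a] integrable_heat[of "2 * t", where 'a='a] integral_heat[of t, where 'a='a] integral_heat[of "2 * t", where 'a='a] t
      unfolding q_def by (cases "t \<le> 1"; simp)+
    have mh: "min 1 ((norm h)\<^sup>2) * heat t h \<le> q h" for h
    proof (cases "t \<le> 1")
      case True
      have "min 1 ((norm h)\<^sup>2) * heat t h \<le> (norm h)\<^sup>2 * heat t h" by (intro mult_right_mono) auto
      also have "\<dots> \<le> 8 * 2 powr (n / 2) * t * heat (2 * t) h" using norm_sq_heat_le[OF t, of h] by (simp add: n)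
      also have "\<dots> \<le> c * t * heat (2 * t) h" by (intro mult_right_mono) (use t in \<open>auto simp: c_def\<close>)
      finally show ?thesis using True by (simp add: q_def)
    next
      case False
      have "min 1 ((norm h)\<^sup>2) * heat t h \<le> 1 * heat t h" by (intro mult_right_mono) auto
      then show ?thesis using False by (simp add: q_def)
    qed
    have "2 * \<bar>w x - heatw t x\<bar> = \<bar>\<integral>h. sdiff w x h * heat t h \<partial>lborel\<bar>"
      unfolding integral_sdiff_w_heat[OF t] by (simp only: abs_mult abs_numeral)
    also have "\<dots> \<le> (\<integral>h. Bw * q h \<partial>lborel)"
    proof (rule order_trans[OF integral_abs_bound], rule integral_mono)
      show le: "\<bar>sdiff w x h * heat t h\<bar> \<le> Bw * q h" for h
      proof -
        have "\<bar>sdiff w x h * heat t h\<bar> \<le> (Bw * min 1 ((norm h)\<^sup>2)) * heat t h"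
          unfolding abs_mult by (simp add: mult_right_mono sdiff_w)
        also have "\<dots> \<le> Bw * q h" using mult_left_mono[OF mh[of h] Bw_nonneg] by (simp add: mult.assoc)
        finally show ?thesis .
      qed
      show "integrable lborel (\<lambda>h. Bw * q h)" by (intro integrable_mult_right qi)
      have "integrable lborel (\<lambda>h. sdiff w x h * heat t h)"
      proof (rule Bochner_Integration.integrable_bound)
        show "integrable lborel (\<lambda>h. Bw * q h)" by (intro integrable_mult_right qi)
        show "AE h in lborel. norm (sdiff w x h * heat t h) \<le> norm (Bw * q h)"
          unfolding real_norm_def using le abs_ge_self order_trans by (intro AE_I2) blast
      qed measurable
      then show "integrable lborel (\<lambda>h. \<bar>sdiff w x h * heat t h\<bar>)" by (rule integrable_abs)
    qed
    also have "\<dots> = Bw * (if t \<le> 1 then c * t else 1)" by (simp only: integral_mult_right_zero qi(2))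
    also have "\<dots> \<le> Bw * (c * min 1 t)" using c1 t by (intro mult_left_mono Bw_nonneg) auto
    finally show ?thesis by simp
  qed
  show ?thesis by (rule that[of "Bw / 2 * c"]) (use b Bw_nonneg c1 in \<open>auto simp: mult.assoc\<close>)
qed

definition wmean :: "real \<Rightarrow> real" where "wmean t = (\<integral>y. w y * heat t y \<partial>lborel)"

lemma integrable_w_heat0: "t > 0 \<Longrightarrow> integrable lborel (\<lambda>y. w y * heat t y)"
  using integrable_w_heat[of t 0] by simp

text \<open>By symmetry of the heat kernel, pairing with it evaluates the semigroup at the origin,
  so evolving for time t and pairing at time R gives the mean at time t + R.\<close>

lemma heatw_mean:
  assumes t: "t > 0" and R: "R > 0"
  shows "has_bochner_integral lborel (\<lambda>x. heatw t x * heat R x) (wmean (t + R))"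
proof (rule has_bochner_integral_nn_integral)
  have P: "ennreal (heatw t x) = (\<integral>\<^sup>+y. ennreal (w y * heat t (y - x)) \<partial>lborel)" for x
  proof -
    have "ennreal (heatw t x) = (\<integral>\<^sup>+h. ennreal (w (x + h) * heat t h) \<partial>lborel)"
      unfolding heatw_def by (rule nn_integral_eq_integral[symmetric, OF integrable_w_heat[OF t]]) simp
    also have "\<dots> = (\<integral>\<^sup>+h. (\<lambda>y. ennreal (w y * heat t (y - x))) (x + h) \<partial>lborel)" by simp
    also have "\<dots> = (\<integral>\<^sup>+y. ennreal (w y * heat t (y - x)) \<partial>lborel)"
      by (rule nn_integral_lborel_shift) measurable
    finally show ?thesis .
  qed
  have h0: "heatw t x \<ge> 0" for x unfolding heatw_def by (intro integral_nonneg_AE) auto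
  show "AE x in lborel. 0 \<le> heatw t x * heat R x" using h0 by simp
  show "0 \<le> wmean (t + R)" unfolding wmean_def by (intro integral_nonneg_AE) auto
  have "(\<integral>\<^sup>+x. ennreal (heatw t x * heat R x) \<partial>lborel) = (\<integral>\<^sup>+x. \<integral>\<^sup>+y. ennreal (w y) * ennreal (heat t (y - x) * heat R x) \<partial>lborel \<partial>lborel)"
  proof (intro nn_integral_cong)
    fix x :: 'a
    have "ennreal (heatw t x * heat R x) = (\<integral>\<^sup>+y. ennreal (w y * heat t (y - x)) \<partial>lborel) * ennreal (heat R x)"
      using h0 by (simp add: ennreal_mult P)
    also have "\<dots> = (\<integral>\<^sup>+y. ennreal (w y * heat t (y - x)) * ennreal (heat R x) \<partial>lborel)"
      by (rule nn_integral_multc[symmetric]) measurable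
    finally show "ennreal (heatw t x * heat R x) = (\<integral>\<^sup>+y. ennreal (w y) * ennreal (heat t (y - x) * heat R x) \<partial>lborel)"
      by (simp add: ennreal_mult[symmetric] mult.assoc)
  qed
  also have "\<dots> = (\<integral>\<^sup>+y. \<integral>\<^sup>+x. ennreal (w y) * ennreal (heat t (y - x) * heat R x) \<partial>lborel \<partial>lborel)"
    by (rule lborel_pair.Fubini') measurable
  also have "\<dots> = (\<integral>\<^sup>+y. ennreal (w y * heat (t + R) y) \<partial>lborel)"
  proof (intro nn_integral_cong)
    fix y :: 'a
    show "(\<integral>\<^sup>+x. ennreal (w y) * ennreal (heat t (y - x) * heat R x) \<partial>lborel) = ennreal (w y * heat (t + R) y)"
      by (subst nn_integral_cmult, measurable, subst heat_semigroup[OF t R]) (simp add: ennreal_mult)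
  qed
  also have "\<dots> = ennreal (wmean (t + R))"
    unfolding wmean_def by (rule nn_integral_eq_integral[OF integrable_w_heat0]) (use t R in auto)
  finally show "(\<integral>\<^sup>+x. ennreal (heatw t x * heat R x) \<partial>lborel) = ennreal (wmean (t + R))" .
qed measurable

text \<open>Pairing with a heat kernel commutes with subordination, so the question about
  \<open>m\<close> on the whole space becomes one about the scalar function \<open>wmean\<close> of
  time.\<close>

lemma integral_m_heat:
  assumes R: "R > 0"
  shows "(\<integral>x. m x * heat R x \<partial>lborel) = (\<integral>t. wmean R - wmean (R + t) \<partial>subord s)"
    "integrable (subord s) (\<lambda>t. wmean R - wmean (R + t))"
proof -
  obtain C where C: "C \<ge> 0" "\<And>t x. t > 0 \<Longrightarrow> \<bar>w x - heatw t x\<bar> \<le> C * min 1 t" using heatw_close by blast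
  define f where "f x t = (w x - heatw t x) * heat R x" for x t
  have fm: "case_prod f \<in> borel_measurable (lborel \<Otimes>\<^sub>M subord s)" unfolding f_def by measurable
  have "(\<integral>\<^sup>+x. \<integral>\<^sup>+t. ennreal \<bar>f x t\<bar> \<partial>subord s \<partial>lborel) \<le> (\<integral>\<^sup>+x. \<integral>\<^sup>+t. ennreal (C * heat R (x::'a)) * ennreal (min 1 t) \<partial>subord s \<partial>lborel)"
  proof (rule nn_integral_mono, rule nn_integral_mono_AE)
    fix x :: 'a
    show "AE t in subord s. ennreal \<bar>f x t\<bar> \<le> ennreal (C * heat R x) * ennreal (min 1 t)"
      using AE_subord_pos[of s]
    proof eventually_elim
      case (elim t)
      have "\<bar>f x t\<bar> \<le> (C * min 1 t) * heat R x" unfolding f_def abs_mult using C(2)[OF elim, of x] by (simp add: mult_right_mono)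
      then show ?case using C(1) elim by (subst ennreal_mult[symmetric]) (auto intro!: ennreal_leI simp: mult_ac)
    qed
  qed
  also have "\<dots> = (\<integral>\<^sup>+x. ennreal (C * heat R (x::'a)) * (\<integral>\<^sup>+t. ennreal (min 1 t) \<partial>subord s) \<partial>lborel)"
    by (intro nn_integral_cong nn_integral_cmult) measurable
  also have "\<dots> = (\<integral>\<^sup>+x. ennreal (C * heat R (x::'a)) \<partial>lborel) * (\<integral>\<^sup>+t. ennreal (min 1 t) \<partial>subord s)"
    by (rule nn_integral_multc) measurable
  also have "(\<integral>\<^sup>+x. ennreal (C * heat R (x::'a)) \<partial>lborel) = ennreal C"
    using nn_integral_heat[OF R, where 'a='a] C(1) by (simp add: ennreal_mult nn_integral_cmult)
  also have "ennreal C * (\<integral>\<^sup>+t. ennreal (min 1 t) \<partial>subord s) < \<infinity>"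
    using nn_integral_subord_min[OF s] by (simp add: ennreal_mult_less_top)
  finally have fin: "(\<integral>\<^sup>+x. \<integral>\<^sup>+t. ennreal \<bar>f x t\<bar> \<partial>subord s \<partial>lborel) < \<infinity>" .
  note F = Fubini_swap[OF sigma_finite_lborel sigma_finite_subord fm fin]
  have inner: "(\<integral>x. f x t \<partial>lborel) = wmean R - wmean (R + t)" if t: "t > 0" for t
  proof -
    have "(\<lambda>x. f x t) = (\<lambda>x. w x * heat R x - heatw t x * heat R x)" by (simp add: f_def left_diff_distrib)
    then show ?thesis
      using heatw_mean[OF t R] integrable_w_heat0[OF R] by (simp add: has_bochner_integral_iff wmean_def add.commute)
  qed
  have AEi: "AE t in subord s. (\<integral>x. f x t \<partial>lborel) = wmean R - wmean (R + t)"
    using AE_subord_pos[of s] by eventually_elim (rule inner)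
  have [measurable]: "(\<lambda>t. wmean R - wmean (R + t)) \<in> borel_measurable (subord s)"
  proof -
    have "(\<lambda>t. \<integral>y. w y * heat (R + t) y \<partial>lborel) \<in> borel_measurable borel"
      by (rule lborel.borel_measurable_lebesgue_integral) measurable
    then have "(\<lambda>t. wmean (R + t)) \<in> borel_measurable (subord s)" by (subst measurable_cong_sets[OF sets_subord refl]) (simp add: wmean_def)
    then show ?thesis by measurable
  qed
  show "integrable (subord s) (\<lambda>t. wmean R - wmean (R + t))"
    by (rule integrable_cong_AE_imp[OF F(2)]) (use AEi in auto)
  have "(\<integral>x. m x * heat R x \<partial>lborel) = (\<integral>x. \<integral>t. f x t \<partial>subord s \<partial>lborel)"
    by (intro Bochner_Integration.integral_cong refl) (simp add: m_eq_subord f_def)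
  also have "\<dots> = (\<integral>t. \<integral>x. f x t \<partial>lborel \<partial>subord s)" by (rule F(3))
  also have "\<dots> = (\<integral>t. wmean R - wmean (R + t) \<partial>subord s)"
    by (rule integral_cong_AE) (use AEi F(2) in auto)
  finally show "(\<integral>x. m x * heat R x \<partial>lborel) = (\<integral>t. wmean R - wmean (R + t) \<partial>subord s)" .
qed

definition \<kappa> :: real where "\<kappa> = (\<integral>x. m x \<partial>lborel)"

text \<open>Since \<open>m\<close> is nonnegative almost everywhere and the heat kernel is at most
  (4 pi R)^(-n/2), \<open>\<kappa>\<close> is at least (4 pi R)^(n/2) times the pairing of
  \<open>m\<close> with \<open>heat R\<close>. In that pairing the part of \<open>w\<close> coming
  from \<open>v\<close> scales exactly like R^(-n/2), and the deficit v - w is smaller by R^(-s).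
  Letting R tend to infinity isolates the constant.\<close>

theorem \<kappa>_lower: "radial_const n * (Gamma s * 4 powr s) * (Gamma (n / 2) / Gamma ((n - 2 * s) / 2)) \<le> \<kappa>"
proof -
  let ?b = "(n - 2 * s) / 2"
  have b0: "?b > 0" using dim by simp
  define kk where "kk = (4 * pi) powr (- (n / 2)) * radial_const n * (Gamma s * 4 powr s)"
  \<comment> \<open>The deficit is nonnegative and, up to the origin, supported in the unit ball,
    hence integrable. The decomposition w = v - G separates an explicit heat mean from a lower order
    one.\<close>
  define G where "G y = v y - w y" for y
  have AEG: "AE y in lborel. 0 \<le> G y" using AE_lborel_singleton[of "0::'a"] by eventually_elim (simp add: G_def w_le_v)
  have Gi: "integrable lborel G"
  proof (rule Bochner_Integration.integrable_bound[OF integrable_v_ball])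
    show "AE y in lborel. norm (G y) \<le> norm (indicator (cball 0 1) y * v y)"
      using AEG
    proof eventually_elim
      case (elim y)
      then show ?case using w_eq_v[of y] w_nonneg[of y] by (cases "norm y \<le> 1") (auto simp: G_def)
    qed
  qed (unfold G_def, measurable)
  define \<gamma> where "\<gamma> = (\<integral>y. G y \<partial>lborel)"
  have \<gamma>0: "\<gamma> \<ge> 0" unfolding \<gamma>_def by (rule integral_nonneg_AE[OF AEG])
  have V: "has_bochner_integral lborel (\<lambda>x. v x * heat R x) (kk * R powr (- ?b))" if "R > 0" for R
    using has_bochner_integral_powr_heat[where 'a='a, of s R, folded n] s dim that by (simp add: v_def kk_def)
  have GH: "integrable lborel (\<lambda>y. G y * heat R y)" if R: "R > 0" for R
  proof -
    have "integrable lborel (\<lambda>y. v y * heat R y - w y * heat R y)"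
      using V[OF R] integrable_w_heat0[OF R] by (intro Bochner_Integration.integrable_diff) (auto simp: has_bochner_integral_iff)
    then show ?thesis by (simp add: G_def left_diff_distrib)
  qed
  have wm: "wmean R = kk * R powr (- ?b) - (\<integral>y. G y * heat R y \<partial>lborel)" if R: "R > 0" for R
  proof -
    have "(\<integral>y. G y * heat R y \<partial>lborel) = (\<integral>y. v y * heat R y - w y * heat R y \<partial>lborel)"
      by (simp add: G_def left_diff_distrib)
    also have "\<dots> = kk * R powr (- ?b) - wmean R"
      using V[OF R] integrable_w_heat0[OF R] by (simp add: has_bochner_integral_iff wmean_def)
    finally show ?thesis by simp
  qed
  let ?g = "Gamma (n / 2 + s) / Gamma (n / 2)"
  have lower: "(4 * pi) powr (n / 2) * (kk * (Gamma (n / 2) / Gamma ?b)) - \<gamma> * ?g * R powr (- s) \<le> \<kappa>" if R: "R > 0" for R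
  proof -
    let ?P = "(4 * pi * R) powr (- (n / 2))"
    have H1: "has_bochner_integral (subord s) (\<lambda>t. 1 - (1 + t / R) powr (- ?b)) (R powr (- s) * Gamma (?b + s) / Gamma ?b)"
      by (rule integral_subord_one_minus_powr[OF s R b0])
    have H2: "has_bochner_integral (subord s) (\<lambda>t. 1 - (1 + t / R) powr (- (n / 2))) (R powr (- s) * Gamma (n / 2 + s) / Gamma (n / 2))"
      by (rule integral_subord_one_minus_powr[OF s R]) (use n_pos in simp)
    have H12: "has_bochner_integral (subord s) (\<lambda>t. (kk * R powr (- ?b)) * (1 - (1 + t / R) powr (- ?b)) - (\<gamma> * ?P) * (1 - (1 + t / R) powr (- (n / 2))))
       ((kk * R powr (- ?b)) * (R powr (- s) * Gamma (?b + s) / Gamma ?b) - (\<gamma> * ?P) * (R powr (- s) * Gamma (n / 2 + s) / Gamma (n / 2)))"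
      by (intro has_bochner_integral_diff has_bochner_integral_mult_right H1 H2)
    have "(\<integral>t. (kk * R powr (- ?b)) * (1 - (1 + t / R) powr (- ?b)) - (\<gamma> * ?P) * (1 - (1 + t / R) powr (- (n / 2))) \<partial>subord s) \<le> (\<integral>t. wmean R - wmean (R + t) \<partial>subord s)"
    proof (rule integral_mono_AE)
      show "integrable (subord s) (\<lambda>t. (kk * R powr (- ?b)) * (1 - (1 + t / R) powr (- ?b)) - (\<gamma> * ?P) * (1 - (1 + t / R) powr (- (n / 2))))"
        using H12 by (simp only: has_bochner_integral_iff)
      show "integrable (subord s) (\<lambda>t. wmean R - wmean (R + t))" by (rule integral_m_heat(2)[OF R])
      show "AE t in subord s. (kk * R powr (- ?b)) * (1 - (1 + t / R) powr (- ?b)) - (\<gamma> * ?P) * (1 - (1 + t / R) powr (- (n / 2))) \<le> wmean R - wmean (R + t)"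
        using AE_subord_pos[of s]
      proof eventually_elim
        case (elim t)
        have Rt: "R + t > 0" using R elim by simp
        have "(R + t) = R * (1 + t / R)" using R by (simp add: field_simps)
        then have p: "(R + t) powr (- ?b) = R powr (- ?b) * (1 + t / R) powr (- ?b)" by (simp only: powr_mult)
        have "(\<integral>y. G y * heat R y \<partial>lborel) - (\<integral>y. G y * heat (R + t) y \<partial>lborel) = (\<integral>y. G y * heat R y - G y * heat (R + t) y \<partial>lborel)"
          by (rule Bochner_Integration.integral_diff[symmetric, OF GH[OF R] GH[OF Rt]])
        also have "\<dots> \<le> (\<integral>y. G y * (?P * (1 - (1 + t / R) powr (- (n / 2)))) \<partial>lborel)"
        proof (rule integral_mono_AE)
          show "integrable lborel (\<lambda>y. G y * heat R y - G y * heat (R + t) y)" by (intro Bochner_Integration.integrable_diff GH R Rt)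
          show "integrable lborel (\<lambda>y. G y * (?P * (1 - (1 + t / R) powr (- (n / 2)))))" by (intro integrable_mult_left Gi)
          show "AE y in lborel. G y * heat R y - G y * heat (R + t) y \<le> G y * (?P * (1 - (1 + t / R) powr (- (n / 2))))"
            using AEG
          proof eventually_elim
            case (elim y)
            have "heat R y - heat (R + t) y \<le> ?P * (1 - (1 + t / R) powr (- (n / 2)))"
              using heat_difference_le[OF R \<open>t > 0\<close>, of y] by (simp add: n)
            then have "G y * (heat R y - heat (R + t) y) \<le> G y * (?P * (1 - (1 + t / R) powr (- (n / 2))))"
              by (rule mult_left_mono[OF _ elim])
            then show ?case by (simp add: right_diff_distrib)
          qed
        qed
        also have "\<dots> = \<gamma> * (?P * (1 - (1 + t / R) powr (- (n / 2))))" by (simp add: \<gamma>_def)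
        finally show ?case unfolding wm[OF R] wm[OF Rt] p by (simp add: algebra_simps)
      qed
    qed
    then have le: "(kk * R powr (- ?b)) * (R powr (- s) * Gamma (?b + s) / Gamma ?b) - (\<gamma> * ?P) * (R powr (- s) * Gamma (n / 2 + s) / Gamma (n / 2)) \<le> (\<integral>x. m x * heat R x \<partial>lborel)"
      using H12 unfolding integral_m_heat(1)[OF R] by (simp only: has_bochner_integral_iff)
    \<comment> \<open>Nonnegativity of \<open>m\<close> is essential here: the heat kernel is
      replaced by its maximum.\<close>
    have "(\<integral>x. m x * heat R x \<partial>lborel) \<le> (\<integral>x. m x * ?P \<partial>lborel)"
    proof (rule integral_mono_AE)
      show i: "integrable lborel (\<lambda>x. m x * ?P)" by (intro integrable_mult_left integrable_m)
      have le: "AE x in lborel. m x * heat R x \<le> m x * ?P"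
        using AE_m_nonneg by eventually_elim (use heat_le[OF R, where 'a='a] in \<open>auto intro!: mult_left_mono simp: n\<close>)
      then show "AE x in lborel. m x * heat R x \<le> m x * ?P" .
      show "integrable lborel (\<lambda>x. m x * heat R x)"
      proof (rule Bochner_Integration.integrable_bound[OF i])
        show "AE x in lborel. norm (m x * heat R x) \<le> norm (m x * ?P)"
          using le AE_m_nonneg by eventually_elim simp
      qed measurable
    qed
    also have "\<dots> = ?P * \<kappa>" by (simp add: \<kappa>_def)
    finally have "(kk * R powr (- ?b)) * (R powr (- s) * Gamma (?b + s) / Gamma ?b) - (\<gamma> * ?P) * (R powr (- s) * Gamma (n / 2 + s) / Gamma (n / 2)) \<le> ?P * \<kappa>"
      using le by linarith
    then have le2: "(4 * pi * R) powr (n / 2) * ((kk * R powr (- ?b)) * (R powr (- s) * Gamma (?b + s) / Gamma ?b) - (\<gamma> * ?P) * (R powr (- s) * Gamma (n / 2 + s) / Gamma (n / 2))) \<le> (4 * pi * R) powr (n / 2) * (?P * \<kappa>)"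
      by (rule mult_left_mono) simp
    \<comment> \<open>The powers of R cancel because (n-2s)/2 + s = n/2, so the main term is
      independent of R.\<close>
    have PP: "(4 * pi * R) powr (n / 2) * ?P = 1" using R by (simp add: powr_add[symmetric])
    have QQ: "(4 * pi * R) powr (n / 2) * (R powr (- ?b) * R powr (- s)) = (4 * pi) powr (n / 2)"
    proof -
      have "R powr (n / 2) * (R powr (- ?b) * R powr (- s)) = 1"
        unfolding powr_add[symmetric] using R by (simp add: diff_divide_distrib)
      then show ?thesis unfolding powr_mult[of "4 * pi" R] by (simp only: mult.assoc mult_1_right)
    qed
    have bb: "?b + s = n / 2" by (simp add: field_simps)
    have EE: "(4 * pi * R) powr (n / 2) * ((kk * R powr (- ?b)) * (R powr (- s) * Gamma (?b + s) / Gamma ?b) - (\<gamma> * ?P) * (R powr (- s) * Gamma (n / 2 + s) / Gamma (n / 2)))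
      = ((4 * pi * R) powr (n / 2) * (R powr (- ?b) * R powr (- s))) * (kk * (Gamma (?b + s) / Gamma ?b)) - ((4 * pi * R) powr (n / 2) * ?P) * (\<gamma> * ?g * R powr (- s))"
      by (simp add: right_diff_distrib mult_ac)
    have rhs: "(4 * pi * R) powr (n / 2) * (?P * \<kappa>) = \<kappa>"
      by (simp only: mult.assoc[symmetric] PP mult_1_left)
    show ?thesis using le2[unfolded EE rhs, unfolded QQ PP, unfolded bb] by (simp only: mult_1_left)
  qed
  have lim: "((\<lambda>R. (4 * pi) powr (n / 2) * (kk * (Gamma (n / 2) / Gamma ?b)) - \<gamma> * ?g * R powr (- s)) \<longlongrightarrow> (4 * pi) powr (n / 2) * (kk * (Gamma (n / 2) / Gamma ?b)) - \<gamma> * ?g * 0) at_top"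
    by (intro tendsto_intros tendsto_neg_powr filterlim_ident) (use s in simp)
  have "(4 * pi) powr (n / 2) * (kk * (Gamma (n / 2) / Gamma ?b)) - \<gamma> * ?g * 0 \<le> \<kappa>"
  proof (rule tendsto_upperbound[OF lim])
    show "\<forall>\<^sub>F R in at_top. (4 * pi) powr (n / 2) * (kk * (Gamma (n / 2) / Gamma ?b)) - \<gamma> * ?g * R powr (- s) \<le> \<kappa>"
      using eventually_gt_at_top[of "0::real"] by eventually_elim (rule lower)
  qed simp
  then have fin: "(4 * pi) powr (n / 2) * (kk * (Gamma (n / 2) / Gamma ?b)) \<le> \<kappa>" by simp
  have one: "(4 * pi) powr (n / 2) * (4 * pi) powr (- (n / 2)) = 1" by (simp add: powr_add[symmetric])
  have "(4 * pi) powr (n / 2) * (kk * (Gamma (n / 2) / Gamma ?b)) = ((4 * pi) powr (n / 2) * (4 * pi) powr (- (n / 2))) * (radial_const n * (Gamma s * 4 powr s) * (Gamma (n / 2) / Gamma ?b))"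
    unfolding kk_def by (simp only: mult_ac)
  then show ?thesis using fin unfolding one by (simp only: mult_1_left)
qed

end

section \<open>Nonexistence\<close>

text \<open>A layer cake formula: the decaying weight (1 + r)^(-q) is a superposition of indicators
  of r <= tau. It transfers bounds on annuli to bounds with a polynomial weight.\<close>

lemma nn_integral_one_plus_powr:
  assumes q: "q > 0" and r: "r \<ge> 0"
  shows "(\<integral>\<^sup>+\<tau>. ennreal (q * (1 + \<tau>) powr (- q - 1)) * indicator {r..} \<tau> \<partial>lborel) = ennreal ((1 + r) powr (- q))"
proof -
  have "(\<integral>\<^sup>+\<tau>. ennreal (q * (1 + \<tau>) powr (- q - 1)) * indicator {r..} \<tau> \<partial>lborel) = ennreal (0 - (- ((1 + r) powr (- q))))"
  proof (rule nn_integral_FTC_atLeast)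
    fix x :: real assume "r \<le> x"
    then have x: "1 + x > 0" using r by simp
    have "((\<lambda>x. (1 + x) powr (- q)) has_real_derivative (- q) * (1 + x) powr (- q - 1) * (0 + 1)) (at x)"
      by (rule DERIV_powr[where g="\<lambda>x. 1 + x" and f="\<lambda>_. - q" and r=0, THEN DERIV_cong])
         (use x in \<open>auto intro!: derivative_eq_intros simp: powr_diff field_simps\<close>)
    from DERIV_minus[OF this]
    show "((\<lambda>x. - ((1 + x) powr (- q))) has_real_derivative q * (1 + x) powr (- q - 1)) (at x)" by simp
    show "0 \<le> q * (1 + x) powr (- q - 1)" using q by simp
  next
    have f: "filterlim (\<lambda>x::real. 1 + x) at_top at_top" by (rule filterlim_tendsto_add_at_top[OF tendsto_const filterlim_ident])
    have "((\<lambda>x::real. (1 + x) powr (- q)) \<longlongrightarrow> 0) at_top"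
      by (rule tendsto_neg_powr[OF _ f]) (use q in simp)
    from tendsto_minus[OF this] show "((\<lambda>x::real. - ((1 + x) powr (- q))) \<longlongrightarrow> 0) at_top" by simp
  qed measurable
  then show ?thesis by simp
qed

section \<open>Comparison of weights at scale R\<close>

context truncated
begin

lemma AE_m_scaled_nonneg: "R > 0 \<Longrightarrow> AE x in lborel. 0 \<le> m ((1 / R) *\<^sub>R x)"
  using AE_lborel_singleton[of "0::'a"] by eventually_elim (simp add: m_nonneg)

lemma wt_scale:
  assumes R: "R \<ge> 1"
  shows "wt ((1 / R) *\<^sub>R x) \<le> R powr (n + 2 * s) * wt x"
proof -
  let ?p = "n + 2 * s"
  have p0: "?p > 0" using s n_pos by simp
  have RP: "R powr ?p \<ge> 1" using R p0 by (intro ge_one_powr_ge_zero) auto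
  have e: "norm ((1 / R) *\<^sub>R x) powr ?p = norm x powr ?p / R powr ?p" using R by (simp add: powr_divide)
  have "1 / (1 + y / P) \<le> P * (1 / (1 + y))" if "P \<ge> 1" "y \<ge> 0" for P y :: real
    using that by (simp add: divide_simps)
  from this[OF RP, of "norm x powr ?p"] show ?thesis unfolding wt_def e by simp
qed

lemma w_scaled_nonneg [simp]: "w_scaled R x \<ge> 0" by (simp add: w_scaled_def)

lemma w_scaled_le: "w_scaled R x \<le> R powr (- (n - 2 * s)) * Cg"
  unfolding w_scaled_def by (intro mult_left_mono w_le) auto

text \<open>With r = |x|/R, the weight (1 + r)^(-(n+2s)) is split into r^(-(n-2s)), which is
  \<open>v\<close> up to scaling, and a surplus decay of order 4s. The first factor matches the
  quantity controlled by stability; the second makes the integral over all annuli converge.\<close>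

lemma wt_scaled_le_v:
  assumes Rp: "R > 0" and x: "x \<noteq> 0"
  shows "wt ((1 / R) *\<^sub>R x) \<le> R powr (n - 2 * s) * (2 powr (n + 2 * s) * (v x * (1 + norm x / R) powr (- (4 * s))))"
proof -
  let ?p = "n + 2 * s" and ?q = "4 * s"
  have p0: "?p > 0" using s n_pos by simp
  define r where "r = norm x / R"
  have r: "r > 0" using x Rp by (simp add: r_def)
  have nr: "norm ((1 / R) *\<^sub>R x) = r" using Rp by (simp add: r_def)
  have "((1 + r) / 2) powr ?p \<le> 1 + r powr ?p"
  proof (cases "r \<le> 1")
    case True
    then have "((1 + r) / 2) powr ?p \<le> 1" using r p0 by (intro powr_le1) auto
    then show ?thesis by (simp add: add_increasing2)
  next
    case False
    then have "((1 + r) / 2) powr ?p \<le> r powr ?p" using r p0 by (intro powr_mono2) auto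
    then show ?thesis by simp
  qed
  moreover have "((1 + r) / 2) powr ?p > 0" using r by simp
  ultimately have "1 / (1 + r powr ?p) \<le> 1 / ((1 + r) / 2) powr ?p" by (intro frac_le) auto
  also have "\<dots> = 2 powr ?p * (1 + r) powr (- ?p)" using r by (simp only: powr_minus_divide powr_divide) simp
  also have "(1 + r) powr (- ?p) = (1 + r) powr (- (n - 2 * s)) * (1 + r) powr (- ?q)"
    unfolding powr_add[symmetric] by (rule arg_cong[where f="\<lambda>z. (1 + r) powr z"]) simp
  also have "2 powr ?p * ((1 + r) powr (- (n - 2 * s)) * (1 + r) powr (- ?q)) \<le> 2 powr ?p * (r powr (- (n - 2 * s)) * (1 + r) powr (- ?q))"
    using r dim by (intro mult_left_mono mult_right_mono powr_mono2') auto
  also have "r powr (- (n - 2 * s)) = R powr (n - 2 * s) * v x"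
  proof -
    have "r powr (- (n - 2 * s)) = norm x powr (- (n - 2 * s)) / R powr (- (n - 2 * s))" by (simp only: r_def powr_divide)
    then show ?thesis unfolding v_def powr_minus_divide[of R "n - 2 * s"] by simp
  qed
  finally show ?thesis unfolding wt_def nr r_def[symmetric] by (simp add: mult_ac)
qed

end

text \<open>The analytic core, separated from \<open>lebesgue\<close> and the weak formulation:
  \<open>u\<close> is a Borel representative, the equation is kept only for differences of truncated
  fundamental solutions, and stability only through its logarithmic consequence with slope
  \<open>cc\<close>.\<close>

locale log_bounded_solution = truncated s n cns ty \<theta> g Cg Kg
  for s n cns :: real and ty :: "'a::euclidean_space itself" and \<theta> g Cg Kg +
  fixes u :: "'a \<Rightarrow> real" and F :: "'a \<Rightarrow> real" and a R0 C0 cc :: real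
  assumes a: "a > 0" and u_measurable[measurable]: "u \<in> borel_measurable borel"
    and F: "\<And>x. F x = norm x powr a * exp (u x)"
    and u_int: "integrable lborel (\<lambda>x. u x * wt x)"
    and F_loc: "\<And>r. integrable lborel (\<lambda>x. indicator (cball 0 r) x * F x)"
    and weak_eq: "\<And>R0 R. 0 < R0 \<Longrightarrow> R0 \<le> R \<Longrightarrow>
      (\<integral>x. u x * (Dop (w_scaled R0) x - Dop (w_scaled R) x) \<partial>lborel) = (\<integral>x. F x * (w_scaled R0 x - w_scaled R x) \<partial>lborel)"
    and R0: "R0 \<ge> 1" and C0: "C0 \<ge> 0" and cc: "cc \<ge> 0"
    and log_bound: "\<And>A b. R0 \<le> A \<Longrightarrow> A \<le> b \<Longrightarrow>
      (\<integral>\<^sup>+x. ennreal (indicator {x. A \<le> norm x \<and> norm x \<le> b} x * (F x * v x)) \<partial>lborel) \<le> ennreal (C0 + cc * ln (b / A))"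
begin

lemma borel_measurable_F [measurable]: "F \<in> borel_measurable borel"
  unfolding F[abs_def] by measurable

lemma F0: "F x \<ge> 0" by (simp add: F)

definition I0 :: real where "I0 = (\<integral>x. indicator (cball 0 R0) x * F x \<partial>lborel)"

lemma I0: "I0 \<ge> 0" unfolding I0_def by (intro integral_nonneg_AE) (auto simp: F0)

text \<open>The pairing of u with (-Delta)^s w_R; after dilation it is a mean of u over the scale R
  with total weight \<open>\<kappa>\<close>.\<close>

definition M :: "real \<Rightarrow> real" where "M R = (\<integral>x. u x * Dop (w_scaled R) x \<partial>lborel)"

lemma integrable_u_Dop:
  assumes R: "R \<ge> 1"
  shows "integrable lborel (\<lambda>x. u x * Dop (w_scaled R) x)"
proof -
  let ?p = "n + 2 * s"
  obtain Cm where Cm: "Cm \<ge> 0" "\<And>x. m x \<le> Cm * wt x" using m_le_wt by blast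
  show ?thesis
  proof (rule Bochner_Integration.integrable_bound)
    have Rp: "R > 0" using R by simp
    show "integrable lborel (\<lambda>x. (R powr (- n) * (Cm * R powr ?p)) * (u x * wt x))" by (intro integrable_mult_right u_int)
    show "(\<lambda>x. u x * Dop (w_scaled R) x) \<in> borel_measurable lborel"
      unfolding Dop_w_scaled[OF Rp] m_def[symmetric] by measurable
    show "AE x in lborel. norm (u x * Dop (w_scaled R) x) \<le> norm ((R powr (- n) * (Cm * R powr ?p)) * (u x * wt x))"
      using AE_m_scaled_nonneg[OF Rp]
    proof eventually_elim
      case (elim x)
      have "m ((1 / R) *\<^sub>R x) \<le> Cm * wt ((1 / R) *\<^sub>R x)" by (rule Cm)
      also have "\<dots> \<le> Cm * (R powr ?p * wt x)" by (intro mult_left_mono wt_scale R Cm)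
      finally have "\<bar>u x\<bar> * (R powr (- n) * m ((1 / R) *\<^sub>R x)) \<le> \<bar>u x\<bar> * (R powr (- n) * (Cm * (R powr ?p * wt x)))"
        by (intro mult_left_mono) auto
      then show ?case unfolding Dop_w_scaled[OF Rp] m_def[symmetric] real_norm_def abs_mult
        using elim Cm(1) wt_pos[of x] by (simp add: mult_ac)
    qed
  qed
qed

lemma
  assumes R: "R \<ge> 1"
  shows M_eq_mean: "M R = (\<integral>y. u (R *\<^sub>R y) * m y \<partial>lborel)"
    and integrable_u_scaled_m: "integrable lborel (\<lambda>y. u (R *\<^sub>R y) * m y)"
proof -
  have Rp: "R > 0" using R by simp
  have "M R = \<bar>R\<bar> ^ DIM('a) * (\<integral>y. u (R *\<^sub>R y) * Dop (w_scaled R) (R *\<^sub>R y) \<partial>lborel)"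
    unfolding M_def by (rule integral_lborel_scale) (use integrable_u_Dop[OF R] Rp in auto)
  also have "\<dots> = (\<integral>y. \<bar>R\<bar> ^ DIM('a) * (u (R *\<^sub>R y) * Dop (w_scaled R) (R *\<^sub>R y)) \<partial>lborel)" by (rule integral_mult_right_zero[symmetric])
  finally have 1: "M R = \<dots>" .
  have 2: "\<bar>R\<bar> ^ DIM('a) * (u (R *\<^sub>R y) * Dop (w_scaled R) (R *\<^sub>R y)) = u (R *\<^sub>R y) * m y" for y
  proof -
    have "\<bar>R\<bar> ^ DIM('a) * R powr (- n) = 1" using Rp by (simp add: n powr_minus powr_realpow)
    moreover have "\<bar>R\<bar> ^ DIM('a) * (u (R *\<^sub>R y) * (R powr (- n) * m y)) = (\<bar>R\<bar> ^ DIM('a) * R powr (- n)) * (u (R *\<^sub>R y) * m y)"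
      by (simp only: mult_ac)
    ultimately have "\<bar>R\<bar> ^ DIM('a) * (u (R *\<^sub>R y) * (R powr (- n) * m y)) = u (R *\<^sub>R y) * m y"
      by (simp only: mult_1_left)
    then show ?thesis unfolding Dop_w_scaled[OF Rp] m_def[symmetric] using Rp by simp
  qed
  show "M R = (\<integral>y. u (R *\<^sub>R y) * m y \<partial>lborel)" unfolding 1 2 by simp
  have "integrable lborel (\<lambda>y. \<bar>R\<bar> ^ DIM('a) * (u (R *\<^sub>R y) * Dop (w_scaled R) (R *\<^sub>R y)))"
    by (intro integrable_mult_right integrable_lborel_scale[OF integrable_u_Dop[OF R]]) (use Rp in simp)
  then show "integrable lborel (\<lambda>y. u (R *\<^sub>R y) * m y)" unfolding 2 .
qed

text \<open>Differencing M between the scales \<open>R0\<close> and R gives, by the equation, the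
  integral of F against w_{R0} - w_R. This factor vanishes beyond R, is at most \<open>v\<close> on
  the annulus, where the logarithmic bound applies, and is bounded inside the ball of radius
  \<open>R0\<close>.\<close>

lemma M_lower: obtains E where "\<And>R. R \<ge> R0 \<Longrightarrow> E - cc * ln R \<le> M R"
proof
  define c1 where "c1 = R0 powr (- (n - 2 * s)) * Cg"
  have c10: "c1 \<ge> 0" unfolding c1_def using Cg_nonneg by simp
  show "M R0 - (c1 * I0 + C0) + cc * ln R0 - cc * ln R \<le> M R" if R: "R \<ge> R0" for R
  proof -
    have R1: "R \<ge> 1" using R R0 by simp
    have Rp: "R > 0" "R0 > 0" using R1 R0 by auto
    have Ai: "integrable lborel (\<lambda>x. indicator {x. R0 \<le> norm x \<and> norm x \<le> R} x * (F x * v x))"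
    proof (rule integrableI_bounded)
      show "(\<integral>\<^sup>+x. ennreal (norm (indicator {x. R0 \<le> norm x \<and> norm x \<le> R} x * (F x * v x))) \<partial>lborel) < \<infinity>"
        using order_le_less_trans[OF log_bound[OF order_refl R]] by (simp add: abs_mult F0)
    qed measurable
    have Aint: "(\<integral>x. indicator {x. R0 \<le> norm x \<and> norm x \<le> R} x * (F x * v x) \<partial>lborel) \<le> C0 + cc * ln (R / R0)"
    proof -
      have l: "ln (R / R0) \<ge> 0" using R Rp by (intro ln_ge_zero) simp
      have "ennreal (\<integral>x. indicator {x. R0 \<le> norm x \<and> norm x \<le> R} x * (F x * v x) \<partial>lborel) \<le> ennreal (C0 + cc * ln (R / R0))"
        using log_bound[OF order_refl R] by (subst nn_integral_eq_integral[symmetric, OF Ai]) (auto simp: F0)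
      moreover have "0 \<le> C0 + cc * ln (R / R0)" using C0 cc l by simp
      ultimately show ?thesis by (simp only: ennreal_le_iff)
    qed
    have "M R0 - M R = (\<integral>x. u x * Dop (w_scaled R0) x - u x * Dop (w_scaled R) x \<partial>lborel)"
      unfolding M_def by (rule Bochner_Integration.integral_diff[symmetric, OF integrable_u_Dop[OF R0] integrable_u_Dop[OF R1]])
    also have "\<dots> = (\<integral>x. F x * (w_scaled R0 x - w_scaled R x) \<partial>lborel)"
      unfolding weak_eq[OF Rp(2) R, symmetric] by (simp add: right_diff_distrib)
    also have "\<dots> \<le> (\<integral>x. c1 * (indicator (cball 0 R0) x * F x) + indicator {x. R0 \<le> norm x \<and> norm x \<le> R} x * (F x * v x) \<partial>lborel)"
    proof (rule integral_mono)
      have far: "w_scaled R0 x - w_scaled R x = 0" if "norm x \<ge> R" for x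
        using that R Rp by (simp add: w_scaled_eq_v)
      show "integrable lborel (\<lambda>x. F x * (w_scaled R0 x - w_scaled R x))"
      proof (rule Bochner_Integration.integrable_bound)
        define K where "K = c1 + R powr (- (n - 2 * s)) * Cg"
        show "integrable lborel (\<lambda>x. K * (indicator (cball 0 R) x * F x))" by (intro integrable_mult_right F_loc)
        have pw: "\<bar>F x * (w_scaled R0 x - w_scaled R x)\<bar> \<le> K * (indicator (cball 0 R) x * F x)" for x
        proof (cases "norm x \<le> R")
          case True
          have "\<bar>w_scaled R0 x - w_scaled R x\<bar> \<le> K"
            using w_scaled_nonneg[of R0 x] w_scaled_nonneg[of R x] w_scaled_le[of R0 x] w_scaled_le[of R x] unfolding K_def c1_def by linarith
          then have "F x * \<bar>w_scaled R0 x - w_scaled R x\<bar> \<le> F x * K" by (rule mult_left_mono[OF _ F0])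
          then show ?thesis using True F0[of x] by (simp add: abs_mult mult.commute)
        qed (simp add: far)
        show "AE x in lborel. norm (F x * (w_scaled R0 x - w_scaled R x)) \<le> norm (K * (indicator (cball 0 R) x * F x))"
          unfolding real_norm_def by (intro AE_I2 order_trans[OF pw abs_ge_self])
      qed measurable
      show "integrable lborel (\<lambda>x. c1 * (indicator (cball 0 R0) x * F x) + indicator {x. R0 \<le> norm x \<and> norm x \<le> R} x * (F x * v x))"
        by (intro Bochner_Integration.integrable_add integrable_mult_right F_loc Ai)
      fix x :: 'a
      show "F x * (w_scaled R0 x - w_scaled R x) \<le> c1 * (indicator (cball 0 R0) x * F x) + indicator {x. R0 \<le> norm x \<and> norm x \<le> R} x * (F x * v x)"
      proof (cases "norm x \<ge> R")
        case True
        have "0 \<le> c1 * (indicator (cball 0 R0) x * F x)" "0 \<le> indicator {x. R0 \<le> norm x \<and> norm x \<le> R} x * (F x * v x)"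
          using c10 F0 by (auto intro!: mult_nonneg_nonneg)
        then show ?thesis unfolding far[OF True] by simp
      next
        case False
        have le: "F x * (w_scaled R0 x - w_scaled R x) \<le> F x * w_scaled R0 x"
          by (intro mult_left_mono F0) (use w_scaled_nonneg[of R x] in simp)
        show ?thesis
        proof (cases "norm x \<ge> R0")
          case True
          have "0 \<le> c1 * (indicator (cball 0 R0) x * F x)" using c10 F0 by (auto intro!: mult_nonneg_nonneg)
          then show ?thesis using le True False by (simp add: w_scaled_eq_v[OF Rp(2) True])
        next
          case in0: False
          have "F x * w_scaled R0 x \<le> F x * c1" unfolding c1_def by (intro mult_left_mono F0 w_scaled_le)
          then show ?thesis using le in0 by (simp add: mult.commute)
        qed
      qed
    qed
    also have "\<dots> = c1 * I0 + (\<integral>x. indicator {x. R0 \<le> norm x \<and> norm x \<le> R} x * (F x * v x) \<partial>lborel)"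
      unfolding I0_def by (subst Bochner_Integration.integral_add) (auto intro!: integrable_mult_right F_loc Ai)
    also have "\<dots> \<le> c1 * I0 + (C0 + cc * ln (R / R0))" using Aint by simp
    also have "ln (R / R0) = ln R - ln R0" using Rp by (simp add: ln_div)
    finally show ?thesis by (simp add: algebra_simps)
  qed
qed

text \<open>The layer cake formula expresses the weight by indicators of |x| <= R tau, and the
  logarithmic bound applies to each resulting annulus. Its growth in tau is absorbed by half of the
  decay 4s.\<close>

lemma tail_integral_le:
  assumes R: "R \<ge> R0"
  shows "(\<integral>\<^sup>+x. ennreal (indicator {x. R0 \<le> norm x} x * (F x * v x)) * ennreal ((1 + norm x / R) powr (- (4 * s))) \<partial>lborel) \<le> ennreal (C0 + cc * ln R + cc / s)"
proof -
  let ?q = "4 * s"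
  have Rp: "R > 0" "R0 > 0" using R R0 by auto
  have lnR: "ln R \<ge> 0" using R R0 by simp
  let ?k = "\<lambda>\<tau>. ennreal (?q * (1 + \<tau>) powr (- ?q - 1))"
  have q0: "?q > 0" using s by simp
  have "(\<integral>\<^sup>+x. ennreal (indicator {x. R0 \<le> norm x} x * (F x * v x)) * ennreal ((1 + norm x / R) powr (- ?q)) \<partial>lborel) = (\<integral>\<^sup>+x. \<integral>\<^sup>+\<tau>. ennreal (indicator {x. R0 \<le> norm x} x * (F x * v x)) * (?k \<tau> * indicator {norm x / R..} \<tau>) \<partial>lborel \<partial>lborel)"
  proof (intro nn_integral_cong)
    fix x :: 'a
    show "ennreal (indicator {x. R0 \<le> norm x} x * (F x * v x)) * ennreal ((1 + norm x / R) powr (- ?q)) = (\<integral>\<^sup>+\<tau>. ennreal (indicator {x. R0 \<le> norm x} x * (F x * v x)) * (?k \<tau> * indicator {norm x / R..} \<tau>) \<partial>lborel)"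
      by (subst nn_integral_cmult, measurable, subst nn_integral_one_plus_powr[OF q0]) (use Rp in auto)
  qed
  also have "\<dots> = (\<integral>\<^sup>+\<tau>. \<integral>\<^sup>+x. ennreal (indicator {x. R0 \<le> norm x} x * (F x * v x)) * (?k \<tau> * indicator {norm x / R..} \<tau>) \<partial>lborel \<partial>lborel)"
    by (rule lborel_pair.Fubini') (unfold indicator_def atLeast_iff, measurable)
  \<comment> \<open>Two probability densities in tau: order 4s for the constant part of the bound,
    and order 2s for the part that pays for ln(1 + tau).\<close>
  also have "\<dots> \<le> (\<integral>\<^sup>+\<tau>. ennreal (C0 + cc * ln R) * (?k \<tau> * indicator {0..} \<tau>) + ennreal (cc / s) * (ennreal (2 * s * (1 + \<tau>) powr (- (2 * s) - 1)) * indicator {0..} \<tau>) \<partial>lborel)"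
  proof (intro nn_integral_mono)
    fix \<tau> :: real
    have "(\<integral>\<^sup>+x. ennreal (indicator {x. R0 \<le> norm x} x * (F x * v x)) * (?k \<tau> * indicator {norm x / R..} \<tau>) \<partial>lborel)
      = ?k \<tau> * (\<integral>\<^sup>+x. ennreal (indicator {x. R0 \<le> norm x \<and> norm x \<le> R * \<tau>} x * (F x * v x)) \<partial>lborel)"
    proof (subst nn_integral_cmult[symmetric], measurable, intro nn_integral_cong)
      fix x :: 'a
      have "norm x / R \<le> \<tau> \<longleftrightarrow> norm x \<le> R * \<tau>" using Rp by (simp add: pos_divide_le_eq mult.commute)
      then show "ennreal (indicator {x. R0 \<le> norm x} x * (F x * v x)) * (?k \<tau> * indicator {norm x / R..} \<tau>) = ?k \<tau> * ennreal (indicator {x. R0 \<le> norm x \<and> norm x \<le> R * \<tau>} x * (F x * v x))"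
        by (simp add: indicator_def mult.commute)
    qed
    also have "\<dots> \<le> ennreal (C0 + cc * ln R) * (?k \<tau> * indicator {0..} \<tau>) + ennreal (cc / s) * (ennreal (2 * s * (1 + \<tau>) powr (- (2 * s) - 1)) * indicator {0..} \<tau>)"
    proof (cases "R0 \<le> R * \<tau>")
      case True
      have \<tau>: "\<tau> > 0" using True Rp by (metis less_le_trans zero_less_mult_pos)
      have l1: "ln (R * \<tau> / R0) \<le> ln R + ln (1 + \<tau>)"
      proof -
        have "R * \<tau> / R0 \<le> R * (1 + \<tau>)"
        proof -
          have "R * \<tau> / R0 \<le> R * \<tau> / 1" using R0 Rp \<tau> by (intro frac_le) auto
          also have "\<dots> \<le> R * (1 + \<tau>)" using Rp by simp
          finally show ?thesis .
        qed
        then have "ln (R * \<tau> / R0) \<le> ln (R * (1 + \<tau>))" using Rp \<tau> by (intro ln_mono) auto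
        also have "\<dots> = ln R + ln (1 + \<tau>)" using Rp \<tau> by (intro ln_mult_pos) auto
        finally show ?thesis .
      qed
      \<comment> \<open>The exponent 2s is half of 4s, so what remains is still integrable; combined
        with the factor 4s it produces the coefficient cc/s.\<close>
      have l2: "ln (1 + \<tau>) \<le> (1 + \<tau>) powr (2 * s) / (2 * s)" using \<tau> s by (intro ln_powr_bound) auto
      have "C0 + cc * ln (R * \<tau> / R0) \<le> C0 + cc * (ln R + (1 + \<tau>) powr (2 * s) / (2 * s))"
        using l1 l2 cc by (intro add_left_mono mult_left_mono) auto
      then have "?q * (1 + \<tau>) powr (- ?q - 1) * (C0 + cc * ln (R * \<tau> / R0)) \<le> ?q * (1 + \<tau>) powr (- ?q - 1) * (C0 + cc * (ln R + (1 + \<tau>) powr (2 * s) / (2 * s)))"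
        using s by (intro mult_left_mono) auto
      also have "\<dots> = (C0 + cc * ln R) * (?q * (1 + \<tau>) powr (- ?q - 1)) + cc / s * (2 * s * ((1 + \<tau>) powr (- ?q - 1) * (1 + \<tau>) powr (2 * s)))"
        using s by (simp add: field_simps)
      also have "(1 + \<tau>) powr (- ?q - 1) * (1 + \<tau>) powr (2 * s) = (1 + \<tau>) powr (- (2 * s) - 1)"
        unfolding powr_add[symmetric] by (rule arg_cong[where f="\<lambda>z. (1 + \<tau>) powr z"]) simp
      finally have fin: "?q * (1 + \<tau>) powr (- ?q - 1) * (C0 + cc * ln (R * \<tau> / R0)) \<le> (C0 + cc * ln R) * (?q * (1 + \<tau>) powr (- ?q - 1)) + cc / s * (2 * s * (1 + \<tau>) powr (- (2 * s) - 1))" .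
      have "?k \<tau> * (\<integral>\<^sup>+x. ennreal (indicator {x. R0 \<le> norm x \<and> norm x \<le> R * \<tau>} x * (F x * v x)) \<partial>lborel) \<le> ?k \<tau> * ennreal (C0 + cc * ln (R * \<tau> / R0))"
        by (intro mult_left_mono log_bound True) auto
      also have "\<dots> = ennreal (?q * (1 + \<tau>) powr (- ?q - 1) * (C0 + cc * ln (R * \<tau> / R0)))"
        by (rule ennreal_mult'[symmetric]) (use s in simp)
      also have "\<dots> \<le> ennreal ((C0 + cc * ln R) * (?q * (1 + \<tau>) powr (- ?q - 1)) + cc / s * (2 * s * (1 + \<tau>) powr (- (2 * s) - 1)))"
        by (rule ennreal_leI[OF fin])
      also have "\<dots> = ennreal (C0 + cc * ln R) * ?k \<tau> + ennreal (cc / s) * ennreal (2 * s * (1 + \<tau>) powr (- (2 * s) - 1))"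
      proof -
        have nn: "C0 + cc * ln R \<ge> 0" "cc / s \<ge> 0" using C0 cc lnR s by auto
        have k1: "0 \<le> ?q * (1 + \<tau>) powr (- ?q - 1)" and k2: "0 \<le> 2 * s * (1 + \<tau>) powr (- (2 * s) - 1)" using s by auto
        show ?thesis
          by (simp only: ennreal_plus[OF mult_nonneg_nonneg[OF nn(1) k1] mult_nonneg_nonneg[OF nn(2) k2]] ennreal_mult[OF nn(1) k1] ennreal_mult[OF nn(2) k2])
      qed
      finally show ?thesis using \<tau> by simp
    next
      case False
      have "(\<integral>\<^sup>+x. ennreal (indicator {x. R0 \<le> norm x \<and> norm x \<le> R * \<tau>} x * (F x * v x)) \<partial>lborel) = (\<integral>\<^sup>+(x::'a). 0 \<partial>lborel)"
        using False by (intro nn_integral_cong) (auto simp: indicator_def)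
      then show ?thesis by simp
    qed
    finally show "(\<integral>\<^sup>+x. ennreal (indicator {x. R0 \<le> norm x} x * (F x * v x)) * (?k \<tau> * indicator {norm x / R..} \<tau>) \<partial>lborel)
      \<le> ennreal (C0 + cc * ln R) * (?k \<tau> * indicator {0..} \<tau>) + ennreal (cc / s) * (ennreal (2 * s * (1 + \<tau>) powr (- (2 * s) - 1)) * indicator {0..} \<tau>)" .
  qed
  also have "\<dots> = ennreal (C0 + cc * ln R + cc / s)"
  proof -
    let ?k1 = "\<lambda>\<tau>. ?k \<tau> * indicator {0..} \<tau>" and ?k2 = "\<lambda>\<tau>. ennreal (2 * s * (1 + \<tau>) powr (- (2 * s) - 1)) * indicator {0..} \<tau>"
    have K: "?k1 \<in> borel_measurable lborel" "?k2 \<in> borel_measurable lborel" by measurable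
    have I1: "integral\<^sup>N lborel ?k1 = 1" using nn_integral_one_plus_powr[OF q0, of 0] by simp
    have I2: "integral\<^sup>N lborel ?k2 = 1" using nn_integral_one_plus_powr[of "2 * s" 0] s by simp
    have nn: "C0 + cc * ln R \<ge> 0" "cc / s \<ge> 0" using C0 cc lnR s by auto
    have "(\<integral>\<^sup>+\<tau>. c1 * ?k1 \<tau> + c2 * ?k2 \<tau> \<partial>lborel) = c1 * integral\<^sup>N lborel ?k1 + c2 * integral\<^sup>N lborel ?k2" for c1 c2 :: ennreal
      by (simp only: nn_integral_add[OF borel_measurable_times_ennreal[OF borel_measurable_const K(1)] borel_measurable_times_ennreal[OF borel_measurable_const K(2)]] nn_integral_cmult[OF K(1)] nn_integral_cmult[OF K(2)])
    then show ?thesis by (simp only: I1 I2 mult_1_right ennreal_plus[OF nn])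
  qed
  finally show ?thesis .
qed

text \<open>After dilating back, the ball of radius \<open>R0\<close> contributes O(R^(-n)). Outside
  it, \<open>wt_scaled_le_v\<close> produces R^(n-2s) F v with a convergent weight, so the gain is
  R^(-2s) up to the logarithm.\<close>

lemma mean_F_upper:
  obtains D where "D \<ge> 0" "\<And>R. R \<ge> R0 \<Longrightarrow>
    (\<integral>\<^sup>+y. ennreal (m y * F (R *\<^sub>R y)) \<partial>lborel) \<le> ennreal (R powr (- 2 * s) * (D * (1 + ln R)))"
proof -
  let ?p = "n + 2 * s"
  obtain Cm where Cm: "Cm \<ge> 0" "\<And>x. m x \<le> Cm * wt x" using m_le_wt by blast
  define D where "D = Cm * (I0 + 2 powr ?p * (C0 + cc + cc / s))"
  have D0: "D \<ge> 0" unfolding D_def using Cm(1) I0 C0 cc s by (intro mult_nonneg_nonneg add_nonneg_nonneg) auto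
  have "(\<integral>\<^sup>+y. ennreal (m y * F (R *\<^sub>R y)) \<partial>lborel) \<le> ennreal (R powr (- 2 * s) * (D * (1 + ln R)))" if R: "R \<ge> R0" for R
  proof -
    have R1: "R \<ge> 1" using R R0 by simp
    have Rp: "R > 0" "R0 > 0" using R1 R0 by auto
    have lnR: "ln R \<ge> 0" using R1 by simp
    let ?q = "4 * s"
    define T where "T = (\<integral>\<^sup>+x. ennreal (indicator {x. R0 \<le> norm x} x * (F x * v x)) * ennreal ((1 + norm x / R) powr (- ?q)) \<partial>lborel)"
    have T: "T \<le> ennreal (C0 + cc * ln R + cc / s)" unfolding T_def by (rule tail_integral_le[OF R])
    have "(\<integral>\<^sup>+y. ennreal (m y * F (R *\<^sub>R y)) \<partial>lborel) \<le> (\<integral>\<^sup>+y. ennreal (Cm * (wt y * F (R *\<^sub>R y))) \<partial>lborel)"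
      unfolding mult.assoc[symmetric] by (intro nn_integral_mono ennreal_leI mult_right_mono Cm F0)
    also have "\<dots> = ennreal (\<bar>1 / R\<bar> ^ DIM('a)) * (\<integral>\<^sup>+x. ennreal (Cm * (wt ((1 / R) *\<^sub>R x) * F (R *\<^sub>R ((1 / R) *\<^sub>R x)))) \<partial>lborel)"
      by (rule nn_integral_lborel_scale) (use Rp in auto)
    also have "\<dots> = ennreal (R powr (- n)) * (\<integral>\<^sup>+x. ennreal (Cm * (wt ((1 / R) *\<^sub>R x) * F x)) \<partial>lborel)"
    proof -
      have "\<bar>1 / R\<bar> ^ DIM('a) = R powr (- n)" using Rp by (simp add: n powr_minus powr_realpow power_one_over inverse_eq_divide)
      then show ?thesis using Rp by simp
    qed
    also have "\<dots> \<le> ennreal (R powr (- n)) * (ennreal (Cm * I0) + ennreal (Cm * (R powr (n - 2 * s) * 2 powr ?p)) * T)"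
    proof (rule mult_left_mono)
      have "(\<integral>\<^sup>+x. ennreal (Cm * (wt ((1 / R) *\<^sub>R x) * F x)) \<partial>lborel) \<le>
        (\<integral>\<^sup>+x. ennreal (Cm * (indicator (cball 0 R0) x * F x)) + ennreal (Cm * (R powr (n - 2 * s) * 2 powr ?p)) * (ennreal (indicator {x. R0 \<le> norm x} x * (F x * v x)) * ennreal ((1 + norm x / R) powr (- ?q))) \<partial>lborel)"
      proof (intro nn_integral_mono)
        fix x :: 'a
        show "ennreal (Cm * (wt ((1 / R) *\<^sub>R x) * F x)) \<le> ennreal (Cm * (indicator (cball 0 R0) x * F x)) + ennreal (Cm * (R powr (n - 2 * s) * 2 powr ?p)) * (ennreal (indicator {x. R0 \<le> norm x} x * (F x * v x)) * ennreal ((1 + norm x / R) powr (- ?q)))"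
        proof (cases "norm x \<ge> R0")
          case True
          then have x: "x \<noteq> 0" using Rp by auto
          have "wt ((1 / R) *\<^sub>R x) * F x \<le> R powr (n - 2 * s) * (2 powr ?p * (v x * (1 + norm x / R) powr (- ?q))) * F x"
            by (intro mult_right_mono wt_scaled_le_v Rp x F0)
          then have "Cm * (wt ((1 / R) *\<^sub>R x) * F x) \<le> Cm * (R powr (n - 2 * s) * (2 powr ?p * (v x * (1 + norm x / R) powr (- ?q))) * F x)"
            by (intro mult_left_mono Cm(1))
          then have "ennreal (Cm * (wt ((1 / R) *\<^sub>R x) * F x)) \<le> ennreal (Cm * (R powr (n - 2 * s) * (2 powr ?p * (v x * (1 + norm x / R) powr (- ?q))) * F x))"
            by (rule ennreal_leI)
          also have "Cm * (R powr (n - 2 * s) * (2 powr ?p * (v x * (1 + norm x / R) powr (- ?q))) * F x) = (Cm * (R powr (n - 2 * s) * 2 powr ?p)) * ((F x * v x) * (1 + norm x / R) powr (- ?q))"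
            by (simp only: mult_ac)
          also have "ennreal \<dots> = ennreal (Cm * (R powr (n - 2 * s) * 2 powr ?p)) * (ennreal (F x * v x) * ennreal ((1 + norm x / R) powr (- ?q)))"
          proof -
            have "0 \<le> Cm * (R powr (n - 2 * s) * 2 powr ?p)" "0 \<le> F x * v x" "0 \<le> (1 + norm x / R) powr (- ?q)"
              using Cm(1) F0[of x] by auto
            then show ?thesis by (simp only: ennreal_mult mult_nonneg_nonneg)
          qed
          finally show ?thesis using True by (simp add: add_increasing)
        next
          case False
          have "wt ((1 / R) *\<^sub>R x) * F x \<le> 1 * F x" by (intro mult_right_mono wt_le_1 F0)
          then have "Cm * (wt ((1 / R) *\<^sub>R x) * F x) \<le> Cm * (1 * F x)" by (rule mult_left_mono[OF _ Cm(1)])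
          then show ?thesis using False by (simp add: ennreal_leI)
        qed
      qed
      also have "\<dots> = ennreal (Cm * I0) + ennreal (Cm * (R powr (n - 2 * s) * 2 powr ?p)) * T"
      proof -
        let ?f = "\<lambda>x. ennreal (Cm * (indicator (cball 0 R0) x * F x))"
        let ?g = "\<lambda>x. ennreal (indicator {x. R0 \<le> norm x} x * (F x * v x)) * ennreal ((1 + norm x / R) powr (- ?q))"
        have K: "?f \<in> borel_measurable lborel" "?g \<in> borel_measurable lborel" by measurable
        have "has_bochner_integral lborel (\<lambda>x. Cm * (indicator (cball 0 R0) x * F x)) (Cm * I0)"
          by (intro has_bochner_integral_mult_right) (simp add: has_bochner_integral_iff F_loc I0_def)
        then have I: "integral\<^sup>N lborel ?f = ennreal (Cm * I0)"
          using Cm(1) F0 by (subst nn_integral_eq_integral) (auto simp: has_bochner_integral_iff)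
        have "(\<integral>\<^sup>+x. ?f x + c * ?g x \<partial>lborel) = integral\<^sup>N lborel ?f + c * integral\<^sup>N lborel ?g" for c :: ennreal
          by (simp only: nn_integral_add[OF K(1) borel_measurable_times_ennreal[OF borel_measurable_const K(2)]] nn_integral_cmult[OF K(2)])
        then show ?thesis unfolding T_def I by blast
      qed
      finally show "(\<integral>\<^sup>+x. ennreal (Cm * (wt ((1 / R) *\<^sub>R x) * F x)) \<partial>lborel) \<le> ennreal (Cm * I0) + ennreal (Cm * (R powr (n - 2 * s) * 2 powr ?p)) * T" .
    qed simp
    also have "\<dots> \<le> ennreal (R powr (- n)) * (ennreal (Cm * I0) + ennreal (Cm * (R powr (n - 2 * s) * 2 powr ?p)) * ennreal (C0 + cc * ln R + cc / s))"
      by (intro mult_left_mono add_left_mono T) auto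
    also have "\<dots> = ennreal (R powr (- n) * (Cm * I0 + Cm * (R powr (n - 2 * s) * 2 powr ?p) * (C0 + cc * ln R + cc / s)))"
    proof -
      have nn: "0 \<le> Cm * I0" "0 \<le> Cm * (R powr (n - 2 * s) * 2 powr ?p)" "0 \<le> C0 + cc * ln R + cc / s"
        using Cm(1) I0 C0 cc lnR s by auto
      show ?thesis
        by (simp only: ennreal_mult[OF nn(2) nn(3), symmetric] ennreal_plus[OF nn(1) mult_nonneg_nonneg[OF nn(2) nn(3)], symmetric] ennreal_mult'[OF powr_ge_zero, symmetric])
    qed
    also have "\<dots> \<le> ennreal (R powr (- 2 * s) * (D * (1 + ln R)))"
    proof (rule ennreal_leI)
      have e1: "R powr (- n) * R powr (n - 2 * s) = R powr (- 2 * s)" unfolding powr_add[symmetric] by simp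
      \<comment> \<open>The assumption n > 2s lets the inner contribution be absorbed into the rate
        of the outer one.\<close>
      have e2: "R powr (- n) \<le> R powr (- 2 * s)" using R1 dim by (intro powr_mono) auto
      have a1: "R powr (- n) * (Cm * I0) \<le> R powr (- 2 * s) * (Cm * I0 * (1 + ln R))"
      proof (rule mult_mono[OF e2])
        show "Cm * I0 \<le> Cm * I0 * (1 + ln R)" using Cm(1) I0 lnR by (simp add: distrib_left)
      qed (use Cm(1) I0 in auto)
      have "C0 + cc * ln R + cc / s \<le> (C0 + cc + cc / s) * (1 + ln R)"
      proof -
        have "0 \<le> C0 * ln R" "0 \<le> cc / s * ln R" using C0 cc lnR s by auto
        then show ?thesis using cc by (simp add: algebra_simps)
      qed
      then have a2: "R powr (- 2 * s) * (Cm * 2 powr ?p) * (C0 + cc * ln R + cc / s) \<le> R powr (- 2 * s) * (Cm * 2 powr ?p) * ((C0 + cc + cc / s) * (1 + ln R))"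
        using Cm(1) by (intro mult_left_mono) auto
      have "R powr (- n) * (Cm * I0 + Cm * (R powr (n - 2 * s) * 2 powr ?p) * (C0 + cc * ln R + cc / s))
        = R powr (- n) * (Cm * I0) + (R powr (- n) * R powr (n - 2 * s)) * (Cm * 2 powr ?p) * (C0 + cc * ln R + cc / s)"
        by (simp only: distrib_left mult_ac)
      also have "\<dots> \<le> R powr (- 2 * s) * (Cm * I0 * (1 + ln R)) + R powr (- 2 * s) * (Cm * 2 powr ?p) * ((C0 + cc + cc / s) * (1 + ln R))"
        unfolding e1 by (intro add_mono a1 a2)
      also have "\<dots> = R powr (- 2 * s) * (D * (1 + ln R))"
        unfolding D_def by (simp only: distrib_left distrib_right mult_ac)
      finally show "R powr (- n) * (Cm * I0 + Cm * (R powr (n - 2 * s) * 2 powr ?p) * (C0 + cc * ln R + cc / s)) \<le> R powr (- 2 * s) * (D * (1 + ln R))" .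
    qed
    finally show ?thesis .
  qed
  with D0 show ?thesis by (rule that)
qed

definition ln_mean :: real where "ln_mean = (\<integral>y. ln (norm y) * m y \<partial>lborel)"

lemma integrable_ln_m: "integrable lborel (\<lambda>y. ln (norm y) * m y)"
  by (rule integrable_mult_m[OF integrable_ln_wt]) measurable

text \<open>Jensen's inequality for the probability density \<open>m\<close> /
  \<open>\<kappa>\<close>, by integrating the tangent line of exp at the mean. With F(R y) = exp(X
  y), the mean of X consists of M R / kappa, the term a ln R from the dilation, and the constant a
  \<open>ln_mean\<close> / kappa.\<close>

lemma jensen_lower:
  assumes R1: "R \<ge> 1" and \<kappa>0: "\<kappa> > 0" and B0: "B \<ge> 0"
    and up: "(\<integral>\<^sup>+y. ennreal (m y * F (R *\<^sub>R y)) \<partial>lborel) \<le> ennreal B"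
  shows "\<kappa> * exp (M R / \<kappa> + a * ln R + a * ln_mean / \<kappa>) \<le> B"
proof -
  have Rp: "R > 0" using R1 by auto
  define c where "c = M R / \<kappa> + a * ln R + a * ln_mean / \<kappa>"
  define X where "X y = u (R *\<^sub>R y) + a * ln R + a * ln (norm y)" for y :: 'a
  have Fe: "F (R *\<^sub>R y) = exp (X y)" if "y \<noteq> 0" for y
  proof -
    have "norm (R *\<^sub>R y) powr a = exp (a * ln R + a * ln (norm y))"
      using that Rp by (simp add: powr_def ln_mult distrib_left)
    then show ?thesis by (simp add: F X_def exp_add mult_ac)
  qed
  have AEF: "AE y in lborel. 0 \<le> m y * F (R *\<^sub>R y)" using AE_m_nonneg by eventually_elim (simp add: F0)
  have fin: "(\<integral>\<^sup>+y. ennreal (m y * F (R *\<^sub>R y)) \<partial>lborel) < \<infinity>"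
    using up by (rule order_le_less_trans) simp
  have mF: "integrable lborel (\<lambda>y. m y * F (R *\<^sub>R y))"
  proof (rule integrableI_bounded)
    have "(\<integral>\<^sup>+y. ennreal (norm (m y * F (R *\<^sub>R y))) \<partial>lborel) = (\<integral>\<^sup>+y. ennreal (m y * F (R *\<^sub>R y)) \<partial>lborel)"
      by (rule nn_integral_cong_AE) (use AEF in eventually_elim, simp)
    then show "(\<integral>\<^sup>+y. ennreal (norm (m y * F (R *\<^sub>R y))) \<partial>lborel) < \<infinity>" using fin by simp
  qed measurable
  have "ennreal (\<integral>y. m y * F (R *\<^sub>R y) \<partial>lborel) \<le> ennreal B"
    using up by (subst nn_integral_eq_integral[symmetric, OF mF AEF])
  then have up1: "(\<integral>y. m y * F (R *\<^sub>R y) \<partial>lborel) \<le> B" by (simp only: ennreal_le_iff[OF B0])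
  have hb: "has_bochner_integral lborel (\<lambda>y. exp c * ((1 + a * ln R - c) * m y + u (R *\<^sub>R y) * m y + a * (ln (norm y) * m y)))
    (exp c * ((1 + a * ln R - c) * \<kappa> + M R + a * ln_mean))"
  proof (intro has_bochner_integral_mult_right has_bochner_integral_add)
    show "has_bochner_integral lborel m \<kappa>" using integrable_m by (simp add: has_bochner_integral_iff \<kappa>_def)
    show "has_bochner_integral lborel (\<lambda>y. u (R *\<^sub>R y) * m y) (M R)"
      using integrable_u_scaled_m[OF R1] M_eq_mean[OF R1] by (simp add: has_bochner_integral_iff)
    show "has_bochner_integral lborel (\<lambda>y. ln (norm y) * m y) ln_mean" using integrable_ln_m by (simp add: has_bochner_integral_iff ln_mean_def)
  qed
  \<comment> \<open>Since \<open>c\<close> is the mean of \<open>X\<close>, the linear term of the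
    tangent integrates to zero.\<close>
  have val: "exp c * ((1 + a * ln R - c) * \<kappa> + M R + a * ln_mean) = \<kappa> * exp c"
  proof -
    have "c * \<kappa> = M R + a * ln R * \<kappa> + a * ln_mean" using \<kappa>0 by (simp add: c_def field_simps)
    then have "(1 + a * ln R - c) * \<kappa> + M R + a * ln_mean = \<kappa>" by (simp add: algebra_simps)
    then show ?thesis by (simp only: mult.commute)
  qed
  have "(\<integral>y. exp c * ((1 + a * ln R - c) * m y + u (R *\<^sub>R y) * m y + a * (ln (norm y) * m y)) \<partial>lborel) \<le> (\<integral>y. m y * F (R *\<^sub>R y) \<partial>lborel)"
  proof (rule integral_mono_AE)
    show "integrable lborel (\<lambda>y. exp c * ((1 + a * ln R - c) * m y + u (R *\<^sub>R y) * m y + a * (ln (norm y) * m y)))"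
      using hb by (simp only: has_bochner_integral_iff)
    show "AE y in lborel. exp c * ((1 + a * ln R - c) * m y + u (R *\<^sub>R y) * m y + a * (ln (norm y) * m y)) \<le> m y * F (R *\<^sub>R y)"
      using AE_m_nonneg AE_lborel_singleton[of "0::'a"]
    proof eventually_elim
      case (elim y)
      have "exp c * (1 + (X y - c)) \<le> exp c * exp (X y - c)"
        by (intro mult_left_mono exp_ge_add_one_self) simp
      also have "\<dots> = F (R *\<^sub>R y)" using Fe[OF elim(2)] by (simp add: exp_add[symmetric])
      finally have "m y * (exp c * (1 + (X y - c))) \<le> m y * F (R *\<^sub>R y)" by (rule mult_left_mono[OF _ elim(1)])
      moreover have "exp c * ((1 + a * ln R - c) * m y + u (R *\<^sub>R y) * m y + a * (ln (norm y) * m y)) = m y * (exp c * (1 + (X y - c)))"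
        by (simp add: X_def algebra_simps)
      ultimately show ?case by (simp only:)
    qed
  qed (rule mF)
  then have "\<kappa> * exp c \<le> (\<integral>y. m y * F (R *\<^sub>R y) \<partial>lborel)"
    using hb val by (simp only: has_bochner_integral_iff)
  then show ?thesis using up1 unfolding c_def by linarith
qed

text \<open>The lower bound of order R^(a - cc/kappa) and the upper bound of order R^(-2s) (1 + ln
  R) are incompatible for large R, since the exponents differ by \<open>\<delta>\<close> = 2s + a -
  cc/kappa > 0.\<close>

theorem contradiction:
  assumes cond: "cc < (2 * s + a) * \<kappa>"
  shows False
proof -
  have \<kappa>0: "\<kappa> > 0"
  proof -
    have "0 < (2 * s + a) * \<kappa>" using cc cond by linarith
    moreover have "2 * s + a > 0" using s a by simp
    ultimately show ?thesis by (simp add: zero_less_mult_iff)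
  qed
  obtain E where M_lower: "\<And>R. R \<ge> R0 \<Longrightarrow> E - cc * ln R \<le> M R" using M_lower by blast
  obtain D where D0: "D \<ge> 0" and mean_F_upper: "\<And>R. R \<ge> R0 \<Longrightarrow>
    (\<integral>\<^sup>+y. ennreal (m y * F (R *\<^sub>R y)) \<partial>lborel) \<le> ennreal (R powr (- 2 * s) * (D * (1 + ln R)))" using mean_F_upper by blast
  define \<delta> where "\<delta> = 2 * s + a - cc / \<kappa>"
  have \<delta>: "\<delta> > 0"
  proof -
    have "cc / \<kappa> < 2 * s + a" using cond \<kappa>0 by (simp add: pos_divide_less_eq)
    then show ?thesis by (simp add: \<delta>_def)
  qed
  define k where "k = \<kappa> * exp (E / \<kappa> + a * ln_mean / \<kappa>)"
  have k: "k > 0" unfolding k_def using \<kappa>0 by simp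
  have main: "k * R powr (\<delta> / 2) \<le> D * (1 + 2 / \<delta>)" if R: "R \<ge> R0" for R
  proof -
    have R1: "R \<ge> 1" using R R0 by simp
    have Rp: "R > 0" using R1 by auto
    have "(E - cc * ln R) / \<kappa> \<le> M R / \<kappa>" using M_lower[OF R] \<kappa>0 by (intro divide_right_mono) auto
    then have "E / \<kappa> + a * ln_mean / \<kappa> + (a - cc / \<kappa>) * ln R \<le> M R / \<kappa> + a * ln R + a * ln_mean / \<kappa>"
      by (simp add: diff_divide_distrib algebra_simps)
    then have "\<kappa> * exp (E / \<kappa> + a * ln_mean / \<kappa> + (a - cc / \<kappa>) * ln R) \<le> \<kappa> * exp (M R / \<kappa> + a * ln R + a * ln_mean / \<kappa>)"
      using \<kappa>0 by (intro mult_left_mono) auto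
    also have "\<dots> \<le> R powr (- 2 * s) * (D * (1 + ln R))" by (intro jensen_lower mean_F_upper R R1 \<kappa>0 mult_nonneg_nonneg D0) (use R1 in auto)
    finally have "k * R powr (a - cc / \<kappa>) \<le> R powr (- 2 * s) * (D * (1 + ln R))"
      using Rp by (simp add: k_def exp_add powr_def mult.assoc)
    then have "R powr (2 * s) * (k * R powr (a - cc / \<kappa>)) \<le> R powr (2 * s) * (R powr (- 2 * s) * (D * (1 + ln R)))"
      by (rule mult_left_mono) simp
    moreover have "R powr (2 * s) * (k * R powr (a - cc / \<kappa>)) = k * R powr \<delta>"
    proof -
      have "R powr (2 * s) * R powr (a - cc / \<kappa>) = R powr \<delta>"
        unfolding powr_add[symmetric] \<delta>_def by (simp add: algebra_simps)
      then show ?thesis by (simp only: mult.left_commute)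
    qed
    moreover have "R powr (2 * s) * (R powr (- 2 * s) * (D * (1 + ln R))) = D * (1 + ln R)"
    proof -
      have "R powr (2 * s) * R powr (- 2 * s) = 1" unfolding powr_add[symmetric] using Rp by simp
      then show ?thesis by (simp only: mult.assoc[symmetric] mult_1_left)
    qed
    ultimately have le: "k * R powr \<delta> \<le> D * (1 + ln R)" by (simp only:)
    \<comment> \<open>Half of the excess exponent absorbs the logarithm; the other half still
      diverges.\<close>
    have P1: "R powr (\<delta> / 2) \<ge> 1" using R1 \<delta> by (intro ge_one_powr_ge_zero) auto
    have "ln R \<le> R powr (\<delta> / 2) / (\<delta> / 2)" using R1 \<delta> by (intro ln_powr_bound) auto
    moreover have "(1 + 2 / \<delta>) * R powr (\<delta> / 2) = R powr (\<delta> / 2) + R powr (\<delta> / 2) / (\<delta> / 2)"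
      by (simp add: distrib_right)
    ultimately have "1 + ln R \<le> (1 + 2 / \<delta>) * R powr (\<delta> / 2)" using P1 by linarith
    then have "D * (1 + ln R) \<le> D * ((1 + 2 / \<delta>) * R powr (\<delta> / 2))" by (rule mult_left_mono[OF _ D0])
    then have "k * (R powr (\<delta> / 2) * R powr (\<delta> / 2)) \<le> D * ((1 + 2 / \<delta>) * R powr (\<delta> / 2))"
      using le by (simp add: powr_add[symmetric])
    then have "(k * R powr (\<delta> / 2)) * R powr (\<delta> / 2) \<le> (D * (1 + 2 / \<delta>)) * R powr (\<delta> / 2)" by (simp only: mult.assoc)
    then show ?thesis by (rule mult_right_le_imp_le) (use P1 in linarith)
  qed
  define B where "B = D * (1 + 2 / \<delta>) / k"
  have "filterlim (\<lambda>R::real. R powr (\<delta> / 2)) at_top at_top"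
    using \<delta> by real_asymp
  then have "\<forall>\<^sub>F R in at_top. R powr (\<delta> / 2) > B" by (simp add: filterlim_at_top_dense)
  then have "\<forall>\<^sub>F R in at_top. R powr (\<delta> / 2) > B \<and> R \<ge> R0" using eventually_ge_at_top[of R0] by (rule eventually_conj)
  then obtain R where R: "R powr (\<delta> / 2) > B" "R \<ge> R0" using eventually_happens by force
  have "k * B < k * R powr (\<delta> / 2)" using R(1) k by simp
  moreover have "k * B = D * (1 + 2 / \<delta>)" using k by (simp add: B_def)
  ultimately show False using main[OF R(2)] by linarith
qed

end

section \<open>Explicit constants and reduction of the solution to the abstract setting\<close>

lemma smooth_fun_borel:
  fixes f :: "'a::euclidean_space \<Rightarrow> real"
  assumes "smooth_fun f" shows "f \<in> borel_measurable borel"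
proof (rule borel_measurable_continuous_onI)
  have "f differentiable (at x)" for x
    using assms unfolding smooth_fun_def by (metis dir_derivs.simps(1))
  then show "continuous_on UNIV f"
    by (intro continuous_at_imp_continuous_on ballI differentiable_imp_continuous_within)
qed

context frac
begin

text \<open>With (n+2s)/4 - s = (n-2s)/4 the \<open>marchaud\<close> factor is a single quotient of
  Gamma values. The two Riesz constants give the same quotient again together with 4^s, hence the
  square.\<close>

lemma hardy_const_eq: "\<Lambda> = 4 powr s * (Gamma ((n + 2 * s) / 4) ^ 2 / Gamma ((n - 2 * s) / 4) ^ 2)"
proof -
  let ?g = "(n + 2 * s) / 4" and ?d = "(n - 2 * s) / 4"
  have d: "?d > 0" using dim by simp
  have Gd: "Gamma ?d > 0" using d by simp
  have "Gamma (?d + 1) = ?d * Gamma ?d"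
    by (rule Gamma_plus1) (use d in \<open>auto elim!: nonpos_Ints_cases\<close>)
  moreover have e: "?g + 1 - s = ?d + 1" "?g - s = ?d" by (simp_all add: field_simps)
  ultimately have m: "marchaud s ?g = Gamma ?g / Gamma ?d"
    unfolding marchaud_def e using d Gd by (simp del: times_divide_eq_left)
  have h: "(n + 2 * s) / 2 / 2 = ?g" "(n - 2 * s) / 2 / 2 = ?d" by simp_all
  have p: "(4::real) powr ?g = 4 powr s * 4 powr ?d"
    unfolding powr_add[symmetric] by (rule arg_cong[where f="\<lambda>z. 4 powr z"]) (simp add: field_simps)
  have "riesz_const n ((n + 2 * s) / 2) / riesz_const n ((n - 2 * s) / 2) = Gamma ?g * 4 powr s / Gamma ?d"
    unfolding riesz_const_def h p by simp
  then show ?thesis unfolding \<Lambda>_def m by (simp add: power2_eq_square)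
qed

end

context truncated
begin

text \<open>Multiplying the hypothesis by |S^(n-1)| 4^s turns its right side into the stability
  slope and its left side into (2s + a) times the lower bound for \<open>\<kappa>\<close>.\<close>

lemma supercritical:
  assumes a: "a > 0"
    and cond: "Gamma (n / 2) * Gamma s / Gamma ((n - 2 * s) / 2) * (s + a/2)
      > Gamma ((n + 2 * s) / 4) ^ 2 / Gamma ((n - 2 * s) / 4) ^ 2"
  shows "\<Lambda> * (2 * radial_const n) < (2 * s + a) * \<kappa>"
proof -
  let ?G = "Gamma ((n + 2 * s) / 4) ^ 2 / Gamma ((n - 2 * s) / 4) ^ 2"
  have rc: "radial_const n > 0" by (rule radial_const_pos[OF n_pos])
  have "\<Lambda> * (2 * radial_const n) = 2 * radial_const n * 4 powr s * ?G"
    unfolding hardy_const_eq by (simp only: mult_ac)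
  also have "\<dots> < 2 * radial_const n * 4 powr s * (Gamma (n / 2) * Gamma s / Gamma ((n - 2 * s) / 2) * (s + a/2))"
    using rc by (intro mult_strict_left_mono cond) auto
  also have "\<dots> = (2 * s + a) * (radial_const n * (Gamma s * 4 powr s) * (Gamma (n / 2) / Gamma ((n - 2 * s) / 2)))"
    by (simp only: times_divide_eq_left times_divide_eq_right distrib_left distrib_right) (simp add: mult_ac add_divide_distrib)
  also have "\<dots> \<le> (2 * s + a) * \<kappa>"
    by (intro mult_left_mono \<kappa>_lower) (use s a in auto)
  finally show ?thesis .
qed

lemma test_fun_w_scaled_diff:
  assumes R: "0 < R0" "R0 \<le> R"
  shows "test_fun UNIV (\<lambda>x. w_scaled R0 x - w_scaled R x)"
proof -
  define h where "h \<rho> = R0 powr (- (n - 2 * s)) * g ((1 / R0\<^sup>2) * \<rho> + 0) - R powr (- (n - 2 * s)) * g ((1 / R\<^sup>2) * \<rho> + 0)" for \<rho>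
  have eq: "(\<lambda>x::'a. h ((norm x)\<^sup>2)) = (\<lambda>x. w_scaled R0 x - w_scaled R x)"
    by (simp add: h_def w_scaled_def w_def power_divide fun_eq_iff)
  have "test_fun UNIV (\<lambda>x::'a. h ((norm x)\<^sup>2))"
  proof (rule test_fun_radial[where r=0 and R=R])
    show "smooth1 h" unfolding h_def by (intro smooth1_diff smooth1_scale smooth1_affine g_smooth)
    fix \<rho> :: real assume \<rho>: "\<rho> \<ge> 0" "h \<rho> \<noteq> 0"
    \<comment> \<open>Every rho >= 0 is realised as the squared norm of a multiple of a basis
      vector, so the coincidence of the two scales outside radius R transfers to the profile
      \<open>h\<close>.\<close>
    obtain b :: 'a where b: "b \<in> Basis" using nonempty_Basis by blast
    define x where "x = sqrt \<rho> *\<^sub>R b"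
    have nx: "(norm x)\<^sup>2 = \<rho>" "norm x = sqrt \<rho>" using b \<rho>(1) by (simp_all add: x_def)
    have "w_scaled R0 x - w_scaled R x \<noteq> 0" using \<rho>(2) fun_cong[OF eq, of x] nx by simp
    then have "\<not> norm x \<ge> R" using w_scaled_eq_v[of R0 x] w_scaled_eq_v[of R x] R by auto
    then show "\<rho> \<le> R\<^sup>2" using nx R by (metis less_eq_real_def not_le norm_ge_zero power_mono)
  qed (use R in auto)
  then show ?thesis unfolding eq .
qed

text \<open>This links the principal value in \<open>frac_lap\<close> to the absolutely convergent
  \<open>Dop\<close> for the test functions in use; linearity of \<open>Dop\<close> is justified by
  integrability of the second differences at each scale.\<close>

lemma truncated_Lim_Dop:
  assumes R: "0 < R0" "R0 \<le> R"
  shows "((\<lambda>\<epsilon>. LINT y : {y. dist x y > \<epsilon>} | lborel. ((w_scaled R0 x - w_scaled R x) - (w_scaled R0 y - w_scaled R y)) / dist x y powr (n + 2 * s))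
    \<longlongrightarrow> (Dop (w_scaled R0) x - Dop (w_scaled R) x) / cns) (at_right 0)"
proof -
  define \<phi> where "\<phi> x = w_scaled R0 x - w_scaled R x" for x
  have [measurable]: "\<phi> \<in> borel_measurable borel" unfolding \<phi>_def by measurable
  have Rp: "R > 0" using R by simp
  define k where "k r = r powr (- (n - 2 * s)) * (Bw * max 1 ((1 / r)\<^sup>2))" for r
  have sd: "sdiff \<phi> x h = sdiff (w_scaled R0) x h - sdiff (w_scaled R) x h" for h
    by (simp add: sdiff_def \<phi>_def)
  have B: "\<bar>sdiff \<phi> x h\<bar> \<le> (k R0 + k R) * min 1 ((norm h)\<^sup>2)" for h
    unfolding sd distrib_right using sdiff_w_scaled_le[OF R(1), of x h] sdiff_w_scaled_le[OF Rp, of x h]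
    unfolding k_def by linarith
  have M: "\<bar>\<phi> y\<bar> \<le> R0 powr (- (n - 2 * s)) * Cg + R powr (- (n - 2 * s)) * Cg" for y
  proof -
    have "0 \<le> w_scaled r y \<and> w_scaled r y \<le> r powr (- (n - 2 * s)) * Cg" for r
      unfolding w_scaled_def by (auto intro!: mult_left_mono w_le)
    from this[of R0] this[of R] show ?thesis unfolding \<phi>_def by linarith
  qed
  have i: "integrable lborel (\<lambda>h. cns / 2 * (sdiff (w_scaled r) x h / norm h powr (n + 2 * s)))" if "r > 0" for r
    by (intro integrable_mult_right integrable_kernel_bound[OF _ sdiff_w_scaled_le[OF that]]) measurable
  have "Dop \<phi> x = Dop (w_scaled R0) x - Dop (w_scaled R) x"
    unfolding Dop_def Bochner_Integration.integral_diff[OF i[OF R(1)] i[OF Rp], symmetric]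
    by (intro Bochner_Integration.integral_cong refl) (simp add: sd diff_divide_distrib right_diff_distrib)
  with truncated_integral_tendsto_Dop[OF _ M B] show ?thesis by (simp add: \<phi>_def)
qed

end

lemma integrable_lborel_cong_lebesgue:
  fixes f g :: "'a::euclidean_space \<Rightarrow> real"
  assumes f: "integrable lebesgue f" and g: "g \<in> borel_measurable borel" and fg: "AE x in lborel. f x = g x"
  shows "integrable lborel g"
proof -
  have gl: "g \<in> borel_measurable lebesgue" using g by (intro measurable_completion) simp
  have "integrable lebesgue g"
    by (rule integrable_cong_AE_imp[OF f gl]) (use AE_completion[OF fg] in auto)
  then show ?thesis using g by (simp add: integrable_completion)
qed

lemma integral_lborel_cong_lebesgue:
  fixes f g :: "'a::euclidean_space \<Rightarrow> real"
  assumes f: "f \<in> borel_measurable lebesgue" and g: "g \<in> borel_measurable borel" and fg: "AE x in lborel. f x = g x"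
  shows "(\<integral>x. f x \<partial>lebesgue) = (\<integral>x. g x \<partial>lborel)"
proof -
  have gl: "g \<in> borel_measurable lebesgue" using g by (intro measurable_completion) simp
  have "(\<integral>x. f x \<partial>lebesgue) = (\<integral>x. g x \<partial>lebesgue)"
    by (rule integral_cong_AE[OF f gl AE_completion[OF fg]])
  also have "\<dots> = (\<integral>x. g x \<partial>lborel)" using g by (simp add: integral_completion)
  finally show ?thesis .
qed

theorem theorem1p1:
  fixes s a :: real
  assumes "0 < s" "s < 1" "a > 0"
    and "real CARD('n) > 2 * s"
    and "Gamma (real CARD('n) / 2) * Gamma s / Gamma ((real CARD('n) - 2 * s) / 2) * (s + a/2)
         > Gamma ((real CARD('n) + 2 * s) / 4) ^ 2 / Gamma ((real CARD('n) - 2 * s) / 4) ^ 2"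
  shows "\<not> (\<exists>u :: real^'n \<Rightarrow> real. is_solution s a u \<and> finite_morse s a u \<and> W12_loc u
            \<and> L2_loc (\<lambda>x. norm x powr a * exp (u x)))"
proof
  assume "\<exists>u :: real^'n \<Rightarrow> real. is_solution s a u \<and> finite_morse s a u \<and> W12_loc u
            \<and> L2_loc (\<lambda>x. norm x powr a * exp (u x))"
  then obtain u :: "real^'n \<Rightarrow> real" where sol: "is_solution s a u" and morse: "finite_morse s a u" and W: "W12_loc u"
    by blast
  let ?n = "real CARD('n)"
  let ?cns = "frac_const CARD('n) s"
  obtain \<theta> where \<theta>: "smooth1 \<theta>" "mono \<theta>" "\<And>x. x \<le> 1/2 \<Longrightarrow> \<theta> x = 0" "\<And>x. x \<ge> 1 \<Longrightarrow> \<theta> x = 1"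
    using smooth_step_exists by blast
  have \<theta>01: "0 \<le> \<theta> x" "\<theta> x \<le> 1" for x
    using \<theta>(2)[THEN monoD, of "min x 0" x] \<theta>(2)[THEN monoD, of x "max x 1"] \<theta>(3)[of "min x 0"] \<theta>(4)[of "max x 1"] by auto
  have q: "(?n - 2 * s) / 2 > 0" using assms(4) by simp
  obtain g g1 g2 C K where g: "smooth1 g" 
    "\<And>\<rho>. (g has_real_derivative g1 \<rho>) (at \<rho>)" "\<And>\<rho>. (g1 has_real_derivative g2 \<rho>) (at \<rho>)"
    "\<And>\<rho>. \<rho> \<ge> 1 \<Longrightarrow> g \<rho> = \<rho> powr (- ((?n - 2 * s) / 2))" "\<And>\<rho>. 0 \<le> g \<rho>" "\<And>\<rho>. g \<rho> \<le> C"
    "\<And>\<rho> \<rho>0. \<rho> > 0 \<Longrightarrow> \<rho>0 > 0 \<Longrightarrow> g \<rho> \<le> g \<rho>0 + \<theta> \<rho>0 * (\<rho> powr (- ((?n - 2 * s) / 2)) - \<rho>0 powr (- ((?n - 2 * s) / 2)))"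
    "\<And>\<rho>. \<rho> \<ge> 0 \<Longrightarrow> 4 * \<rho> * \<bar>g2 \<rho>\<bar> + 2 * \<bar>g1 \<rho>\<bar> \<le> K"
    using truncated_powr[OF q \<theta>] by blast
  \<comment> \<open>The factor 2 in the second difference constant is the one lost in
    \<open>second_difference_radial\<close>.\<close>
  interpret truncated s ?n ?cns "TYPE(real^'n)" \<theta> g C "2 * K"
  proof
    show "\<bar>2 * g ((norm x)\<^sup>2) - g ((norm (x + h))\<^sup>2) - g ((norm (x - h))\<^sup>2)\<bar> \<le> 2 * K * (norm h)\<^sup>2" for x h :: "real^'n"
      by (rule second_difference_radial[OF g(2,3,8)])
  qed (use assms \<theta> \<theta>01 g in auto)

  have u_leb: "u \<in> borel_measurable lebesgue" using W by (simp add: W12_loc_def L2_loc_def)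
  \<comment> \<open>A Lebesgue measurable u is exchanged for a Borel function equal to it almost
    everywhere, since the Fubini arguments work on products of Borel spaces. All integrals are
    unaffected.\<close>
  obtain u' where u'[measurable]: "u' \<in> borel_measurable borel" and uu': "AE x in lborel. u x = u' x"
    using completion_ex_borel_measurable_real[OF u_leb] by auto
  define F where "F x = norm x powr a * exp (u' x)" for x
  have [measurable]: "F \<in> borel_measurable borel" unfolding F_def by measurable
  have FF: "AE x in lborel. norm x powr a * exp (u x) = F x" using uu' by eventually_elim (simp add: F_def)
  have F_leb: "(\<lambda>x. norm x powr a * exp (u x)) \<in> borel_measurable lebesgue"
    by (intro borel_measurable_times measurable_completion[of "\<lambda>x. norm x powr a"] 
        measurable_compose[OF u_leb, of exp]) measurable

  have u_int: "integrable lborel (\<lambda>x. u' x * wt x)"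
  proof -
    have "integrable lebesgue (\<lambda>x. \<bar>u x\<bar> / (1 + norm x powr (?n + 2 * s)))"
      using sol by (simp add: is_solution_def L_s_def)
    then have "integrable lborel (\<lambda>x. \<bar>u' x\<bar> / (1 + norm x powr (?n + 2 * s)))"
      by (rule integrable_lborel_cong_lebesgue) (use uu' in \<open>auto elim: eventually_mono\<close>)
    then have "integrable lborel (\<lambda>x. \<bar>u' x * wt x\<bar>)"
      using wt_pos by (simp add: wt_def abs_mult)
    then show ?thesis by (rule integrable_abs_cancel) measurable
  qed
  have F_loc: "integrable lborel (\<lambda>x. indicator (cball 0 r) x * F x)" for r
  proof -
    have "integrable lebesgue (\<lambda>x. indicator (cball 0 r) x *\<^sub>R (norm x powr a * exp (u x)))"
      using sol by (simp add: is_solution_def L1_loc_def set_integrable_def)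
    then show ?thesis
      by (rule integrable_lborel_cong_lebesgue) (use FF in \<open>auto elim: eventually_mono\<close>)
  qed
  have eq: "(\<integral>x. u' x * (Dop (w_scaled R0) x - Dop (w_scaled R) x) \<partial>lborel) = (\<integral>x. F x * (w_scaled R0 x - w_scaled R x) \<partial>lborel)"
    if R: "0 < R0" "R0 \<le> R" for R0 R
  proof -
    define \<phi> where "\<phi> x = w_scaled R0 x - w_scaled R x" for x
    have Rp: "R > 0" using R by simp
    have [measurable]: "\<phi> \<in> borel_measurable borel" unfolding \<phi>_def by measurable
    have test: "test_fun UNIV \<phi>" using test_fun_w_scaled_diff[OF R] by (simp add: \<phi>_def[abs_def])
    have lap: "frac_lap s \<phi> x = Dop (w_scaled R0) x - Dop (w_scaled R) x" for x
    proof -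
      have "(LINT y : {y. dist x y > \<epsilon>} | lebesgue. (\<phi> x - \<phi> y) / dist x y powr (?n + 2 * s))
        = (LINT y : {y. dist x y > \<epsilon>} | lborel. (\<phi> x - \<phi> y) / dist x y powr (?n + 2 * s))" for \<epsilon>
        unfolding set_lebesgue_integral_def by (rule integral_completion) measurable
      \<comment> \<open>\<open>Lim\<close> is a definite description; its value is secured by the
        convergence proved in \<open>truncated_Lim_Dop\<close>.\<close>
      then have "Lim (at_right 0) (\<lambda>\<epsilon>. LINT y : {y. dist x y > \<epsilon>} | lebesgue. (\<phi> x - \<phi> y) / dist x y powr (?n + 2 * s))
        = (Dop (w_scaled R0) x - Dop (w_scaled R) x) / ?cns"
        using truncated_Lim_Dop[OF R, of x] by (intro tendsto_Lim) (simp_all add: \<phi>_def)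
      then show ?thesis unfolding frac_lap_def using cns_pos by simp
    qed
    have [measurable]: "Dop (w_scaled r) \<in> borel_measurable borel" if "r > 0" for r
      unfolding Dop_w_scaled[OF that, abs_def] m_def[symmetric] by measurable
    have Dm[measurable]: "Dop (w_scaled R0) \<in> borel_measurable borel" "Dop (w_scaled R) \<in> borel_measurable borel"
      using Rp R by auto
    have "(\<integral>x. u' x * (Dop (w_scaled R0) x - Dop (w_scaled R) x) \<partial>lborel) = (\<integral>x. u x * frac_lap s \<phi> x \<partial>lebesgue)"
      unfolding lap
    proof (rule integral_lborel_cong_lebesgue[symmetric])
      show "(\<lambda>x. u x * (Dop (w_scaled R0) x - Dop (w_scaled R) x)) \<in> borel_measurable lebesgue"
        by (intro borel_measurable_times[OF u_leb] measurable_completion) (use Dm in auto)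
      show "AE x in lborel. u x * (Dop (w_scaled R0) x - Dop (w_scaled R) x) = u' x * (Dop (w_scaled R0) x - Dop (w_scaled R) x)"
        using uu' by eventually_elim simp
    qed measurable
    also have "\<dots> = (\<integral>x. norm x powr a * exp (u x) * \<phi> x \<partial>lebesgue)"
      using sol test by (simp add: is_solution_def)
    also have "\<dots> = (\<integral>x. F x * \<phi> x \<partial>lborel)"
    proof (rule integral_lborel_cong_lebesgue)
      show "(\<lambda>x. norm x powr a * exp (u x) * \<phi> x) \<in> borel_measurable lebesgue"
        by (intro borel_measurable_times[OF F_leb] measurable_completion) measurable
      show "AE x in lborel. norm x powr a * exp (u x) * \<phi> x = F x * \<phi> x"
        using FF by eventually_elim simp
    qed measurable
    finally show ?thesis by (simp add: \<phi>_def)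
  qed

  obtain K0 where K0: "compact K0" "stable_in s a u (UNIV - K0)" using morse by (auto simp: finite_morse_def)
  obtain r where r: "r > 0" "K0 \<subseteq> cball 0 r"
    using compact_imp_bounded[OF K0(1)] by (meson bounded_subset_ballD ball_subset_cball subset_trans)
  have F0: "F x \<ge> 0" for x by (simp add: F_def)
  \<comment> \<open>The inequality of \<open>stable_in\<close> in the form required by
    \<open>stability_log_bound\<close>: over \<open>lborel\<close>, with the Borel representative,
    and with the constant c/2 moved inside the double integral.\<close>
  have stable: "(\<integral>\<^sup>+x. ennreal (F x * (\<phi> x)\<^sup>2) \<partial>lborel) \<le>
       (\<integral>\<^sup>+x. \<integral>\<^sup>+y. ennreal (?cns * (1/2 * (\<phi> x - \<phi> y)\<^sup>2) / dist x y powr (?n + 2 * s)) \<partial>lborel \<partial>lborel)"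
    if t: "test_fun (UNIV - K0) \<phi>" for \<phi>
  proof -
    have [measurable]: "\<phi> \<in> borel_measurable borel" using t smooth_fun_borel by (auto simp: test_fun_def)
    have "(\<integral>\<^sup>+x. ennreal (F x * (\<phi> x)\<^sup>2) \<partial>lborel) = (\<integral>\<^sup>+x. ennreal (norm x powr a * exp (u x) * (\<phi> x)\<^sup>2) \<partial>lborel)"
      by (rule nn_integral_cong_AE) (use FF in \<open>auto elim: eventually_mono\<close>)
    also have "\<dots> \<le> ennreal (?cns / 2) * (\<integral>\<^sup>+x. \<integral>\<^sup>+y. ennreal ((\<phi> x - \<phi> y)\<^sup>2 / dist x y powr (?n + 2 * s)) \<partial>lborel \<partial>lborel)"
      using K0(2) t unfolding stable_in_def by (simp add: nn_integral_completion)
    also have "\<dots> = (\<integral>\<^sup>+x. \<integral>\<^sup>+y. ennreal (?cns / 2) * ennreal ((\<phi> x - \<phi> y)\<^sup>2 / dist x y powr (?n + 2 * s)) \<partial>lborel \<partial>lborel)"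
      by (simp add: nn_integral_cmult)
    also have "\<dots> = (\<integral>\<^sup>+x. \<integral>\<^sup>+y. ennreal (?cns * (1/2 * (\<phi> x - \<phi> y)\<^sup>2) / dist x y powr (?n + 2 * s)) \<partial>lborel \<partial>lborel)"
      using cns_pos by (intro nn_integral_cong) (simp add: ennreal_mult[symmetric])
    finally show ?thesis .
  qed
  obtain C0 where C0: "C0 \<ge> 0" "\<And>A b. 4 * r \<le> A \<Longrightarrow> A \<le> b \<Longrightarrow>
     (\<integral>\<^sup>+x. ennreal (indicator {x. A \<le> norm x \<and> norm x \<le> b} x * (F x * norm x powr (- (?n - 2 * s)))) \<partial>lborel)
       \<le> ennreal (C0 + \<Lambda> * (2 * radial_const ?n) * ln (b / A))"
    using stability_log_bound[of F K0 r] F0 r stable by auto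
  \<comment> \<open>The radius 4 r keeps the cutoff away from the compact set, and the maximum with
    1 puts the annuli where logarithms are nonnegative and \<open>R0\<close> >= 1. The slope is
    Lambda |S^(n-1)|.\<close>
  interpret log_bounded_solution s ?n ?cns "TYPE(real^'n)" \<theta> g C "2 * K" u' F a "max 1 (4 * r)" C0 "\<Lambda> * (2 * radial_const ?n)"
    by unfold_locales (use assms(3) u' u_int F_loc eq C0 \<Lambda>_nonneg in \<open>simp_all add: F_def v_def del: ennreal_plus\<close>)
  show False by (rule contradiction[OF supercritical[OF assms(3,5)]])
qed

end
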